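(* Let $\mathcal U$ be a univalent universe and let $\mathcal V:\mathcal U$ be a type of codes with an embedding $\mathrm{El}:\mathcal V\to\mathcal U$, closed under dependent sums and finite coproducts and containing the terminal type. The functor $!:\mathcal U\to\mathcal U$ preserves pullbacks, and therefore lifts to a functor $\mathrm{Span}(!):\mathrm{Span}(\mathcal U)\to\mathrm{Span}(\mathcal U)$.
   Context: We work in homotopy type theory (as in the HoTT book). $\mathcal U$ also denotes the wild category of types in $\mathcal U$ and functions. For $E:\mathcal V$ one writes $E$ also for the type $\mathrm{El}(E)$. For $A:\mathcal U$, $!A:=\sum_{E:\mathcal V}(E\to A)$; for $f:A\to B$, $!f:{!A}\to{!B}$ is $!f(E,p):=(E,f\circ p)$. Pullbacks are homotopy pullbacks: for $f:A\to C$ and $g:B\to C$, $A\times_CB:=\sum_{a:A}\sum_{b:B}(f(a)=g(b))$. $\mathrm{Span}(\mathcal U)$ is the wild category with types in $\mathcal U$ as objects, spans $A\xleftarrow{s}X\xrightarrow{t}B$ (with $X:\mathcal U$) as morphisms from $A$ to $B$, identities $A\xleftarrow{\mathrm{id}}A\xrightarrow{\mathrm{id}}A$, and composition by pullback. (A wild category has types of objects and morphisms, composition and identities, with identifications witnessing associativity and unit laws, no higher coherence or truncation, and is univalent. A functor has maps on objects and morphisms with identifications witnessing preservation of identities and composition.) The lift $\mathrm{Span}(F)$ of an endofunctor $F$ of $\mathcal U$ acts as $F$ on objects and sends $A\xleftarrow{s}X\xrightarrow{t}B$ to $FA\xleftarrow{Fs}FX\xrightarrow{Ft}FB$. *)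

theory Defs
  imports Main
begin

text \<open>
  Homotopy type theory is incompatible with reading types as HOL sets (or with functions of HOL as
  functions of the type theory), so it is represented as a formal system: the type theory of the
  appendix of the HoTT book, with \<open>\<Pi>\<close>, \<open>\<Sigma>\<close>, binary coproducts, the empty type, the unit type, the
  natural numbers, identity types, a cumulative hierarchy of universes a la Russell, function
  extensionality and univalence.  Higher inductive types are left out; a derivation in this system
  is in particular a derivation in any extension by such types.

  Raw terms use de Bruijn indices.  Bound variables per argument:
  \<open>IndSg\<close> 1,2,0; \<open>IndCo\<close> 1,1,1,0; \<open>IndEmp\<close> 1,0; \<open>IndOne\<close> 1,0,0; \<open>IndNat\<close> 1,0,2,0;
  \<open>IndId\<close> 3,1,0,0,0, the first argument being the motive.
\<close>

section \<open>Raw syntax\<close>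

datatype tm =
    Var nat
  | Uni nat
  | PiT tm tm | Lam tm tm | App tm tm
  | SgT tm tm | Pr tm tm | IndSg tm tm tm
  | CoT tm tm | InL tm | InR tm | IndCo tm tm tm tm
  | Emp | IndEmp tm tm
  | One | Star | IndOne tm tm tm
  | NatT | Zero | Succ tm | IndNat tm tm tm tm
  | IdT tm tm tm | Rfl tm | IndId tm tm tm tm tm
  | FunextC nat
  | UaC nat

definition up_ren :: "(nat \<Rightarrow> nat) \<Rightarrow> nat \<Rightarrow> nat" where
  "up_ren r = (\<lambda>n. case n of 0 \<Rightarrow> 0 | Suc m \<Rightarrow> Suc (r m))"

primrec ren :: "(nat \<Rightarrow> nat) \<Rightarrow> tm \<Rightarrow> tm" where
  "ren r (Var n) = Var (r n)"
| "ren r (Uni i) = Uni i"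
| "ren r (PiT A B) = PiT (ren r A) (ren (up_ren r) B)"
| "ren r (Lam A b) = Lam (ren r A) (ren (up_ren r) b)"
| "ren r (App f a) = App (ren r f) (ren r a)"
| "ren r (SgT A B) = SgT (ren r A) (ren (up_ren r) B)"
| "ren r (Pr a b) = Pr (ren r a) (ren r b)"
| "ren r (IndSg C g p) = IndSg (ren (up_ren r) C) (ren (up_ren (up_ren r)) g) (ren r p)"
| "ren r (CoT A B) = CoT (ren r A) (ren r B)"
| "ren r (InL a) = InL (ren r a)"
| "ren r (InR b) = InR (ren r b)"
| "ren r (IndCo C c d e) =
     IndCo (ren (up_ren r) C) (ren (up_ren r) c) (ren (up_ren r) d) (ren r e)"
| "ren r Emp = Emp"
| "ren r (IndEmp C a) = IndEmp (ren (up_ren r) C) (ren r a)"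
| "ren r One = One"
| "ren r Star = Star"
| "ren r (IndOne C c a) = IndOne (ren (up_ren r) C) (ren r c) (ren r a)"
| "ren r NatT = NatT"
| "ren r Zero = Zero"
| "ren r (Succ n) = Succ (ren r n)"
| "ren r (IndNat C c d n) =
     IndNat (ren (up_ren r) C) (ren r c) (ren (up_ren (up_ren r)) d) (ren r n)"
| "ren r (IdT A a b) = IdT (ren r A) (ren r a) (ren r b)"
| "ren r (Rfl a) = Rfl (ren r a)"
| "ren r (IndId C c a b p) =
     IndId (ren (up_ren (up_ren (up_ren r))) C) (ren (up_ren r) c) (ren r a) (ren r b) (ren r p)"
| "ren r (FunextC i) = FunextC i"
| "ren r (UaC i) = UaC i"

definition scons :: "tm \<Rightarrow> (nat \<Rightarrow> tm) \<Rightarrow> nat \<Rightarrow> tm" (infixr "\<bullet>" 65) where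
  "a \<bullet> s = (\<lambda>n. case n of 0 \<Rightarrow> a | Suc m \<Rightarrow> s m)"

definition up :: "(nat \<Rightarrow> tm) \<Rightarrow> nat \<Rightarrow> tm" where
  "up s = Var 0 \<bullet> (\<lambda>n. ren Suc (s n))"

primrec sub :: "(nat \<Rightarrow> tm) \<Rightarrow> tm \<Rightarrow> tm" where
  "sub s (Var n) = s n"
| "sub s (Uni i) = Uni i"
| "sub s (PiT A B) = PiT (sub s A) (sub (up s) B)"
| "sub s (Lam A b) = Lam (sub s A) (sub (up s) b)"
| "sub s (App f a) = App (sub s f) (sub s a)"
| "sub s (SgT A B) = SgT (sub s A) (sub (up s) B)"
| "sub s (Pr a b) = Pr (sub s a) (sub s b)"
| "sub s (IndSg C g p) = IndSg (sub (up s) C) (sub (up (up s)) g) (sub s p)"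
| "sub s (CoT A B) = CoT (sub s A) (sub s B)"
| "sub s (InL a) = InL (sub s a)"
| "sub s (InR b) = InR (sub s b)"
| "sub s (IndCo C c d e) = IndCo (sub (up s) C) (sub (up s) c) (sub (up s) d) (sub s e)"
| "sub s Emp = Emp"
| "sub s (IndEmp C a) = IndEmp (sub (up s) C) (sub s a)"
| "sub s One = One"
| "sub s Star = Star"
| "sub s (IndOne C c a) = IndOne (sub (up s) C) (sub s c) (sub s a)"
| "sub s NatT = NatT"
| "sub s Zero = Zero"
| "sub s (Succ n) = Succ (sub s n)"
| "sub s (IndNat C c d n) = IndNat (sub (up s) C) (sub s c) (sub (up (up s)) d) (sub s n)"
| "sub s (IdT A a b) = IdT (sub s A) (sub s a) (sub s b)"
| "sub s (Rfl a) = Rfl (sub s a)"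
| "sub s (IndId C c a b p) =
     IndId (sub (up (up (up s))) C) (sub (up s) c) (sub s a) (sub s b) (sub s p)"
| "sub s (FunextC i) = FunextC i"
| "sub s (UaC i) = UaC i"

abbreviation inst1 :: "tm \<Rightarrow> tm \<Rightarrow> tm" ("_\<langle>_\<rangle>" [1000, 0] 1000) where
  "B\<langle>a\<rangle> \<equiv> sub (a \<bullet> Var) B"

abbreviation wk :: "nat \<Rightarrow> tm \<Rightarrow> tm" where
  "wk k \<equiv> ren (\<lambda>n. n + k)"


section \<open>Notation for terms with named variables\<close>

text \<open>
  An \<open>expr\<close> maps the length of the ambient context to a raw term, so that weakening is implicit and
  binders can be written with HOL's own variables: \<open>lv k\<close> is the variable introduced at position
  \<open>k\<close> of the context (counted from the outside), whose de Bruijn index in a context of length \<open>m\<close>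
  is \<open>m - k - 1\<close>.  An \<open>expr\<close> is only used as a readable way of writing down a raw term.
\<close>

type_synonym expr = "nat \<Rightarrow> tm"

definition lv :: "nat \<Rightarrow> expr" where
  "lv k = (\<lambda>m. Var (m - Suc k))"

definition uni :: "nat \<Rightarrow> expr" where "uni i = (\<lambda>n. Uni i)"

definition pi :: "expr \<Rightarrow> (expr \<Rightarrow> expr) \<Rightarrow> expr" where
  "pi A B = (\<lambda>n. PiT (A n) (B (lv n) (Suc n)))"
definition lam :: "expr \<Rightarrow> (expr \<Rightarrow> expr) \<Rightarrow> expr" where
  "lam A b = (\<lambda>n. Lam (A n) (b (lv n) (Suc n)))"
definition sg :: "expr \<Rightarrow> (expr \<Rightarrow> expr) \<Rightarrow> expr" where
  "sg A B = (\<lambda>n. SgT (A n) (B (lv n) (Suc n)))"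

syntax
  "_pi" :: "pttrn \<Rightarrow> expr \<Rightarrow> expr \<Rightarrow> expr" ("(3\<^bold>\<Pi>_\<^bold>:_./ _)" [0, 0, 50] 50)
  "_lam" :: "pttrn \<Rightarrow> expr \<Rightarrow> expr \<Rightarrow> expr" ("(3\<^bold>\<lambda>_\<^bold>:_./ _)" [0, 0, 50] 50)
  "_sg" :: "pttrn \<Rightarrow> expr \<Rightarrow> expr \<Rightarrow> expr" ("(3\<^bold>\<Sigma>_\<^bold>:_./ _)" [0, 0, 50] 50)
translations
  "\<^bold>\<Pi>x\<^bold>:A. B" == "CONST pi A (\<lambda>x. B)"
  "\<^bold>\<lambda>x\<^bold>:A. b" == "CONST lam A (\<lambda>x. b)"
  "\<^bold>\<Sigma>x\<^bold>:A. B" == "CONST sg A (\<lambda>x. B)"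

abbreviation arr :: "expr \<Rightarrow> expr \<Rightarrow> expr" (infixr "\<^bold>\<rightarrow>" 60) where
  "A \<^bold>\<rightarrow> B \<equiv> pi A (\<lambda>_. B)"
abbreviation prodt :: "expr \<Rightarrow> expr \<Rightarrow> expr" (infixr "\<^bold>\<times>" 70) where
  "A \<^bold>\<times> B \<equiv> sg A (\<lambda>_. B)"

definition app :: "expr \<Rightarrow> expr \<Rightarrow> expr" (infixl "\<cdot>" 90) where
  "f \<cdot> a = (\<lambda>n. App (f n) (a n))"
definition pr :: "expr \<Rightarrow> expr \<Rightarrow> expr" ("\<^bold>\<langle>_,/ _\<^bold>\<rangle>") where
  "\<^bold>\<langle>a, b\<^bold>\<rangle> = (\<lambda>n. Pr (a n) (b n))"
definition ind_sg :: "(expr \<Rightarrow> expr) \<Rightarrow> (expr \<Rightarrow> expr \<Rightarrow> expr) \<Rightarrow> expr \<Rightarrow> expr" where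
  "ind_sg C g p =
     (\<lambda>n. IndSg (C (lv n) (Suc n)) (g (lv n) (lv (Suc n)) (Suc (Suc n))) (p n))"
definition cot :: "expr \<Rightarrow> expr \<Rightarrow> expr" (infixr "\<^bold>+" 65) where
  "A \<^bold>+ B = (\<lambda>n. CoT (A n) (B n))"
definition emp :: expr where "emp = (\<lambda>n. Emp)"
definition one :: expr where "one = (\<lambda>n. One)"
definition idt :: "expr \<Rightarrow> expr \<Rightarrow> expr \<Rightarrow> expr" where
  "idt A a b = (\<lambda>n. IdT (A n) (a n) (b n))"
definition rfl :: "expr \<Rightarrow> expr" where
  "rfl a = (\<lambda>n. Rfl (a n))"
definition ind_id ::
    "(expr \<Rightarrow> expr \<Rightarrow> expr \<Rightarrow> expr) \<Rightarrow> (expr \<Rightarrow> expr) \<Rightarrow> expr \<Rightarrow> expr \<Rightarrow> expr \<Rightarrow> expr" where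
  "ind_id C c a b p =
     (\<lambda>n. IndId (C (lv n) (lv (Suc n)) (lv (Suc (Suc n))) (Suc (Suc (Suc n))))
            (c (lv n) (Suc n)) (a n) (b n) (p n))"

text \<open>The projections out of \<open>\<Sigma>x:A. B x\<close>.\<close>

definition fstp :: "expr \<Rightarrow> expr \<Rightarrow> expr" where
  "fstp A p = ind_sg (\<lambda>_. A) (\<lambda>x y. x) p"
definition sndp :: "expr \<Rightarrow> (expr \<Rightarrow> expr) \<Rightarrow> expr \<Rightarrow> expr" where
  "sndp A B p = ind_sg (\<lambda>z. B (fstp A z)) (\<lambda>x y. y) p"


section \<open>Basic notions of homotopy type theory\<close>

definition idfun :: "expr \<Rightarrow> expr" where
  "idfun A = (\<^bold>\<lambda>x\<^bold>:A. x)"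

text \<open>\<open>fcomp A g f\<close> is \<open>g \<circ> f\<close> for \<open>f\<close> with domain \<open>A\<close>.\<close>
definition fcomp :: "expr \<Rightarrow> expr \<Rightarrow> expr \<Rightarrow> expr" where
  "fcomp A g f = (\<^bold>\<lambda>x\<^bold>:A. g \<cdot> (f \<cdot> x))"

definition isequiv :: "expr \<Rightarrow> expr \<Rightarrow> expr \<Rightarrow> expr" where
  "isequiv X Y f =
     (\<^bold>\<Sigma>g\<^bold>:Y \<^bold>\<rightarrow> X. \<^bold>\<Pi>y\<^bold>:Y. idt Y (f \<cdot> (g \<cdot> y)) y) \<^bold>\<times>
     (\<^bold>\<Sigma>h\<^bold>:Y \<^bold>\<rightarrow> X. \<^bold>\<Pi>x\<^bold>:X. idt X (h \<cdot> (f \<cdot> x)) x)"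

definition eqv_inv :: "expr \<Rightarrow> expr \<Rightarrow> expr \<Rightarrow> expr \<Rightarrow> expr" where
  "eqv_inv X Y f e =
     fstp (Y \<^bold>\<rightarrow> X) (fstp (\<^bold>\<Sigma>g\<^bold>:Y \<^bold>\<rightarrow> X. \<^bold>\<Pi>y\<^bold>:Y. idt Y (f \<cdot> (g \<cdot> y)) y) e)"

definition equivt :: "expr \<Rightarrow> expr \<Rightarrow> expr" where
  "equivt X Y = (\<^bold>\<Sigma>f\<^bold>:X \<^bold>\<rightarrow> Y. isequiv X Y f)"

definition idequiv :: "expr \<Rightarrow> expr" where
  "idequiv X =
     \<^bold>\<langle>idfun X, \<^bold>\<langle>\<^bold>\<langle>idfun X, \<^bold>\<lambda>x\<^bold>:X. rfl x\<^bold>\<rangle>, \<^bold>\<langle>idfun X, \<^bold>\<lambda>x\<^bold>:X. rfl x\<^bold>\<rangle>\<^bold>\<rangle>\<^bold>\<rangle>"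

text \<open>The arguments of \<open>path_inv\<close>, \<open>path_conc\<close>, \<open>ap\<close> and \<open>happly\<close> before the paths are the types and
  endpoints.\<close>

definition path_inv :: "expr \<Rightarrow> expr \<Rightarrow> expr \<Rightarrow> expr \<Rightarrow> expr" where
  "path_inv X x y p = ind_id (\<lambda>u v _. idt X v u) (\<lambda>u. rfl u) x y p"

definition path_conc :: "expr \<Rightarrow> expr \<Rightarrow> expr \<Rightarrow> expr \<Rightarrow> expr \<Rightarrow> expr \<Rightarrow> expr" where
  "path_conc X x y z p q =
     ind_id (\<lambda>u v _. idt X x u \<^bold>\<rightarrow> idt X x v) (\<lambda>u. \<^bold>\<lambda>h\<^bold>:idt X x u. h) y z q \<cdot> p"

definition ap :: "expr \<Rightarrow> expr \<Rightarrow> expr \<Rightarrow> expr \<Rightarrow> expr \<Rightarrow> expr" where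
  "ap Y f x y p = ind_id (\<lambda>u v _. idt Y (f \<cdot> u) (f \<cdot> v)) (\<lambda>u. rfl (f \<cdot> u)) x y p"

definition happly :: "expr \<Rightarrow> (expr \<Rightarrow> expr) \<Rightarrow> expr \<Rightarrow> expr \<Rightarrow> expr \<Rightarrow> expr" where
  "happly A B f g p =
     ind_id (\<lambda>h k _. \<^bold>\<Pi>x\<^bold>:A. idt (B x) (h \<cdot> x) (k \<cdot> x)) (\<lambda>h. \<^bold>\<lambda>x\<^bold>:A. rfl (h \<cdot> x)) f g p"

definition idtoeqv :: "nat \<Rightarrow> expr \<Rightarrow> expr \<Rightarrow> expr" where
  "idtoeqv i X Y =
     (\<^bold>\<lambda>p\<^bold>:idt (uni i) X Y. ind_id (\<lambda>u v _. equivt u v) (\<lambda>u. idequiv u) X Y p)"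

definition is_embedding :: "expr \<Rightarrow> expr \<Rightarrow> expr \<Rightarrow> expr" where
  "is_embedding X Y f =
     (\<^bold>\<Pi>x\<^bold>:X. \<^bold>\<Pi>y\<^bold>:X.
        isequiv (idt X x y) (idt Y (f \<cdot> x) (f \<cdot> y)) (\<^bold>\<lambda>p\<^bold>:idt X x y. ap Y f x y p))"

definition univalence_ty :: "nat \<Rightarrow> expr" where
  "univalence_ty i =
     (\<^bold>\<Pi>X\<^bold>:uni i. \<^bold>\<Pi>Y\<^bold>:uni i. isequiv (idt (uni i) X Y) (equivt X Y) (idtoeqv i X Y))"

definition funext_ty :: "nat \<Rightarrow> expr" where
  "funext_ty i =
     (\<^bold>\<Pi>A\<^bold>:uni i. \<^bold>\<Pi>B\<^bold>:A \<^bold>\<rightarrow> uni i. \<^bold>\<Pi>f\<^bold>:(\<^bold>\<Pi>x\<^bold>:A. B \<cdot> x). \<^bold>\<Pi>g\<^bold>:(\<^bold>\<Pi>x\<^bold>:A. B \<cdot> x).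
        isequiv (idt (\<^bold>\<Pi>x\<^bold>:A. B \<cdot> x) f g) (\<^bold>\<Pi>x\<^bold>:A. idt (B \<cdot> x) (f \<cdot> x) (g \<cdot> x))
          (\<^bold>\<lambda>p\<^bold>:idt (\<^bold>\<Pi>x\<^bold>:A. B \<cdot> x) f g. happly A (\<lambda>x. B \<cdot> x) f g p))"

text \<open>The identification \<open>f = g\<close> of functions \<open>A \<rightarrow> B\<close> (in the \<open>i\<close>-th universe) given by a pointwise
  one.\<close>
definition funext :: "nat \<Rightarrow> expr \<Rightarrow> expr \<Rightarrow> expr \<Rightarrow> expr \<Rightarrow> expr \<Rightarrow> expr" where
  "funext i A B f g h =
     eqv_inv (idt (A \<^bold>\<rightarrow> B) f g) (\<^bold>\<Pi>x\<^bold>:A. idt B (f \<cdot> x) (g \<cdot> x))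
       (\<^bold>\<lambda>p\<^bold>:idt (A \<^bold>\<rightarrow> B) f g. happly A (\<lambda>_. B) f g p)
       ((\<lambda>n. FunextC i) \<cdot> A \<cdot> (\<^bold>\<lambda>_\<^bold>:A. B) \<cdot> f \<cdot> g) \<cdot> h"


section \<open>Judgments\<close>

text \<open>The head of a context is the most recently declared variable.\<close>

type_synonym ctx = "tm list"

inductive
  wf :: "ctx \<Rightarrow> bool" and
  has_ty :: "ctx \<Rightarrow> tm \<Rightarrow> tm \<Rightarrow> bool" ("_ \<turnstile> _ \<^bold>: _" [51, 51, 51] 50) and
  eq_tm :: "ctx \<Rightarrow> tm \<Rightarrow> tm \<Rightarrow> tm \<Rightarrow> bool" ("_ \<turnstile> _ \<doteq> _ \<^bold>: _" [51, 51, 51, 51] 50)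
where
  wf_Nil: "wf []"
| wf_Cons: "\<Gamma> \<turnstile> A \<^bold>: Uni i \<Longrightarrow> wf (A # \<Gamma>)"

| ty_Var: "wf \<Gamma> \<Longrightarrow> n < length \<Gamma> \<Longrightarrow> \<Gamma> \<turnstile> Var n \<^bold>: wk (Suc n) (\<Gamma> ! n)"
| ty_conv: "\<Gamma> \<turnstile> a \<^bold>: A \<Longrightarrow> \<Gamma> \<turnstile> A \<doteq> B \<^bold>: Uni i \<Longrightarrow> \<Gamma> \<turnstile> a \<^bold>: B"
| eq_conv: "\<Gamma> \<turnstile> a \<doteq> b \<^bold>: A \<Longrightarrow> \<Gamma> \<turnstile> A \<doteq> B \<^bold>: Uni i \<Longrightarrow> \<Gamma> \<turnstile> a \<doteq> b \<^bold>: B"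
| eq_refl: "\<Gamma> \<turnstile> a \<^bold>: A \<Longrightarrow> \<Gamma> \<turnstile> a \<doteq> a \<^bold>: A"
| eq_sym: "\<Gamma> \<turnstile> a \<doteq> b \<^bold>: A \<Longrightarrow> \<Gamma> \<turnstile> b \<doteq> a \<^bold>: A"
| eq_trans: "\<Gamma> \<turnstile> a \<doteq> b \<^bold>: A \<Longrightarrow> \<Gamma> \<turnstile> b \<doteq> c \<^bold>: A \<Longrightarrow> \<Gamma> \<turnstile> a \<doteq> c \<^bold>: A"

| ty_Uni: "wf \<Gamma> \<Longrightarrow> \<Gamma> \<turnstile> Uni i \<^bold>: Uni (Suc i)"
| ty_cumul: "\<Gamma> \<turnstile> A \<^bold>: Uni i \<Longrightarrow> \<Gamma> \<turnstile> A \<^bold>: Uni (Suc i)"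
| eq_cumul: "\<Gamma> \<turnstile> A \<doteq> B \<^bold>: Uni i \<Longrightarrow> \<Gamma> \<turnstile> A \<doteq> B \<^bold>: Uni (Suc i)"

| ty_Pi: "\<Gamma> \<turnstile> A \<^bold>: Uni i \<Longrightarrow> A # \<Gamma> \<turnstile> B \<^bold>: Uni i \<Longrightarrow> \<Gamma> \<turnstile> PiT A B \<^bold>: Uni i"
| eq_Pi: "\<Gamma> \<turnstile> A \<doteq> A' \<^bold>: Uni i \<Longrightarrow> A # \<Gamma> \<turnstile> B \<doteq> B' \<^bold>: Uni i \<Longrightarrow> \<Gamma> \<turnstile> PiT A B \<doteq> PiT A' B' \<^bold>: Uni i"
| ty_Lam: "A # \<Gamma> \<turnstile> b \<^bold>: B \<Longrightarrow> \<Gamma> \<turnstile> Lam A b \<^bold>: PiT A B"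
| eq_Lam: "\<Gamma> \<turnstile> A \<doteq> A' \<^bold>: Uni i \<Longrightarrow> A # \<Gamma> \<turnstile> b \<doteq> b' \<^bold>: B \<Longrightarrow> \<Gamma> \<turnstile> Lam A b \<doteq> Lam A' b' \<^bold>: PiT A B"
| ty_App: "\<Gamma> \<turnstile> f \<^bold>: PiT A B \<Longrightarrow> \<Gamma> \<turnstile> a \<^bold>: A \<Longrightarrow> \<Gamma> \<turnstile> App f a \<^bold>: B\<langle>a\<rangle>"
| eq_App: "\<Gamma> \<turnstile> f \<doteq> f' \<^bold>: PiT A B \<Longrightarrow> \<Gamma> \<turnstile> a \<doteq> a' \<^bold>: A \<Longrightarrow> \<Gamma> \<turnstile> App f a \<doteq> App f' a' \<^bold>: B\<langle>a\<rangle>"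
| Pi_comp: "A # \<Gamma> \<turnstile> b \<^bold>: B \<Longrightarrow> \<Gamma> \<turnstile> a \<^bold>: A \<Longrightarrow> \<Gamma> \<turnstile> App (Lam A b) a \<doteq> b\<langle>a\<rangle> \<^bold>: B\<langle>a\<rangle>"
| Pi_uniq: "\<Gamma> \<turnstile> f \<^bold>: PiT A B \<Longrightarrow> \<Gamma> \<turnstile> f \<doteq> Lam A (App (wk 1 f) (Var 0)) \<^bold>: PiT A B"

| ty_Sg: "\<Gamma> \<turnstile> A \<^bold>: Uni i \<Longrightarrow> A # \<Gamma> \<turnstile> B \<^bold>: Uni i \<Longrightarrow> \<Gamma> \<turnstile> SgT A B \<^bold>: Uni i"
| eq_Sg: "\<Gamma> \<turnstile> A \<doteq> A' \<^bold>: Uni i \<Longrightarrow> A # \<Gamma> \<turnstile> B \<doteq> B' \<^bold>: Uni i \<Longrightarrow> \<Gamma> \<turnstile> SgT A B \<doteq> SgT A' B' \<^bold>: Uni i"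
| ty_Pr: "A # \<Gamma> \<turnstile> B \<^bold>: Uni i \<Longrightarrow> \<Gamma> \<turnstile> a \<^bold>: A \<Longrightarrow> \<Gamma> \<turnstile> b \<^bold>: B\<langle>a\<rangle> \<Longrightarrow> \<Gamma> \<turnstile> Pr a b \<^bold>: SgT A B"
| eq_Pr: "A # \<Gamma> \<turnstile> B \<^bold>: Uni i \<Longrightarrow> \<Gamma> \<turnstile> a \<doteq> a' \<^bold>: A \<Longrightarrow> \<Gamma> \<turnstile> b \<doteq> b' \<^bold>: B\<langle>a\<rangle> \<Longrightarrow>
    \<Gamma> \<turnstile> Pr a b \<doteq> Pr a' b' \<^bold>: SgT A B"
| ty_IndSg: "SgT A B # \<Gamma> \<turnstile> C \<^bold>: Uni i \<Longrightarrow>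
    B # A # \<Gamma> \<turnstile> g \<^bold>: sub (Pr (Var 1) (Var 0) \<bullet> (\<lambda>n. Var (n + 2))) C \<Longrightarrow>
    \<Gamma> \<turnstile> p \<^bold>: SgT A B \<Longrightarrow> \<Gamma> \<turnstile> IndSg C g p \<^bold>: C\<langle>p\<rangle>"
| eq_IndSg: "SgT A B # \<Gamma> \<turnstile> C \<doteq> C' \<^bold>: Uni i \<Longrightarrow>
    B # A # \<Gamma> \<turnstile> g \<doteq> g' \<^bold>: sub (Pr (Var 1) (Var 0) \<bullet> (\<lambda>n. Var (n + 2))) C \<Longrightarrow>
    \<Gamma> \<turnstile> p \<doteq> p' \<^bold>: SgT A B \<Longrightarrow> \<Gamma> \<turnstile> IndSg C g p \<doteq> IndSg C' g' p' \<^bold>: C\<langle>p\<rangle>"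
| Sg_comp: "SgT A B # \<Gamma> \<turnstile> C \<^bold>: Uni i \<Longrightarrow>
    B # A # \<Gamma> \<turnstile> g \<^bold>: sub (Pr (Var 1) (Var 0) \<bullet> (\<lambda>n. Var (n + 2))) C \<Longrightarrow>
    \<Gamma> \<turnstile> a \<^bold>: A \<Longrightarrow> \<Gamma> \<turnstile> b \<^bold>: B\<langle>a\<rangle> \<Longrightarrow>
    \<Gamma> \<turnstile> IndSg C g (Pr a b) \<doteq> sub (b \<bullet> a \<bullet> Var) g \<^bold>: C\<langle>Pr a b\<rangle>"

| ty_Co: "\<Gamma> \<turnstile> A \<^bold>: Uni i \<Longrightarrow> \<Gamma> \<turnstile> B \<^bold>: Uni i \<Longrightarrow> \<Gamma> \<turnstile> CoT A B \<^bold>: Uni i"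
| eq_Co: "\<Gamma> \<turnstile> A \<doteq> A' \<^bold>: Uni i \<Longrightarrow> \<Gamma> \<turnstile> B \<doteq> B' \<^bold>: Uni i \<Longrightarrow> \<Gamma> \<turnstile> CoT A B \<doteq> CoT A' B' \<^bold>: Uni i"
| ty_InL: "\<Gamma> \<turnstile> A \<^bold>: Uni i \<Longrightarrow> \<Gamma> \<turnstile> B \<^bold>: Uni i \<Longrightarrow> \<Gamma> \<turnstile> a \<^bold>: A \<Longrightarrow> \<Gamma> \<turnstile> InL a \<^bold>: CoT A B"
| eq_InL: "\<Gamma> \<turnstile> A \<^bold>: Uni i \<Longrightarrow> \<Gamma> \<turnstile> B \<^bold>: Uni i \<Longrightarrow> \<Gamma> \<turnstile> a \<doteq> a' \<^bold>: A \<Longrightarrow> \<Gamma> \<turnstile> InL a \<doteq> InL a' \<^bold>: CoT A B"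
| ty_InR: "\<Gamma> \<turnstile> A \<^bold>: Uni i \<Longrightarrow> \<Gamma> \<turnstile> B \<^bold>: Uni i \<Longrightarrow> \<Gamma> \<turnstile> b \<^bold>: B \<Longrightarrow> \<Gamma> \<turnstile> InR b \<^bold>: CoT A B"
| eq_InR: "\<Gamma> \<turnstile> A \<^bold>: Uni i \<Longrightarrow> \<Gamma> \<turnstile> B \<^bold>: Uni i \<Longrightarrow> \<Gamma> \<turnstile> b \<doteq> b' \<^bold>: B \<Longrightarrow> \<Gamma> \<turnstile> InR b \<doteq> InR b' \<^bold>: CoT A B"
| ty_IndCo: "CoT A B # \<Gamma> \<turnstile> C \<^bold>: Uni i \<Longrightarrow>
    A # \<Gamma> \<turnstile> c \<^bold>: sub (InL (Var 0) \<bullet> (\<lambda>n. Var (n + 1))) C \<Longrightarrow>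
    B # \<Gamma> \<turnstile> d \<^bold>: sub (InR (Var 0) \<bullet> (\<lambda>n. Var (n + 1))) C \<Longrightarrow>
    \<Gamma> \<turnstile> e \<^bold>: CoT A B \<Longrightarrow> \<Gamma> \<turnstile> IndCo C c d e \<^bold>: C\<langle>e\<rangle>"
| eq_IndCo: "CoT A B # \<Gamma> \<turnstile> C \<doteq> C' \<^bold>: Uni i \<Longrightarrow>
    A # \<Gamma> \<turnstile> c \<doteq> c' \<^bold>: sub (InL (Var 0) \<bullet> (\<lambda>n. Var (n + 1))) C \<Longrightarrow>
    B # \<Gamma> \<turnstile> d \<doteq> d' \<^bold>: sub (InR (Var 0) \<bullet> (\<lambda>n. Var (n + 1))) C \<Longrightarrow>
    \<Gamma> \<turnstile> e \<doteq> e' \<^bold>: CoT A B \<Longrightarrow> \<Gamma> \<turnstile> IndCo C c d e \<doteq> IndCo C' c' d' e' \<^bold>: C\<langle>e\<rangle>"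
| Co_comp_InL: "CoT A B # \<Gamma> \<turnstile> C \<^bold>: Uni i \<Longrightarrow>
    A # \<Gamma> \<turnstile> c \<^bold>: sub (InL (Var 0) \<bullet> (\<lambda>n. Var (n + 1))) C \<Longrightarrow>
    B # \<Gamma> \<turnstile> d \<^bold>: sub (InR (Var 0) \<bullet> (\<lambda>n. Var (n + 1))) C \<Longrightarrow>
    \<Gamma> \<turnstile> a \<^bold>: A \<Longrightarrow> \<Gamma> \<turnstile> IndCo C c d (InL a) \<doteq> c\<langle>a\<rangle> \<^bold>: C\<langle>InL a\<rangle>"
| Co_comp_InR: "CoT A B # \<Gamma> \<turnstile> C \<^bold>: Uni i \<Longrightarrow>
    A # \<Gamma> \<turnstile> c \<^bold>: sub (InL (Var 0) \<bullet> (\<lambda>n. Var (n + 1))) C \<Longrightarrow>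
    B # \<Gamma> \<turnstile> d \<^bold>: sub (InR (Var 0) \<bullet> (\<lambda>n. Var (n + 1))) C \<Longrightarrow>
    \<Gamma> \<turnstile> b \<^bold>: B \<Longrightarrow> \<Gamma> \<turnstile> IndCo C c d (InR b) \<doteq> d\<langle>b\<rangle> \<^bold>: C\<langle>InR b\<rangle>"

| ty_Emp: "wf \<Gamma> \<Longrightarrow> \<Gamma> \<turnstile> Emp \<^bold>: Uni i"
| ty_IndEmp: "Emp # \<Gamma> \<turnstile> C \<^bold>: Uni i \<Longrightarrow> \<Gamma> \<turnstile> a \<^bold>: Emp \<Longrightarrow> \<Gamma> \<turnstile> IndEmp C a \<^bold>: C\<langle>a\<rangle>"
| eq_IndEmp: "Emp # \<Gamma> \<turnstile> C \<doteq> C' \<^bold>: Uni i \<Longrightarrow> \<Gamma> \<turnstile> a \<doteq> a' \<^bold>: Emp \<Longrightarrow>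
    \<Gamma> \<turnstile> IndEmp C a \<doteq> IndEmp C' a' \<^bold>: C\<langle>a\<rangle>"

| ty_One: "wf \<Gamma> \<Longrightarrow> \<Gamma> \<turnstile> One \<^bold>: Uni i"
| ty_Star: "wf \<Gamma> \<Longrightarrow> \<Gamma> \<turnstile> Star \<^bold>: One"
| ty_IndOne: "One # \<Gamma> \<turnstile> C \<^bold>: Uni i \<Longrightarrow> \<Gamma> \<turnstile> c \<^bold>: C\<langle>Star\<rangle> \<Longrightarrow> \<Gamma> \<turnstile> a \<^bold>: One \<Longrightarrow> \<Gamma> \<turnstile> IndOne C c a \<^bold>: C\<langle>a\<rangle>"
| eq_IndOne: "One # \<Gamma> \<turnstile> C \<doteq> C' \<^bold>: Uni i \<Longrightarrow> \<Gamma> \<turnstile> c \<doteq> c' \<^bold>: C\<langle>Star\<rangle> \<Longrightarrow> \<Gamma> \<turnstile> a \<doteq> a' \<^bold>: One \<Longrightarrow>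
    \<Gamma> \<turnstile> IndOne C c a \<doteq> IndOne C' c' a' \<^bold>: C\<langle>a\<rangle>"
| One_comp: "One # \<Gamma> \<turnstile> C \<^bold>: Uni i \<Longrightarrow> \<Gamma> \<turnstile> c \<^bold>: C\<langle>Star\<rangle> \<Longrightarrow> \<Gamma> \<turnstile> IndOne C c Star \<doteq> c \<^bold>: C\<langle>Star\<rangle>"

| ty_Nat: "wf \<Gamma> \<Longrightarrow> \<Gamma> \<turnstile> NatT \<^bold>: Uni i"
| ty_Zero: "wf \<Gamma> \<Longrightarrow> \<Gamma> \<turnstile> Zero \<^bold>: NatT"
| ty_Succ: "\<Gamma> \<turnstile> n \<^bold>: NatT \<Longrightarrow> \<Gamma> \<turnstile> Succ n \<^bold>: NatT"
| eq_Succ: "\<Gamma> \<turnstile> n \<doteq> n' \<^bold>: NatT \<Longrightarrow> \<Gamma> \<turnstile> Succ n \<doteq> Succ n' \<^bold>: NatT"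
| ty_IndNat: "NatT # \<Gamma> \<turnstile> C \<^bold>: Uni i \<Longrightarrow> \<Gamma> \<turnstile> c \<^bold>: C\<langle>Zero\<rangle> \<Longrightarrow>
    C # NatT # \<Gamma> \<turnstile> d \<^bold>: sub (Succ (Var 1) \<bullet> (\<lambda>n. Var (n + 2))) C \<Longrightarrow>
    \<Gamma> \<turnstile> n \<^bold>: NatT \<Longrightarrow> \<Gamma> \<turnstile> IndNat C c d n \<^bold>: C\<langle>n\<rangle>"
| eq_IndNat: "NatT # \<Gamma> \<turnstile> C \<doteq> C' \<^bold>: Uni i \<Longrightarrow> \<Gamma> \<turnstile> c \<doteq> c' \<^bold>: C\<langle>Zero\<rangle> \<Longrightarrow>
    C # NatT # \<Gamma> \<turnstile> d \<doteq> d' \<^bold>: sub (Succ (Var 1) \<bullet> (\<lambda>n. Var (n + 2))) C \<Longrightarrow>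
    \<Gamma> \<turnstile> n \<doteq> n' \<^bold>: NatT \<Longrightarrow> \<Gamma> \<turnstile> IndNat C c d n \<doteq> IndNat C' c' d' n' \<^bold>: C\<langle>n\<rangle>"
| Nat_comp_Zero: "NatT # \<Gamma> \<turnstile> C \<^bold>: Uni i \<Longrightarrow> \<Gamma> \<turnstile> c \<^bold>: C\<langle>Zero\<rangle> \<Longrightarrow>
    C # NatT # \<Gamma> \<turnstile> d \<^bold>: sub (Succ (Var 1) \<bullet> (\<lambda>n. Var (n + 2))) C \<Longrightarrow>
    \<Gamma> \<turnstile> IndNat C c d Zero \<doteq> c \<^bold>: C\<langle>Zero\<rangle>"
| Nat_comp_Succ: "NatT # \<Gamma> \<turnstile> C \<^bold>: Uni i \<Longrightarrow> \<Gamma> \<turnstile> c \<^bold>: C\<langle>Zero\<rangle> \<Longrightarrow>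
    C # NatT # \<Gamma> \<turnstile> d \<^bold>: sub (Succ (Var 1) \<bullet> (\<lambda>n. Var (n + 2))) C \<Longrightarrow> \<Gamma> \<turnstile> n \<^bold>: NatT \<Longrightarrow>
    \<Gamma> \<turnstile> IndNat C c d (Succ n) \<doteq> sub (IndNat C c d n \<bullet> n \<bullet> Var) d \<^bold>: C\<langle>Succ n\<rangle>"

| ty_Id: "\<Gamma> \<turnstile> A \<^bold>: Uni i \<Longrightarrow> \<Gamma> \<turnstile> a \<^bold>: A \<Longrightarrow> \<Gamma> \<turnstile> b \<^bold>: A \<Longrightarrow> \<Gamma> \<turnstile> IdT A a b \<^bold>: Uni i"
| eq_Id: "\<Gamma> \<turnstile> A \<doteq> A' \<^bold>: Uni i \<Longrightarrow> \<Gamma> \<turnstile> a \<doteq> a' \<^bold>: A \<Longrightarrow> \<Gamma> \<turnstile> b \<doteq> b' \<^bold>: A \<Longrightarrow>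
    \<Gamma> \<turnstile> IdT A a b \<doteq> IdT A' a' b' \<^bold>: Uni i"
| ty_Rfl: "\<Gamma> \<turnstile> A \<^bold>: Uni i \<Longrightarrow> \<Gamma> \<turnstile> a \<^bold>: A \<Longrightarrow> \<Gamma> \<turnstile> Rfl a \<^bold>: IdT A a a"
| eq_Rfl: "\<Gamma> \<turnstile> A \<^bold>: Uni i \<Longrightarrow> \<Gamma> \<turnstile> a \<doteq> a' \<^bold>: A \<Longrightarrow> \<Gamma> \<turnstile> Rfl a \<doteq> Rfl a' \<^bold>: IdT A a a"
| ty_IndId: "IdT (wk 2 A) (Var 1) (Var 0) # wk 1 A # A # \<Gamma> \<turnstile> C \<^bold>: Uni i \<Longrightarrow>
    A # \<Gamma> \<turnstile> c \<^bold>: sub (Rfl (Var 0) \<bullet> Var 0 \<bullet> Var 0 \<bullet> (\<lambda>n. Var (n + 1))) C \<Longrightarrow>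
    \<Gamma> \<turnstile> a \<^bold>: A \<Longrightarrow> \<Gamma> \<turnstile> b \<^bold>: A \<Longrightarrow> \<Gamma> \<turnstile> p \<^bold>: IdT A a b \<Longrightarrow>
    \<Gamma> \<turnstile> IndId C c a b p \<^bold>: sub (p \<bullet> b \<bullet> a \<bullet> Var) C"
| eq_IndId: "IdT (wk 2 A) (Var 1) (Var 0) # wk 1 A # A # \<Gamma> \<turnstile> C \<doteq> C' \<^bold>: Uni i \<Longrightarrow>
    A # \<Gamma> \<turnstile> c \<doteq> c' \<^bold>: sub (Rfl (Var 0) \<bullet> Var 0 \<bullet> Var 0 \<bullet> (\<lambda>n. Var (n + 1))) C \<Longrightarrow>
    \<Gamma> \<turnstile> a \<doteq> a' \<^bold>: A \<Longrightarrow> \<Gamma> \<turnstile> b \<doteq> b' \<^bold>: A \<Longrightarrow> \<Gamma> \<turnstile> p \<doteq> p' \<^bold>: IdT A a b \<Longrightarrow>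
    \<Gamma> \<turnstile> IndId C c a b p \<doteq> IndId C' c' a' b' p' \<^bold>: sub (p \<bullet> b \<bullet> a \<bullet> Var) C"
| Id_comp: "IdT (wk 2 A) (Var 1) (Var 0) # wk 1 A # A # \<Gamma> \<turnstile> C \<^bold>: Uni i \<Longrightarrow>
    A # \<Gamma> \<turnstile> c \<^bold>: sub (Rfl (Var 0) \<bullet> Var 0 \<bullet> Var 0 \<bullet> (\<lambda>n. Var (n + 1))) C \<Longrightarrow>
    \<Gamma> \<turnstile> a \<^bold>: A \<Longrightarrow>
    \<Gamma> \<turnstile> IndId C c a a (Rfl a) \<doteq> c\<langle>a\<rangle> \<^bold>: sub (Rfl a \<bullet> a \<bullet> a \<bullet> Var) C"

| ax_funext: "wf \<Gamma> \<Longrightarrow> \<Gamma> \<turnstile> FunextC i \<^bold>: funext_ty i (length \<Gamma>)"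
| ax_univalence: "wf \<Gamma> \<Longrightarrow> \<Gamma> \<turnstile> UaC i \<^bold>: univalence_ty i (length \<Gamma>)"

definition has_ty_expr :: "ctx \<Rightarrow> expr \<Rightarrow> expr \<Rightarrow> bool" ("_ \<tturnstile> _ \<^bold>: _" [51, 51, 51] 50) where
  "\<Gamma> \<tturnstile> e \<^bold>: T \<longleftrightarrow> \<Gamma> \<turnstile> e (length \<Gamma>) \<^bold>: T (length \<Gamma>)"


section \<open>Pullbacks\<close>

definition pb :: "expr \<Rightarrow> expr \<Rightarrow> expr \<Rightarrow> expr \<Rightarrow> expr \<Rightarrow> expr" where
  "pb A B C f g = (\<^bold>\<Sigma>a\<^bold>:A. \<^bold>\<Sigma>b\<^bold>:B. idt C (f \<cdot> a) (g \<cdot> b))"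

definition pb1 :: "expr \<Rightarrow> expr \<Rightarrow> expr \<Rightarrow> expr \<Rightarrow> expr \<Rightarrow> expr" where
  "pb1 A B C f g = (\<^bold>\<lambda>w\<^bold>:pb A B C f g. fstp A w)"

definition pb2 :: "expr \<Rightarrow> expr \<Rightarrow> expr \<Rightarrow> expr \<Rightarrow> expr \<Rightarrow> expr" where
  "pb2 A B C f g =
     (\<^bold>\<lambda>w\<^bold>:pb A B C f g. fstp B (sndp A (\<lambda>a. \<^bold>\<Sigma>b\<^bold>:B. idt C (f \<cdot> a) (g \<cdot> b)) w))"

text \<open>The homotopy from \<open>f \<circ> pb1\<close> to \<open>g \<circ> pb2\<close>.\<close>
definition pb3 :: "expr \<Rightarrow> expr \<Rightarrow> expr \<Rightarrow> expr \<Rightarrow> expr \<Rightarrow> expr" where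
  "pb3 A B C f g =
     (\<^bold>\<lambda>w\<^bold>:pb A B C f g.
        sndp B (\<lambda>b. idt C (f \<cdot> fstp A w) (g \<cdot> b))
          (sndp A (\<lambda>a. \<^bold>\<Sigma>b\<^bold>:B. idt C (f \<cdot> a) (g \<cdot> b)) w))"


section \<open>Wild categories and functors\<close>

text \<open>
  The notion of functor refers to the objects, morphisms, identities and composition of its source
  and target, but not to the associativity, unit and univalence data, which are therefore not
  recorded.  \<open>Cmp C X Y Z g f\<close> is the composite of \<open>f : X \<rightarrow> Y\<close> and \<open>g : Y \<rightarrow> Z\<close>.
\<close>

record wcat =
  Ob :: expr
  Hom :: "expr \<Rightarrow> expr \<Rightarrow> expr"
  Idm :: "expr \<Rightarrow> expr"
  Cmp :: "expr \<Rightarrow> expr \<Rightarrow> expr \<Rightarrow> expr \<Rightarrow> expr \<Rightarrow> expr"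

text \<open>The type of identifications witnessing that the maps \<open>F0\<close> on objects and \<open>F1\<close> on morphisms
  preserve identities, and likewise for composition.\<close>

definition pres_id_ty :: "wcat \<Rightarrow> wcat \<Rightarrow> expr \<Rightarrow> expr \<Rightarrow> expr" where
  "pres_id_ty C D F0 F1 =
     (\<^bold>\<Pi>X\<^bold>:Ob C. idt (Hom D (F0 \<cdot> X) (F0 \<cdot> X)) (F1 \<cdot> X \<cdot> X \<cdot> Idm C X) (Idm D (F0 \<cdot> X)))"

definition pres_cmp_ty :: "wcat \<Rightarrow> wcat \<Rightarrow> expr \<Rightarrow> expr \<Rightarrow> expr" where
  "pres_cmp_ty C D F0 F1 =
     (\<^bold>\<Pi>X\<^bold>:Ob C. \<^bold>\<Pi>Y\<^bold>:Ob C. \<^bold>\<Pi>Z\<^bold>:Ob C. \<^bold>\<Pi>f\<^bold>:Hom C X Y. \<^bold>\<Pi>g\<^bold>:Hom C Y Z.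
        idt (Hom D (F0 \<cdot> X) (F0 \<cdot> Z))
          (F1 \<cdot> X \<cdot> Z \<cdot> Cmp C X Y Z g f)
          (Cmp D (F0 \<cdot> X) (F0 \<cdot> Y) (F0 \<cdot> Z) (F1 \<cdot> Y \<cdot> Z \<cdot> g) (F1 \<cdot> X \<cdot> Y \<cdot> f)))"

definition functor_ty :: "wcat \<Rightarrow> wcat \<Rightarrow> expr" where
  "functor_ty C D =
     (\<^bold>\<Sigma>F0\<^bold>:Ob C \<^bold>\<rightarrow> Ob D.
      \<^bold>\<Sigma>F1\<^bold>:(\<^bold>\<Pi>X\<^bold>:Ob C. \<^bold>\<Pi>Y\<^bold>:Ob C. Hom C X Y \<^bold>\<rightarrow> Hom D (F0 \<cdot> X) (F0 \<cdot> Y)).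
        pres_id_ty C D F0 F1 \<^bold>\<times> pres_cmp_ty C D F0 F1)"

record wfunctor =
  on_ob :: expr
  on_mor :: expr
  pres_id :: expr
  pres_cmp :: expr

definition functor_tm :: "wfunctor \<Rightarrow> expr" where
  "functor_tm F = \<^bold>\<langle>on_ob F, \<^bold>\<langle>on_mor F, \<^bold>\<langle>pres_id F, pres_cmp F\<^bold>\<rangle>\<^bold>\<rangle>\<^bold>\<rangle>"

definition TYPE_cat :: "nat \<Rightarrow> wcat" where
  "TYPE_cat i =
     \<lparr>Ob = uni i,
      Hom = (\<lambda>A B. A \<^bold>\<rightarrow> B),
      Idm = (\<lambda>A. idfun A),
      Cmp = (\<lambda>A B C g f. fcomp A g f)\<rparr>"

definition span_ty :: "nat \<Rightarrow> expr \<Rightarrow> expr \<Rightarrow> expr" where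
  "span_ty i A B = (\<^bold>\<Sigma>X\<^bold>:uni i. (X \<^bold>\<rightarrow> A) \<^bold>\<times> (X \<^bold>\<rightarrow> B))"

definition apex :: "nat \<Rightarrow> expr \<Rightarrow> expr" where
  "apex i S = fstp (uni i) S"

definition legs :: "nat \<Rightarrow> expr \<Rightarrow> expr \<Rightarrow> expr \<Rightarrow> expr" where
  "legs i A B S = sndp (uni i) (\<lambda>X. (X \<^bold>\<rightarrow> A) \<^bold>\<times> (X \<^bold>\<rightarrow> B)) S"

definition src :: "nat \<Rightarrow> expr \<Rightarrow> expr \<Rightarrow> expr \<Rightarrow> expr" where
  "src i A B S = fstp (apex i S \<^bold>\<rightarrow> A) (legs i A B S)"

definition tgt :: "nat \<Rightarrow> expr \<Rightarrow> expr \<Rightarrow> expr \<Rightarrow> expr" where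
  "tgt i A B S = sndp (apex i S \<^bold>\<rightarrow> A) (\<lambda>_. apex i S \<^bold>\<rightarrow> B) (legs i A B S)"

definition span_cmp :: "nat \<Rightarrow> expr \<Rightarrow> expr \<Rightarrow> expr \<Rightarrow> expr \<Rightarrow> expr \<Rightarrow> expr" where
  "span_cmp i A B C T S =
     (let X = apex i S; Y = apex i T; t = tgt i A B S; s = src i B C T; P = pb X Y B t s
      in \<^bold>\<langle>P, \<^bold>\<langle>fcomp P (src i A B S) (pb1 X Y B t s), fcomp P (tgt i B C T) (pb2 X Y B t s)\<^bold>\<rangle>\<^bold>\<rangle>)"

definition SPAN_cat :: "nat \<Rightarrow> wcat" where
  "SPAN_cat i =
     \<lparr>Ob = uni i,
      Hom = span_ty i,
      Idm = (\<lambda>A. \<^bold>\<langle>A, \<^bold>\<langle>idfun A, idfun A\<^bold>\<rangle>\<^bold>\<rangle>),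
      Cmp = span_cmp i\<rparr>"


section \<open>Preservation of pullbacks and the lift to spans\<close>

text \<open>
  For an endofunctor \<open>F\<close> of the \<open>i\<close>-th universe and \<open>f : A \<rightarrow> C\<close>, \<open>g : B \<rightarrow> C\<close>, the comparison map
  \<open>F (A \<times>\<^sub>C B) \<rightarrow> F A \<times>\<^bsub>F C\<^esub> F B\<close> is given by \<open>F pb1\<close>, \<open>F pb2\<close> and the composite identification
  \<open>F f \<circ> F pb1 = F (f \<circ> pb1) = F (g \<circ> pb2) = F g \<circ> F pb2\<close>.
\<close>

definition comparison_path ::
    "nat \<Rightarrow> wfunctor \<Rightarrow> expr \<Rightarrow> expr \<Rightarrow> expr \<Rightarrow> expr \<Rightarrow> expr \<Rightarrow> expr" where
  "comparison_path i F A B C f g =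
     (let P = pb A B C f g; p = pb1 A B C f g; q = pb2 A B C f g;
          FP = on_ob F \<cdot> P; FC = on_ob F \<cdot> C;
          fp = fcomp P f p; gq = fcomp P g q;
          F_fp = on_mor F \<cdot> P \<cdot> C \<cdot> fp;
          F_gq = on_mor F \<cdot> P \<cdot> C \<cdot> gq;
          Ff_Fp = fcomp FP (on_mor F \<cdot> A \<cdot> C \<cdot> f) (on_mor F \<cdot> P \<cdot> A \<cdot> p);
          Fg_Fq = fcomp FP (on_mor F \<cdot> B \<cdot> C \<cdot> g) (on_mor F \<cdot> P \<cdot> B \<cdot> q)
      in path_conc (FP \<^bold>\<rightarrow> FC) Ff_Fp F_fp Fg_Fq
           (path_inv (FP \<^bold>\<rightarrow> FC) F_fp Ff_Fp (pres_cmp F \<cdot> P \<cdot> A \<cdot> C \<cdot> p \<cdot> f))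
           (path_conc (FP \<^bold>\<rightarrow> FC) F_fp F_gq Fg_Fq
              (ap (FP \<^bold>\<rightarrow> FC) (on_mor F \<cdot> P \<cdot> C) fp gq (funext i P C fp gq (pb3 A B C f g)))
              (pres_cmp F \<cdot> P \<cdot> B \<cdot> C \<cdot> q \<cdot> g)))"

definition comparison ::
    "nat \<Rightarrow> wfunctor \<Rightarrow> expr \<Rightarrow> expr \<Rightarrow> expr \<Rightarrow> expr \<Rightarrow> expr \<Rightarrow> expr" where
  "comparison i F A B C f g =
     (let P = pb A B C f g; FP = on_ob F \<cdot> P; FC = on_ob F \<cdot> C;
          Fp = on_mor F \<cdot> P \<cdot> A \<cdot> pb1 A B C f g; Fq = on_mor F \<cdot> P \<cdot> B \<cdot> pb2 A B C f g
      in \<^bold>\<lambda>w\<^bold>:FP. \<^bold>\<langle>Fp \<cdot> w, \<^bold>\<langle>Fq \<cdot> w,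
           happly FP (\<lambda>_. FC)
             (fcomp FP (on_mor F \<cdot> A \<cdot> C \<cdot> f) Fp) (fcomp FP (on_mor F \<cdot> B \<cdot> C \<cdot> g) Fq)
             (comparison_path i F A B C f g) \<cdot> w\<^bold>\<rangle>\<^bold>\<rangle>)"

definition preserves_pullbacks_ty :: "nat \<Rightarrow> wfunctor \<Rightarrow> expr" where
  "preserves_pullbacks_ty i F =
     (\<^bold>\<Pi>A\<^bold>:uni i. \<^bold>\<Pi>B\<^bold>:uni i. \<^bold>\<Pi>C\<^bold>:uni i. \<^bold>\<Pi>f\<^bold>:A \<^bold>\<rightarrow> C. \<^bold>\<Pi>g\<^bold>:B \<^bold>\<rightarrow> C.
        isequiv (on_ob F \<cdot> pb A B C f g)
          (pb (on_ob F \<cdot> A) (on_ob F \<cdot> B) (on_ob F \<cdot> C)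
             (on_mor F \<cdot> A \<cdot> C \<cdot> f) (on_mor F \<cdot> B \<cdot> C \<cdot> g))
          (comparison i F A B C f g))"

definition span_on_mor :: "nat \<Rightarrow> wfunctor \<Rightarrow> expr" where
  "span_on_mor i F =
     (\<^bold>\<lambda>A\<^bold>:uni i. \<^bold>\<lambda>B\<^bold>:uni i. \<^bold>\<lambda>S\<^bold>:span_ty i A B.
        \<^bold>\<langle>on_ob F \<cdot> apex i S,
         \<^bold>\<langle>on_mor F \<cdot> apex i S \<cdot> A \<cdot> src i A B S,
          on_mor F \<cdot> apex i S \<cdot> B \<cdot> tgt i A B S\<^bold>\<rangle>\<^bold>\<rangle>)"

text \<open>\<open>Span(F)\<close>, given witnesses \<open>p\<close> and \<open>q\<close> for the preservation of identities and composition.\<close>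
definition span_lift :: "nat \<Rightarrow> wfunctor \<Rightarrow> expr \<Rightarrow> expr \<Rightarrow> wfunctor" where
  "span_lift i F p q =
     \<lparr>on_ob = on_ob F, on_mor = span_on_mor i F, pres_id = p, pres_cmp = q\<rparr>"


section \<open>The universe of codes and the functor !\<close>

abbreviation V :: expr where "V \<equiv> lv 0"
abbreviation El :: "expr \<Rightarrow> expr" where "El E \<equiv> lv 1 \<cdot> E"

text \<open>The type of codes for \<open>T\<close>, that is, the fibre of \<open>El\<close> over \<open>T\<close>; it is a proposition as \<open>El\<close> is
  an embedding.\<close>
definition code_for :: "nat \<Rightarrow> expr \<Rightarrow> expr" where
  "code_for i T = (\<^bold>\<Sigma>G\<^bold>:V. idt (uni i) (El G) T)"

definition telescope :: "expr list \<Rightarrow> ctx" where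
  "telescope Ts = rev (map (\<lambda>k. (Ts ! k) k) [0..<length Ts])"

definition codes_ctx :: "nat \<Rightarrow> ctx" where
  "codes_ctx i = telescope
     [uni i,
      V \<^bold>\<rightarrow> uni i,
      is_embedding V (uni i) (lv 1),
      (\<^bold>\<Pi>E\<^bold>:V. \<^bold>\<Pi>F\<^bold>:El E \<^bold>\<rightarrow> V. code_for i (\<^bold>\<Sigma>x\<^bold>:El E. El (F \<cdot> x))),
      code_for i emp,
      (\<^bold>\<Pi>E\<^bold>:V. \<^bold>\<Pi>F\<^bold>:V. code_for i (El E \<^bold>+ El F)),
      code_for i one]"

definition bang_ty :: "expr \<Rightarrow> expr" where
  "bang_ty A = (\<^bold>\<Sigma>E\<^bold>:V. El E \<^bold>\<rightarrow> A)"

text \<open>By the computation rules for projections, \<open>bang_fun A f\<close> sends \<open>(E, p)\<close> to \<open>(E, f \<circ> p)\<close>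
  judgmentally.\<close>
definition bang_fun :: "expr \<Rightarrow> expr \<Rightarrow> expr" where
  "bang_fun A f =
     (\<^bold>\<lambda>w\<^bold>:bang_ty A.
        \<^bold>\<langle>fstp V w, fcomp (El (fstp V w)) f (sndp V (\<lambda>E. El E \<^bold>\<rightarrow> A) w)\<^bold>\<rangle>)"

text \<open>
  Composition is preserved judgmentally.  Identities are preserved by the uniqueness principle of
  \<open>\<Sigma>\<close>-types and function extensionality.
\<close>
definition bang :: "nat \<Rightarrow> wfunctor" where
  "bang i =
     \<lparr>on_ob = (\<^bold>\<lambda>A\<^bold>:uni i. bang_ty A),
      on_mor = (\<^bold>\<lambda>A\<^bold>:uni i. \<^bold>\<lambda>B\<^bold>:uni i. \<^bold>\<lambda>f\<^bold>:A \<^bold>\<rightarrow> B. bang_fun A f),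
      pres_id =
        (\<^bold>\<lambda>A\<^bold>:uni i.
           funext i (bang_ty A) (bang_ty A) (bang_fun A (idfun A)) (idfun (bang_ty A))
             (\<^bold>\<lambda>w\<^bold>:bang_ty A.
                ind_sg (\<lambda>z. idt (bang_ty A) (bang_fun A (idfun A) \<cdot> z) z)
                  (\<lambda>E p. rfl \<^bold>\<langle>E, p\<^bold>\<rangle>) w)),
      pres_cmp =
        (\<^bold>\<lambda>A\<^bold>:uni i. \<^bold>\<lambda>B\<^bold>:uni i. \<^bold>\<lambda>C\<^bold>:uni i. \<^bold>\<lambda>f\<^bold>:A \<^bold>\<rightarrow> B. \<^bold>\<lambda>g\<^bold>:B \<^bold>\<rightarrow> C.
           rfl (bang_fun A (fcomp A g f)))\<rparr>"

end

theory Submission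
  imports Defs
begin

text \<open>
  The derivations are found by a type checker for the fragment of the theory that is used, which is
  proved sound here and run by rewriting.  It elaborates source terms to terms in which every
  elimination carries the types it needs.  Universe levels are checked relative to a base level, so
  that one run serves all \<open>i\<close>.

  For the mathematics, let \<open>P = A \<times>\<^sub>C B\<close>.  By function extensionality a map \<open>u : E \<rightarrow> P\<close> is a triple of
  maps \<open>a\<close>, \<open>b\<close> and an identification \<open>f \<circ> a = g \<circ> b\<close>.  On the other hand the fibre of \<open>!g\<close> over
  \<open>(E, c)\<close> is the type of \<open>b : E \<rightarrow> B\<close> with \<open>c = g \<circ> b\<close>.  So both \<open>!P\<close> and the pullback of \<open>!f\<close> and \<open>!g\<close>
  are equivalent to the type of such triples with varying \<open>E\<close>.  The comparison map commutes with
  the two equivalences because the identification in its definition, evaluated at \<open>(E, u)\<close>, is the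
  image under \<open>(E, _)\<close> of the one belonging to \<open>u\<close>.  Finally, univalence turns the equivalence over
  the legs of two spans into an identification of spans.
\<close>

section \<open>Substitution calculus\<close>

text \<open>The statement fixes raw terms, redexes included, so inhabiting some convertible type is
  not enough: each elaborated term has to erase to the given source literally. This is why annotated
  terms keep what the source wrote next to what its type prescribes. Deciding conversion would
  ordinarily rest on normalization; here the checker is sound but claims no completeness: it runs on
  fuel, and a redex is contracted only after its annotations have been compared.

  The delicate point of the mathematics is the path component of the comparison map. It is built
  from a value of function extensionality, which no computation rule reduces. Its value at
  \<open>(E, u)\<close> is therefore found for an arbitrary identification of functions, where path
  induction applies, and specialized afterwards. Fibres of \<open>!g\<close> are treated in the same
  spirit: one transports along a path in \<open>!C\<close> and never splits it into a path of codes
  and a path over it.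

  Since \<open>isequiv\<close> has separate left and right inverses, cancellation laws that are
  immediate for a two-sided inverse need a detour through both.\<close>

lemma up_ren_simps [simp]: "up_ren r 0 = 0" "up_ren r (Suc n) = Suc (r n)"
  by (simp_all add: up_ren_def)

lemma scons_simps [simp]: "(a \<bullet> s) 0 = a" "(a \<bullet> s) (Suc n) = s n"
  by (simp_all add: scons_def)

lemma up_simps [simp]: "up s 0 = Var 0" "up s (Suc n) = ren Suc (s n)"
  by (simp_all add: up_def)

lemma nat_fun_eqI: "f 0 = g 0 \<Longrightarrow> (\<And>n. f (Suc n) = g (Suc n)) \<Longrightarrow> f = g"
  by (rule ext) (metis nat.exhaust)

lemma up_ren_comp: "(\<lambda>x. up_ren r (up_ren q x)) = up_ren (\<lambda>x. r (q x))"
  by (rule nat_fun_eqI) simp_all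

lemma ren_ren [simp]: "ren r (ren q t) = ren (\<lambda>x. r (q x)) t"
  by (induction t arbitrary: r q) (simp_all add: up_ren_comp)

lemma up_up_ren: "(\<lambda>x. up s (up_ren r x)) = up (\<lambda>x. s (r x))"
  by (rule nat_fun_eqI) simp_all

lemma sub_ren [simp]: "sub s (ren r t) = sub (\<lambda>x. s (r x)) t"
  by (induction t arbitrary: r s) (simp_all add: up_up_ren)

lemma ren_up: "(\<lambda>x. ren (up_ren r) (up s x)) = up (\<lambda>x. ren r (s x))"
  by (rule nat_fun_eqI) simp_all

lemma ren_sub: "ren r (sub s t) = sub (\<lambda>x. ren r (s x)) t"
  by (induction t arbitrary: r s) (simp_all add: ren_up)

lemma sub_up: "(\<lambda>x. sub (up s) (up q x)) = up (\<lambda>x. sub s (q x))"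
  by (rule nat_fun_eqI) (simp_all add: ren_sub)

lemma sub_sub [simp]: "sub s (sub q t) = sub (\<lambda>x. sub s (q x)) t"
  by (induction t arbitrary: q s) (simp_all add: sub_up)

lemma up_Var: "up Var = Var"
  by (rule nat_fun_eqI) simp_all

lemma sub_Var [simp]: "sub Var t = t"
  by (induction t) (simp_all add: up_Var)

lemma up_Var_ren: "up (\<lambda>x. Var (r x)) = (\<lambda>x. Var (up_ren r x))"
  by (rule nat_fun_eqI) simp_all

lemma ren_eq_sub: "ren r t = sub (\<lambda>x. Var (r x)) t"
  by (induction t arbitrary: r) (simp_all add: up_Var_ren)

lemma ren_id [simp]: "ren (\<lambda>n. n) t = t"
  by (simp add: ren_eq_sub)

lemma scons_o: "(\<lambda>x. sub s ((a \<bullet> q) x)) = sub s a \<bullet> (\<lambda>x. sub s (q x))"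
  by (rule nat_fun_eqI) simp_all

lemma scons_sub_up: "(\<lambda>x. sub (a \<bullet> q) (up s x)) = a \<bullet> (\<lambda>x. sub q (s x))"
  by (rule nat_fun_eqI) simp_all

text \<open>The typing rules build types by instantiating one to three variables, by the patterns of
  the eliminators under binders, and by weakening. \<open>sub_push\<close> collects how a
  substitution moves inside each of these, so that a substituted instance of a rule is again an
  instance of that rule.\<close>

lemma sub_inst1: "sub s (B\<langle>a\<rangle>) = (sub (up s) B)\<langle>sub s a\<rangle>"
  by (simp add: scons_o scons_sub_up)

lemma sub_inst2: "sub s (sub (b \<bullet> a \<bullet> Var) g) = sub (sub s b \<bullet> sub s a \<bullet> Var) (sub (up (up s)) g)"
  by (simp add: scons_o scons_sub_up)

lemma sub_inst3: "sub s (sub (c \<bullet> b \<bullet> a \<bullet> Var) g) =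
    sub (sub s c \<bullet> sub s b \<bullet> sub s a \<bullet> Var) (sub (up (up (up s))) g)"
  by (simp add: scons_o scons_sub_up)

lemma ren_as_sub1: "ren Suc = sub (\<lambda>n. Var (Suc n))"
  by (rule ext) (simp add: ren_eq_sub)

lemma sub_pat1: "sub (up s) (sub (a \<bullet> (\<lambda>n. Var (n + 1))) C) =
    sub (sub (up s) a \<bullet> (\<lambda>n. Var (n + 1))) (sub (up s) C)"
  by (simp add: scons_o scons_sub_up ren_as_sub1)

lemma sub_pat2: "sub (up (up s)) (sub (a \<bullet> (\<lambda>n. Var (n + 2))) C) =
    sub (sub (up (up s)) a \<bullet> (\<lambda>n. Var (n + 2))) (sub (up s) C)"
  by (simp add: scons_o scons_sub_up ren_as_sub1)

lemma sub_pat3: "sub (up s) (sub (c \<bullet> b \<bullet> a \<bullet> (\<lambda>n. Var (n + 1))) C) =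
    sub (sub (up s) c \<bullet> sub (up s) b \<bullet> sub (up s) a \<bullet> (\<lambda>n. Var (n + 1))) (sub (up (up (up s))) C)"
  by (simp add: scons_o scons_sub_up ren_as_sub1)

lemma sub_wk1: "sub (up s) (wk 1 A) = wk 1 (sub s A)"
  by (simp add: ren_sub)

lemma sub_wk2: "sub (up (up s)) (wk 2 A) = wk 2 (sub s A)"
  by (simp add: ren_sub)

lemmas sub_push = sub_inst1 sub_inst2 sub_inst3 sub_pat1 sub_pat2 sub_pat3 sub_wk1 sub_wk2

lemmas expr_defs = lv_def uni_def pi_def lam_def sg_def app_def pr_def ind_sg_def cot_def emp_def
  one_def idt_def rfl_def ind_id_def fstp_def sndp_def idfun_def fcomp_def isequiv_def eqv_inv_def
  equivt_def idequiv_def path_inv_def path_conc_def ap_def happly_def idtoeqv_def is_embedding_def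
  univalence_ty_def funext_ty_def funext_def

lemma up_numeral: "up s (numeral k) = ren Suc (s (pred_numeral k))"
  by (simp add: numeral_eq_Suc)

text \<open>The type is closed: every \<open>lv k\<close> in it is bound inside, so the ambient
  length cancels in the de Bruijn index. Hence the axioms, whose types mention
  \<open>length \<Gamma>\<close>, survive substitution into contexts of any other length.\<close>

lemma sub_funext_ty: "sub s (funext_ty i m) = funext_ty i n"
  by (simp add: expr_defs up_numeral Suc_diff_le)

lemma sub_univalence_ty: "sub s (univalence_ty i m) = univalence_ty i n"
  by (simp add: expr_defs up_numeral Suc_diff_le)


text \<open>Rules such as \<open>ty_Lam\<close> have no premise that types the domain, so the
  well-formed context needed to go under the binder has to be extracted from the derivation of the
  body. This predicate records it for every entry of the context.\<close>

definition prefix_wf :: "((nat \<Rightarrow> tm) \<Rightarrow> ctx \<Rightarrow> ctx \<Rightarrow> bool) \<Rightarrow> ctx \<Rightarrow> bool" where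
  "prefix_wf K \<Gamma> \<longleftrightarrow> (\<forall>\<Xi> A \<Gamma>' s \<Delta>. \<Gamma> = \<Xi> @ A # \<Gamma>' \<longrightarrow> wf \<Delta> \<longrightarrow> K s \<Delta> \<Gamma>' \<longrightarrow> wf (sub s A # \<Delta>))"

definition mor_class :: "((nat \<Rightarrow> tm) \<Rightarrow> ctx \<Rightarrow> ctx \<Rightarrow> bool) \<Rightarrow> bool" where
  "mor_class K \<longleftrightarrow>
     (\<forall>s \<Delta> \<Gamma> n. K s \<Delta> \<Gamma> \<longrightarrow> wf \<Delta> \<longrightarrow> n < length \<Gamma> \<longrightarrow> \<Delta> \<turnstile> s n \<^bold>: sub s (wk (Suc n) (\<Gamma> ! n))) \<and>
     (\<forall>s \<Delta> \<Gamma> A. K s \<Delta> \<Gamma> \<longrightarrow> wf (sub s A # \<Delta>) \<longrightarrow> K (up s) (sub s A # \<Delta>) (A # \<Gamma>))"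

lemma prefix_wf_tail: "prefix_wf K (A # \<Gamma>) \<Longrightarrow> prefix_wf K \<Gamma>"
  unfolding prefix_wf_def by (metis append_Cons)

lemma prefix_wf_ext:
  "prefix_wf K (A # \<Gamma>) \<Longrightarrow> mor_class K \<Longrightarrow> wf \<Delta> \<Longrightarrow> K s \<Delta> \<Gamma> \<Longrightarrow>
     wf (sub s A # \<Delta>) \<and> K (up s) (sub s A # \<Delta>) (A # \<Gamma>)"
  unfolding prefix_wf_def mor_class_def by (metis append_Nil)

lemma prefix_wf_Nil: "prefix_wf K []"
  by (simp add: prefix_wf_def)

lemma prefix_wf_Cons:
  "prefix_wf K \<Gamma> \<Longrightarrow> (\<And>s \<Delta>. wf \<Delta> \<Longrightarrow> K s \<Delta> \<Gamma> \<Longrightarrow> wf (sub s A # \<Delta>)) \<Longrightarrow> prefix_wf K (A # \<Gamma>)"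
  unfolding prefix_wf_def by (metis Cons_eq_append_conv list.inject)

lemmas congruence_rules =
  ty_Uni ty_Pi eq_Pi ty_Lam eq_Lam ty_App eq_App Pi_comp
  ty_Sg eq_Sg ty_Pr eq_Pr ty_IndSg eq_IndSg Sg_comp
  ty_Co eq_Co ty_InL eq_InL ty_InR eq_InR ty_IndCo eq_IndCo Co_comp_InL Co_comp_InR
  ty_Emp ty_IndEmp eq_IndEmp ty_One ty_Star ty_IndOne eq_IndOne One_comp
  ty_Nat ty_Zero ty_Succ eq_Succ ty_IndNat eq_IndNat Nat_comp_Zero Nat_comp_Succ
  ty_Id eq_Id ty_Rfl eq_Rfl ty_IndId eq_IndId Id_comp

text \<open>These four rules are shaped for forward resolution: they turn the induction hypothesis
  of a premise under zero to three binders into its instance for the substitution lifted as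
  often.\<close>

lemma under_0:
  "Q \<and> (\<forall>s \<Delta>. wf \<Delta> \<longrightarrow> K s \<Delta> \<Gamma> \<longrightarrow> P s \<Delta>) \<Longrightarrow> wf \<Delta> \<Longrightarrow> K s \<Delta> \<Gamma> \<Longrightarrow> P s \<Delta>"
  by blast

lemma under_1:
  "mor_class K \<Longrightarrow>
   prefix_wf K (A # \<Gamma>) \<and> (\<forall>s \<Delta>. wf \<Delta> \<longrightarrow> K s \<Delta> (A # \<Gamma>) \<longrightarrow> P s \<Delta>) \<Longrightarrow>
   wf \<Delta> \<Longrightarrow> K s \<Delta> \<Gamma> \<Longrightarrow> P (up s) (sub s A # \<Delta>)"
  using prefix_wf_ext by blast

lemma under_2:
  "mor_class K \<Longrightarrow>
   prefix_wf K (B # A # \<Gamma>) \<and> (\<forall>s \<Delta>. wf \<Delta> \<longrightarrow> K s \<Delta> (B # A # \<Gamma>) \<longrightarrow> P s \<Delta>) \<Longrightarrow>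
   wf \<Delta> \<Longrightarrow> K s \<Delta> \<Gamma> \<Longrightarrow> P (up (up s)) (sub (up s) B # sub s A # \<Delta>)"
  using prefix_wf_ext prefix_wf_tail by blast

lemma under_3:
  "mor_class K \<Longrightarrow>
   prefix_wf K (C # B # A # \<Gamma>) \<and> (\<forall>s \<Delta>. wf \<Delta> \<longrightarrow> K s \<Delta> (C # B # A # \<Gamma>) \<longrightarrow> P s \<Delta>) \<Longrightarrow>
   wf \<Delta> \<Longrightarrow> K s \<Delta> \<Gamma> \<Longrightarrow> P (up (up (up s))) (sub (up (up s)) C # sub (up s) B # sub s A # \<Delta>)"
  using prefix_wf_ext prefix_wf_tail by blast

lemma up_low: "up s 0 = Var 0" "up (up s) 1 = Var 1"
  by simp_all

lemma has_ty_eq: "\<Gamma> \<turnstile> a \<^bold>: A \<Longrightarrow> B = A \<Longrightarrow> \<Gamma> \<turnstile> a \<^bold>: B"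
  by simp

text \<open>
  One induction serves renamings and substitutions: \<open>K\<close> is a class of them that is closed under
  binders, and \<open>prefix_wf\<close> provides the well-formedness of the contexts that binders lead to.
\<close>
lemma morphism:
  assumes K: "mor_class K"
  shows "wf \<Gamma> \<Longrightarrow> prefix_wf K \<Gamma>"
    and "\<Gamma> \<turnstile> a \<^bold>: A \<Longrightarrow> prefix_wf K \<Gamma> \<and>
           (\<forall>s \<Delta>. wf \<Delta> \<longrightarrow> K s \<Delta> \<Gamma> \<longrightarrow> \<Delta> \<turnstile> sub s a \<^bold>: sub s A)"
    and "\<Gamma> \<turnstile> a \<doteq> b \<^bold>: A \<Longrightarrow> prefix_wf K \<Gamma> \<and>
           (\<forall>s \<Delta>. wf \<Delta> \<longrightarrow> K s \<Delta> \<Gamma> \<longrightarrow> \<Delta> \<turnstile> sub s a \<doteq> sub s b \<^bold>: sub s A)"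
proof (induction rule: wf_has_ty_eq_tm.inducts)
  case (ty_Var \<Gamma> n)
  then show ?case using K unfolding mor_class_def by auto
next
  case (Pi_uniq \<Gamma> f A B)
  show ?case
  proof (intro conjI allI impI)
    show "prefix_wf K \<Gamma>"
      using Pi_uniq by blast
    fix s \<Delta> assume "wf \<Delta>" "K s \<Delta> \<Gamma>"
    with Pi_uniq have "\<Delta> \<turnstile> sub s f \<^bold>: PiT (sub s A) (sub (up s) B)"
      by auto
    from wf_has_ty_eq_tm.Pi_uniq[OF this]
    show "\<Delta> \<turnstile> sub s f \<doteq> sub s (Lam A (App (wk 1 f) (Var 0))) \<^bold>: sub s (PiT A B)"
      by (simp add: ren_sub)
  qed
next
  case (ax_funext \<Gamma> i)
  then show ?case
    by (auto intro!: wf_has_ty_eq_tm.ax_funext[THEN has_ty_eq] sub_funext_ty)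
next
  case (ax_univalence \<Gamma> i)
  then show ?case
    by (auto intro!: wf_has_ty_eq_tm.ax_univalence[THEN has_ty_eq] sub_univalence_ty)
next
  case (wf_Cons \<Gamma> A i)
  then show ?case
    by (auto intro!: prefix_wf_Cons intro: wf_has_ty_eq_tm.wf_Cons)
next
  case (ty_conv \<Gamma> a A B i)
  then show ?case
    by (simp, blast intro: wf_has_ty_eq_tm.ty_conv)
next
  case (eq_conv \<Gamma> a b A B i)
  then show ?case
    by (simp, blast intro: wf_has_ty_eq_tm.eq_conv)
next
  case (eq_refl \<Gamma> a A)
  then show ?case
    by (simp, blast intro: wf_has_ty_eq_tm.eq_refl)
next
  case (eq_sym \<Gamma> a b A)
  then show ?case
    by (simp, blast intro: wf_has_ty_eq_tm.eq_sym)
next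
  case (eq_trans \<Gamma> a b A c)
  then show ?case
    by (simp, blast intro: wf_has_ty_eq_tm.eq_trans)
next
  case (ty_cumul \<Gamma> A i)
  then show ?case
    by (simp, blast intro: wf_has_ty_eq_tm.ty_cumul)
next
  case (eq_cumul \<Gamma> A B i)
  then show ?case
    by (simp, blast intro: wf_has_ty_eq_tm.eq_cumul)
\<comment> \<open>The remaining rules are stable for one reason: once the substitution is pushed
  inside, the goal is a conclusion of the same rule, and each premise is an induction hypothesis
  taken under at most three binders.\<close>
qed (
  (simp only: prefix_wf_Nil)
  | (rule conjI, (blast dest: prefix_wf_tail), intro allI impI,
     simp only: sub.simps sub_push up_low,
     rule congruence_rules;
     (assumption
      | (drule under_0, assumption, assumption, assumption)
      | (drule under_1[OF K], assumption, assumption, (simp only: sub.simps sub_push up_low; fail))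
      | (drule under_2[OF K], assumption, assumption, (simp only: sub.simps sub_push up_low; fail))
      | (drule under_3[OF K], assumption, assumption, (simp only: sub.simps sub_push up_low; fail)))))+


text \<open>Asserting all suffixes, not only the context itself, lets a premise in an extended
  context yield the claim for the context of the conclusion by dropping its head.\<close>

definition drops_wf :: "ctx \<Rightarrow> bool" where
  "drops_wf \<Gamma> \<longleftrightarrow> (\<forall>k. wf (drop k \<Gamma>))"

lemma drops_wf_tail: "drops_wf (A # \<Gamma>) \<Longrightarrow> drops_wf \<Gamma>"
  unfolding drops_wf_def by (metis drop_Suc_Cons)

lemma drops_wf_Cons: "drops_wf \<Gamma> \<Longrightarrow> wf (A # \<Gamma>) \<Longrightarrow> drops_wf (A # \<Gamma>)"
  unfolding drops_wf_def by (simp add: drop_Cons')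

lemma
  shows wf_drops_wf: "wf \<Gamma> \<Longrightarrow> drops_wf \<Gamma>"
    and has_ty_drops_wf: "\<Gamma> \<turnstile> a \<^bold>: A \<Longrightarrow> drops_wf \<Gamma>"
    and eq_tm_drops_wf: "\<Gamma> \<turnstile> a \<doteq> b \<^bold>: A \<Longrightarrow> drops_wf \<Gamma>"
proof (induction rule: wf_has_ty_eq_tm.inducts)
  case wf_Nil
  then show ?case by (simp add: drops_wf_def wf_has_ty_eq_tm.wf_Nil)
next
  case (wf_Cons \<Gamma> A i)
  then show ?case by (blast intro: drops_wf_Cons wf_has_ty_eq_tm.wf_Cons)
qed (assumption | (erule drops_wf_tail))+

lemma has_ty_wf: "\<Gamma> \<turnstile> a \<^bold>: A \<Longrightarrow> wf \<Gamma>"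
  using has_ty_drops_wf unfolding drops_wf_def by (metis drop0)

section \<open>Renaming and substitution of typed terms\<close>

definition tm_mor :: "(nat \<Rightarrow> tm) \<Rightarrow> ctx \<Rightarrow> ctx \<Rightarrow> bool" where
  "tm_mor s \<Delta> \<Gamma> \<longleftrightarrow> (\<forall>n < length \<Gamma>. \<Delta> \<turnstile> s n \<^bold>: sub s (wk (Suc n) (\<Gamma> ! n)))"

definition ren_mor :: "(nat \<Rightarrow> nat) \<Rightarrow> ctx \<Rightarrow> ctx \<Rightarrow> bool" where
  "ren_mor r \<Delta> \<Gamma> \<longleftrightarrow>
     (\<forall>n < length \<Gamma>. r n < length \<Delta> \<and> wk (Suc (r n)) (\<Delta> ! r n) = ren r (wk (Suc n) (\<Gamma> ! n)))"

lemma ren_mor_up: "ren_mor r \<Delta> \<Gamma> \<Longrightarrow> ren_mor (up_ren r) (ren r A # \<Delta>) (A # \<Gamma>)"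
proof -
  assume r: "ren_mor r \<Delta> \<Gamma>"
  have "wk (Suc (Suc (r n))) (\<Delta> ! r n) = ren (up_ren r) (wk (Suc (Suc n)) (\<Gamma> ! n))"
    if "n < length \<Gamma>" for n
  proof -
    have "ren Suc (wk (Suc (r n)) (\<Delta> ! r n)) = ren Suc (ren r (wk (Suc n) (\<Gamma> ! n)))"
      using r that by (simp add: ren_mor_def)
    then show ?thesis by simp
  qed
  with r show ?thesis
    by (auto simp: ren_mor_def nth_Cons less_Suc_eq_0_disj split: nat.splits)
qed

lemma ren_mor_Suc: "ren_mor Suc (B # \<Gamma>) \<Gamma>"
  by (simp add: ren_mor_def)

lemma mor_class_ren: "mor_class (\<lambda>s \<Delta> \<Gamma>. \<exists>r. s = (\<lambda>n. Var (r n)) \<and> ren_mor r \<Delta> \<Gamma>)"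
  unfolding mor_class_def
proof (intro conjI allI impI; elim exE conjE)
  fix s \<Delta> \<Gamma> n r
  assume "wf \<Delta>" "n < length \<Gamma>" "s = (\<lambda>n. Var (r n))" "ren_mor r \<Delta> \<Gamma>"
  then show "\<Delta> \<turnstile> s n \<^bold>: sub s (wk (Suc n) (\<Gamma> ! n))"
    using ty_Var[of \<Delta> "r n"] by (simp add: ren_mor_def ren_eq_sub)
next
  fix s \<Delta> \<Gamma> A r
  assume "s = (\<lambda>n. Var (r n))" "ren_mor r \<Delta> \<Gamma>"
  then show "\<exists>q. up s = (\<lambda>n. Var (q n)) \<and> ren_mor q (sub s A # \<Delta>) (A # \<Gamma>)"
    using ren_mor_up[of r \<Delta> \<Gamma> A] by (auto simp: up_Var_ren ren_eq_sub)
qed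

lemma
  assumes "wf \<Delta>" "ren_mor r \<Delta> \<Gamma>"
  shows has_ty_ren: "\<Gamma> \<turnstile> a \<^bold>: A \<Longrightarrow> \<Delta> \<turnstile> ren r a \<^bold>: ren r A"
    and eq_tm_ren: "\<Gamma> \<turnstile> a \<doteq> b \<^bold>: A \<Longrightarrow> \<Delta> \<turnstile> ren r a \<doteq> ren r b \<^bold>: ren r A"
proof -
  let ?s = "\<lambda>n. Var (r n)"
  show "\<Delta> \<turnstile> ren r a \<^bold>: ren r A" if "\<Gamma> \<turnstile> a \<^bold>: A"
    unfolding ren_eq_sub[abs_def]
    using morphism(2)[OF mor_class_ren that, THEN conjunct2, rule_format, of \<Delta> ?s] assms by blast
  show "\<Delta> \<turnstile> ren r a \<doteq> ren r b \<^bold>: ren r A" if "\<Gamma> \<turnstile> a \<doteq> b \<^bold>: A"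
    unfolding ren_eq_sub[abs_def]
    using morphism(3)[OF mor_class_ren that, THEN conjunct2, rule_format, of \<Delta> ?s] assms by blast
qed

lemma has_ty_Suc: "\<Gamma> \<turnstile> a \<^bold>: A \<Longrightarrow> wf (B # \<Gamma>) \<Longrightarrow> B # \<Gamma> \<turnstile> ren Suc a \<^bold>: ren Suc A"
  using has_ty_ren ren_mor_Suc by blast

text \<open>Lifting a substitution under a binder weakens its terms. Closure under binders thus
  depends on weakening of judgments, which is why renamings are treated before.\<close>

lemma mor_class_tm: "mor_class tm_mor"
  unfolding mor_class_def
proof (intro conjI allI impI)
  fix s \<Delta> \<Gamma> A
  assume s: "tm_mor s \<Delta> \<Gamma>" and wf: "wf (sub s A # \<Delta>)"
  show "tm_mor (up s) (sub s A # \<Delta>) (A # \<Gamma>)"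
    unfolding tm_mor_def
  proof (intro allI impI)
    fix n assume "n < length (A # \<Gamma>)"
    then show "sub s A # \<Delta> \<turnstile> up s n \<^bold>: sub (up s) (wk (Suc n) ((A # \<Gamma>) ! n))"
    proof (cases n)
      case 0
      then show ?thesis
        using ty_Var[OF wf, of 0] by (simp add: ren_sub)
    next
      case (Suc m)
      with s \<open>n < length (A # \<Gamma>)\<close> have "\<Delta> \<turnstile> s m \<^bold>: sub s (wk (Suc m) (\<Gamma> ! m))"
        by (simp add: tm_mor_def)
      from has_ty_Suc[OF this wf] Suc show ?thesis
        by (simp add: ren_sub)
    qed
  qed
qed (simp add: tm_mor_def)

lemma
  assumes "wf \<Delta>" "tm_mor s \<Delta> \<Gamma>"
  shows has_ty_sub: "\<Gamma> \<turnstile> a \<^bold>: A \<Longrightarrow> \<Delta> \<turnstile> sub s a \<^bold>: sub s A"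
    and eq_tm_sub: "\<Gamma> \<turnstile> a \<doteq> b \<^bold>: A \<Longrightarrow> \<Delta> \<turnstile> sub s a \<doteq> sub s b \<^bold>: sub s A"
  using morphism(2,3)[OF mor_class_tm] assms by auto

section \<open>Cumulativity and subsumption\<close>

lemma cumul: "\<Gamma> \<turnstile> A \<^bold>: Uni j \<Longrightarrow> j \<le> k \<Longrightarrow> \<Gamma> \<turnstile> A \<^bold>: Uni k"
  by (rotate_tac, induction rule: dec_induct) (auto intro: ty_cumul)

lemma cumul_eq: "\<Gamma> \<turnstile> A \<doteq> B \<^bold>: Uni j \<Longrightarrow> j \<le> k \<Longrightarrow> \<Gamma> \<turnstile> A \<doteq> B \<^bold>: Uni k"
  by (rotate_tac, induction rule: dec_induct) (auto intro: eq_cumul)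

text \<open>The closure of judgmental equality of types and inclusion of universes, that is, of what
  \<open>ty_conv\<close> and \<open>ty_cumul\<close> permit. There is no variance under Pi or Sigma,
  as the theory has no rule for it. Transitivity is built in so that several conversions count as
  one step.\<close>

inductive le :: "ctx \<Rightarrow> tm \<Rightarrow> tm \<Rightarrow> bool" where
  le_eq: "\<Gamma> \<turnstile> A \<doteq> B \<^bold>: Uni k \<Longrightarrow> le \<Gamma> A B"
| le_Uni: "j \<le> k \<Longrightarrow> le \<Gamma> (Uni j) (Uni k)"
| le_trans: "le \<Gamma> A B \<Longrightarrow> le \<Gamma> B C \<Longrightarrow> le \<Gamma> A C"

lemma le_refl: "\<Gamma> \<turnstile> A \<^bold>: Uni k \<Longrightarrow> le \<Gamma> A A"
  by (rule le_eq) (rule eq_refl)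

lemma le_ty: "le \<Gamma> A B \<Longrightarrow> \<Gamma> \<turnstile> a \<^bold>: A \<Longrightarrow> \<Gamma> \<turnstile> a \<^bold>: B"
  by (induction rule: le.induct) (auto intro: ty_conv cumul)

lemma le_eq_tm: "le \<Gamma> A B \<Longrightarrow> \<Gamma> \<turnstile> a \<doteq> b \<^bold>: A \<Longrightarrow> \<Gamma> \<turnstile> a \<doteq> b \<^bold>: B"
  by (induction rule: le.induct) (auto intro: eq_conv cumul_eq)

lemma le_sub: "le \<Gamma> A B \<Longrightarrow> wf \<Delta> \<Longrightarrow> tm_mor s \<Delta> \<Gamma> \<Longrightarrow> le \<Delta> (sub s A) (sub s B)"
  by (induction rule: le.induct) (auto intro: le.intros, metis eq_tm_sub le_eq sub.simps(2))

section \<open>Scoping of typed terms\<close>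

primrec closed_at :: "nat \<Rightarrow> tm \<Rightarrow> bool" where
  "closed_at k (Var n) \<longleftrightarrow> n < k"
| "closed_at k (Uni i) \<longleftrightarrow> True"
| "closed_at k (PiT A B) \<longleftrightarrow> closed_at k A \<and> closed_at (Suc k) B"
| "closed_at k (Lam A b) \<longleftrightarrow> closed_at k A \<and> closed_at (Suc k) b"
| "closed_at k (App f a) \<longleftrightarrow> closed_at k f \<and> closed_at k a"
| "closed_at k (SgT A B) \<longleftrightarrow> closed_at k A \<and> closed_at (Suc k) B"
| "closed_at k (Pr a b) \<longleftrightarrow> closed_at k a \<and> closed_at k b"
| "closed_at k (IndSg C g p) \<longleftrightarrow>
     closed_at (Suc k) C \<and> closed_at (Suc (Suc k)) g \<and> closed_at k p"
| "closed_at k (CoT A B) \<longleftrightarrow> closed_at k A \<and> closed_at k B"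
| "closed_at k (InL a) \<longleftrightarrow> closed_at k a"
| "closed_at k (InR b) \<longleftrightarrow> closed_at k b"
| "closed_at k (IndCo C c d e) \<longleftrightarrow>
     closed_at (Suc k) C \<and> closed_at (Suc k) c \<and> closed_at (Suc k) d \<and> closed_at k e"
| "closed_at k Emp \<longleftrightarrow> True"
| "closed_at k (IndEmp C a) \<longleftrightarrow> closed_at (Suc k) C \<and> closed_at k a"
| "closed_at k One \<longleftrightarrow> True"
| "closed_at k Star \<longleftrightarrow> True"
| "closed_at k (IndOne C c a) \<longleftrightarrow> closed_at (Suc k) C \<and> closed_at k c \<and> closed_at k a"
| "closed_at k NatT \<longleftrightarrow> True"
| "closed_at k Zero \<longleftrightarrow> True"
| "closed_at k (Succ n) \<longleftrightarrow> closed_at k n"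
| "closed_at k (IndNat C c d n) \<longleftrightarrow>
     closed_at (Suc k) C \<and> closed_at k c \<and> closed_at (Suc (Suc k)) d \<and> closed_at k n"
| "closed_at k (IdT A a b) \<longleftrightarrow> closed_at k A \<and> closed_at k a \<and> closed_at k b"
| "closed_at k (Rfl a) \<longleftrightarrow> closed_at k a"
| "closed_at k (IndId C c a b p) \<longleftrightarrow> closed_at (Suc (Suc (Suc k))) C \<and> closed_at (Suc k) c \<and>
     closed_at k a \<and> closed_at k b \<and> closed_at k p"
| "closed_at k (FunextC i) \<longleftrightarrow> True"
| "closed_at k (UaC i) \<longleftrightarrow> True"

primrec ctx_closed :: "ctx \<Rightarrow> bool" where
  "ctx_closed [] \<longleftrightarrow> True"
| "ctx_closed (A # \<Gamma>) \<longleftrightarrow> closed_at (length \<Gamma>) A \<and> ctx_closed \<Gamma>"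

lemma
  shows "wf \<Gamma> \<Longrightarrow> ctx_closed \<Gamma>"
    and has_ty_closed: "\<Gamma> \<turnstile> a \<^bold>: A \<Longrightarrow> ctx_closed \<Gamma> \<and> closed_at (length \<Gamma>) a"
    and "\<Gamma> \<turnstile> a \<doteq> b \<^bold>: A \<Longrightarrow> ctx_closed \<Gamma>"
  by (induction rule: wf_has_ty_eq_tm.inducts) simp_all

definition agree :: "nat \<Rightarrow> (nat \<Rightarrow> tm) \<Rightarrow> (nat \<Rightarrow> tm) \<Rightarrow> bool" where
  "agree k s q \<longleftrightarrow> (\<forall>n<k. s n = q n)"

lemma agree_up: "agree k s q \<Longrightarrow> agree (Suc k) (up s) (up q)"
  unfolding agree_def
proof (intro allI impI)
  fix n assume "\<forall>n<k. s n = q n" "n < Suc k"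
  then show "up s n = up q n"
    by (cases n) simp_all
qed

lemma sub_closed_cong: "closed_at k t \<Longrightarrow> agree k s q \<Longrightarrow> sub s t = sub q t"
proof (induction t arbitrary: k s q)
  case (Var n)
  then show ?case by (simp add: agree_def)
qed (simp_all, (meson agree_up)+)

text \<open>A typed term is well scoped, so the values of a substitution beyond the context are
  irrelevant. This reconciles \<open>vsub\<close>, which has a default there, with substitutions
  that send further variables to variables.\<close>

lemma has_ty_sub_cong:
  "\<Gamma> \<turnstile> a \<^bold>: A \<Longrightarrow> (\<And>n. n < length \<Gamma> \<Longrightarrow> s n = q n) \<Longrightarrow> sub s a = sub q a"
  by (rule sub_closed_cong) (auto dest: has_ty_closed simp: agree_def)


section \<open>Annotated terms\<close>

text \<open>In \<open>ALam A' A B b\<close> the domain \<open>A'\<close> is the one that the raw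
  term carries, while \<open>A\<close> and \<open>B\<close> describe the Pi type it belongs to.
  Similarly \<open>ARfl A a b z\<close> has the point \<open>z\<close> of the raw term and the two
  end points of its type. An introduction form can so be given a type that matches it only
  judgmentally without altering its erasure. \<open>ADef\<close> contains its whole definition,
  which replaces a global environment.\<close>

datatype atm =
    AVar nat
  | AUni nat
  | APi atm atm
  | ALam atm atm atm atm
  | AApp atm atm atm atm
  | ASg atm atm
  | APr atm atm atm atm
  | AIndSg atm atm atm atm atm
  | ACo atm atm
  | AEmp
  | AOne
  | AId atm atm atm
  | ARfl atm atm atm atm
  | AIndId atm atm atm atm atm atm
  | AFunext nat
  | AUa nat
  | ADef num dfn "atm list"
and dfn = Dfn (transparent: bool) (dtele: "atm list") (dtype: atm) (dbody: atm)

text \<open>A definition is closed over its own telescope and untouched by substitution, so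
  inductions recurse into the arguments of \<open>ADef\<close> but not into the definition.\<close>

lemmas atm_induct = atm.induct[where ?P2.0 = "\<lambda>_. True", OF _ _ _ _ _ _ _ _ _ _ _ _ _ _ _ _ _ TrueI,
  case_names AVar AUni APi ALam AApp ASg APr AIndSg ACo AEmp AOne AId ARfl AIndId AFunext AUa ADef]

text \<open>\<open>vsub as\<close> is the substitution of \<open>as\<close> for the variables of a context of the same length, with
  a closed default beyond it.\<close>
definition vsub :: "tm list \<Rightarrow> nat \<Rightarrow> tm" where
  "vsub as n = (if n < length as then as ! n else Emp)"

text \<open>Because the default value of \<open>vsub\<close> is closed, this holds without any bound
  on the variables of \<open>t\<close>.\<close>

lemma sub_vsub: "sub s (sub (vsub as) t) = sub (vsub (map (sub s) as)) t"
  unfolding sub_sub by (rule arg_cong[where f = "\<lambda>f. sub f t"]) (auto simp: vsub_def)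

lemma vsub_drop: "(\<lambda>n. vsub as (n + k)) = vsub (drop k as)"
  by (auto simp: vsub_def add.commute less_diff_conv)

primrec er :: "nat \<Rightarrow> atm \<Rightarrow> tm" and er_dfn :: "nat \<Rightarrow> dfn \<Rightarrow> tm" where
  "er l (AVar n) = Var n"
| "er l (AUni k) = Uni (k + l)"
| "er l (APi A B) = PiT (er l A) (er l B)"
| "er l (ALam A' A B b) = Lam (er l A') (er l b)"
| "er l (AApp A B f a) = App (er l f) (er l a)"
| "er l (ASg A B) = SgT (er l A) (er l B)"
| "er l (APr A B a b) = Pr (er l a) (er l b)"
| "er l (AIndSg A B C g p) = IndSg (er l C) (er l g) (er l p)"
| "er l (ACo A B) = CoT (er l A) (er l B)"
| "er l AEmp = Emp"
| "er l AOne = One"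
| "er l (AId A a b) = IdT (er l A) (er l a) (er l b)"
| "er l (ARfl A a b z) = Rfl (er l z)"
| "er l (AIndId A C c a b p) = IndId (er l C) (er l c) (er l a) (er l b) (er l p)"
| "er l (AFunext k) = FunextC (k + l)"
| "er l (AUa k) = UaC (k + l)"
| "er l (ADef n d as) = sub (vsub (map (er l) as)) (er_dfn l d)"
| "er_dfn l (Dfn tr tele ty b) = er l b"

primrec aren :: "(nat \<Rightarrow> nat) \<Rightarrow> atm \<Rightarrow> atm" where
  "aren r (AVar n) = AVar (r n)"
| "aren r (AUni k) = AUni k"
| "aren r (APi A B) = APi (aren r A) (aren (up_ren r) B)"
| "aren r (ALam A' A B b) = ALam (aren r A') (aren r A) (aren (up_ren r) B) (aren (up_ren r) b)"
| "aren r (AApp A B f a) = AApp (aren r A) (aren (up_ren r) B) (aren r f) (aren r a)"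
| "aren r (ASg A B) = ASg (aren r A) (aren (up_ren r) B)"
| "aren r (APr A B a b) = APr (aren r A) (aren (up_ren r) B) (aren r a) (aren r b)"
| "aren r (AIndSg A B C g p) =
     AIndSg (aren r A) (aren (up_ren r) B) (aren (up_ren r) C) (aren (up_ren (up_ren r)) g) (aren r p)"
| "aren r (ACo A B) = ACo (aren r A) (aren r B)"
| "aren r AEmp = AEmp"
| "aren r AOne = AOne"
| "aren r (AId A a b) = AId (aren r A) (aren r a) (aren r b)"
| "aren r (ARfl A a b z) = ARfl (aren r A) (aren r a) (aren r b) (aren r z)"
| "aren r (AIndId A C c a b p) =
     AIndId (aren r A) (aren (up_ren (up_ren (up_ren r))) C) (aren (up_ren r) c)
       (aren r a) (aren r b) (aren r p)"
| "aren r (AFunext k) = AFunext k"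
| "aren r (AUa k) = AUa k"
| "aren r (ADef n d as) = ADef n d (map (aren r) as)"

definition aup :: "(nat \<Rightarrow> atm) \<Rightarrow> nat \<Rightarrow> atm" where
  "aup s n = (case n of 0 \<Rightarrow> AVar 0 | Suc m \<Rightarrow> aren Suc (s m))"

lemma aup_simps [simp]: "aup s 0 = AVar 0" "aup s (Suc n) = aren Suc (s n)"
  by (simp_all add: aup_def)

primrec asub :: "(nat \<Rightarrow> atm) \<Rightarrow> atm \<Rightarrow> atm" where
  "asub s (AVar n) = s n"
| "asub s (AUni k) = AUni k"
| "asub s (APi A B) = APi (asub s A) (asub (aup s) B)"
| "asub s (ALam A' A B b) = ALam (asub s A') (asub s A) (asub (aup s) B) (asub (aup s) b)"
| "asub s (AApp A B f a) = AApp (asub s A) (asub (aup s) B) (asub s f) (asub s a)"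
| "asub s (ASg A B) = ASg (asub s A) (asub (aup s) B)"
| "asub s (APr A B a b) = APr (asub s A) (asub (aup s) B) (asub s a) (asub s b)"
| "asub s (AIndSg A B C g p) =
     AIndSg (asub s A) (asub (aup s) B) (asub (aup s) C) (asub (aup (aup s)) g) (asub s p)"
| "asub s (ACo A B) = ACo (asub s A) (asub s B)"
| "asub s AEmp = AEmp"
| "asub s AOne = AOne"
| "asub s (AId A a b) = AId (asub s A) (asub s a) (asub s b)"
| "asub s (ARfl A a b z) = ARfl (asub s A) (asub s a) (asub s b) (asub s z)"
| "asub s (AIndId A C c a b p) =
     AIndId (asub s A) (asub (aup (aup (aup s))) C) (asub (aup s) c) (asub s a) (asub s b) (asub s p)"
| "asub s (AFunext k) = AFunext k"
| "asub s (AUa k) = AUa k"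
| "asub s (ADef n d as) = ADef n d (map (asub s) as)"

lemma er_aren [simp]: "er l (aren r t) = ren r (er l t)"
  by (induction t arbitrary: r rule: atm_induct) (simp_all add: ren_eq_sub up_Var_ren sub_vsub del: sub_sub cong: map_cong)

lemma er_aup: "(\<lambda>n. er l (aup s n)) = up (\<lambda>n. er l (s n))"
  by (rule nat_fun_eqI) simp_all

lemma er_asub [simp]: "er l (asub s t) = sub (\<lambda>n. er l (s n)) (er l t)"
  by (induction t arbitrary: s rule: atm_induct) (simp_all add: er_aup sub_vsub del: sub_sub cong: map_cong)

lemma aup_AVar_ren: "aup (\<lambda>x. AVar (r x)) = (\<lambda>x. AVar (up_ren r x))"
  by (rule nat_fun_eqI) simp_all

lemma aren_eq_asub: "aren r t = asub (\<lambda>n. AVar (r n)) t"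
  by (induction t arbitrary: r rule: atm_induct) (simp_all add: aup_AVar_ren)

lemma aup_AVar: "aup AVar = AVar"
  by (rule nat_fun_eqI) simp_all

lemma asub_AVar: "asub AVar t = t"
  by (induction t rule: atm_induct) (simp_all add: aup_AVar map_idI)

abbreviation pair_pat :: "tm \<Rightarrow> tm" where
  "pair_pat C \<equiv> sub (Pr (Var 1) (Var 0) \<bullet> (\<lambda>n. Var (n + 2))) C"

abbreviation refl_pat :: "tm \<Rightarrow> tm" where
  "refl_pat C \<equiv> sub (Rfl (Var 0) \<bullet> Var 0 \<bullet> Var 0 \<bullet> (\<lambda>n. Var (n + 1))) C"

abbreviation id_ctx :: "tm \<Rightarrow> ctx" where
  "id_ctx A \<equiv> [IdT (wk 2 A) (Var 1) (Var 0), wk 1 A, A]"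

text \<open>
  \<open>ok l \<Gamma> T t\<close> says that the erasure of \<open>t\<close> has type \<open>T\<close> by a derivation in which every elimination
  and every binder is typed by its annotation.  Inverting it never needs the injectivity of the type
  formers, which is not available for judgmental equality without a normalization theorem.
\<close>

primrec okm :: "nat \<Rightarrow> atm \<Rightarrow> ctx \<Rightarrow> tm \<Rightarrow> bool" and okd :: "nat \<Rightarrow> dfn \<Rightarrow> bool" where
  "okm l (AVar n) \<Gamma> T \<longleftrightarrow> n < length \<Gamma> \<and> le \<Gamma> (wk (Suc n) (\<Gamma> ! n)) T"
| "okm l (AUni k) \<Gamma> T \<longleftrightarrow> le \<Gamma> (Uni (Suc k + l)) T"
| "okm l (APi A B) \<Gamma> T \<longleftrightarrow>
     (\<exists>k. okm l A \<Gamma> (Uni k) \<and> okm l B (er l A # \<Gamma>) (Uni k) \<and> le \<Gamma> (Uni k) T)"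
| "okm l (ALam A' A B b) \<Gamma> T \<longleftrightarrow>
     (\<exists>k. okm l A' \<Gamma> (Uni k) \<and> okm l A \<Gamma> (Uni k) \<and> okm l B (er l A # \<Gamma>) (Uni k) \<and>
        \<Gamma> \<turnstile> er l A' \<doteq> er l A \<^bold>: Uni k) \<and>
     okm l b (er l A # \<Gamma>) (er l B) \<and> le \<Gamma> (PiT (er l A) (er l B)) T"
| "okm l (AApp A B f a) \<Gamma> T \<longleftrightarrow>
     (\<exists>k. okm l A \<Gamma> (Uni k) \<and> okm l B (er l A # \<Gamma>) (Uni k)) \<and>
     okm l f \<Gamma> (PiT (er l A) (er l B)) \<and> okm l a \<Gamma> (er l A) \<and> le \<Gamma> ((er l B)\<langle>er l a\<rangle>) T"
| "okm l (ASg A B) \<Gamma> T \<longleftrightarrow>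
     (\<exists>k. okm l A \<Gamma> (Uni k) \<and> okm l B (er l A # \<Gamma>) (Uni k) \<and> le \<Gamma> (Uni k) T)"
| "okm l (APr A B a b) \<Gamma> T \<longleftrightarrow>
     (\<exists>k. okm l A \<Gamma> (Uni k) \<and> okm l B (er l A # \<Gamma>) (Uni k)) \<and>
     okm l a \<Gamma> (er l A) \<and> okm l b \<Gamma> ((er l B)\<langle>er l a\<rangle>) \<and> le \<Gamma> (SgT (er l A) (er l B)) T"
| "okm l (AIndSg A B C g p) \<Gamma> T \<longleftrightarrow>
     (\<exists>k. okm l A \<Gamma> (Uni k) \<and> okm l B (er l A # \<Gamma>) (Uni k)) \<and>
     (\<exists>k. okm l C (SgT (er l A) (er l B) # \<Gamma>) (Uni k)) \<and>
     okm l g (er l B # er l A # \<Gamma>) (pair_pat (er l C)) \<and> okm l p \<Gamma> (SgT (er l A) (er l B)) \<and>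
     le \<Gamma> ((er l C)\<langle>er l p\<rangle>) T"
| "okm l (ACo A B) \<Gamma> T \<longleftrightarrow> (\<exists>k. okm l A \<Gamma> (Uni k) \<and> okm l B \<Gamma> (Uni k) \<and> le \<Gamma> (Uni k) T)"
| "okm l AEmp \<Gamma> T \<longleftrightarrow> le \<Gamma> (Uni l) T"
| "okm l AOne \<Gamma> T \<longleftrightarrow> le \<Gamma> (Uni l) T"
| "okm l (AId A a b) \<Gamma> T \<longleftrightarrow>
     (\<exists>k. okm l A \<Gamma> (Uni k) \<and> le \<Gamma> (Uni k) T) \<and> okm l a \<Gamma> (er l A) \<and> okm l b \<Gamma> (er l A)"
| "okm l (ARfl A a b z) \<Gamma> T \<longleftrightarrow>
     (\<exists>k. okm l A \<Gamma> (Uni k)) \<and> okm l a \<Gamma> (er l A) \<and> okm l b \<Gamma> (er l A) \<and> okm l z \<Gamma> (er l A) \<and>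
     \<Gamma> \<turnstile> er l z \<doteq> er l a \<^bold>: er l A \<and> \<Gamma> \<turnstile> er l z \<doteq> er l b \<^bold>: er l A \<and>
     le \<Gamma> (IdT (er l A) (er l a) (er l b)) T"
| "okm l (AIndId A C c a b p) \<Gamma> T \<longleftrightarrow>
     (\<exists>k. okm l A \<Gamma> (Uni k)) \<and> (\<exists>k. okm l C (id_ctx (er l A) @ \<Gamma>) (Uni k)) \<and>
     okm l c (er l A # \<Gamma>) (refl_pat (er l C)) \<and> okm l a \<Gamma> (er l A) \<and> okm l b \<Gamma> (er l A) \<and>
     okm l p \<Gamma> (IdT (er l A) (er l a) (er l b)) \<and>
     le \<Gamma> (sub (er l p \<bullet> er l b \<bullet> er l a \<bullet> Var) (er l C)) T"
| "okm l (AFunext k) \<Gamma> T \<longleftrightarrow> le \<Gamma> (funext_ty (k + l) (length \<Gamma>)) T"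
| "okm l (AUa k) \<Gamma> T \<longleftrightarrow> le \<Gamma> (univalence_ty (k + l) (length \<Gamma>)) T"
| "okm l (ADef n d as) \<Gamma> T \<longleftrightarrow> okd l d \<and> length as = length (dtele d) \<and>
     (\<forall>j < length as. (map (okm l) as ! j) \<Gamma>
        (sub (vsub (drop (Suc j) (map (er l) as))) (er l (dtele d ! j)))) \<and>
     le \<Gamma> (sub (vsub (map (er l) as)) (er l (dtype d))) T"
| "okd l (Dfn tr tele ty b) \<longleftrightarrow> wf (map (er l) tele) \<and> map (er l) tele \<turnstile> er l b \<^bold>: er l ty \<and>
     (\<forall>j < length tele. \<exists>k. (map (okm l) tele ! j) (map (er l) (drop (Suc j) tele)) (Uni k)) \<and>
     (\<exists>k. okm l ty (map (er l) tele) (Uni k)) \<and> okm l b (map (er l) tele) (er l ty)"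

abbreviation ok :: "nat \<Rightarrow> ctx \<Rightarrow> tm \<Rightarrow> atm \<Rightarrow> bool" where
  "ok l \<Gamma> T t \<equiv> okm l t \<Gamma> T"

text \<open>Every clause of \<open>okm\<close> ends in a \<open>le\<close> towards the ascribed
  type, so subsumption is absorbed by transitivity of \<open>le\<close>.\<close>

lemma ok_le: "ok l \<Gamma> T t \<Longrightarrow> le \<Gamma> T T' \<Longrightarrow> ok l \<Gamma> T' t"
  by (cases t) (auto intro: le_trans)

lemma ok_cumul: "ok l \<Gamma> (Uni j) t \<Longrightarrow> j \<le> k \<Longrightarrow> ok l \<Gamma> (Uni k) t"
  using ok_le le_Uni by blast

lemma le_Suc: "le \<Gamma> A B \<Longrightarrow> wf (C # \<Gamma>) \<Longrightarrow> le (C # \<Gamma>) (ren Suc A) (ren Suc B)"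
proof (induction rule: le.induct)
  case (le_eq \<Gamma> A B k)
  then show ?case
    using eq_tm_ren[OF _ ren_mor_Suc] le.le_eq by fastforce
qed (auto intro: le.intros)

lemma tm_mor_Var_Cons:
  assumes "wf (A # \<Gamma>)" "le \<Gamma> A B"
  shows "tm_mor Var (A # \<Gamma>) (B # \<Gamma>)"
  unfolding tm_mor_def
proof (intro allI impI)
  fix n assume n: "n < length (B # \<Gamma>)"
  show "A # \<Gamma> \<turnstile> Var n \<^bold>: sub Var (wk (Suc n) ((B # \<Gamma>) ! n))"
  proof (cases n)
    case 0
    then show ?thesis
      using ty_Var[OF assms(1), of 0] le_ty[OF le_Suc[OF assms(2,1)]] by (simp add: ren_eq_sub)
  next
    case (Suc m)
    then show ?thesis
      using ty_Var[OF assms(1), of n] n by (simp add: ren_eq_sub)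
  qed
qed

lemma ctx_conv_ty:
  "B # \<Gamma> \<turnstile> b \<^bold>: T \<Longrightarrow> wf (A # \<Gamma>) \<Longrightarrow> le \<Gamma> A B \<Longrightarrow> A # \<Gamma> \<turnstile> b \<^bold>: T"
  using has_ty_sub[OF _ tm_mor_Var_Cons] by fastforce

lemma ctx_conv_eq:
  "B # \<Gamma> \<turnstile> b \<doteq> c \<^bold>: T \<Longrightarrow> wf (A # \<Gamma>) \<Longrightarrow> le \<Gamma> A B \<Longrightarrow> A # \<Gamma> \<turnstile> b \<doteq> c \<^bold>: T"
  using eq_tm_sub[OF _ tm_mor_Var_Cons] by fastforce

text \<open>The abstraction is typed over its own domain, and the resulting Pi type is converted to
  the annotated one. This justifies the two domains of \<open>ALam\<close>.\<close>

lemma Lam_conv: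
  assumes "\<Gamma> \<turnstile> A' \<doteq> A \<^bold>: Uni k" "\<Gamma> \<turnstile> A' \<^bold>: Uni k" "A # \<Gamma> \<turnstile> B \<^bold>: Uni k" "A # \<Gamma> \<turnstile> b \<^bold>: B"
  shows "\<Gamma> \<turnstile> Lam A' b \<^bold>: PiT A B" "A' # \<Gamma> \<turnstile> b \<^bold>: B"
proof -
  have le: "le \<Gamma> A' A" and wf: "wf (A' # \<Gamma>)"
    using assms by (auto intro: le_eq wf_Cons)
  from ctx_conv_ty[OF assms(4) wf le] show b: "A' # \<Gamma> \<turnstile> b \<^bold>: B" .
  have "\<Gamma> \<turnstile> PiT A' B \<doteq> PiT A B \<^bold>: Uni k"
    using assms(1) ctx_conv_ty[OF assms(3) wf le] by (auto intro: eq_Pi eq_refl)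
  then show "\<Gamma> \<turnstile> Lam A' b \<^bold>: PiT A B"
    using b by (blast intro: ty_conv ty_Lam)
qed

text \<open>This lets a reflexivity inhabit identity types whose two sides agree only after
  computation.\<close>

lemma Rfl_conv:
  assumes "\<Gamma> \<turnstile> A \<^bold>: Uni k" "\<Gamma> \<turnstile> z \<^bold>: A" "\<Gamma> \<turnstile> z \<doteq> a \<^bold>: A" "\<Gamma> \<turnstile> z \<doteq> b \<^bold>: A"
  shows "\<Gamma> \<turnstile> Rfl z \<^bold>: IdT A a b" "\<Gamma> \<turnstile> IdT A z z \<doteq> IdT A a b \<^bold>: Uni k"
proof -
  show "\<Gamma> \<turnstile> IdT A z z \<doteq> IdT A a b \<^bold>: Uni k"
    using assms by (auto intro: eq_Id eq_refl)
  then show "\<Gamma> \<turnstile> Rfl z \<^bold>: IdT A a b"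
    using assms by (blast intro: ty_conv ty_Rfl)
qed

lemma wf_Sg:
  assumes "\<Gamma> \<turnstile> A \<^bold>: Uni k" "A # \<Gamma> \<turnstile> B \<^bold>: Uni k"
  shows "wf (SgT A B # \<Gamma>)"
  using assms by (blast intro: wf_Cons ty_Sg)

lemma wf_id_ctx:
  assumes "\<Gamma> \<turnstile> A \<^bold>: Uni k"
  shows "wf (id_ctx A @ \<Gamma>)"
proof -
  have w1: "wf (A # \<Gamma>)"
    using assms by (rule wf_Cons)
  from has_ty_Suc[OF assms w1] have A1: "A # \<Gamma> \<turnstile> ren Suc A \<^bold>: Uni k"
    by simp
  then have w2: "wf (ren Suc A # A # \<Gamma>)"
    by (rule wf_Cons)
  from has_ty_Suc[OF A1 w2] have A2: "ren Suc A # A # \<Gamma> \<turnstile> ren (\<lambda>n. Suc (Suc n)) A \<^bold>: Uni k"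
    by simp
  have "ren Suc A # A # \<Gamma> \<turnstile> IdT (ren (\<lambda>n. Suc (Suc n)) A) (Var 1) (Var 0) \<^bold>: Uni k"
    using A2 ty_Var[OF w2, of 1] ty_Var[OF w2, of 0] by (auto intro: ty_Id)
  then show ?thesis
    using wf_Cons by (auto simp: numeral_2_eq_2)
qed

lemma okd_ty:
  assumes "okd l d"
  shows "wf (map (er l) (dtele d))" "map (er l) (dtele d) \<turnstile> er_dfn l d \<^bold>: er l (dtype d)"
  using assms by (cases d; simp)+

lemma tm_mor_vsub:
  assumes "length as = length Ts"
    and "\<And>j. j < length as \<Longrightarrow> \<Delta> \<turnstile> as ! j \<^bold>: sub (vsub (drop (Suc j) as)) (Ts ! j)"
  shows "tm_mor (vsub as) \<Delta> Ts"
  unfolding tm_mor_def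
proof (intro allI impI)
  fix j assume "j < length Ts"
  with assms show "\<Delta> \<turnstile> vsub as j \<^bold>: sub (vsub as) (wk (Suc j) (Ts ! j))"
    unfolding sub_ren vsub_drop by (simp add: vsub_def)
qed

lemma ok_ty: "ok l \<Gamma> T t \<Longrightarrow> wf \<Gamma> \<Longrightarrow> \<Gamma> \<turnstile> er l t \<^bold>: T"
proof (induction t arbitrary: \<Gamma> T rule: atm_induct)
  case (AVar n)
  then show ?case using ty_Var[of \<Gamma> n] by (auto intro: le_ty)
next
  case (AUni k)
  then show ?case by (auto intro: le_ty ty_Uni)
next
  case (APi A B)
  then obtain k where k: "ok l \<Gamma> (Uni k) A" "ok l (er l A # \<Gamma>) (Uni k) B" "le \<Gamma> (Uni k) T"
    by auto
  note A = APi.IH(1)[OF k(1) APi.prems(2)]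
  note B = APi.IH(2)[OF k(2) wf_Cons[OF A]]
  show ?case
    using le_ty[OF k(3) ty_Pi[OF A B]] by simp
next
  case (ASg A B)
  then obtain k where k: "ok l \<Gamma> (Uni k) A" "ok l (er l A # \<Gamma>) (Uni k) B" "le \<Gamma> (Uni k) T"
    by auto
  note A = ASg.IH(1)[OF k(1) ASg.prems(2)]
  note B = ASg.IH(2)[OF k(2) wf_Cons[OF A]]
  show ?case
    using le_ty[OF k(3) ty_Sg[OF A B]] by simp
next
  case (ALam A' A B b)
  then obtain k where k: "ok l \<Gamma> (Uni k) A'" "ok l \<Gamma> (Uni k) A" "ok l (er l A # \<Gamma>) (Uni k) B"
      "\<Gamma> \<turnstile> er l A' \<doteq> er l A \<^bold>: Uni k"
    and b: "ok l (er l A # \<Gamma>) (er l B) b" "le \<Gamma> (PiT (er l A) (er l B)) T" by auto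
  note A' = ALam.IH(1)[OF k(1) ALam.prems(2)]
  note A = ALam.IH(2)[OF k(2) ALam.prems(2)]
  note B = ALam.IH(3)[OF k(3) wf_Cons[OF A]]
  note b' = ALam.IH(4)[OF b(1) wf_Cons[OF A]]
  show ?case
    using le_ty[OF b(2) Lam_conv(1)[OF k(4) A' B b']] by simp
next
  case (AApp A B f a)
  then have k: "ok l \<Gamma> (PiT (er l A) (er l B)) f" "ok l \<Gamma> (er l A) a" "le \<Gamma> ((er l B)\<langle>er l a\<rangle>) T"
    by auto
  show ?case
    using le_ty[OF k(3) ty_App[OF AApp.IH(3)[OF k(1) AApp.prems(2)] AApp.IH(4)[OF k(2) AApp.prems(2)]]]
    by simp
next
  case (APr A B a b)
  then obtain k where k: "ok l \<Gamma> (Uni k) A" "ok l (er l A # \<Gamma>) (Uni k) B"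
    and a: "ok l \<Gamma> (er l A) a" "ok l \<Gamma> ((er l B)\<langle>er l a\<rangle>) b" "le \<Gamma> (SgT (er l A) (er l B)) T"
    by auto
  note A = APr.IH(1)[OF k(1) APr.prems(2)]
  note B = APr.IH(2)[OF k(2) wf_Cons[OF A]]
  show ?case
    using le_ty[OF a(3) ty_Pr[OF B APr.IH(3)[OF a(1) APr.prems(2)] APr.IH(4)[OF a(2) APr.prems(2)]]]
    by simp
next
  case (AIndSg A B C g p)
  then obtain k m where k: "ok l \<Gamma> (Uni k) A" "ok l (er l A # \<Gamma>) (Uni k) B"
      "ok l (SgT (er l A) (er l B) # \<Gamma>) (Uni m) C"
    and f: "ok l (er l B # er l A # \<Gamma>) (pair_pat (er l C)) g" "ok l \<Gamma> (SgT (er l A) (er l B)) p"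
      "le \<Gamma> ((er l C)\<langle>er l p\<rangle>) T"
    unfolding okm.simps by blast
  note A = AIndSg.IH(1)[OF k(1) AIndSg.prems(2)]
  note B = AIndSg.IH(2)[OF k(2) wf_Cons[OF A]]
  show ?case
    using le_ty[OF f(3) ty_IndSg[OF AIndSg.IH(3)[OF k(3) wf_Sg[OF A B]]
        AIndSg.IH(4)[OF f(1) wf_Cons[OF B]] AIndSg.IH(5)[OF f(2) AIndSg.prems(2)]]]
    by simp
next
  case (ACo A B)
  then obtain k where "ok l \<Gamma> (Uni k) A" "ok l \<Gamma> (Uni k) B" "le \<Gamma> (Uni k) T"
    by auto
  with ACo show ?case by (auto intro: le_ty[OF _ ty_Co])
next
  case (AId A a b)
  then obtain k where "ok l \<Gamma> (Uni k) A" "le \<Gamma> (Uni k) T"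
    by auto
  with AId show ?case by (auto intro: le_ty[OF _ ty_Id])
next
  case (ARfl A a b z)
  then obtain k where k: "ok l \<Gamma> (Uni k) A" "ok l \<Gamma> (er l A) z"
      "\<Gamma> \<turnstile> er l z \<doteq> er l a \<^bold>: er l A" "\<Gamma> \<turnstile> er l z \<doteq> er l b \<^bold>: er l A"
      "le \<Gamma> (IdT (er l A) (er l a) (er l b)) T"
    by auto
  show ?case
    using le_ty[OF k(5) Rfl_conv(1)[OF ARfl.IH(1)[OF k(1) ARfl.prems(2)]
        ARfl.IH(4)[OF k(2) ARfl.prems(2)] k(3,4)]]
    by simp
next
  case (AIndId A C c a b p)
  then obtain k m where k: "ok l \<Gamma> (Uni k) A" "ok l (id_ctx (er l A) @ \<Gamma>) (Uni m) C"
      "ok l (er l A # \<Gamma>) (refl_pat (er l C)) c" "ok l \<Gamma> (er l A) a" "ok l \<Gamma> (er l A) b"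
      "ok l \<Gamma> (IdT (er l A) (er l a) (er l b)) p"
      "le \<Gamma> (sub (er l p \<bullet> er l b \<bullet> er l a \<bullet> Var) (er l C)) T"
    unfolding okm.simps by blast
  note A = AIndId.IH(1)[OF k(1) AIndId.prems(2)]
  note C = AIndId.IH(2)[OF k(2) wf_id_ctx[OF A], unfolded append_Cons append_Nil]
  show ?case
    using le_ty[OF k(7) ty_IndId[OF C AIndId.IH(3)[OF k(3) wf_Cons[OF A]]
        AIndId.IH(4)[OF k(4) AIndId.prems(2)] AIndId.IH(5)[OF k(5) AIndId.prems(2)]
        AIndId.IH(6)[OF k(6) AIndId.prems(2)]]]
    by simp
next
  case (ADef n d as)
  then have d: "okd l d" and len: "length as = length (dtele d)"
    and as: "\<And>j. j < length as \<Longrightarrow> ok l \<Gamma> (sub (vsub (drop (Suc j) (map (er l) as))) (er l (dtele d ! j))) (as ! j)"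
    and T: "le \<Gamma> (sub (vsub (map (er l) as)) (er l (dtype d))) T"
    by auto
  have "tm_mor (vsub (map (er l) as)) \<Gamma> (map (er l) (dtele d))"
    by (rule tm_mor_vsub) (use len as ADef.IH ADef.prems(2) in auto)
  from has_ty_sub[OF ADef.prems(2) this okd_ty(2)[OF d]] T show ?case
    by (auto intro: le_ty)
qed (auto intro: le_ty ty_Emp ty_One ax_funext ax_univalence)

section \<open>Stability of annotated typing under renaming and substitution\<close>

definition atm_mor_class :: "nat \<Rightarrow> ((nat \<Rightarrow> atm) \<Rightarrow> ctx \<Rightarrow> ctx \<Rightarrow> bool) \<Rightarrow> bool" where
  "atm_mor_class l K \<longleftrightarrow>
     (\<forall>s \<Delta> \<Gamma> n. K s \<Delta> \<Gamma> \<longrightarrow> wf \<Delta> \<longrightarrow> n < length \<Gamma> \<longrightarrow>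
        ok l \<Delta> (sub (\<lambda>n. er l (s n)) (wk (Suc n) (\<Gamma> ! n))) (s n)) \<and>
     (\<forall>s \<Delta> \<Gamma> A. K s \<Delta> \<Gamma> \<longrightarrow> wf (sub (\<lambda>n. er l (s n)) A # \<Delta>) \<longrightarrow>
        K (aup s) (sub (\<lambda>n. er l (s n)) A # \<Delta>) (A # \<Gamma>))"

lemma atm_mor_class_up:
  "atm_mor_class l K \<Longrightarrow> K s \<Delta> \<Gamma> \<Longrightarrow> \<Delta> \<turnstile> sub (\<lambda>n. er l (s n)) A \<^bold>: Uni k \<Longrightarrow>
     K (aup s) (sub (\<lambda>n. er l (s n)) A # \<Delta>) (A # \<Gamma>)"
  unfolding atm_mor_class_def using wf_Cons by blast

lemma atm_mor_class_tm_mor: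
  "atm_mor_class l K \<Longrightarrow> K s \<Delta> \<Gamma> \<Longrightarrow> wf \<Delta> \<Longrightarrow> tm_mor (\<lambda>n. er l (s n)) \<Delta> \<Gamma>"
  unfolding atm_mor_class_def tm_mor_def using ok_ty by blast

lemma ok_under:
  assumes K: "atm_mor_class l K" and mor: "wf \<Gamma>" "wf \<Delta>" "K s \<Delta> \<Gamma>"
    and A: "ok l \<Gamma> (Uni k) A" "ok l \<Delta> (sub (\<lambda>n. er l (s n)) (Uni k)) (asub s A)"
  shows "wf (er l A # \<Gamma>)" "wf (sub (\<lambda>n. er l (s n)) (er l A) # \<Delta>)"
    "K (aup s) (sub (\<lambda>n. er l (s n)) (er l A) # \<Delta>) (er l A # \<Gamma>)"
    "\<Gamma> \<turnstile> er l A \<^bold>: Uni k" "\<Delta> \<turnstile> sub (\<lambda>n. er l (s n)) (er l A) \<^bold>: Uni k"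
proof -
  show "\<Gamma> \<turnstile> er l A \<^bold>: Uni k" and D: "\<Delta> \<turnstile> sub (\<lambda>n. er l (s n)) (er l A) \<^bold>: Uni k"
    using ok_ty[OF A(1) mor(1)] ok_ty[OF A(2) mor(2)] by simp_all
  then show "wf (er l A # \<Gamma>)" "wf (sub (\<lambda>n. er l (s n)) (er l A) # \<Delta>)"
    by (auto intro: wf_Cons)
  show "K (aup s) (sub (\<lambda>n. er l (s n)) (er l A) # \<Delta>) (er l A # \<Gamma>)"
    using atm_mor_class_up[OF K mor(3) D] .
qed

lemmas sub_norm = sub.simps sub_push up_low er_asub er_aup

text \<open>The counterpart of \<open>morphism\<close>, by induction on the annotated term instead
  of on derivations. The equalities and subsumptions stored in \<open>okm\<close> are judgments
  about raw terms, so the substitution lemmas already proved for those carry them along.\<close>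

lemma ok_mor:
  assumes K: "atm_mor_class l K"
  shows "ok l \<Gamma> T t \<Longrightarrow> wf \<Gamma> \<Longrightarrow> wf \<Delta> \<Longrightarrow> K s \<Delta> \<Gamma> \<Longrightarrow>
           ok l \<Delta> (sub (\<lambda>n. er l (s n)) T) (asub s t)"
proof (induction t arbitrary: \<Gamma> T \<Delta> s rule: atm_induct)
  case (AVar n)
  then have n: "n < length \<Gamma>" "le \<Gamma> (wk (Suc n) (\<Gamma> ! n)) T"
    by auto
  have "ok l \<Delta> (sub (\<lambda>n. er l (s n)) (wk (Suc n) (\<Gamma> ! n))) (s n)"
    using K AVar.prems n(1) unfolding atm_mor_class_def by blast
  then show ?case
    using ok_le[OF _ le_sub[OF n(2) AVar.prems(3) atm_mor_class_tm_mor[OF K]]] AVar.prems by simp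
next
  case (AUni k)
  then show ?case
    using le_sub[OF _ _ atm_mor_class_tm_mor[OF K]] by fastforce
next
  case (APi A B)
  note mor = \<open>wf \<Gamma>\<close> \<open>wf \<Delta>\<close> \<open>K s \<Delta> \<Gamma>\<close>
  note tr = le_sub[OF _ mor(2) atm_mor_class_tm_mor[OF K mor(3,2)]]
  obtain k where k: "ok l \<Gamma> (Uni k) A" "ok l (er l A # \<Gamma>) (Uni k) B" "le \<Gamma> (Uni k) T"
    using APi by auto
  note A = APi.IH(1)[OF k(1) mor]
  note u = ok_under[OF K mor k(1) A]
  note A APi.IH(2)[OF k(2) u(1-3)] tr[OF k(3)]
  then show ?case
    unfolding okm.simps asub.simps sub_norm by blast
next
  case (ASg A B)
  note mor = \<open>wf \<Gamma>\<close> \<open>wf \<Delta>\<close> \<open>K s \<Delta> \<Gamma>\<close>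
  note tr = le_sub[OF _ mor(2) atm_mor_class_tm_mor[OF K mor(3,2)]]
  obtain k where k: "ok l \<Gamma> (Uni k) A" "ok l (er l A # \<Gamma>) (Uni k) B" "le \<Gamma> (Uni k) T"
    using ASg by auto
  note A = ASg.IH(1)[OF k(1) mor]
  note u = ok_under[OF K mor k(1) A]
  note A ASg.IH(2)[OF k(2) u(1-3)] tr[OF k(3)]
  then show ?case
    unfolding okm.simps asub.simps sub_norm by blast
next
  case (ALam A' A B b)
  note mor = \<open>wf \<Gamma>\<close> \<open>wf \<Delta>\<close> \<open>K s \<Delta> \<Gamma>\<close>
  note tr = le_sub[OF _ mor(2) atm_mor_class_tm_mor[OF K mor(3,2)]]
    and tre = eq_tm_sub[OF mor(2) atm_mor_class_tm_mor[OF K mor(3,2)]]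
  obtain k where k: "ok l \<Gamma> (Uni k) A'" "ok l \<Gamma> (Uni k) A" "ok l (er l A # \<Gamma>) (Uni k) B"
      "\<Gamma> \<turnstile> er l A' \<doteq> er l A \<^bold>: Uni k"
    and b: "ok l (er l A # \<Gamma>) (er l B) b" "le \<Gamma> (PiT (er l A) (er l B)) T"
    using ALam by auto
  note A = ALam.IH(2)[OF k(2) mor]
  note u = ok_under[OF K mor k(2) A]
  note ALam.IH(1)[OF k(1) mor] A ALam.IH(3)[OF k(3) u(1-3)] ALam.IH(4)[OF b(1) u(1-3)]
    tr[OF b(2)] tre[OF k(4)]
  then show ?case
    unfolding okm.simps asub.simps sub_norm by blast
next
  case (AApp A B f a)
  note mor = \<open>wf \<Gamma>\<close> \<open>wf \<Delta>\<close> \<open>K s \<Delta> \<Gamma>\<close>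
  note tr = le_sub[OF _ mor(2) atm_mor_class_tm_mor[OF K mor(3,2)]]
  obtain k where k: "ok l \<Gamma> (Uni k) A" "ok l (er l A # \<Gamma>) (Uni k) B"
    and f: "ok l \<Gamma> (PiT (er l A) (er l B)) f" "ok l \<Gamma> (er l A) a" "le \<Gamma> ((er l B)\<langle>er l a\<rangle>) T"
    using AApp by auto
  note A = AApp.IH(1)[OF k(1) mor]
  note u = ok_under[OF K mor k(1) A]
  note A AApp.IH(2)[OF k(2) u(1-3)] AApp.IH(3)[OF f(1) mor] AApp.IH(4)[OF f(2) mor] tr[OF f(3)]
  then show ?case
    unfolding okm.simps asub.simps sub_norm by blast
next
  case (APr A B a b)
  note mor = \<open>wf \<Gamma>\<close> \<open>wf \<Delta>\<close> \<open>K s \<Delta> \<Gamma>\<close>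
  note tr = le_sub[OF _ mor(2) atm_mor_class_tm_mor[OF K mor(3,2)]]
  obtain k where k: "ok l \<Gamma> (Uni k) A" "ok l (er l A # \<Gamma>) (Uni k) B"
    and f: "ok l \<Gamma> (er l A) a" "ok l \<Gamma> ((er l B)\<langle>er l a\<rangle>) b" "le \<Gamma> (SgT (er l A) (er l B)) T"
    using APr by auto
  note A = APr.IH(1)[OF k(1) mor]
  note u = ok_under[OF K mor k(1) A]
  note A APr.IH(2)[OF k(2) u(1-3)] APr.IH(3)[OF f(1) mor] APr.IH(4)[OF f(2) mor] tr[OF f(3)]
  then show ?case
    unfolding okm.simps asub.simps sub_norm by blast
next
  case (AIndSg A B C g p)
  note mor = \<open>wf \<Gamma>\<close> \<open>wf \<Delta>\<close> \<open>K s \<Delta> \<Gamma>\<close>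
  note tr = le_sub[OF _ mor(2) atm_mor_class_tm_mor[OF K mor(3,2)]]
  obtain k m where k: "ok l \<Gamma> (Uni k) A" "ok l (er l A # \<Gamma>) (Uni k) B"
      "ok l (SgT (er l A) (er l B) # \<Gamma>) (Uni m) C"
    and f: "ok l (er l B # er l A # \<Gamma>) (pair_pat (er l C)) g" "ok l \<Gamma> (SgT (er l A) (er l B)) p"
      "le \<Gamma> ((er l C)\<langle>er l p\<rangle>) T"
    using AIndSg.prems(1) unfolding okm.simps by blast
  note A = AIndSg.IH(1)[OF k(1) mor]
  note u = ok_under[OF K mor k(1) A]
  note B = AIndSg.IH(2)[OF k(2) u(1-3)]
  note v = ok_under[OF K u(1-3) k(2) B]
  have S: "\<Delta> \<turnstile> sub (\<lambda>n. er l (s n)) (SgT (er l A) (er l B)) \<^bold>: Uni k"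
    using u(5) v(5) unfolding sub_norm by (blast intro: ty_Sg)
  have G: "wf (SgT (er l A) (er l B) # \<Gamma>)"
    using wf_Sg[OF u(4) v(4)] .
  note A B AIndSg.IH(3)[OF k(3) G wf_Cons[OF S] atm_mor_class_up[OF K mor(3) S]]
    AIndSg.IH(4)[OF f(1) v(1-3)] AIndSg.IH(5)[OF f(2) mor] tr[OF f(3)]
  then show ?case
    unfolding okm.simps asub.simps sub_norm by blast
next
  case (ACo A B)
  note mor = \<open>wf \<Gamma>\<close> \<open>wf \<Delta>\<close> \<open>K s \<Delta> \<Gamma>\<close>
  note tr = le_sub[OF _ mor(2) atm_mor_class_tm_mor[OF K mor(3,2)]]
  obtain k where k: "ok l \<Gamma> (Uni k) A" "ok l \<Gamma> (Uni k) B" "le \<Gamma> (Uni k) T"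
    using ACo by auto
  note ACo.IH(1)[OF k(1) mor] ACo.IH(2)[OF k(2) mor] tr[OF k(3)]
  then show ?case
    unfolding okm.simps asub.simps sub_norm by blast
next
  case (AId A a b)
  note mor = \<open>wf \<Gamma>\<close> \<open>wf \<Delta>\<close> \<open>K s \<Delta> \<Gamma>\<close>
  note tr = le_sub[OF _ mor(2) atm_mor_class_tm_mor[OF K mor(3,2)]]
  obtain k where k: "ok l \<Gamma> (Uni k) A" "le \<Gamma> (Uni k) T" "ok l \<Gamma> (er l A) a" "ok l \<Gamma> (er l A) b"
    using AId by auto
  note AId.IH(1)[OF k(1) mor] AId.IH(2)[OF k(3) mor] AId.IH(3)[OF k(4) mor] tr[OF k(2)]
  then show ?case
    unfolding okm.simps asub.simps sub_norm by blast
next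
  case (ARfl A a b z)
  note mor = \<open>wf \<Gamma>\<close> \<open>wf \<Delta>\<close> \<open>K s \<Delta> \<Gamma>\<close>
  note tr = le_sub[OF _ mor(2) atm_mor_class_tm_mor[OF K mor(3,2)]]
    and tre = eq_tm_sub[OF mor(2) atm_mor_class_tm_mor[OF K mor(3,2)]]
  obtain k where k: "ok l \<Gamma> (Uni k) A" "ok l \<Gamma> (er l A) a" "ok l \<Gamma> (er l A) b" "ok l \<Gamma> (er l A) z"
     "\<Gamma> \<turnstile> er l z \<doteq> er l a \<^bold>: er l A" "\<Gamma> \<turnstile> er l z \<doteq> er l b \<^bold>: er l A"
     "le \<Gamma> (IdT (er l A) (er l a) (er l b)) T"
    using ARfl.prems(1) unfolding okm.simps by blast
  note ARfl.IH(1)[OF k(1) mor] ARfl.IH(2)[OF k(2) mor] ARfl.IH(3)[OF k(3) mor]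
    ARfl.IH(4)[OF k(4) mor] tre[OF k(5)] tre[OF k(6)] tr[OF k(7)]
  then show ?case
    unfolding okm.simps asub.simps sub_norm by blast
next
  case (AIndId A C c a b p)
  let ?s = "\<lambda>n. er l (s n)"
  note mor = \<open>wf \<Gamma>\<close> \<open>wf \<Delta>\<close> \<open>K s \<Delta> \<Gamma>\<close>
  note tr = le_sub[OF _ mor(2) atm_mor_class_tm_mor[OF K mor(3,2)]]
  obtain k m where k: "ok l \<Gamma> (Uni k) A" "ok l (id_ctx (er l A) @ \<Gamma>) (Uni m) C"
      "ok l (er l A # \<Gamma>) (refl_pat (er l C)) c" "ok l \<Gamma> (er l A) a" "ok l \<Gamma> (er l A) b"
      "ok l \<Gamma> (IdT (er l A) (er l a) (er l b)) p"
      "le \<Gamma> (sub (er l p \<bullet> er l b \<bullet> er l a \<bullet> Var) (er l C)) T"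
    using AIndId.prems(1) unfolding okm.simps by blast
  note A = AIndId.IH(1)[OF k(1) mor]
  note u = ok_under[OF K mor k(1) A]
  have G: "wf (id_ctx (er l A) @ \<Gamma>)" and D: "wf (id_ctx (sub ?s (er l A)) @ \<Delta>)"
    using wf_id_ctx u(4,5) by blast+
  have D': "wf (wk 1 (sub ?s (er l A)) # sub ?s (er l A) # \<Delta>)"
    using has_ty_Suc[OF u(5,2)] by (auto intro: wf_Cons)
  have K1: "K (aup (aup s)) (wk 1 (sub ?s (er l A)) # sub ?s (er l A) # \<Delta>) (wk 1 (er l A) # er l A # \<Gamma>)"
    using K u(3) D' unfolding atm_mor_class_def by (metis er_aup sub_wk1)
  have K2: "K (aup (aup (aup s))) (id_ctx (sub ?s (er l A)) @ \<Delta>) (id_ctx (er l A) @ \<Gamma>)"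
  proof -
    have "sub (\<lambda>n. er l (aup (aup s) n)) (IdT (wk 2 (er l A)) (Var 1) (Var 0)) =
        IdT (wk 2 (sub ?s (er l A))) (Var 1) (Var 0)"
      unfolding sub_norm ..
    then show ?thesis
      using K K1 D unfolding atm_mor_class_def append_Cons append_Nil by metis
  qed
  note A AIndId.IH(2)[OF k(2) G D K2] AIndId.IH(3)[OF k(3) u(1-3)] AIndId.IH(4)[OF k(4) mor]
    AIndId.IH(5)[OF k(5) mor] AIndId.IH(6)[OF k(6) mor] tr[OF k(7)]
  then show ?case
    unfolding okm.simps asub.simps sub_norm by blast
next
  case (AFunext k)
  then show ?case
    using le_sub[OF _ _ atm_mor_class_tm_mor[OF K], of \<Gamma> "funext_ty (k + l) (length \<Gamma>)" T]
    by (simp add: sub_funext_ty[where n = "length \<Delta>"])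
next
  case (AUa k)
  then show ?case
    using le_sub[OF _ _ atm_mor_class_tm_mor[OF K], of \<Gamma> "univalence_ty (k + l) (length \<Gamma>)" T]
    by (simp add: sub_univalence_ty[where n = "length \<Delta>"])
next
  case (ADef n d as)
  let ?s = "\<lambda>n. er l (s n)"
  note mor = \<open>wf \<Gamma>\<close> \<open>wf \<Delta>\<close> \<open>K s \<Delta> \<Gamma>\<close>
  have d: "okd l d" and len: "length as = length (dtele d)"
    and as: "\<And>j. j < length as \<Longrightarrow> ok l \<Gamma> (sub (vsub (drop (Suc j) (map (er l) as))) (er l (dtele d ! j))) (as ! j)"
    and T: "le \<Gamma> (sub (vsub (map (er l) as)) (er l (dtype d))) T"
    using ADef.prems(1) by auto
  have er: "map (er l) (map (asub s) as) = map (sub ?s) (map (er l) as)"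
    by simp
  have "ok l \<Delta> (sub (vsub (drop (Suc j) (map (er l) (map (asub s) as)))) (er l (dtele d ! j))) (asub s (as ! j))"
    if "j < length as" for j
    using ADef.IH[OF nth_mem[OF that] as[OF that] mor]
    unfolding sub_vsub er by (simp only: drop_map)
  moreover have "le \<Delta> (sub (vsub (map (er l) (map (asub s) as))) (er l (dtype d))) (sub ?s T)"
    using le_sub[OF T mor(2) atm_mor_class_tm_mor[OF K mor(3,2)]] unfolding sub_vsub er .
  ultimately show ?case
    using d len by simp
next
  case AEmp
  then show ?case
    using le_sub[OF _ _ atm_mor_class_tm_mor[OF K]] by fastforce
next
  case AOne
  then show ?case
    using le_sub[OF _ _ atm_mor_class_tm_mor[OF K]] by fastforce
qed


lemma atm_mor_class_ren: "atm_mor_class l (\<lambda>s \<Delta> \<Gamma>. \<exists>r. s = (\<lambda>n. AVar (r n)) \<and> ren_mor r \<Delta> \<Gamma>)"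
  unfolding atm_mor_class_def
proof (intro conjI allI impI; elim exE conjE)
  fix s \<Delta> \<Gamma> n r
  assume wf: "wf \<Delta>" and n: "n < length \<Gamma>" and s: "s = (\<lambda>n. AVar (r n))" and r: "ren_mor r \<Delta> \<Gamma>"
  have eq: "sub (\<lambda>n. er l (s n)) (wk (Suc n) (\<Gamma> ! n)) = wk (Suc (r n)) (\<Delta> ! r n)"
    using r n s by (simp add: ren_mor_def flip: ren_eq_sub)
  have len: "r n < length \<Delta>"
    using r n by (simp add: ren_mor_def)
  \<comment> \<open>\<open>le\<close> is reflexive only on types, so the type of the variable has to
    be shown to be one.\<close>
  have "\<exists>k. \<Delta> \<turnstile> wk (Suc m) (\<Delta> ! m) \<^bold>: Uni k" if "wf \<Delta>" "m < length \<Delta>" for \<Delta> m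
    using that
  proof (induction m arbitrary: \<Delta>)
    case 0
    then obtain A \<Delta>' where \<Delta>: "\<Delta> = A # \<Delta>'" by (cases \<Delta>) auto
    with 0 obtain k where "\<Delta>' \<turnstile> A \<^bold>: Uni k" by (auto elim: wf.cases)
    from has_ty_Suc[OF this] 0 \<Delta> show ?case by auto
  next
    case (Suc m)
    then obtain A \<Delta>' where \<Delta>: "\<Delta> = A # \<Delta>'" by (cases \<Delta>) auto
    with Suc.prems(1) obtain k where "\<Delta>' \<turnstile> A \<^bold>: Uni k" by (auto elim: wf.cases)
    then have "wf \<Delta>'"
      using has_ty_wf by blast
    then obtain j where "\<Delta>' \<turnstile> wk (Suc m) (\<Delta>' ! m) \<^bold>: Uni j"
      using Suc \<Delta> by auto
    from has_ty_Suc[OF this] Suc \<Delta> show ?case by auto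
  qed
  with wf len obtain k where "\<Delta> \<turnstile> wk (Suc (r n)) (\<Delta> ! r n) \<^bold>: Uni k"
    by blast
  then show "ok l \<Delta> (sub (\<lambda>n. er l (s n)) (wk (Suc n) (\<Gamma> ! n))) (s n)"
    unfolding eq using s len by (simp add: le_refl)
next
  fix s \<Delta> \<Gamma> A r
  assume "s = (\<lambda>n. AVar (r n))" "ren_mor r \<Delta> \<Gamma>"
  then show "\<exists>q. aup s = (\<lambda>n. AVar (q n)) \<and> ren_mor q (sub (\<lambda>n. er l (s n)) A # \<Delta>) (A # \<Gamma>)"
    using ren_mor_up[of r \<Delta> \<Gamma> A] by (auto simp: aup_AVar_ren ren_eq_sub)
qed

lemma ok_ren:
  assumes "ok l \<Gamma> T t" "wf \<Gamma>" "wf \<Delta>" "ren_mor r \<Delta> \<Gamma>"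
  shows "ok l \<Delta> (ren r T) (aren r t)"
proof -
  have "ok l \<Delta> (sub (\<lambda>n. er l (AVar (r n))) T) (asub (\<lambda>n. AVar (r n)) t)"
    by (rule ok_mor[OF atm_mor_class_ren assms(1-3)]) (use assms(4) in blast)
  then show ?thesis
    by (simp add: ren_eq_sub aren_eq_asub)
qed

lemma ok_Suc: "ok l \<Gamma> T t \<Longrightarrow> wf \<Gamma> \<Longrightarrow> wf (B # \<Gamma>) \<Longrightarrow> ok l (B # \<Gamma>) (ren Suc T) (aren Suc t)"
  using ok_ren ren_mor_Suc by blast

definition atm_mor :: "nat \<Rightarrow> (nat \<Rightarrow> atm) \<Rightarrow> ctx \<Rightarrow> ctx \<Rightarrow> bool" where
  "atm_mor l s \<Delta> \<Gamma> \<longleftrightarrow> wf \<Delta> \<and>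
     (\<forall>n < length \<Gamma>. ok l \<Delta> (sub (\<lambda>n. er l (s n)) (wk (Suc n) (\<Gamma> ! n))) (s n))"

lemma atm_mor_class_atm: "atm_mor_class l (atm_mor l)"
  unfolding atm_mor_class_def
proof (intro conjI allI impI)
  fix s :: "nat \<Rightarrow> atm" and \<Delta> \<Gamma> A
  let ?s = "\<lambda>n. er l (s n)"
  assume s: "atm_mor l s \<Delta> \<Gamma>" and wf: "wf (sub ?s A # \<Delta>)"
  then obtain k where A: "\<Delta> \<turnstile> sub ?s A \<^bold>: Uni k"
    by (auto elim: wf.cases)
  have "ok l (sub ?s A # \<Delta>) (sub (\<lambda>n. er l (aup s n)) (wk (Suc n) ((A # \<Gamma>) ! n))) (aup s n)"
    if n: "n < length (A # \<Gamma>)" for n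
  proof (cases n)
    case 0
    have "le (sub ?s A # \<Delta>) (ren Suc (sub ?s A)) (ren Suc (sub ?s A))"
      using le_refl[OF has_ty_Suc[OF A wf, unfolded ren.simps]] .
    then show ?thesis
      unfolding er_aup by (simp add: 0 ren_sub)
  next
    case (Suc m)
    with s n have "ok l \<Delta> (sub ?s (wk (Suc m) (\<Gamma> ! m))) (s m)"
      by (simp add: atm_mor_def)
    from ok_Suc[OF this _ wf] s Suc show ?thesis
      unfolding er_aup by (simp add: ren_sub atm_mor_def)
  qed
  with wf show "atm_mor l (aup s) (sub ?s A # \<Delta>) (A # \<Gamma>)"
    by (simp add: atm_mor_def)
qed (simp add: atm_mor_def)

lemma ok_sub:
  "ok l \<Gamma> T t \<Longrightarrow> wf \<Gamma> \<Longrightarrow> atm_mor l s \<Delta> \<Gamma> \<Longrightarrow> ok l \<Delta> (sub (\<lambda>n. er l (s n)) T) (asub s t)"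
  using ok_mor[OF atm_mor_class_atm] by (auto simp: atm_mor_def)


section \<open>Conversion of contexts and functoriality of substitution\<close>

lemma sub_Var_ren [simp]: "sub (\<lambda>x. Var (r x)) t = ren r t"
  by (simp add: ren_eq_sub)

lemma all_less_Suc_eq_0: "(\<forall>n < Suc k. P n) \<longleftrightarrow> P 0 \<and> (\<forall>n < k. P (Suc n))"
  by (auto simp: less_Suc_eq_0_disj)

lemma wf_ConsD: "wf (A # \<Gamma>) \<Longrightarrow> wf \<Gamma>"
  by (auto elim: wf.cases dest: has_ty_wf)

lemma atm_mor_ren: "ren_mor r \<Delta> \<Gamma> \<Longrightarrow> wf \<Delta> \<Longrightarrow> atm_mor l (\<lambda>n. AVar (r n)) \<Delta> \<Gamma>"
  using atm_mor_class_ren[of l] unfolding atm_mor_class_def atm_mor_def by blast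

lemma ren_mor_id: "ren_mor (\<lambda>n. n) \<Gamma> \<Gamma>"
  by (simp add: ren_mor_def)

lemma atm_mor_AVar: "wf \<Gamma> \<Longrightarrow> atm_mor l AVar \<Gamma> \<Gamma>"
  using atm_mor_ren[OF ren_mor_id] by simp

text \<open>The identity substitution is a morphism between contexts that differ by subsumption.
  Retyping a term in a converted context thereby becomes an instance of the substitution
  lemma.\<close>

lemma atm_mor_conv:
  assumes "atm_mor l AVar \<Delta> \<Gamma>" "wf (A # \<Delta>)" "le \<Delta> A B"
  shows "atm_mor l AVar (A # \<Delta>) (B # \<Gamma>)"
proof -
  have "ok l (A # \<Delta>) (wk (Suc n) ((B # \<Gamma>) ! n)) (AVar n)" if n: "n < length (B # \<Gamma>)" for n
  proof (cases n)
    case 0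
    then show ?thesis
      using le_Suc[OF assms(3,2)] by simp
  next
    case (Suc m)
    with n assms(1) have "ok l \<Delta> (wk (Suc m) (\<Gamma> ! m)) (AVar m)"
      by (auto simp: atm_mor_def)
    from ok_Suc[OF this wf_ConsD[OF assms(2)] assms(2)] Suc show ?thesis
      by simp
  qed
  then show ?thesis
    using assms(2) by (simp add: atm_mor_def del: okm.simps)
qed

lemma ok_conv: "ok l \<Gamma> T t \<Longrightarrow> wf \<Gamma> \<Longrightarrow> atm_mor l AVar \<Delta> \<Gamma> \<Longrightarrow> ok l \<Delta> T t"
  using ok_sub[where s = AVar] by (simp add: asub_AVar)

lemma atm_mor_conv1: "wf (A # \<Gamma>) \<Longrightarrow> le \<Gamma> A B \<Longrightarrow> atm_mor l AVar (A # \<Gamma>) (B # \<Gamma>)"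
  using atm_mor_conv atm_mor_AVar wf_ConsD by blast

definition ascons :: "atm \<Rightarrow> (nat \<Rightarrow> atm) \<Rightarrow> nat \<Rightarrow> atm" where
  "ascons a s n = (case n of 0 \<Rightarrow> a | Suc m \<Rightarrow> s m)"

lemma ascons_simps [simp]: "ascons a s 0 = a" "ascons a s (Suc n) = s n"
  by (simp_all add: ascons_def)

lemma er_ascons: "(\<lambda>n. er l (ascons a s n)) = er l a \<bullet> (\<lambda>n. er l (s n))"
  by (rule nat_fun_eqI) simp_all

lemma atm_mor_ascons:
  assumes "atm_mor l s \<Delta> \<Gamma>" "ok l \<Delta> (sub (\<lambda>n. er l (s n)) A) a"
  shows "atm_mor l (ascons a s) \<Delta> (A # \<Gamma>)"
proof -
  have "ok l \<Delta> (sub (\<lambda>n. er l (ascons a s n)) (wk (Suc n) ((A # \<Gamma>) ! n))) (ascons a s n)"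
    if "n < length (A # \<Gamma>)" for n
    unfolding er_ascons
    using assms that by (cases n) (auto simp: atm_mor_def)
  then show ?thesis
    using assms(1) by (simp add: atm_mor_def)
qed

lemma ok_inst:
  assumes "ok l (A # \<Gamma>) T t" "wf (A # \<Gamma>)" "ok l \<Gamma> A a"
  shows "ok l \<Gamma> (T\<langle>er l a\<rangle>) (asub (ascons a AVar) t)"
proof -
  have "atm_mor l (ascons a AVar) \<Gamma> (A # \<Gamma>)"
    by (rule atm_mor_ascons) (use assms in \<open>auto intro: atm_mor_AVar dest: wf_ConsD\<close>)
  from ok_sub[OF assms(1,2) this] show ?thesis
    by (simp add: er_ascons)
qed

lemma ok_inst2:
  assumes "ok l (B # A # \<Gamma>) T t" "wf (B # A # \<Gamma>)" "ok l \<Gamma> A a" "ok l \<Gamma> (B\<langle>er l a\<rangle>) b"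
  shows "ok l \<Gamma> (sub (er l b \<bullet> er l a \<bullet> Var) T) (asub (ascons b (ascons a AVar)) t)"
proof -
  have "atm_mor l (ascons a AVar) \<Gamma> (A # \<Gamma>)"
    by (rule atm_mor_ascons) (use assms in \<open>auto intro: atm_mor_AVar dest: wf_ConsD\<close>)
  then have "atm_mor l (ascons b (ascons a AVar)) \<Gamma> (B # A # \<Gamma>)"
    by (rule atm_mor_ascons) (use assms in \<open>simp add: er_ascons\<close>)
  from ok_sub[OF assms(1,2) this] show ?thesis
    by (simp add: er_ascons)
qed

lemma tm_mor_Var: "wf \<Gamma> \<Longrightarrow> tm_mor Var \<Gamma> \<Gamma>"
  using ty_Var by (auto simp: tm_mor_def)

lemma tm_mor_up:
  "tm_mor s \<Delta> \<Gamma> \<Longrightarrow> sub s A = A' \<Longrightarrow> wf (A' # \<Delta>) \<Longrightarrow> tm_mor (up s) (A' # \<Delta>) (A # \<Gamma>)"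
  using mor_class_tm unfolding mor_class_def by blast

lemma tm_mor_scons:
  "tm_mor s \<Delta> \<Gamma> \<Longrightarrow> \<Delta> \<turnstile> a \<^bold>: sub s A \<Longrightarrow> tm_mor (a \<bullet> s) \<Delta> (A # \<Gamma>)"
  unfolding tm_mor_def by (auto simp: less_Suc_eq_0_disj)

lemma tm_mor_inst: "wf \<Gamma> \<Longrightarrow> \<Gamma> \<turnstile> a \<^bold>: A \<Longrightarrow> tm_mor (a \<bullet> Var) \<Gamma> (A # \<Gamma>)"
  using tm_mor_scons tm_mor_Var by fastforce

lemma has_ty_inst: "A # \<Gamma> \<turnstile> b \<^bold>: B \<Longrightarrow> \<Gamma> \<turnstile> a \<^bold>: A \<Longrightarrow> \<Gamma> \<turnstile> b\<langle>a\<rangle> \<^bold>: B\<langle>a\<rangle>"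
  using has_ty_sub tm_mor_inst has_ty_wf by blast

lemma eq_tm_inst: "A # \<Gamma> \<turnstile> b \<doteq> c \<^bold>: B \<Longrightarrow> \<Gamma> \<turnstile> a \<^bold>: A \<Longrightarrow> \<Gamma> \<turnstile> b\<langle>a\<rangle> \<doteq> c\<langle>a\<rangle> \<^bold>: B\<langle>a\<rangle>"
  using eq_tm_sub tm_mor_inst has_ty_wf by blast

section \<open>Substitution of judgmentally equal terms\<close>

definition eq_mor :: "ctx \<Rightarrow> (nat \<Rightarrow> tm) \<Rightarrow> (nat \<Rightarrow> tm) \<Rightarrow> ctx \<Rightarrow> bool" where
  "eq_mor \<Delta> s q \<Gamma> \<longleftrightarrow> tm_mor s \<Delta> \<Gamma> \<and> tm_mor q \<Delta> \<Gamma> \<and>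
     (\<forall>n < length \<Gamma>. \<Delta> \<turnstile> s n \<doteq> q n \<^bold>: sub s (wk (Suc n) (\<Gamma> ! n)))"

lemma eq_mor_scons:
  "eq_mor \<Delta> s q \<Gamma> \<Longrightarrow> \<Delta> \<turnstile> a \<^bold>: sub s A \<Longrightarrow> \<Delta> \<turnstile> a' \<^bold>: sub q A \<Longrightarrow> \<Delta> \<turnstile> a \<doteq> a' \<^bold>: sub s A \<Longrightarrow>
     eq_mor \<Delta> (a \<bullet> s) (a' \<bullet> q) (A # \<Gamma>)"
  unfolding eq_mor_def by (auto simp: tm_mor_scons less_Suc_eq_0_disj)

lemma eq_mor_Var: "wf \<Gamma> \<Longrightarrow> eq_mor \<Gamma> Var Var \<Gamma>"
  using tm_mor_Var unfolding eq_mor_def tm_mor_def by (auto intro: eq_refl)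

lemma tm_mor_tail: "tm_mor s \<Delta> (A # \<Gamma>) \<Longrightarrow> tm_mor (\<lambda>n. s (Suc n)) \<Delta> \<Gamma> \<and> \<Delta> \<turnstile> s 0 \<^bold>: sub (\<lambda>n. s (Suc n)) A"
  unfolding tm_mor_def by (auto simp: all_less_Suc_eq_0)

lemma eq_mor_tail:
  "eq_mor \<Delta> s q (A # \<Gamma>) \<Longrightarrow>
     eq_mor \<Delta> (\<lambda>n. s (Suc n)) (\<lambda>n. q (Suc n)) \<Gamma> \<and> \<Delta> \<turnstile> s 0 \<doteq> q 0 \<^bold>: sub (\<lambda>n. s (Suc n)) A"
  unfolding eq_mor_def using tm_mor_tail by (auto simp: all_less_Suc_eq_0)

lemma scons_eta: "s 0 \<bullet> (\<lambda>n. s (Suc n)) = s"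
  by (rule nat_fun_eqI) simp_all

lemma inst_up: "(sub (up (\<lambda>n. s (Suc n))) b)\<langle>s 0\<rangle> = sub s b"
  by (simp add: scons_sub_up scons_eta)

text \<open>A substitution instance is a beta reduct: abstract the innermost variable, substitute
  for the others, and apply to the value of that variable. Equality of instances is thereby reduced
  to the congruence rule for application and one variable less.\<close>

lemma beta_tail:
  assumes "wf \<Delta>" "tm_mor s \<Delta> (A # \<Gamma>)" "A # \<Gamma> \<turnstile> b \<^bold>: B" "\<Gamma> \<turnstile> A \<^bold>: Uni j"
  shows "\<Delta> \<turnstile> App (sub (\<lambda>n. s (Suc n)) (Lam A b)) (s 0) \<doteq> sub s b \<^bold>: sub s B"
proof -
  let ?s = "\<lambda>n. s (Suc n)"
  note s = tm_mor_tail[OF assms(2)]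
  have A: "\<Delta> \<turnstile> sub ?s A \<^bold>: Uni j"
    using has_ty_sub[OF assms(1) _ assms(4)] s by simp
  note w = wf_Cons[OF A]
  from has_ty_sub[OF w tm_mor_up[OF conjunct1[OF s] refl w] assms(3)]
  have "sub ?s A # \<Delta> \<turnstile> sub (up ?s) b \<^bold>: sub (up ?s) B" .
  from Pi_comp[OF this conjunct2[OF s]] show ?thesis
    unfolding inst_up by simp
qed

text \<open>Functoriality in the substitution is inherited from application.\<close>
lemma sub_cong:
  assumes "wf \<Delta>"
  shows "eq_mor \<Delta> s q \<Gamma> \<Longrightarrow> \<Gamma> \<turnstile> b \<^bold>: B \<Longrightarrow> \<Gamma> \<turnstile> B \<^bold>: Uni k \<Longrightarrow> \<Delta> \<turnstile> sub s b \<doteq> sub q b \<^bold>: sub s B"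
proof (induction \<Gamma> arbitrary: s q b B k)
  case Nil
  then have "sub s b = sub q b"
    by (intro has_ty_sub_cong) auto
  moreover have "\<Delta> \<turnstile> sub s b \<^bold>: sub s B"
    using Nil has_ty_sub[OF assms] by (auto simp: eq_mor_def)
  ultimately show ?case
    by (simp add: eq_refl)
next
  case (Cons A \<Gamma>)
  let ?s = "\<lambda>n. s (Suc n)" and ?q = "\<lambda>n. q (Suc n)"
  note t = eq_mor_tail[OF Cons.prems(1)]
  have s: "tm_mor s \<Delta> (A # \<Gamma>)" and q: "tm_mor q \<Delta> (A # \<Gamma>)"
    using Cons.prems(1) by (auto simp: eq_mor_def)
  obtain j where A: "\<Gamma> \<turnstile> A \<^bold>: Uni j"
    using has_ty_wf[OF Cons.prems(2)] by (auto elim: wf.cases)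
  \<comment> \<open>The two redexes are typed by the instances of \<open>C\<close> under
    \<open>s\<close> and under \<open>q\<close>, so the claim for a term presupposes that these
    instances of its type are equal.\<close>
  have step: "\<Delta> \<turnstile> sub s c \<doteq> sub q c \<^bold>: sub s C"
    if c: "A # \<Gamma> \<turnstile> c \<^bold>: C" and C: "A # \<Gamma> \<turnstile> C \<^bold>: Uni m" and ty: "\<Delta> \<turnstile> sub s C \<doteq> sub q C \<^bold>: Uni m"
    for c C m
  proof -
    have "\<Gamma> \<turnstile> PiT A C \<^bold>: Uni (max j m)"
      using cumul[OF A, of "max j m"] cumul[OF C, of "max j m"] by (auto intro: ty_Pi)
    from Cons.IH[OF conjunct1[OF t] ty_Lam[OF c] this]
    have "\<Delta> \<turnstile> sub ?s (Lam A c) \<doteq> sub ?q (Lam A c) \<^bold>: PiT (sub ?s A) (sub (up ?s) C)"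
      by simp
    from eq_App[OF this conjunct2[OF t]]
    have "\<Delta> \<turnstile> App (sub ?s (Lam A c)) (s 0) \<doteq> App (sub ?q (Lam A c)) (q 0) \<^bold>: sub s C"
      unfolding inst_up .
    with beta_tail[OF assms s c A] eq_conv[OF beta_tail[OF assms q c A] eq_sym[OF ty]] show ?thesis
      by (meson eq_sym eq_trans)
  qed
  \<comment> \<open>For a type the presupposition is trivial, because a universe is its own
    instance; this settles the presupposition for its elements.\<close>
  have "\<Delta> \<turnstile> sub s B \<doteq> sub q B \<^bold>: sub s (Uni k)"
    using Cons.prems(3) by (rule step) (use has_ty_wf[OF Cons.prems(2)] assms in \<open>auto intro: ty_Uni eq_refl\<close>)
  then show ?case
    using step Cons.prems by simp
qed

lemma inst_cong:
  assumes "A # \<Gamma> \<turnstile> B \<^bold>: Uni k" "\<Gamma> \<turnstile> a \<doteq> a' \<^bold>: A" "\<Gamma> \<turnstile> a \<^bold>: A" "\<Gamma> \<turnstile> a' \<^bold>: A"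
  shows "\<Gamma> \<turnstile> B\<langle>a\<rangle> \<doteq> B\<langle>a'\<rangle> \<^bold>: Uni k"
proof -
  have wf: "wf \<Gamma>"
    using assms(3) by (rule has_ty_wf)
  have "eq_mor \<Gamma> (a \<bullet> Var) (a' \<bullet> Var) (A # \<Gamma>)"
    using assms by (intro eq_mor_scons eq_mor_Var wf) auto
  from sub_cong[OF wf this assms(1) ty_Uni[OF has_ty_wf[OF assms(1)]]] show ?thesis
    by simp
qed

lemma inst_cong3:
  assumes C: "id_ctx A @ \<Gamma> \<turnstile> C \<^bold>: Uni k"
    and a: "\<Gamma> \<turnstile> a \<doteq> a' \<^bold>: A" "\<Gamma> \<turnstile> a \<^bold>: A" "\<Gamma> \<turnstile> a' \<^bold>: A"
    and b: "\<Gamma> \<turnstile> b \<doteq> b' \<^bold>: A" "\<Gamma> \<turnstile> b \<^bold>: A" "\<Gamma> \<turnstile> b' \<^bold>: A"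
    and p: "\<Gamma> \<turnstile> p \<doteq> p' \<^bold>: IdT A a b" "\<Gamma> \<turnstile> p \<^bold>: IdT A a b" "\<Gamma> \<turnstile> p' \<^bold>: IdT A a' b'"
  shows "\<Gamma> \<turnstile> sub (p \<bullet> b \<bullet> a \<bullet> Var) C \<doteq> sub (p' \<bullet> b' \<bullet> a' \<bullet> Var) C \<^bold>: Uni k"
proof -
  have wf: "wf \<Gamma>"
    using a(2) by (rule has_ty_wf)
  have "sub (y \<bullet> x \<bullet> Var) (IdT (wk 2 A) (Var 1) (Var 0)) = IdT A x y" for x y
    by (simp add: numeral_2_eq_2)
  then have "eq_mor \<Gamma> (p \<bullet> b \<bullet> a \<bullet> Var) (p' \<bullet> b' \<bullet> a' \<bullet> Var) (id_ctx A @ \<Gamma>)"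
    unfolding append_Cons append_Nil
    using a b p by (intro eq_mor_scons eq_mor_Var wf) auto
  from sub_cong[OF wf this C ty_Uni[OF has_ty_wf[OF C]]] show ?thesis
    by simp
qed


section \<open>Executable substitution\<close>

text \<open>Renaming and substitution are repeated with numbers and lists in place of functions on
  indices, so that the simplifier only rewrites constructor terms. \<open>aren\<close> and
  \<open>asub\<close> stay the versions that are reasoned about.\<close>

fun shift_var :: "nat \<Rightarrow> nat \<Rightarrow> nat \<Rightarrow> nat" where
  "shift_var 0 d n = d + n"
| "shift_var (Suc k) d 0 = 0"
| "shift_var (Suc k) d (Suc n) = Suc (shift_var k d n)"

primrec lift :: "nat \<Rightarrow> nat \<Rightarrow> atm \<Rightarrow> atm" where
  "lift k d (AVar n) = AVar (shift_var k d n)"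
| "lift k d (AUni j) = AUni j"
| "lift k d (APi A B) = APi (lift k d A) (lift (Suc k) d B)"
| "lift k d (ALam A' A B b) = ALam (lift k d A') (lift k d A) (lift (Suc k) d B) (lift (Suc k) d b)"
| "lift k d (AApp A B f a) = AApp (lift k d A) (lift (Suc k) d B) (lift k d f) (lift k d a)"
| "lift k d (ASg A B) = ASg (lift k d A) (lift (Suc k) d B)"
| "lift k d (APr A B a b) = APr (lift k d A) (lift (Suc k) d B) (lift k d a) (lift k d b)"
| "lift k d (AIndSg A B C g p) =
     AIndSg (lift k d A) (lift (Suc k) d B) (lift (Suc k) d C) (lift (Suc (Suc k)) d g) (lift k d p)"
| "lift k d (ACo A B) = ACo (lift k d A) (lift k d B)"
| "lift k d AEmp = AEmp"
| "lift k d AOne = AOne"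
| "lift k d (AId A a b) = AId (lift k d A) (lift k d a) (lift k d b)"
| "lift k d (ARfl A a b z) = ARfl (lift k d A) (lift k d a) (lift k d b) (lift k d z)"
| "lift k d (AIndId A C c a b p) =
     AIndId (lift k d A) (lift (Suc (Suc (Suc k))) d C) (lift (Suc k) d c)
       (lift k d a) (lift k d b) (lift k d p)"
| "lift k d (AFunext j) = AFunext j"
| "lift k d (AUa j) = AUa j"
| "lift k d (ADef n e as) = ADef n e (map (lift k d) as)"

fun lift0 :: "nat \<Rightarrow> atm \<Rightarrow> atm" where
  "lift0 0 t = t"
| "lift0 (Suc d) t = lift 0 (Suc d) t"

fun pick :: "nat \<Rightarrow> nat \<Rightarrow> atm list \<Rightarrow> nat \<Rightarrow> atm" where
  "pick k d [] n = AVar (k + (d + n))"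
| "pick k d (a # as) 0 = lift0 k a"
| "pick k d (a # as) (Suc n) = pick k d as n"

text \<open>The index and the depth are counted down together, while \<open>n0\<close> and
  \<open>k0\<close> keep their original values: the former is returned for a bound variable, the
  latter is the amount by which an inserted term is lifted.\<close>

fun subst_var :: "nat \<Rightarrow> nat \<Rightarrow> nat \<Rightarrow> nat \<Rightarrow> atm list \<Rightarrow> nat \<Rightarrow> atm" where
  "subst_var n0 k0 0 d as n = pick k0 d as n"
| "subst_var n0 k0 (Suc k) d as 0 = AVar n0"
| "subst_var n0 k0 (Suc k) d as (Suc n) = subst_var n0 k0 k d as n"

text \<open>
  \<open>subst k d as\<close> replaces the variables \<open>k\<close>, \<open>k + 1\<close>, \dots by the terms of \<open>as\<close> and shifts the
  remaining ones, which lose \<open>length as\<close> binders and gain \<open>d\<close>.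
\<close>
primrec subst :: "nat \<Rightarrow> nat \<Rightarrow> atm list \<Rightarrow> atm \<Rightarrow> atm" where
  "subst k d as (AVar n) = subst_var n k k d as n"
| "subst k d as (AUni j) = AUni j"
| "subst k d as (APi A B) = APi (subst k d as A) (subst (Suc k) d as B)"
| "subst k d as (ALam A' A B b) =
     ALam (subst k d as A') (subst k d as A) (subst (Suc k) d as B) (subst (Suc k) d as b)"
| "subst k d as (AApp A B f a) =
     AApp (subst k d as A) (subst (Suc k) d as B) (subst k d as f) (subst k d as a)"
| "subst k d as (ASg A B) = ASg (subst k d as A) (subst (Suc k) d as B)"
| "subst k d as (APr A B a b) =
     APr (subst k d as A) (subst (Suc k) d as B) (subst k d as a) (subst k d as b)"
| "subst k d as (AIndSg A B C g p) =
     AIndSg (subst k d as A) (subst (Suc k) d as B) (subst (Suc k) d as C)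
       (subst (Suc (Suc k)) d as g) (subst k d as p)"
| "subst k d as (ACo A B) = ACo (subst k d as A) (subst k d as B)"
| "subst k d as AEmp = AEmp"
| "subst k d as AOne = AOne"
| "subst k d as (AId A a b) = AId (subst k d as A) (subst k d as a) (subst k d as b)"
| "subst k d as (ARfl A a b z) =
     ARfl (subst k d as A) (subst k d as a) (subst k d as b) (subst k d as z)"
| "subst k d as (AIndId A C c a b p) =
     AIndId (subst k d as A) (subst (Suc (Suc (Suc k))) d as C) (subst (Suc k) d as c)
       (subst k d as a) (subst k d as b) (subst k d as p)"
| "subst k d as (AFunext j) = AFunext j"
| "subst k d as (AUa j) = AUa j"
| "subst k d as (ADef n e bs) = ADef n e (map (subst k d as) bs)"


section \<open>Source terms\<close>

text \<open>
  The input of the checker: raw terms with type ascriptions and defined constants.  Universe levels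
  are relative to a base level \<open>l\<close>, which \<open>strip l\<close> and \<open>er l\<close> add to them.
\<close>
datatype src =
    SVar nat
  | SUni nat
  | SPi src src
  | SLam src src
  | SApp src src
  | SSg src src
  | SPr src src
  | SIndSg src src src
  | SCo src src
  | SEmp
  | SOne
  | SId src src src
  | SRfl src
  | SIndId src src src src src
  | SFunext nat
  | SUa nat
  | SAsc src src
  | SDef num dfn "src list"

primrec strip :: "nat \<Rightarrow> src \<Rightarrow> tm" where
  "strip l (SVar n) = Var n"
| "strip l (SUni k) = Uni (k + l)"
| "strip l (SPi A B) = PiT (strip l A) (strip l B)"
| "strip l (SLam A b) = Lam (strip l A) (strip l b)"
| "strip l (SApp f a) = App (strip l f) (strip l a)"
| "strip l (SSg A B) = SgT (strip l A) (strip l B)"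
| "strip l (SPr a b) = Pr (strip l a) (strip l b)"
| "strip l (SIndSg C g p) = IndSg (strip l C) (strip l g) (strip l p)"
| "strip l (SCo A B) = CoT (strip l A) (strip l B)"
| "strip l SEmp = Emp"
| "strip l SOne = One"
| "strip l (SId A a b) = IdT (strip l A) (strip l a) (strip l b)"
| "strip l (SRfl a) = Rfl (strip l a)"
| "strip l (SIndId C c a b p) = IndId (strip l C) (strip l c) (strip l a) (strip l b) (strip l p)"
| "strip l (SFunext k) = FunextC (k + l)"
| "strip l (SUa k) = UaC (k + l)"
| "strip l (SAsc T t) = strip l t"
| "strip l (SDef n d as) = sub (vsub (map (strip l) as)) (er_dfn l d)"

text \<open>Nothing is assumed about the term itself, only that the definitions it contains by value
  have been checked.\<close>

primrec src_ok :: "nat \<Rightarrow> src \<Rightarrow> bool" where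
  "src_ok l (SVar n) = True"
| "src_ok l (SUni k) = True"
| "src_ok l (SPi A B) = (src_ok l A \<and> src_ok l B)"
| "src_ok l (SLam A b) = (src_ok l A \<and> src_ok l b)"
| "src_ok l (SApp f a) = (src_ok l f \<and> src_ok l a)"
| "src_ok l (SSg A B) = (src_ok l A \<and> src_ok l B)"
| "src_ok l (SPr a b) = (src_ok l a \<and> src_ok l b)"
| "src_ok l (SIndSg C g p) = (src_ok l C \<and> src_ok l g \<and> src_ok l p)"
| "src_ok l (SCo A B) = (src_ok l A \<and> src_ok l B)"
| "src_ok l SEmp = True"
| "src_ok l SOne = True"
| "src_ok l (SId A a b) = (src_ok l A \<and> src_ok l a \<and> src_ok l b)"
| "src_ok l (SRfl a) = src_ok l a"
| "src_ok l (SIndId C c a b p) =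
     (src_ok l C \<and> src_ok l c \<and> src_ok l a \<and> src_ok l b \<and> src_ok l p)"
| "src_ok l (SFunext k) = True"
| "src_ok l (SUa k) = True"
| "src_ok l (SAsc T t) = (src_ok l T \<and> src_ok l t)"
| "src_ok l (SDef n d as) = (okd l d \<and> list_all (\<lambda>b. b) (map (src_ok l) as))"

text \<open>The analogue of \<open>expr\<close> for source terms, again with \<open>sv k\<close> for the \<open>k\<close>-th variable of the
  context.\<close>
type_synonym sexpr = "nat \<Rightarrow> src"

definition sv :: "nat \<Rightarrow> sexpr" where "sv k = (\<lambda>m. SVar (m - Suc k))"
definition su :: "nat \<Rightarrow> sexpr" where "su k = (\<lambda>m. SUni k)"
definition spi :: "sexpr \<Rightarrow> (sexpr \<Rightarrow> sexpr) \<Rightarrow> sexpr" where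
  "spi A B = (\<lambda>n. SPi (A n) (B (sv n) (Suc n)))"
definition sla :: "sexpr \<Rightarrow> (sexpr \<Rightarrow> sexpr) \<Rightarrow> sexpr" where
  "sla A b = (\<lambda>n. SLam (A n) (b (sv n) (Suc n)))"
definition ssg :: "sexpr \<Rightarrow> (sexpr \<Rightarrow> sexpr) \<Rightarrow> sexpr" where
  "ssg A B = (\<lambda>n. SSg (A n) (B (sv n) (Suc n)))"

syntax
  "_spi" :: "pttrn \<Rightarrow> sexpr \<Rightarrow> sexpr \<Rightarrow> sexpr" ("(3\<Pi> _:_./ _)" [0, 0, 50] 50)
  "_sla" :: "pttrn \<Rightarrow> sexpr \<Rightarrow> sexpr \<Rightarrow> sexpr" ("(3\<Lambda> _:_./ _)" [0, 0, 50] 50)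
  "_ssg" :: "pttrn \<Rightarrow> sexpr \<Rightarrow> sexpr \<Rightarrow> sexpr" ("(3\<Sigma> _:_./ _)" [0, 0, 50] 50)
translations
  "\<Pi> x:A. B" == "CONST spi A (\<lambda>x. B)"
  "\<Lambda> x:A. b" == "CONST sla A (\<lambda>x. b)"
  "\<Sigma> x:A. B" == "CONST ssg A (\<lambda>x. B)"

abbreviation sarr :: "sexpr \<Rightarrow> sexpr \<Rightarrow> sexpr" (infixr "\<rightharpoonup>" 60) where
  "A \<rightharpoonup> B \<equiv> spi A (\<lambda>_. B)"
abbreviation sprod :: "sexpr \<Rightarrow> sexpr \<Rightarrow> sexpr" (infixr "\<otimes>" 70) where
  "A \<otimes> B \<equiv> ssg A (\<lambda>_. B)"
definition sapp :: "sexpr \<Rightarrow> sexpr \<Rightarrow> sexpr" (infixl "\<star>" 90) where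
  "f \<star> a = (\<lambda>n. SApp (f n) (a n))"
definition spr :: "sexpr \<Rightarrow> sexpr \<Rightarrow> sexpr" ("\<lblot>_,/ _\<rblot>") where
  "\<lblot>a, b\<rblot> = (\<lambda>n. SPr (a n) (b n))"
definition sind_sg :: "(sexpr \<Rightarrow> sexpr) \<Rightarrow> (sexpr \<Rightarrow> sexpr \<Rightarrow> sexpr) \<Rightarrow> sexpr \<Rightarrow> sexpr" where
  "sind_sg C g p =
     (\<lambda>n. SIndSg (C (sv n) (Suc n)) (g (sv n) (sv (Suc n)) (Suc (Suc n))) (p n))"
definition sid :: "sexpr \<Rightarrow> sexpr \<Rightarrow> sexpr \<Rightarrow> sexpr" where
  "sid A a b = (\<lambda>n. SId (A n) (a n) (b n))"
definition srf :: "sexpr \<Rightarrow> sexpr" where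
  "srf a = (\<lambda>n. SRfl (a n))"
definition sind_id ::
    "(sexpr \<Rightarrow> sexpr \<Rightarrow> sexpr \<Rightarrow> sexpr) \<Rightarrow> (sexpr \<Rightarrow> sexpr) \<Rightarrow> sexpr \<Rightarrow> sexpr \<Rightarrow> sexpr \<Rightarrow> sexpr" where
  "sind_id C c a b p =
     (\<lambda>n. SIndId (C (sv n) (sv (Suc n)) (sv (Suc (Suc n))) (Suc (Suc (Suc n))))
            (c (sv n) (Suc n)) (a n) (b n) (p n))"
definition sco :: "sexpr \<Rightarrow> sexpr \<Rightarrow> sexpr" where
  "sco A B = (\<lambda>n. SCo (A n) (B n))"
definition semp :: sexpr where "semp = (\<lambda>n. SEmp)"
definition sone :: sexpr where "sone = (\<lambda>n. SOne)"
definition sfx :: "nat \<Rightarrow> sexpr" where "sfx k = (\<lambda>n. SFunext k)"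
definition sua :: "nat \<Rightarrow> sexpr" where "sua k = (\<lambda>n. SUa k)"
definition sasc :: "sexpr \<Rightarrow> sexpr \<Rightarrow> sexpr" (infix "\<Colon>" 55) where
  "t \<Colon> T = (\<lambda>n. SAsc (T n) (t n))"

definition sfst :: "sexpr \<Rightarrow> sexpr \<Rightarrow> sexpr" where
  "sfst A p = sind_sg (\<lambda>_. A) (\<lambda>x y. x) p"
definition ssnd :: "sexpr \<Rightarrow> (sexpr \<Rightarrow> sexpr) \<Rightarrow> sexpr \<Rightarrow> sexpr" where
  "ssnd A B p = sind_sg (\<lambda>z. B (sfst A z)) (\<lambda>x y. y) p"
definition sidfun :: "sexpr \<Rightarrow> sexpr" where
  "sidfun A = (\<Lambda> x:A. x)"
definition sfcomp :: "sexpr \<Rightarrow> sexpr \<Rightarrow> sexpr \<Rightarrow> sexpr" where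
  "sfcomp A g f = (\<Lambda> x:A. g \<star> (f \<star> x))"
definition sisequiv :: "sexpr \<Rightarrow> sexpr \<Rightarrow> sexpr \<Rightarrow> sexpr" where
  "sisequiv X Y f =
     (\<Sigma> g:Y \<rightharpoonup> X. \<Pi> y:Y. sid Y (f \<star> (g \<star> y)) y) \<otimes>
     (\<Sigma> h:Y \<rightharpoonup> X. \<Pi> x:X. sid X (h \<star> (f \<star> x)) x)"
definition sequivt :: "sexpr \<Rightarrow> sexpr \<Rightarrow> sexpr" where
  "sequivt X Y = (\<Sigma> f:X \<rightharpoonup> Y. sisequiv X Y f)"
definition sidequiv :: "sexpr \<Rightarrow> sexpr" where
  "sidequiv X =
     \<lblot>sidfun X, \<lblot>\<lblot>sidfun X, \<Lambda> x:X. srf x\<rblot>, \<lblot>sidfun X, \<Lambda> x:X. srf x\<rblot>\<rblot>\<rblot>"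
definition sap :: "sexpr \<Rightarrow> sexpr \<Rightarrow> sexpr \<Rightarrow> sexpr \<Rightarrow> sexpr \<Rightarrow> sexpr" where
  "sap Y f x y p = sind_id (\<lambda>u v _. sid Y (f \<star> u) (f \<star> v)) (\<lambda>u. srf (f \<star> u)) x y p"
definition shapply :: "sexpr \<Rightarrow> (sexpr \<Rightarrow> sexpr) \<Rightarrow> sexpr \<Rightarrow> sexpr \<Rightarrow> sexpr \<Rightarrow> sexpr" where
  "shapply A B f g p =
     sind_id (\<lambda>h k _. \<Pi> x:A. sid (B x) (h \<star> x) (k \<star> x)) (\<lambda>h. \<Lambda> x:A. srf (h \<star> x)) f g p"
definition sidtoeqv :: "nat \<Rightarrow> sexpr \<Rightarrow> sexpr \<Rightarrow> sexpr" where
  "sidtoeqv i X Y =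
     (\<Lambda> p:sid (su i) X Y. sind_id (\<lambda>u v _. sequivt u v) (\<lambda>u. sidequiv u) X Y p)"
definition suniv_ty :: "nat \<Rightarrow> sexpr" where
  "suniv_ty i =
     (\<Pi> X:su i. \<Pi> Y:su i. sisequiv (sid (su i) X Y) (sequivt X Y) (sidtoeqv i X Y))"
definition sfunext_ty :: "nat \<Rightarrow> sexpr" where
  "sfunext_ty i =
     (\<Pi> A:su i. \<Pi> B:A \<rightharpoonup> su i. \<Pi> f:(\<Pi> x:A. B \<star> x). \<Pi> g:(\<Pi> x:A. B \<star> x).
        sisequiv (sid (\<Pi> x:A. B \<star> x) f g) (\<Pi> x:A. sid (B \<star> x) (f \<star> x) (g \<star> x))
          (\<Lambda> p:sid (\<Pi> x:A. B \<star> x) f g. shapply A (\<lambda>x. B \<star> x) f g p))"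

lemmas sexpr_defs = sv_def su_def spi_def sla_def ssg_def sapp_def spr_def sind_sg_def sid_def srf_def
  sind_id_def sco_def semp_def sone_def sfx_def sua_def sasc_def sfst_def ssnd_def sidfun_def
  sfcomp_def sisequiv_def sequivt_def sidequiv_def sap_def shapply_def sidtoeqv_def suniv_ty_def
  sfunext_ty_def

text \<open>The checker obtains an annotated type for the axiom by elaborating a source copy of that
  type; this ties the copy to the type in the rule \<open>ax_funext\<close>.\<close>

lemma strip_sfunext_ty: "strip l (sfunext_ty k n) = funext_ty (k + l) n"
  by (simp add: sexpr_defs expr_defs)

lemma strip_suniv_ty: "strip l (suniv_ty k n) = univalence_ty (k + l) n"
  by (simp add: sexpr_defs expr_defs)

lemma src_ok_sfunext_ty: "src_ok l (sfunext_ty k n)"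
  by (simp add: sexpr_defs)

lemma src_ok_suniv_ty: "src_ok l (suniv_ty k n)"
  by (simp add: sexpr_defs)


section \<open>The type checker\<close>

type_synonym actx = "atm list"

type_synonym whnf_fun = "actx \<Rightarrow> atm \<Rightarrow> atm"
type_synonym conv_fun = "actx \<Rightarrow> atm \<Rightarrow> atm \<Rightarrow> bool"
type_synonym infer_fun = "actx \<Rightarrow> src \<Rightarrow> (atm \<times> atm) option"
type_synonym check_fun = "actx \<Rightarrow> src \<Rightarrow> atm \<Rightarrow> atm option"

text \<open>
  The functions below are evaluated by rewriting.  They branch by pattern matching on arguments that
  are already values, so that the simplifier never revisits a computed term.
\<close>

fun match' :: "bool \<Rightarrow> conv_fun \<Rightarrow> conv_fun" where
  "match' True c G t u = True"
| "match' False c G t u = c G t u"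

definition match :: "conv_fun \<Rightarrow> conv_fun" where
  "match c G t u = match' (t = u) c G t u"

fun contract :: "bool \<Rightarrow> whnf_fun \<Rightarrow> actx \<Rightarrow> atm \<Rightarrow> atm \<Rightarrow> atm" where
  "contract True w G r t = w G r"
| "contract False w G r t = t"

text \<open>Two Pi types of the same function may not be assumed to have equal components, so the
  redex is contracted only if the annotations of the application and of the abstraction are found
  convertible. Otherwise it is treated as stuck, which is sound.\<close>

fun whnf_app :: "whnf_fun \<Rightarrow> conv_fun \<Rightarrow> actx \<Rightarrow> atm \<Rightarrow> atm \<Rightarrow> atm \<Rightarrow> atm \<Rightarrow> atm" where
  "whnf_app w c G A B a (ALam A0 A' B' b) =
     contract (match c G A A' \<and> match c (A # G) B B') w G
       (subst 0 0 [a] b) (AApp A B (ALam A0 A' B' b) a)"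
| "whnf_app w c G A B a f = AApp A B f a"

fun whnf_ind_sg :: "whnf_fun \<Rightarrow> conv_fun \<Rightarrow> actx \<Rightarrow> atm \<Rightarrow> atm \<Rightarrow> atm \<Rightarrow> atm \<Rightarrow> atm \<Rightarrow> atm" where
  "whnf_ind_sg w c G A B C g (APr A' B' a b) =
     contract (match c G A A' \<and> match c (A # G) B B') w G
       (subst 0 0 [b, a] g) (AIndSg A B C g (APr A' B' a b))"
| "whnf_ind_sg w c G A B C g p = AIndSg A B C g p"

fun whnf_ind_id ::
    "whnf_fun \<Rightarrow> conv_fun \<Rightarrow> actx \<Rightarrow> atm \<Rightarrow> atm \<Rightarrow> atm \<Rightarrow> atm \<Rightarrow> atm \<Rightarrow> atm \<Rightarrow> atm" where
  "whnf_ind_id w c G A C d a b (ARfl A' a' b' z) =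
     contract (match c G A A' \<and> match c G a a' \<and> match c G b b') w G
       (subst 0 0 [z] d) (AIndId A C d a b (ARfl A' a' b' z))"
| "whnf_ind_id w c G A C d a b p = AIndId A C d a b p"

fun whnf_def :: "bool \<Rightarrow> whnf_fun \<Rightarrow> actx \<Rightarrow> num \<Rightarrow> dfn \<Rightarrow> atm list \<Rightarrow> atm" where
  "whnf_def True w G n d as = w G (subst 0 0 as (dbody d))"
| "whnf_def False w G n d as = ADef n d as"

fun whnf_step :: "whnf_fun \<Rightarrow> conv_fun \<Rightarrow> whnf_fun" where
  "whnf_step w c G (AApp A B f a) = whnf_app w c G A B a (w G f)"
| "whnf_step w c G (AIndSg A B C g p) = whnf_ind_sg w c G A B C g (w G p)"
| "whnf_step w c G (AIndId A C d a b p) = whnf_ind_id w c G A C d a b (w G p)"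
| "whnf_step w c G (ADef n d as) = whnf_def (transparent d) w G n d as"
| "whnf_step w c G t = t"

text \<open>Subterms are replaced by a fixed dummy, so that equality of heads tests just the
  constructor and the data that are not terms, such as an index, a level or a constant.\<close>

fun head :: "atm \<Rightarrow> atm" where
  "head (APi A B) = APi AEmp AEmp"
| "head (ALam A' A B b) = ALam AEmp AEmp AEmp AEmp"
| "head (AApp A B f a) = AApp AEmp AEmp AEmp AEmp"
| "head (ASg A B) = ASg AEmp AEmp"
| "head (APr A B a b) = APr AEmp AEmp AEmp AEmp"
| "head (AIndSg A B C g p) = AIndSg AEmp AEmp AEmp AEmp AEmp"
| "head (ACo A B) = ACo AEmp AEmp"
| "head (AId A a b) = AId AEmp AEmp AEmp"
| "head (ARfl A a b z) = ARfl AEmp AEmp AEmp AEmp"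
| "head (AIndId A C c a b p) = AIndId AEmp AEmp AEmp AEmp AEmp AEmp"
| "head (ADef n d as) = ADef n d []"
| "head t = t"

definition aid_ctx :: "atm \<Rightarrow> actx" where
  "aid_ctx A = [AId (lift 0 2 A) (AVar 1) (AVar 0), lift 0 1 A, A]"

text \<open>The written domain of an abstraction and the end points of a reflexivity are left out,
  being judgmentally equal to components that are compared. Every component comes after the types
  that make up the context it lives in, since its comparison in the context of the left term
  presupposes their equality.\<close>

fun parts :: "atm \<Rightarrow> (actx \<times> atm) list" where
  "parts (APi A B) = [([], A), ([A], B)]"
| "parts (ALam A' A B b) = [([], A), ([A], B), ([A], b)]"
| "parts (AApp A B f a) = [([], A), ([A], B), ([], f), ([], a)]"
| "parts (ASg A B) = [([], A), ([A], B)]"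
| "parts (APr A B a b) = [([], A), ([A], B), ([], a), ([], b)]"
| "parts (AIndSg A B C g p) = [([], A), ([A], B), ([], p), ([ASg A B], C), ([B, A], g)]"
| "parts (ACo A B) = [([], A), ([], B)]"
| "parts (AId A a b) = [([], A), ([], a), ([], b)]"
| "parts (ARfl A a b z) = [([], A), ([], z)]"
| "parts (AIndId A C c a b p) = [([], A), ([], a), ([], b), ([], p), (aid_ctx A, C), ([A], c)]"
| "parts (ADef n d as) = map (Pair []) as"
| "parts t = []"

fun conv_parts :: "conv_fun \<Rightarrow> actx \<Rightarrow> (actx \<times> atm) list \<Rightarrow> (actx \<times> atm) list \<Rightarrow> bool"
  and conv_parts' :: "bool \<Rightarrow> conv_fun \<Rightarrow> actx \<Rightarrow> (actx \<times> atm) list \<Rightarrow> (actx \<times> atm) list \<Rightarrow> bool" where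
  "conv_parts c G ((E, t) # xs) ((E', u) # ys) = conv_parts' (c (E @ G) t u) c G xs ys"
| "conv_parts c G [] [] = True"
| "conv_parts c G [] (y # ys) = False"
| "conv_parts c G (x # xs) [] = False"
| "conv_parts' True c G xs ys = conv_parts c G xs ys"
| "conv_parts' False c G xs ys = False"

fun same' :: "bool \<Rightarrow> conv_fun \<Rightarrow> conv_fun" where
  "same' True c G t u = conv_parts c G (parts t) (parts u)"
| "same' False c G t u = False"

definition same :: "conv_fun \<Rightarrow> conv_fun" where
  "same c G t u = same' (head t = head u) c G t u"

fun lookup :: "actx \<Rightarrow> nat \<Rightarrow> atm option" where
  "lookup [] n = None"
| "lookup (A # G) 0 = Some A"
| "lookup (A # G) (Suc n) = lookup G n"

fun lift_opt :: "nat \<Rightarrow> atm option \<Rightarrow> atm option" where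
  "lift_opt d None = None"
| "lift_opt d (Some t) = Some (lift 0 d t)"

text \<open>The annotations already contain the type, so nothing has to be inferred. The function
  serves the side of an eta comparison that is not an abstraction, which is why variables,
  eliminations and applied definitions are the cases with a result.\<close>

fun elim_type :: "actx \<Rightarrow> atm \<Rightarrow> atm option" where
  "elim_type G (AVar n) = lift_opt (Suc n) (lookup G n)"
| "elim_type G (AApp A B f a) = Some (subst 0 0 [a] B)"
| "elim_type G (AIndSg A B C g p) = Some (subst 0 0 [p] C)"
| "elim_type G (AIndId A C c a b p) = Some (subst 0 0 [p, b, a] C)"
| "elim_type G (ADef n d as) = Some (subst 0 0 as (dtype d))"
| "elim_type G t = None"

fun eta'' :: "bool \<Rightarrow> conv_fun \<Rightarrow> actx \<Rightarrow> atm \<Rightarrow> atm \<Rightarrow> atm \<Rightarrow> atm \<Rightarrow> bool" where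
  "eta'' True c G A B b u = c (A # G) b (AApp (lift 0 1 A) (lift 1 1 B) (lift 0 1 u) (AVar 0))"
| "eta'' False c G A B b u = False"

fun eta' :: "atm option \<Rightarrow> conv_fun \<Rightarrow> actx \<Rightarrow> atm \<Rightarrow> atm \<Rightarrow> atm \<Rightarrow> atm \<Rightarrow> bool" where
  "eta' None c G A B b u = False"
| "eta' (Some T) c G A B b u = eta'' (c G T (APi A B)) c G A B b u"

text \<open>Uniqueness is judgmental for functions but not for pairs, so only abstractions are
  compared by expansion. The type of the other side must be found convertible to the annotated Pi
  type before it may be expanded over it.\<close>

fun eta :: "conv_fun \<Rightarrow> conv_fun" where
  "eta c G (ALam A0 A B b) u = eta' (elim_type G u) c G A B b u"
| "eta c G t u = False"

fun is_lam :: "atm \<Rightarrow> bool" where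
  "is_lam (ALam A0 A B b) = True"
| "is_lam t = False"

fun is_elim :: "atm \<Rightarrow> bool" where
  "is_elim (AApp A B f a) = True"
| "is_elim (AIndSg A B C g p) = True"
| "is_elim (AIndId A C c a b p) = True"
| "is_elim (ADef n d as) = True"
| "is_elim t = False"

fun conv_values' :: "bool \<Rightarrow> bool \<Rightarrow> conv_fun \<Rightarrow> conv_fun" where
  "conv_values' True False c G t u = eta c G t u"
| "conv_values' False True c G t u = eta c G u t"
| "conv_values' True True c G t u = same c G t u"
| "conv_values' False False c G t u = same c G t u"

definition conv_values :: "conv_fun \<Rightarrow> conv_fun" where
  "conv_values c G t u = conv_values' (is_lam t) (is_lam u) c G t u"

fun conv_elims :: "bool \<Rightarrow> conv_fun \<Rightarrow> conv_fun" where
  "conv_elims True c G t u = same c G t u"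
| "conv_elims False c G t u = False"

fun conv_unfold :: "bool \<Rightarrow> whnf_fun \<Rightarrow> conv_fun \<Rightarrow> conv_fun" where
  "conv_unfold True w c G t u = True"
| "conv_unfold False w c G t u = conv_values c G (w G t) (w G u)"

fun conv_step' :: "bool \<Rightarrow> whnf_fun \<Rightarrow> conv_fun \<Rightarrow> conv_fun" where
  "conv_step' True w c G t u = True"
| "conv_step' False w c G t u = conv_unfold (conv_elims (is_elim t) c G t u) w c G t u"

text \<open>Eliminations and applied constants are compared componentwise before anything is
  unfolded. When this succeeds the terms stay small; when it fails nothing is lost, as both sides
  are then reduced and compared again.\<close>

definition conv_step :: "whnf_fun \<Rightarrow> conv_fun \<Rightarrow> conv_fun" where
  "conv_step w c G t u = conv_step' (t = u) w c G t u"

section \<open>Inference of types\<close>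

fun type_level :: "atm \<Rightarrow> atm \<Rightarrow> (atm \<times> nat) option" where
  "type_level A (AUni k) = Some (A, k)"
| "type_level A T = None"

fun as_type' :: "whnf_fun \<Rightarrow> actx \<Rightarrow> (atm \<times> atm) option \<Rightarrow> (atm \<times> nat) option" where
  "as_type' w G None = None"
| "as_type' w G (Some (A, T)) = type_level A (w G T)"

definition as_type :: "whnf_fun \<Rightarrow> infer_fun \<Rightarrow> actx \<Rightarrow> src \<Rightarrow> (atm \<times> nat) option" where
  "as_type w i G A = as_type' w G (i G A)"

fun infer_binder' :: "(atm \<Rightarrow> atm \<Rightarrow> atm) \<Rightarrow> atm \<Rightarrow> nat \<Rightarrow> (atm \<times> nat) option \<Rightarrow> (atm \<times> atm) option" where
  "infer_binder' F A j None = None"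
| "infer_binder' F A j (Some (B, k)) = Some (F A B, AUni (max j k))"

fun infer_binder ::
    "(atm \<Rightarrow> atm \<Rightarrow> atm) \<Rightarrow> whnf_fun \<Rightarrow> infer_fun \<Rightarrow> actx \<Rightarrow> src \<Rightarrow> (atm \<times> nat) option \<Rightarrow> (atm \<times> atm) option"
  where
  "infer_binder F w i G B None = None"
| "infer_binder F w i G B (Some (A, j)) = infer_binder' F A j (as_type w i (A # G) B)"

fun infer_co :: "whnf_fun \<Rightarrow> infer_fun \<Rightarrow> actx \<Rightarrow> src \<Rightarrow> (atm \<times> nat) option \<Rightarrow> (atm \<times> atm) option" where
  "infer_co w i G B None = None"
| "infer_co w i G B (Some (A, j)) = infer_binder' ACo A j (as_type w i G B)"

fun infer_var :: "nat \<Rightarrow> atm option \<Rightarrow> (atm \<times> atm) option" where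
  "infer_var n None = None"
| "infer_var n (Some T) = Some (AVar n, T)"

fun infer_lam' :: "atm \<Rightarrow> (atm \<times> atm) option \<Rightarrow> (atm \<times> atm) option" where
  "infer_lam' A None = None"
| "infer_lam' A (Some (b, B)) = Some (ALam A A B b, APi A B)"

fun infer_lam :: "infer_fun \<Rightarrow> actx \<Rightarrow> src \<Rightarrow> (atm \<times> nat) option \<Rightarrow> (atm \<times> atm) option" where
  "infer_lam i G b None = None"
| "infer_lam i G b (Some (A, j)) = infer_lam' A (i (A # G) b)"

fun infer_app'' :: "atm \<Rightarrow> atm \<Rightarrow> atm \<Rightarrow> atm option \<Rightarrow> (atm \<times> atm) option" where
  "infer_app'' A B f None = None"
| "infer_app'' A B f (Some a) = Some (AApp A B f a, subst 0 0 [a] B)"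

fun infer_app' :: "check_fun \<Rightarrow> actx \<Rightarrow> src \<Rightarrow> atm \<Rightarrow> atm \<Rightarrow> (atm \<times> atm) option" where
  "infer_app' k G a f (APi A B) = infer_app'' A B f (k G a A)"
| "infer_app' k G a f T = None"

fun infer_app :: "whnf_fun \<Rightarrow> check_fun \<Rightarrow> actx \<Rightarrow> src \<Rightarrow> (atm \<times> atm) option \<Rightarrow> (atm \<times> atm) option" where
  "infer_app w k G a None = None"
| "infer_app w k G a (Some (f, T)) = infer_app' k G a f (w G T)"

text \<open>The instance of the motive in the branch of \<open>ty_IndSg\<close>. The pair needs its
  annotations over a context that is longer by two entries, hence the lifts by 2.\<close>

definition apair_pat :: "atm \<Rightarrow> atm \<Rightarrow> atm \<Rightarrow> atm" where
  "apair_pat A B C = subst 0 2 [APr (lift 0 2 A) (lift 1 2 B) (AVar 1) (AVar 0)] C"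

fun infer_ind_sg''' :: "atm \<Rightarrow> atm \<Rightarrow> atm \<Rightarrow> atm \<Rightarrow> atm option \<Rightarrow> (atm \<times> atm) option" where
  "infer_ind_sg''' A B C p None = None"
| "infer_ind_sg''' A B C p (Some g) = Some (AIndSg A B C g p, subst 0 0 [p] C)"

fun infer_ind_sg'' ::
    "check_fun \<Rightarrow> actx \<Rightarrow> src \<Rightarrow> atm \<Rightarrow> atm \<Rightarrow> atm \<Rightarrow> (atm \<times> nat) option \<Rightarrow> (atm \<times> atm) option" where
  "infer_ind_sg'' k G g A B p None = None"
| "infer_ind_sg'' k G g A B p (Some (C, j)) =
     infer_ind_sg''' A B C p (k (B # A # G) g (apair_pat A B C))"

fun infer_ind_sg' ::
    "whnf_fun \<Rightarrow> infer_fun \<Rightarrow> check_fun \<Rightarrow> actx \<Rightarrow> src \<Rightarrow> src \<Rightarrow> atm \<Rightarrow> atm \<Rightarrow> (atm \<times> atm) option" where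
  "infer_ind_sg' w i k G C g p (ASg A B) =
     infer_ind_sg'' k G g A B p (as_type w i (ASg A B # G) C)"
| "infer_ind_sg' w i k G C g p T = None"

fun infer_ind_sg ::
    "whnf_fun \<Rightarrow> infer_fun \<Rightarrow> check_fun \<Rightarrow> actx \<Rightarrow> src \<Rightarrow> src \<Rightarrow> (atm \<times> atm) option \<Rightarrow> (atm \<times> atm) option"
  where
  "infer_ind_sg w i k G C g None = None"
| "infer_ind_sg w i k G C g (Some (p, T)) = infer_ind_sg' w i k G C g p (w G T)"

fun infer_id' :: "atm \<Rightarrow> nat \<Rightarrow> atm option \<Rightarrow> atm option \<Rightarrow> (atm \<times> atm) option" where
  "infer_id' A j (Some a) (Some b) = Some (AId A a b, AUni j)"
| "infer_id' A j None b = None"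
| "infer_id' A j (Some a) None = None"

fun infer_id :: "check_fun \<Rightarrow> actx \<Rightarrow> src \<Rightarrow> src \<Rightarrow> (atm \<times> nat) option \<Rightarrow> (atm \<times> atm) option" where
  "infer_id k G a b None = None"
| "infer_id k G a b (Some (A, j)) = infer_id' A j (k G a A) (k G b A)"

fun infer_rfl :: "(atm \<times> atm) option \<Rightarrow> (atm \<times> atm) option" where
  "infer_rfl None = None"
| "infer_rfl (Some (a, A)) = Some (ARfl A a a a, AId A a a)"

definition arefl_pat :: "atm \<Rightarrow> atm \<Rightarrow> atm" where
  "arefl_pat A C = subst 0 1 [ARfl (lift 0 1 A) (AVar 0) (AVar 0) (AVar 0), AVar 0, AVar 0] C"

fun infer_ind_id'''' ::
    "atm \<Rightarrow> atm \<Rightarrow> atm \<Rightarrow> atm \<Rightarrow> atm \<Rightarrow> atm option \<Rightarrow> (atm \<times> atm) option" where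
  "infer_ind_id'''' A a b p C None = None"
| "infer_ind_id'''' A a b p C (Some c) = Some (AIndId A C c a b p, subst 0 0 [p, b, a] C)"

fun infer_ind_id''' ::
    "check_fun \<Rightarrow> actx \<Rightarrow> src \<Rightarrow> atm \<Rightarrow> atm \<Rightarrow> atm \<Rightarrow> atm \<Rightarrow> (atm \<times> nat) option \<Rightarrow> (atm \<times> atm) option" where
  "infer_ind_id''' k G c A a b p None = None"
| "infer_ind_id''' k G c A a b p (Some (C, j)) =
     infer_ind_id'''' A a b p C (k (A # G) c (arefl_pat A C))"

fun infer_ind_id'' ::
    "whnf_fun \<Rightarrow> infer_fun \<Rightarrow> check_fun \<Rightarrow> actx \<Rightarrow> src \<Rightarrow> src \<Rightarrow> atm \<Rightarrow> atm \<Rightarrow> atm \<Rightarrow> atm option \<Rightarrow>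
      (atm \<times> atm) option" where
  "infer_ind_id'' w i k G C c A a b None = None"
| "infer_ind_id'' w i k G C c A a b (Some p) =
     infer_ind_id''' k G c A a b p (as_type w i (aid_ctx A @ G) C)"

fun infer_ind_id' ::
    "whnf_fun \<Rightarrow> infer_fun \<Rightarrow> check_fun \<Rightarrow> actx \<Rightarrow> src \<Rightarrow> src \<Rightarrow> src \<Rightarrow> atm \<Rightarrow> atm \<Rightarrow> atm option \<Rightarrow>
      (atm \<times> atm) option" where
  "infer_ind_id' w i k G C c p A a None = None"
| "infer_ind_id' w i k G C c p A a (Some b) = infer_ind_id'' w i k G C c A a b (k G p (AId A a b))"

fun infer_ind_id ::
    "whnf_fun \<Rightarrow> infer_fun \<Rightarrow> check_fun \<Rightarrow> actx \<Rightarrow> src \<Rightarrow> src \<Rightarrow> src \<Rightarrow> src \<Rightarrow> (atm \<times> atm) option \<Rightarrow>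
      (atm \<times> atm) option" where
  "infer_ind_id w i k G C c b p None = None"
| "infer_ind_id w i k G C c b p (Some (a, A)) = infer_ind_id' w i k G C c p A a (k G b A)"

fun infer_const :: "atm \<Rightarrow> (atm \<times> nat) option \<Rightarrow> (atm \<times> atm) option" where
  "infer_const c None = None"
| "infer_const c (Some (T, j)) = Some (c, T)"

fun infer_asc' :: "atm \<Rightarrow> atm option \<Rightarrow> (atm \<times> atm) option" where
  "infer_asc' T None = None"
| "infer_asc' T (Some t) = Some (t, T)"

fun infer_asc :: "check_fun \<Rightarrow> actx \<Rightarrow> src \<Rightarrow> (atm \<times> nat) option \<Rightarrow> (atm \<times> atm) option" where
  "infer_asc k G t None = None"
| "infer_asc k G t (Some (T, j)) = infer_asc' T (k G t T)"

text \<open>Arguments are in the order of the context, so the first one to be checked is the last of the list.\<close>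
fun check_args'' :: "atm list \<Rightarrow> atm option \<Rightarrow> atm list option" where
  "check_args'' as None = None"
| "check_args'' as (Some a) = Some (a # as)"

fun check_args' :: "check_fun \<Rightarrow> actx \<Rightarrow> atm \<Rightarrow> src \<Rightarrow> atm list option \<Rightarrow> atm list option" where
  "check_args' k G T t None = None"
| "check_args' k G T t (Some as) = check_args'' as (k G t (subst 0 0 as T))"

fun check_args :: "check_fun \<Rightarrow> actx \<Rightarrow> atm list \<Rightarrow> src list \<Rightarrow> atm list option" where
  "check_args k G [] [] = Some []"
| "check_args k G (T # Ts) (t # ts) = check_args' k G T t (check_args k G Ts ts)"
| "check_args k G [] (t # ts) = None"
| "check_args k G (T # Ts) [] = None"

fun infer_def :: "num \<Rightarrow> dfn \<Rightarrow> atm list option \<Rightarrow> (atm \<times> atm) option" where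
  "infer_def n d None = None"
| "infer_def n d (Some as) = Some (ADef n d as, subst 0 0 as (dtype d))"

fun infer_step :: "whnf_fun \<Rightarrow> infer_fun \<Rightarrow> check_fun \<Rightarrow> infer_fun" where
  "infer_step w i k G (SVar n) = infer_var n (lift_opt (Suc n) (lookup G n))"
| "infer_step w i k G (SUni j) = Some (AUni j, AUni (Suc j))"
| "infer_step w i k G (SPi A B) = infer_binder APi w i G B (as_type w i G A)"
| "infer_step w i k G (SSg A B) = infer_binder ASg w i G B (as_type w i G A)"
| "infer_step w i k G (SCo A B) = infer_co w i G B (as_type w i G A)"
| "infer_step w i k G (SLam A b) = infer_lam i G b (as_type w i G A)"
| "infer_step w i k G (SApp f a) = infer_app w k G a (i G f)"
| "infer_step w i k G (SPr a b) = None"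
| "infer_step w i k G (SIndSg C g p) = infer_ind_sg w i k G C g (i G p)"
| "infer_step w i k G SEmp = Some (AEmp, AUni 0)"
| "infer_step w i k G SOne = Some (AOne, AUni 0)"
| "infer_step w i k G (SId A a b) = infer_id k G a b (as_type w i G A)"
| "infer_step w i k G (SRfl a) = infer_rfl (i G a)"
| "infer_step w i k G (SIndId C c a b p) = infer_ind_id w i k G C c b p (i G a)"
| "infer_step w i k G (SFunext j) = infer_const (AFunext j) (as_type w i G (sfunext_ty j (length G)))"
| "infer_step w i k G (SUa j) = infer_const (AUa j) (as_type w i G (suniv_ty j (length G)))"
| "infer_step w i k G (SAsc T t) = infer_asc k G t (as_type w i G T)"
| "infer_step w i k G (SDef n d as) = infer_def n d (check_args k G (dtele d) as)"

section \<open>Checking against a given type\<close>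

fun check_lam''' :: "atm \<Rightarrow> atm \<Rightarrow> atm \<Rightarrow> atm option \<Rightarrow> atm option" where
  "check_lam''' A0 A B None = None"
| "check_lam''' A0 A B (Some b) = Some (ALam A0 A B b)"

fun check_lam'' :: "bool \<Rightarrow> check_fun \<Rightarrow> actx \<Rightarrow> src \<Rightarrow> atm \<Rightarrow> atm \<Rightarrow> atm \<Rightarrow> atm option" where
  "check_lam'' True k G b A0 A B = check_lam''' A0 A B (k (A # G) b B)"
| "check_lam'' False k G b A0 A B = None"

fun check_lam' ::
    "conv_fun \<Rightarrow> check_fun \<Rightarrow> actx \<Rightarrow> src \<Rightarrow> atm \<Rightarrow> atm \<Rightarrow> (atm \<times> nat) option \<Rightarrow> atm option" where
  "check_lam' c k G b A B None = None"
| "check_lam' c k G b A B (Some (A0, j)) = check_lam'' (c G A0 A) k G b A0 A B"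

text \<open>The domain \<open>A0\<close> of the source is retained for erasure, while the body is
  checked over the domain of the expected type, so that its own type is the expected one without
  conversion.\<close>

fun check_lam ::
    "whnf_fun \<Rightarrow> conv_fun \<Rightarrow> infer_fun \<Rightarrow> check_fun \<Rightarrow> actx \<Rightarrow> src \<Rightarrow> src \<Rightarrow> atm \<Rightarrow> atm option" where
  "check_lam w c i k G A0 b (APi A B) = check_lam' c k G b A B (as_type w i G A0)"
| "check_lam w c i k G A0 b T = None"

fun check_pr'' :: "atm \<Rightarrow> atm \<Rightarrow> atm \<Rightarrow> atm option \<Rightarrow> atm option" where
  "check_pr'' A B a None = None"
| "check_pr'' A B a (Some b) = Some (APr A B a b)"

fun check_pr' :: "check_fun \<Rightarrow> actx \<Rightarrow> src \<Rightarrow> atm \<Rightarrow> atm \<Rightarrow> atm option \<Rightarrow> atm option" where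
  "check_pr' k G b A B None = None"
| "check_pr' k G b A B (Some a) = check_pr'' A B a (k G b (subst 0 0 [a] B))"

fun check_pr :: "check_fun \<Rightarrow> actx \<Rightarrow> src \<Rightarrow> src \<Rightarrow> atm \<Rightarrow> atm option" where
  "check_pr k G a b (ASg A B) = check_pr' k G b A B (k G a A)"
| "check_pr k G a b T = None"

fun check_rfl'' :: "bool \<Rightarrow> atm \<Rightarrow> atm \<Rightarrow> atm \<Rightarrow> atm \<Rightarrow> atm option" where
  "check_rfl'' True A a b z = Some (ARfl A a b z)"
| "check_rfl'' False A a b z = None"

fun check_rfl' :: "conv_fun \<Rightarrow> actx \<Rightarrow> atm \<Rightarrow> atm \<Rightarrow> atm \<Rightarrow> atm option \<Rightarrow> atm option" where
  "check_rfl' c G A a b None = None"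
| "check_rfl' c G A a b (Some z) = check_rfl'' (c G z a \<and> c G z b) A a b z"

fun check_rfl :: "conv_fun \<Rightarrow> check_fun \<Rightarrow> actx \<Rightarrow> src \<Rightarrow> atm \<Rightarrow> atm option" where
  "check_rfl c k G z (AId A a b) = check_rfl' c G A a b (k G z A)"
| "check_rfl c k G z T = None"

fun check_cumul' :: "bool \<Rightarrow> atm \<Rightarrow> atm option" where
  "check_cumul' True a = Some a"
| "check_cumul' False a = None"

fun check_cumul :: "atm \<Rightarrow> atm \<Rightarrow> atm \<Rightarrow> atm option" where
  "check_cumul a (AUni j) (AUni k) = check_cumul' (j \<le> k) a"
| "check_cumul a T U = None"

text \<open>Subsumption that is not conversion is confined to universes: both types must reduce to
  universes whose levels are in the right order.\<close>

fun check_infer' :: "bool \<Rightarrow> whnf_fun \<Rightarrow> actx \<Rightarrow> atm \<Rightarrow> atm \<Rightarrow> atm \<Rightarrow> atm option" where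
  "check_infer' True w G T a U = Some a"
| "check_infer' False w G T a U = check_cumul a (w G U) (w G T)"

fun check_infer :: "whnf_fun \<Rightarrow> conv_fun \<Rightarrow> actx \<Rightarrow> atm \<Rightarrow> (atm \<times> atm) option \<Rightarrow> atm option" where
  "check_infer w c G T None = None"
| "check_infer w c G T (Some (a, U)) = check_infer' (c G U T) w G T a U"

text \<open>These three introduction forms take their annotations from the expected type; for a pair
  this is the sole source of its family. All other terms are inferred and compared.\<close>

fun check_step :: "whnf_fun \<Rightarrow> conv_fun \<Rightarrow> infer_fun \<Rightarrow> check_fun \<Rightarrow> check_fun" where
  "check_step w c i k G (SLam A0 b) T = check_lam w c i k G A0 b (w G T)"
| "check_step w c i k G (SPr a b) T = check_pr k G a b (w G T)"
| "check_step w c i k G (SRfl z) T = check_rfl c k G z (w G T)"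
| "check_step w c i k G t T = check_infer w c G T (i G t)"

text \<open>Fuel stands in for termination, which would amount to normalization. Running out leaves
  a term unreduced or a comparison unsuccessful, so soundness never depends on the amount.\<close>

fun whnf :: "nat \<Rightarrow> whnf_fun" and conv :: "nat \<Rightarrow> conv_fun" where
  "whnf 0 G t = t"
| "whnf (Suc n) G t = whnf_step (whnf n) (conv n) G t"
| "conv 0 G t u = False"
| "conv (Suc n) G t u = conv_step (whnf n) (conv n) G t u"

fun infer :: "nat \<Rightarrow> infer_fun" and check :: "nat \<Rightarrow> check_fun" where
  "infer 0 G t = None"
| "infer (Suc n) G t = infer_step (whnf n) (infer n) (check n) G t"
| "check 0 G t T = None"
| "check (Suc n) G t T = check_step (whnf n) (conv n) (infer n) (check n) G t T"

section \<open>Elaboration of contexts and definitions\<close>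

fun elab_ctx' :: "whnf_fun \<Rightarrow> infer_fun \<Rightarrow> src \<Rightarrow> actx option \<Rightarrow> actx option" where
  "elab_ctx' w i T None = None"
| "elab_ctx' w i T (Some G) = map_option (\<lambda>(A, j). A # G) (as_type w i G T)"

primrec elab_ctx :: "whnf_fun \<Rightarrow> infer_fun \<Rightarrow> src list \<Rightarrow> actx option" where
  "elab_ctx w i [] = Some []"
| "elab_ctx w i (T # Ts) = elab_ctx' w i T (elab_ctx w i Ts)"

fun elab_dfn''' :: "bool \<Rightarrow> actx \<Rightarrow> atm \<Rightarrow> atm option \<Rightarrow> dfn option" where
  "elab_dfn''' tr G T None = None"
| "elab_dfn''' tr G T (Some t) = Some (Dfn tr G T t)"

fun elab_dfn'' :: "bool \<Rightarrow> check_fun \<Rightarrow> actx \<Rightarrow> src \<Rightarrow> (atm \<times> nat) option \<Rightarrow> dfn option" where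
  "elab_dfn'' tr k G t None = None"
| "elab_dfn'' tr k G t (Some (T, j)) = elab_dfn''' tr G T (k G t T)"

fun elab_dfn' ::
    "bool \<Rightarrow> whnf_fun \<Rightarrow> infer_fun \<Rightarrow> check_fun \<Rightarrow> src \<Rightarrow> src \<Rightarrow> actx option \<Rightarrow> dfn option" where
  "elab_dfn' tr w i k T t None = None"
| "elab_dfn' tr w i k T t (Some G) = elab_dfn'' tr k G t (as_type w i G T)"

definition elab_dfn :: "nat \<Rightarrow> bool \<Rightarrow> src list \<Rightarrow> src \<Rightarrow> src \<Rightarrow> dfn option" where
  "elab_dfn n tr Ts T t =
     elab_dfn' tr (whnf n) (infer n) (check n) T t (elab_ctx (whnf n) (infer n) Ts)"


section \<open>Soundness of the checker\<close>

subsection \<open>Substitution\<close>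

definition sh :: "nat \<Rightarrow> nat \<Rightarrow> nat \<Rightarrow> nat" where
  "sh k d n = (if n < k then n else n + d)"

lemma up_ren_sh: "up_ren (sh k d) = sh (Suc k) d"
  by (rule nat_fun_eqI) (simp_all add: sh_def)

lemma shift_var_eq: "shift_var k d n = sh k d n"
  by (induction k d n rule: shift_var.induct) (simp_all add: sh_def)

lemma lift_eq: "lift k d t = aren (sh k d) t"
  by (induction t arbitrary: k rule: atm_induct) (simp_all add: up_ren_sh shift_var_eq)

lemma aren_id: "aren (\<lambda>n. n) t = t"
  by (simp add: aren_eq_asub asub_AVar)

lemma aren_aren: "aren r (aren q t) = aren (\<lambda>n. r (q n)) t"
  by (induction t arbitrary: r q rule: atm_induct) (simp_all add: up_ren_comp)

lemma lift_0: "lift 0 d t = aren (\<lambda>n. n + d) t"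
proof -
  have "sh 0 d = (\<lambda>n. n + d)"
    by (rule ext) (simp add: sh_def)
  then show ?thesis
    by (simp add: lift_eq)
qed

lemma lift_0_1: "lift 0 1 t = aren Suc t"
  by (simp add: lift_0)

lemma lift_1_1: "lift 1 1 t = aren (up_ren Suc) t"
proof -
  have "sh 1 1 = up_ren Suc"
    by (rule nat_fun_eqI) (simp_all add: sh_def)
  then show ?thesis
    by (simp add: lift_eq)
qed

lemma lift0_eq: "lift0 d t = aren (\<lambda>n. n + d) t"
  by (cases d) (simp_all add: lift_0 aren_id)

fun asb :: "nat \<Rightarrow> atm list \<Rightarrow> nat \<Rightarrow> atm" where
  "asb d [] n = AVar (n + d)"
| "asb d (a # as) n = ascons a (asb d as) n"

definition sb :: "nat \<Rightarrow> nat \<Rightarrow> atm list \<Rightarrow> nat \<Rightarrow> atm" where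
  "sb k d as n = (if n < k then AVar n else aren (\<lambda>m. m + k) (asb d as (n - k)))"

lemma aup_sb: "aup (sb k d as) = sb (Suc k) d as"
  by (rule nat_fun_eqI) (simp_all add: sb_def aren_aren)

lemma pick_eq: "pick k d as n = aren (\<lambda>m. m + k) (asb d as n)"
  by (induction k d as n rule: pick.induct) (simp_all add: lift0_eq)

lemma subst_var_eq: "subst_var n0 k0 k d as n = (if n < k then AVar n0 else pick k0 d as (n - k))"
  by (induction n0 k0 k d as n rule: subst_var.induct) simp_all

lemma subst_eq: "subst k d as t = asub (sb k d as) t"
  by (induction t arbitrary: k rule: atm_induct)
    (simp_all add: aup_sb subst_var_eq pick_eq sb_def[of _ _ as])

lemma subst_0: "subst 0 d as t = asub (asb d as) t"
proof -
  have "sb 0 d as = asb d as"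
    by (rule ext) (simp add: sb_def aren_id)
  then show ?thesis
    by (simp add: subst_eq)
qed

lemma asb_ascons: "asb d [] = (\<lambda>n. AVar (n + d))" "asb d (a # as) = ascons a (asb d as)"
  by (rule ext, simp)+

lemma er_asb: "(\<lambda>n. er l (asb d [] n)) = (\<lambda>n. Var (n + d))"
    "(\<lambda>n. er l (asb d (a # as) n)) = er l a \<bullet> (\<lambda>n. er l (asb d as n))"
  by (simp, simp add: asb_ascons er_ascons del: asb.simps)

lemma er_subst: "er l (subst 0 d as t) = sub (\<lambda>n. er l (asb d as n)) (er l t)"
  by (simp add: subst_0)

lemma subst_inst: "subst 0 0 [a] t = asub (ascons a AVar) t"
    "subst 0 0 [b, a] t = asub (ascons b (ascons a AVar)) t"
    "subst 0 0 [p, b, a] t = asub (ascons p (ascons b (ascons a AVar))) t"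
  by (simp_all add: subst_0 asb_ascons del: asb.simps)

lemma er_inst: "er l (subst 0 0 [a] t) = (er l t)\<langle>er l a\<rangle>"
    "er l (subst 0 0 [b, a] t) = sub (er l b \<bullet> er l a \<bullet> Var) (er l t)"
    "er l (subst 0 0 [p, b, a] t) = sub (er l p \<bullet> er l b \<bullet> er l a \<bullet> Var) (er l t)"
  by (simp_all add: subst_inst er_ascons)

lemma er_lift: "er l (lift 0 d t) = wk d (er l t)"
  by (simp add: lift_0)

lemma er_aid_ctx: "map (er l) (aid_ctx A) = id_ctx (er l A)"
  by (simp add: aid_ctx_def er_lift)

lemma er_apair_pat: "er l (apair_pat A B C) = pair_pat (er l C)"
  unfolding apair_pat_def er_subst er_asb by simp

lemma er_arefl_pat: "er l (arefl_pat A C) = refl_pat (er l C)"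
  unfolding arefl_pat_def er_subst er_asb by simp

lemma lookup_eq: "lookup G n = Some A \<Longrightarrow> n < length G \<and> A = G ! n"
  by (induction G n rule: lookup.induct) auto


subsection \<open>Contexts and telescopes\<close>

lemma ren_mor_drop: "ren_mor (\<lambda>n. n + d) \<Gamma> (drop d \<Gamma>)"
  by (auto simp: ren_mor_def ac_simps)

locale at_level =
  fixes l :: nat
begin

abbreviation erc :: "actx \<Rightarrow> ctx" where
  "erc G \<equiv> map (er l) G"

abbreviation tok :: "actx \<Rightarrow> tm \<Rightarrow> atm \<Rightarrow> bool" where
  "tok G T t \<equiv> ok l (erc G) T t"

primrec cok :: "actx \<Rightarrow> bool" where
  "cok [] = True"
| "cok (A # G) = (cok G \<and> (\<exists>k. tok G (Uni k) A))"

lemma cok_wf: "cok G \<Longrightarrow> wf (erc G)"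
  by (induction G) (auto intro: wf_Nil wf_Cons dest: ok_ty)

lemma cok_Cons: "cok G \<Longrightarrow> tok G (Uni k) A \<Longrightarrow> cok (A # G)"
  by auto

lemma tok_ty: "cok G \<Longrightarrow> tok G T t \<Longrightarrow> erc G \<turnstile> er l t \<^bold>: T"
  using ok_ty cok_wf by blast

lemma tok_Suc: "cok (B # G) \<Longrightarrow> tok G T t \<Longrightarrow> tok (B # G) (ren Suc T) (aren Suc t)"
  using ok_Suc[where l = l and \<Gamma> = "erc G" and B = "er l B"] cok_wf[of G] cok_wf[of "B # G"] by simp

lemma tok_up_Suc:
  assumes "cok (A # G)" "cok (B # G)" "tok (A # G) T t"
  shows "tok (aren Suc A # B # G) (ren (up_ren Suc) T) (aren (up_ren Suc) t)"
proof -
  have "cok (aren Suc A # B # G)"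
    using assms tok_Suc[OF assms(2), where t = A] by fastforce
  moreover have "ren_mor (up_ren Suc) (erc (aren Suc A # B # G)) (erc (A # G))"
    using ren_mor_up[OF ren_mor_Suc] by simp
  ultimately show ?thesis
    using ok_ren[OF assms(3) cok_wf[OF assms(1)] cok_wf] by blast
qed

lemma cok_drop: "cok G \<Longrightarrow> cok (drop d G)"
  by (induction G arbitrary: d) (auto simp: drop_Cons' split: if_splits)

lemma cok_nth: "cok G \<Longrightarrow> n < length G \<Longrightarrow> \<exists>k. tok (drop (Suc n) G) (Uni k) (G ! n)"
  by (induction G arbitrary: n) (auto simp: less_Suc_eq_0_disj)

lemma cok_lookup:
  assumes "cok G" "n < length G"
  shows "\<exists>k. tok G (Uni k) (lift 0 (Suc n) (G ! n))"
proof -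
  obtain k where k: "ok l (drop (Suc n) (erc G)) (Uni k) (G ! n)"
    using cok_nth[OF assms] by (auto simp: drop_map)
  have "wf (drop (Suc n) (erc G))"
    using cok_wf[OF cok_drop[OF assms(1)]] by (simp add: drop_map)
  from ok_ren[OF k this cok_wf[OF assms(1)] ren_mor_drop] show ?thesis
    by (auto simp: lift_0)
qed

lemma cok_aid_ctx:
  assumes "cok G" "tok G (Uni k) A"
  shows "cok (aid_ctx A @ G)"
proof -
  have 1: "cok (A # G)"
    using assms by auto
  note A1 = tok_Suc[OF 1 assms(2)]
  have 2: "cok (aren Suc A # A # G)"
    using A1 1 by auto
  note A2 = tok_Suc[OF 2 A1]
  have v: "tok (aren Suc A # A # G) (wk 2 (er l A)) (AVar n)" if "n < 2" for n
  proof -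
    have "erc (aren Suc A # A # G) \<turnstile> wk 2 (er l A) \<^bold>: Uni k"
      using tok_ty[OF 2 A2] by (simp add: numeral_2_eq_2)
    from le_refl[OF this] show ?thesis
      using less_2_cases[OF that] by (elim disjE) (simp_all add: numeral_2_eq_2)
  qed
  have "tok (aren Suc A # A # G) (Uni k) (AId (aren (\<lambda>n. n + 2) A) (AVar 1) (AVar 0))"
    using A2 v[of 1] v[of 0] le_refl[OF ty_Uni[OF cok_wf[OF 2]]]
    by (simp del: okm.simps(1) add: okm.simps(12) aren_aren) blast
  with 2 show ?thesis
    by (auto simp: aid_ctx_def lift_0 simp del: okm.simps)
qed

text \<open>Arguments are listed in context order, so the type of entry \<open>j\<close> depends on
  the entries behind it, and \<open>drop (Suc j)\<close> gives the substitution for them. The second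
  claim exchanges the executable substitution with \<open>vsub\<close> on typed terms, as the two
  differ only beyond the telescope.\<close>

lemma atm_mor_tele:
  assumes "cok G" "cok Ts" "length as = length Ts"
    and "\<And>j. j < length as \<Longrightarrow> tok G (sub (vsub (drop (Suc j) (map (er l) as))) (er l (Ts ! j))) (as ! j)"
  shows "atm_mor l (asb 0 as) (erc G) (erc Ts)"
    and "erc Ts \<turnstile> t \<^bold>: T \<Longrightarrow> sub (\<lambda>n. er l (asb 0 as n)) t = sub (vsub (map (er l) as)) t"
proof -
  have asb: "er l (asb 0 as n) = vsub (map (er l) as) n" "asb 0 as n = as ! n" if "n < length as" for n as
    using that by (induction as arbitrary: n) (auto simp: less_Suc_eq_0_disj vsub_def)
  show "sub (\<lambda>n. er l (asb 0 as n)) t = sub (vsub (map (er l) as)) t"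
    if "erc Ts \<turnstile> t \<^bold>: T" for t T
    by (rule has_ty_sub_cong[OF that]) (use assms(3) asb in auto)
  have "ok l (erc G) (sub (\<lambda>n. er l (asb 0 as n)) (wk (Suc j) (erc Ts ! j))) (asb 0 as j)"
    if j: "j < length (erc Ts)" for j
  proof -
    obtain k where k: "tok (drop (Suc j) Ts) (Uni k) (Ts ! j)"
      using cok_nth[OF assms(2)] j by auto
    from tok_ty[OF cok_drop[OF assms(2)] this]
    have "sub (\<lambda>n. er l (asb 0 as (n + Suc j))) (er l (Ts ! j)) =
        sub (vsub (drop (Suc j) (map (er l) as))) (er l (Ts ! j))"
      by (rule has_ty_sub_cong) (use j assms(3) in \<open>simp add: asb vsub_drop[symmetric] vsub_def less_diff_conv\<close>)
    with assms(4)[of j] j assms(3) show ?thesis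
      by (simp add: asb)
  qed
  then show "atm_mor l (asb 0 as) (erc G) (erc Ts)"
    using cok_wf[OF assms(1)] by (auto simp: atm_mor_def)
qed

lemma cok_iff: "cok Ts \<longleftrightarrow> (\<forall>j < length Ts. \<exists>k. tok (drop (Suc j) Ts) (Uni k) (Ts ! j))"
  by (induction Ts) (auto simp: all_less_Suc_eq_0)

lemma okd_cok: "okd l d \<Longrightarrow> cok (dtele d)"
  by (cases d) (simp add: cok_iff)

text \<open>Definitions exist in annotated terms only. Erasure already puts the arguments into the
  body, so unfolding leaves the raw term unchanged and needs no rule of the theory.\<close>

lemma tok_ADef:
  assumes "cok G" "tok G T (ADef n d as)"
  shows "\<exists>k. tok G (Uni k) (subst 0 0 as (dtype d))"
    and "tok G (er l (subst 0 0 as (dtype d))) (ADef n d as)"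
    and "tok G (er l (subst 0 0 as (dtype d))) (subst 0 0 as (dbody d))"
    and "er l (ADef n d as) = er l (subst 0 0 as (dbody d))"
    and "le (erc G) (er l (subst 0 0 as (dtype d))) T"
proof -
  have d: "okd l d" and len: "length as = length (dtele d)"
    and as: "\<And>j. j < length as \<Longrightarrow> tok G (sub (vsub (drop (Suc j) (map (er l) as))) (er l (dtele d ! j))) (as ! j)"
    and le: "le (erc G) (sub (vsub (map (er l) as)) (er l (dtype d))) T"
    using assms(2) by auto
  note m = atm_mor_tele[OF assms(1) okd_cok[OF d] len as]
  note w = okd_ty(1)[OF d]
  obtain k where k: "ok l (map (er l) (dtele d)) (Uni k) (dtype d)"
    and b: "ok l (map (er l) (dtele d)) (er l (dtype d)) (dbody d)" "er_dfn l d = er l (dbody d)"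
    using d by (cases d) auto
  have ty: "er l (subst 0 0 as (dtype d)) = sub (vsub (map (er l) as)) (er l (dtype d))"
    unfolding er_subst by (rule m(2)[OF _ ok_ty[OF k w]]) simp
  show tyk: "\<exists>k. tok G (Uni k) (subst 0 0 as (dtype d))"
    using ok_sub[OF k w m(1)] by (auto simp: subst_0)
  show "tok G (er l (subst 0 0 as (dtype d))) (subst 0 0 as (dbody d))"
    using ok_sub[OF b(1) w m(1)] by (simp add: subst_0)
  show "er l (ADef n d as) = er l (subst 0 0 as (dbody d))"
    using m(2)[OF _ ok_ty[OF b(1) w]] by (simp add: er_subst b(2))
  show "le (erc G) (er l (subst 0 0 as (dtype d))) T"
    unfolding ty by (rule le)
  show "tok G (er l (subst 0 0 as (dtype d))) (ADef n d as)"
  proof -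
    obtain k where "tok G (Uni k) (subst 0 0 as (dtype d))"
      using tyk ..
    from le_refl[OF tok_ty[OF assms(1) this]] show ?thesis
      using assms(2) unfolding ty okm.simps by blast
  qed
qed

end


subsection \<open>Weak head reduction\<close>

context at_level
begin

abbreviation teq :: "actx \<Rightarrow> tm \<Rightarrow> atm \<Rightarrow> atm \<Rightarrow> bool" where
  "teq G T t u \<equiv> erc G \<turnstile> er l t \<doteq> er l u \<^bold>: T"

definition reds :: "actx \<Rightarrow> tm \<Rightarrow> atm \<Rightarrow> atm \<Rightarrow> bool" where
  "reds G T t u \<longleftrightarrow> tok G T u \<and> teq G T t u"

lemma reds_trans: "reds G T t u \<Longrightarrow> reds G T u v \<Longrightarrow> reds G T t v"
  unfolding reds_def by (blast intro: eq_trans)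

lemma reds_le: "reds G S t u \<Longrightarrow> le (erc G) S T \<Longrightarrow> reds G T t u"
  unfolding reds_def by (blast intro: ok_le le_eq_tm)

lemma reds_refl: "cok G \<Longrightarrow> tok G T t \<Longrightarrow> reds G T t t"
  unfolding reds_def by (blast intro: eq_refl tok_ty)

definition sound_w :: "whnf_fun \<Rightarrow> bool" where
  "sound_w w \<longleftrightarrow> (\<forall>G T t. cok G \<longrightarrow> tok G T t \<longrightarrow> reds G T t (w G t))"

definition sound_c :: "conv_fun \<Rightarrow> bool" where
  "sound_c c \<longleftrightarrow>
     (\<forall>G T t u. cok G \<longrightarrow> tok G T t \<longrightarrow> tok G T u \<longrightarrow> c G t u \<longrightarrow> teq G T t u)"

text \<open>The erasure of the result is pinned to the stripped source, so a successful run types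
  exactly the raw term that was given and not some elaboration of it.\<close>

definition sound_i :: "infer_fun \<Rightarrow> bool" where
  "sound_i i \<longleftrightarrow>
     (\<forall>G s a T. cok G \<longrightarrow> src_ok l s \<longrightarrow> i G s = Some (a, T) \<longrightarrow>
        tok G (er l T) a \<and> (\<exists>k. tok G (Uni k) T) \<and> er l a = strip l s)"

definition sound_k :: "check_fun \<Rightarrow> bool" where
  "sound_k k \<longleftrightarrow>
     (\<forall>G s T j a. cok G \<longrightarrow> src_ok l s \<longrightarrow> tok G (Uni j) T \<longrightarrow> k G s T = Some a \<longrightarrow>
        tok G (er l T) a \<and> er l a = strip l s)"

lemma sound_wD: "sound_w w \<Longrightarrow> cok G \<Longrightarrow> tok G T t \<Longrightarrow> reds G T t (w G t)"
  unfolding sound_w_def by blast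

lemma sound_cD: "sound_c c \<Longrightarrow> cok G \<Longrightarrow> tok G T t \<Longrightarrow> tok G T u \<Longrightarrow> c G t u \<Longrightarrow> teq G T t u"
  unfolding sound_c_def by blast

text \<open>The two types may be known at different levels; by cumulativity they are compared at the
  larger one.\<close>

lemma conv_ty:
  assumes "sound_c c" "cok G" "tok G (Uni k) A" "tok G (Uni j) B" "c G A B"
  shows "teq G (Uni (max k j)) A B"
  using sound_cD[OF assms(1,2) ok_cumul[OF assms(3)] ok_cumul[OF assms(4)] assms(5)] by simp

lemma sound_match: "sound_c c \<Longrightarrow> sound_c (match c)"
  unfolding sound_c_def
proof (intro allI impI)
  fix G T t u
  assume *: "\<forall>G T t u. cok G \<longrightarrow> tok G T t \<longrightarrow> tok G T u \<longrightarrow> c G t u \<longrightarrow> teq G T t u"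
    "cok G" "tok G T t" "tok G T u" "match c G t u"
  show "teq G T t u"
  proof (cases "t = u")
    case True
    then show ?thesis
      using eq_refl[OF tok_ty[OF *(2,3)]] by simp
  next
    case False
    then show ?thesis
      using * by (simp add: match_def del: okm.simps)
  qed
qed

lemma contract_reds:
  assumes "sound_w w" "cok G" "tok G T t" "P \<Longrightarrow> reds G T t r"
  shows "reds G T t (contract P w G r t)"
  using assms reds_refl[where G = G and t = t and T = T] sound_wD[where G = G and t = r and T = T]
    reds_trans[where G = G and t = t and u = r and T = T]
  by (cases P) (auto simp: reds_def)

lemma tok_conv:
  assumes "cok (A # G)" "tok (A' # G) T t" "cok (A' # G)" "teq G (Uni k) A A'"
  shows "tok (A # G) T t"
proof -
  have "le (erc G) (er l A) (er l A')"
    using assms(4) by (rule le_eq)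
  from ok_conv[OF assms(2) cok_wf[OF assms(3)]] atm_mor_conv1[OF _ this, of l] cok_wf[OF assms(1)]
  show ?thesis
    by simp
qed

lemma tok_inst:
  assumes "cok (A # G)" "tok (A # G) T t" "tok G (er l A) a"
  shows "tok G (T\<langle>er l a\<rangle>) (subst 0 0 [a] t)"
  using ok_inst[where A = "er l A" and \<Gamma> = "erc G" and l = l] assms cok_wf[OF assms(1)] by (simp add: subst_inst)

lemma tok_inst2:
  assumes "cok (B # A # G)" "tok (B # A # G) T t" "tok G (er l A) a" "tok G ((er l B)\<langle>er l a\<rangle>) b"
  shows "tok G (sub (er l b \<bullet> er l a \<bullet> Var) T) (subst 0 0 [b, a] t)"
  using ok_inst2[where A = "er l A" and B = "er l B" and \<Gamma> = "erc G" and l = l] assms cok_wf[OF assms(1)]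
  by (simp add: subst_inst)

lemma tok_inst3:
  assumes G: "cok G" and A: "tok G (Uni k) A" and t: "tok (aid_ctx A @ G) T t"
    and a: "tok G (er l A) a" and b: "tok G (er l A) b" and p: "tok G (IdT (er l A) (er l a) (er l b)) p"
  shows "tok G (sub (er l p \<bullet> er l b \<bullet> er l a \<bullet> Var) T) (subst 0 0 [p, b, a] t)"
proof -
  have "atm_mor l (ascons a AVar) (erc G) (er l A # erc G)"
    by (rule atm_mor_ascons) (use a atm_mor_AVar[OF cok_wf[OF G]] in simp_all)
  then have "atm_mor l (ascons b (ascons a AVar)) (erc G) (wk 1 (er l A) # er l A # erc G)"
    by (rule atm_mor_ascons) (use b in \<open>simp add: er_ascons\<close>)
  then have "atm_mor l (ascons p (ascons b (ascons a AVar))) (erc G) (erc (aid_ctx A @ G))"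
    unfolding map_append er_aid_ctx append_Cons append_Nil
    by (rule atm_mor_ascons) (use p in \<open>simp add: er_ascons numeral_2_eq_2\<close>)
  from ok_sub[OF t cok_wf[OF cok_aid_ctx[OF G A]] this] show ?thesis
    by (simp add: subst_inst er_ascons)
qed

text \<open>The conversions tested on the annotations take the place of injectivity of Pi: they move
  the body and its type from \<open>A'\<close> and \<open>B'\<close> to \<open>A\<close> and
  \<open>B\<close>.\<close>

lemma beta_app:
  assumes c: "sound_c c" and G: "cok G"
    and t: "tok G (Uni k) A" "tok (A # G) (Uni k) B" "tok G (er l A) a"
    and f: "tok G (PiT (er l A) (er l B)) (ALam A0 A' B' b)"
    and m: "c G A A'" "c (A # G) B B'"
  shows "reds G ((er l B)\<langle>er l a\<rangle>) (AApp A B (ALam A0 A' B' b) a) (subst 0 0 [a] b)"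
proof -
  obtain j where j: "tok G (Uni j) A0" "tok G (Uni j) A'" "tok (A' # G) (Uni j) B'"
      "teq G (Uni j) A0 A'" and b: "tok (A' # G) (er l B') b"
    using f by auto
  note G1 = cok_Cons[OF G t(1)] and G1' = cok_Cons[OF G j(2)]
  note AA = conv_ty[OF c G t(1) j(2) m(1)]
  note toA = tok_conv[OF G1 _ G1' AA]
  note BB = conv_ty[OF c G1 t(2) toA[OF j(3)] m(2)]
  have "le (erc (A # G)) (er l B') (er l B)"
    using BB eq_sym le_eq by blast
  from ok_le[OF toA[OF b] this] have b': "tok (A # G) (er l B) b" .
  have A0: "teq G (Uni (max j k)) A0 A"
    using cumul_eq[OF j(4), of "max j k"] cumul_eq[OF AA, of "max j k"] by (auto intro: eq_trans eq_sym)
  have A0': "erc G \<turnstile> er l A0 \<^bold>: Uni (max j k)"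
    using cumul[OF tok_ty[OF G j(1)]] by simp
  have B': "er l A # erc G \<turnstile> er l B \<^bold>: Uni (max j k)"
    using cumul[OF tok_ty[OF G1 t(2)]] by simp
  have "er l A # erc G \<turnstile> er l b \<^bold>: er l B"
    using tok_ty[OF G1 b'] by simp
  \<comment> \<open>The erased abstraction carries \<open>A0\<close>, so \<open>Pi_comp\<close>
    needs the body and the argument over \<open>A0\<close> instead of the annotated domain.\<close>
  from Lam_conv(2)[OF A0 A0' B' this] have "er l A0 # erc G \<turnstile> er l b \<^bold>: er l B" .
  moreover have "erc G \<turnstile> er l a \<^bold>: er l A0"
    using tok_ty[OF G t(3)] eq_sym[OF A0] by (rule ty_conv)
  ultimately have "erc G \<turnstile> App (Lam (er l A0) (er l b)) (er l a) \<doteq> (er l b)\<langle>er l a\<rangle> \<^bold>: (er l B)\<langle>er l a\<rangle>"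
    by (rule Pi_comp)
  with tok_inst[OF G1 b' t(3)] show ?thesis
    by (simp add: reds_def er_inst)
qed

lemma beta_sg:
  assumes c: "sound_c c" and G: "cok G"
    and t: "tok G (Uni k) A" "tok (A # G) (Uni k) B" "tok (ASg A B # G) (Uni m) C"
      "tok (B # A # G) (pair_pat (er l C)) g"
    and p: "tok G (SgT (er l A) (er l B)) (APr A' B' a b)"
    and m: "c G A A'" "c (A # G) B B'"
  shows "reds G ((er l C)\<langle>Pr (er l a) (er l b)\<rangle>) (AIndSg A B C g (APr A' B' a b)) (subst 0 0 [b, a] g)"
proof -
  obtain j where j: "tok G (Uni j) A'" "tok (A' # G) (Uni j) B'"
    and ab: "tok G (er l A') a" "tok G ((er l B')\<langle>er l a\<rangle>) b"
    using p by auto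
  note G1 = cok_Cons[OF G t(1)] and G1' = cok_Cons[OF G j(1)]
  note G2 = cok_Cons[OF G1 t(2)]
  note AA = conv_ty[OF c G t(1) j(1) m(1)]
  note BB = conv_ty[OF c G1 t(2) tok_conv[OF G1 j(2) G1' AA] m(2)]
  have a: "tok G (er l A) a"
    using ok_le[OF ab(1) le_eq[OF eq_sym[OF AA]]] .
  have "erc G \<turnstile> (er l B)\<langle>er l a\<rangle> \<doteq> (er l B')\<langle>er l a\<rangle> \<^bold>: Uni (max k j)"
    using eq_tm_inst[of "er l A" "erc G" "er l B" "er l B'" "Uni (max k j)"] BB tok_ty[OF G a] by simp
  from ok_le[OF ab(2) le_eq[OF eq_sym[OF this]]] have b: "tok G ((er l B)\<langle>er l a\<rangle>) b" .
  have eq: "sub (er l b \<bullet> er l a \<bullet> Var) (pair_pat (er l C)) = (er l C)\<langle>Pr (er l a) (er l b)\<rangle>"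
    by (simp add: scons_o)
  have "erc G \<turnstile> IndSg (er l C) (er l g) (Pr (er l a) (er l b)) \<doteq>
      sub (er l b \<bullet> er l a \<bullet> Var) (er l g) \<^bold>: (er l C)\<langle>Pr (er l a) (er l b)\<rangle>"
    by (rule Sg_comp) (use tok_ty[OF G a] tok_ty[OF G b] tok_ty[OF G2 t(4)] tok_ty[OF cok_Cons[OF G] t(3)]
      t(1,2) le_refl[OF ty_Uni[OF cok_wf[OF G]]] in auto)
  with tok_inst2[OF G2 t(4) a b] show ?thesis
    unfolding eq by (simp add: reds_def er_inst)
qed

lemma beta_id:
  assumes c: "sound_c c" and G: "cok G"
    and t: "tok G (Uni k) A" "tok (aid_ctx A @ G) (Uni m) C" "tok (A # G) (refl_pat (er l C)) d"
      "tok G (er l A) a" "tok G (er l A) b"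
    and p: "tok G (IdT (er l A) (er l a) (er l b)) (ARfl A' a' b' z)"
    and m: "c G A A'" "c G a a'" "c G b b'"
  shows "reds G (sub (Rfl (er l z) \<bullet> er l b \<bullet> er l a \<bullet> Var) (er l C))
    (AIndId A C d a b (ARfl A' a' b' z)) (subst 0 0 [z] d)"
proof -
  obtain j where j: "tok G (Uni j) A'" "tok G (er l A') a'" "tok G (er l A') b'" "tok G (er l A') z"
      "teq G (er l A') z a'" "teq G (er l A') z b'"
    using p by auto
  note G1 = cok_Cons[OF G t(1)] and G3 = cok_aid_ctx[OF G t(1)]
  note AA = eq_sym[OF conv_ty[OF c G t(1) j(1) m(1)]]
  have z: "tok G (er l A) z"
    using ok_le[OF j(4) le_eq[OF AA]] .
  have za: "teq G (er l A) z a"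
    using eq_conv[OF j(5) AA] sound_cD[OF c G t(4) ok_le[OF j(2) le_eq[OF AA]] m(2)] by (blast intro: eq_trans eq_sym)
  have zb: "teq G (er l A) z b"
    using eq_conv[OF j(6) AA] sound_cD[OF c G t(5) ok_le[OF j(3) le_eq[OF AA]] m(3)] by (blast intro: eq_trans eq_sym)
  note A' = tok_ty[OF G t(1)] and a' = tok_ty[OF G t(4)] and b' = tok_ty[OF G t(5)] and z' = tok_ty[OF G z]
  have C': "id_ctx (er l A) @ erc G \<turnstile> er l C \<^bold>: Uni m"
    using tok_ty[OF G3 t(2)] by (simp add: er_aid_ctx)
  have d': "er l A # erc G \<turnstile> er l d \<^bold>: refl_pat (er l C)"
    using tok_ty[OF G1 t(3)] by simp
  note rab = Rfl_conv(1)[OF A' z' za zb]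
  \<comment> \<open>The computation rule wants both end points to be the point of the reflexivity.
    They are replaced by \<open>z\<close> by congruence, and the type is moved back afterwards with
    \<open>inst_cong3\<close>.\<close>
  have "erc G \<turnstile> IndId (er l C) (er l d) (er l a) (er l b) (Rfl (er l z)) \<doteq>
      IndId (er l C) (er l d) (er l z) (er l z) (Rfl (er l z)) \<^bold>:
      sub (Rfl (er l z) \<bullet> er l b \<bullet> er l a \<bullet> Var) (er l C)"
    by (rule eq_IndId) (use eq_refl[OF C'] eq_refl[OF d'] eq_sym[OF za] eq_sym[OF zb] eq_refl[OF rab] in auto)
  moreover have C2: "erc G \<turnstile> sub (Rfl (er l z) \<bullet> er l z \<bullet> er l z \<bullet> Var) (er l C) \<doteq>
      sub (Rfl (er l z) \<bullet> er l b \<bullet> er l a \<bullet> Var) (er l C) \<^bold>: Uni m"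
    by (rule inst_cong3[OF C' za z' a' zb z' b' _ ty_Rfl[OF A' z'] rab])
      (rule eq_refl[OF ty_Rfl[OF A' z']])
  moreover have "erc G \<turnstile> IndId (er l C) (er l d) (er l z) (er l z) (Rfl (er l z)) \<doteq> (er l d)\<langle>er l z\<rangle> \<^bold>:
      sub (Rfl (er l z) \<bullet> er l z \<bullet> er l z \<bullet> Var) (er l C)"
    by (rule Id_comp) (use C' d' z' in auto)
  ultimately have "erc G \<turnstile> IndId (er l C) (er l d) (er l a) (er l b) (Rfl (er l z)) \<doteq> (er l d)\<langle>er l z\<rangle> \<^bold>:
      sub (Rfl (er l z) \<bullet> er l b \<bullet> er l a \<bullet> Var) (er l C)"
    by (blast intro: eq_trans eq_conv)
  moreover have "(refl_pat (er l C))\<langle>er l z\<rangle> = sub (Rfl (er l z) \<bullet> er l z \<bullet> er l z \<bullet> Var) (er l C)"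
    by (simp add: scons_o)
  ultimately show ?thesis
    using ok_le[OF tok_inst[OF G1 t(3) z] ] le_eq[OF C2] by (simp add: reds_def er_inst)
qed

lemma sound_whnf_step:
  assumes w: "sound_w w" and c: "sound_c c"
  shows "sound_w (whnf_step w c)"
  unfolding sound_w_def
proof (intro allI impI)
  fix G T t assume G: "cok G" and t: "tok G T t"
  note m = sound_match[OF c]
  show "reds G T t (whnf_step w c G t)"
  proof (cases t)
    case (AApp A B f a)
    obtain k where k: "tok G (Uni k) A" "tok (A # G) (Uni k) B"
      and f: "tok G (PiT (er l A) (er l B)) f" "tok G (er l A) a" and le: "le (erc G) ((er l B)\<langle>er l a\<rangle>) T"
      using t AApp by auto
    note f' = sound_wD[OF w G f(1), unfolded reds_def]
    note a' = tok_ty[OF G f(2)]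
    have ty: "le (erc G) ((er l B)\<langle>er l a\<rangle>) ((er l B)\<langle>er l a\<rangle>)"
      using has_ty_inst[of "er l A" "erc G" "er l B" "Uni k"] tok_ty[OF cok_Cons[OF G k(1)] k(2)] a'
      by (auto intro: le_refl)
    have r: "reds G ((er l B)\<langle>er l a\<rangle>) (AApp A B f a) (AApp A B (w G f) a)"
      using f' k f(2) ty eq_App[OF conjunct2[OF f'] eq_refl[OF a']] by (auto simp: reds_def)
    have "reds G ((er l B)\<langle>er l a\<rangle>) (AApp A B f a) (whnf_app w c G A B a (w G f))"
    proof (cases "w G f")
      case (ALam A0 A' B' b)
      have "reds G ((er l B)\<langle>er l a\<rangle>) (AApp A B (w G f) a) (whnf_app w c G A B a (w G f))"
        unfolding ALam whnf_app.simps
        by (rule contract_reds[OF w G])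
          (use r f' ALam beta_app[OF m G k f(2)] in \<open>auto simp: reds_def simp del: okm.simps er.simps\<close>)
      with r show ?thesis
        by (rule reds_trans)
    qed (use r in simp_all)
    with le show ?thesis
      unfolding AApp whnf_step.simps by (rule reds_le[rotated])
  next
    case (AIndSg A B C g p)
    obtain k m where k: "tok G (Uni k) A" "tok (A # G) (Uni k) B" "tok (ASg A B # G) (Uni m) C"
      and g: "tok (B # A # G) (pair_pat (er l C)) g" and p: "tok G (SgT (er l A) (er l B)) p"
      and le: "le (erc G) ((er l C)\<langle>er l p\<rangle>) T"
      using t AIndSg by auto
    note p' = sound_wD[OF w G p, unfolded reds_def]
    note G1 = cok_Cons[OF G k(1)]
    note G2 = cok_Cons[OF G1 k(2)]
    have "tok G (Uni k) (ASg A B)"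
      using k le_refl[OF ty_Uni[OF cok_wf[OF G]]] by auto
    note GS = cok_Cons[OF G this]
    have C': "SgT (er l A) (er l B) # erc G \<turnstile> er l C \<^bold>: Uni m"
      using tok_ty[OF GS k(3)] by simp
    \<comment> \<open>Reducing the scrutinee changes the type of the elimination, because the motive
      is instantiated with it. Functoriality of substitution makes the two instances equal.\<close>
    have CC: "erc G \<turnstile> (er l C)\<langle>er l p\<rangle> \<doteq> (er l C)\<langle>er l (w G p)\<rangle> \<^bold>: Uni m"
      by (rule inst_cong[OF C']) (use p' tok_ty[OF G p] tok_ty[OF G conjunct1[OF p']] in auto)
    have r: "reds G ((er l C)\<langle>er l p\<rangle>) (AIndSg A B C g p) (AIndSg A B C g (w G p))"
    proof -
      have "erc G \<turnstile> IndSg (er l C) (er l g) (er l p) \<doteq> IndSg (er l C) (er l g) (er l (w G p)) \<^bold>: (er l C)\<langle>er l p\<rangle>"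
        by (rule eq_IndSg) (use eq_refl[OF C'] eq_refl[OF tok_ty[OF G2 g]] p' in auto)
      then show ?thesis
        using k g p' le_eq[OF eq_sym[OF CC]] by (auto simp: reds_def)
    qed
    have "reds G ((er l C)\<langle>er l p\<rangle>) (AIndSg A B C g p) (whnf_ind_sg w c G A B C g (w G p))"
    proof (cases "w G p")
      case (APr A' B' a b)
      have "reds G ((er l C)\<langle>er l p\<rangle>) (AIndSg A B C g (w G p)) (whnf_ind_sg w c G A B C g (w G p))"
        unfolding APr whnf_ind_sg.simps
      proof (rule contract_reds[OF w G])
        show "tok G ((er l C)\<langle>er l p\<rangle>) (AIndSg A B C g (APr A' B' a b))"
          using r APr by (simp add: reds_def del: okm.simps)
        assume "match c G A A' \<and> match c (A # G) B B'"
        then show "reds G ((er l C)\<langle>er l p\<rangle>) (AIndSg A B C g (APr A' B' a b)) (subst 0 0 [b, a] g)"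
          using reds_le[OF beta_sg[OF m G k g] le_eq[OF eq_sym[OF CC[unfolded APr er.simps]]]] p' APr
          by (auto simp del: okm.simps)
      qed
      with r show ?thesis
        by (rule reds_trans)
    qed (use r in simp_all)
    with le show ?thesis
      unfolding AIndSg whnf_step.simps by (rule reds_le[rotated])
  next
    case (AIndId A C d a b p)
    obtain k m where k: "tok G (Uni k) A" "tok (aid_ctx A @ G) (Uni m) C"
        "tok (A # G) (refl_pat (er l C)) d" "tok G (er l A) a" "tok G (er l A) b"
      and p: "tok G (IdT (er l A) (er l a) (er l b)) p"
      and le: "le (erc G) (sub (er l p \<bullet> er l b \<bullet> er l a \<bullet> Var) (er l C)) T"
      using t AIndId by (auto simp: er_aid_ctx)
    note p' = sound_wD[OF w G p, unfolded reds_def]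
    note G1 = cok_Cons[OF G k(1)] and G3 = cok_aid_ctx[OF G k(1)]
    note a' = tok_ty[OF G k(4)] and b' = tok_ty[OF G k(5)] and pt = tok_ty[OF G p]
      and pt' = tok_ty[OF G conjunct1[OF p']]
    have C': "id_ctx (er l A) @ erc G \<turnstile> er l C \<^bold>: Uni m"
      using tok_ty[OF G3 k(2)] by (simp add: er_aid_ctx)
    have CC: "erc G \<turnstile> sub (er l p \<bullet> er l b \<bullet> er l a \<bullet> Var) (er l C) \<doteq>
        sub (er l (w G p) \<bullet> er l b \<bullet> er l a \<bullet> Var) (er l C) \<^bold>: Uni m"
      by (rule inst_cong3[OF C' eq_refl[OF a'] a' a' eq_refl[OF b'] b' b' conjunct2[OF p'] pt pt'])
    let ?T = "sub (er l p \<bullet> er l b \<bullet> er l a \<bullet> Var) (er l C)"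
    have r: "reds G ?T (AIndId A C d a b p) (AIndId A C d a b (w G p))"
    proof -
      have "erc G \<turnstile> IndId (er l C) (er l d) (er l a) (er l b) (er l p) \<doteq>
          IndId (er l C) (er l d) (er l a) (er l b) (er l (w G p)) \<^bold>: ?T"
        by (rule eq_IndId)
          (use eq_refl[OF C'] eq_refl[OF tok_ty[OF G1 k(3)]] eq_refl[OF a'] eq_refl[OF b'] p' in auto)
      then show ?thesis
        using k p' le_eq[OF eq_sym[OF CC]] by (auto simp: reds_def er_aid_ctx)
    qed
    have "reds G ?T (AIndId A C d a b p) (whnf_ind_id w c G A C d a b (w G p))"
    proof (cases "w G p")
      case (ARfl A' a1 b1 z)
      have "reds G ?T (AIndId A C d a b (w G p)) (whnf_ind_id w c G A C d a b (w G p))"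
        unfolding ARfl whnf_ind_id.simps
      proof (rule contract_reds[OF w G])
        show "tok G ?T (AIndId A C d a b (ARfl A' a1 b1 z))"
          using r ARfl by (simp add: reds_def del: okm.simps)
        assume "match c G A A' \<and> match c G a a1 \<and> match c G b b1"
        then show "reds G ?T (AIndId A C d a b (ARfl A' a1 b1 z)) (subst 0 0 [z] d)"
          using reds_le[OF beta_id[OF m G k] le_eq[OF eq_sym[OF CC[unfolded ARfl er.simps]]]] p' ARfl
          by (auto simp del: okm.simps)
      qed
      with r show ?thesis
        by (rule reds_trans)
    qed (use r in simp_all)
    with le show ?thesis
      unfolding AIndId whnf_step.simps by (rule reds_le[rotated])
  next
    case (ADef n d as)
    note d = tok_ADef[OF G t[unfolded ADef]]
    have "teq G (er l (subst 0 0 as (dtype d))) (ADef n d as) (subst 0 0 as (dbody d))"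
      unfolding d(4) by (rule eq_refl[OF tok_ty[OF G d(3)]])
    with d(3) have "reds G (er l (subst 0 0 as (dtype d))) (ADef n d as) (subst 0 0 as (dbody d))"
      by (simp add: reds_def del: er.simps)
    from reds_trans[OF this sound_wD[OF w G d(3)]]
    have "reds G T (ADef n d as) (w G (subst 0 0 as (dbody d)))"
      using d(5) by (rule reds_le)
    with reds_refl[OF G t] show ?thesis
      unfolding ADef by (cases "transparent d") (simp_all del: okm.simps)
  qed (use reds_refl[OF G t] in simp_all)
qed

end


subsection \<open>Conversion\<close>

lemma conv_parts'_iff: "conv_parts' P c G xs ys \<longleftrightarrow> P \<and> conv_parts c G xs ys"
  by (cases P) simp_all

lemma conv_parts_map: "conv_parts c G (map (Pair []) as) (map (Pair []) bs) \<longleftrightarrow> list_all2 (c G) as bs"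
proof (induction as arbitrary: bs)
  case Nil
  then show ?case by (cases bs) simp_all
next
  case (Cons a as)
  then show ?case by (cases bs) (simp_all add: conv_parts'_iff)
qed

context at_level
begin

lemma tok_conv2:
  assumes G: "cok (B # A # G)" "cok (B' # A' # G)" and t: "tok (B' # A' # G) T t"
    and A: "teq G (Uni k) A A'" and B: "teq (A # G) (Uni j) B B'"
  shows "tok (B # A # G) T t"
proof -
  have "atm_mor l AVar (erc (A # G)) (erc (A' # G))"
    using atm_mor_conv1[OF _ le_eq[OF A], of l] cok_wf[of "A # G"] G(1) by simp
  from atm_mor_conv[OF this[unfolded list.map] _ le_eq[OF B[unfolded list.map]]]
  have "atm_mor l AVar (erc (B # A # G)) (erc (B' # A' # G))"
    using cok_wf[OF G(1)] by simp
  from ok_conv[OF t cok_wf[OF G(2)] this] show ?thesis .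
qed

lemma tok_conv3:
  assumes G: "cok G" and A: "tok G (Uni k) A" "tok G (Uni k') A'" "teq G (Uni m) A A'"
    and t: "tok (aid_ctx A' @ G) T t"
  shows "tok (aid_ctx A @ G) T t"
proof -
  let ?A = "er l A" and ?A' = "er l A'"
  have wf: "wf (id_ctx ?A @ erc G)" and wf': "wf (id_ctx ?A' @ erc G)"
    using cok_wf[OF cok_aid_ctx[OF G A(1)]] cok_wf[OF cok_aid_ctx[OF G A(2)]] by (simp_all add: er_aid_ctx)
  note wf2 = wf_ConsD[OF wf[unfolded append_Cons append_Nil]]
  note wf1 = wf_ConsD[OF wf2]
  have 1: "atm_mor l AVar (?A # erc G) (?A' # erc G)"
    using atm_mor_conv1[OF wf1 le_eq[OF A(3)]] .
  have le1: "le (?A # erc G) (wk 1 ?A) (wk 1 ?A')"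
    using le_Suc[OF le_eq[OF A(3)] wf1] by simp
  have 2: "atm_mor l AVar (wk 1 ?A # ?A # erc G) (wk 1 ?A' # ?A' # erc G)"
    using atm_mor_conv[OF 1 _ le1] wf2 by simp
  have A2: "wk 1 ?A # ?A # erc G \<turnstile> wk 2 ?A \<doteq> wk 2 ?A' \<^bold>: Uni m"
    using eq_tm_ren[OF wf2 _ A(3), of "\<lambda>n. n + 2"] ren_mor_drop[of 2 "wk 1 ?A # ?A # erc G"]
    by (simp add: numeral_2_eq_2)
  have v: "wk 1 ?A # ?A # erc G \<turnstile> Var n \<^bold>: wk 2 ?A" if "n < 2" for n
    using less_2_cases[OF that] ty_Var[OF wf2, of n] by (elim disjE) (simp_all add: numeral_2_eq_2)
  have "wk 1 ?A # ?A # erc G \<turnstile> IdT (wk 2 ?A) (Var 1) (Var 0) \<doteq> IdT (wk 2 ?A') (Var 1) (Var 0) \<^bold>: Uni m"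
    by (rule eq_Id[OF A2]) (use eq_refl[OF v] in auto)
  from atm_mor_conv[OF 2 _ le_eq[OF this]] wf
  have "atm_mor l AVar (id_ctx ?A @ erc G) (id_ctx ?A' @ erc G)"
    by simp
  with ok_conv[OF _ wf', of l] t show ?thesis
    by (simp add: er_aid_ctx)
qed

lemma atm_mor_tm: "atm_mor l s \<Delta> \<Gamma> \<Longrightarrow> tm_mor (\<lambda>n. er l (s n)) \<Delta> \<Gamma>"
  using atm_mor_class_tm_mor[OF atm_mor_class_atm] by (auto simp: atm_mor_def)

text \<open>This is the substitution behind \<open>apair_pat\<close>. It shows that the expected
  type of a branch is a type, and it carries an equality of two motives over to their pair
  patterns.\<close>

lemma atm_mor_pair:
  assumes G: "cok G" and A: "tok G (Uni k) A" and B: "tok (A # G) (Uni k) B"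
  shows "atm_mor l (asb 2 [APr (lift 0 2 A) (lift 1 2 B) (AVar 1) (AVar 0)])
    (erc (B # A # G)) (SgT (er l A) (er l B) # erc G)"
proof -
  note G1 = cok_Cons[OF G A]
  note G2 = cok_Cons[OF G1 B]
  have r: "ren_mor (\<lambda>n. n + 2) (erc (B # A # G)) (erc G)"
    using ren_mor_drop[of 2 "erc (B # A # G)"] by (simp add: numeral_2_eq_2)
  have A2: "tok (B # A # G) (Uni k) (aren (\<lambda>n. n + 2) A)"
    using ok_ren[OF A cok_wf[OF G] cok_wf[OF G2] r] by simp
  note G3 = cok_Cons[OF G2 A2]
  have "ren_mor (up_ren (\<lambda>n. n + 2)) (erc (aren (\<lambda>n. n + 2) A # B # A # G)) (erc (A # G))"
    using ren_mor_up[OF r] by simp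
  from ok_ren[OF B cok_wf[OF G1] cok_wf[OF G3] this]
  have B2: "tok (aren (\<lambda>n. n + 2) A # B # A # G) (Uni k) (aren (up_ren (\<lambda>n. n + 2)) B)"
    by simp
  have sh: "sh 1 2 = up_ren (\<lambda>n. n + 2)"
    by (rule nat_fun_eqI) (simp_all add: sh_def)
  have v1: "tok (B # A # G) (wk 2 (er l A)) (AVar 1)"
    using le_refl[OF tok_ty[OF G2 A2]] by (simp add: numeral_2_eq_2)
  have eq: "(\<lambda>x. (Var 1 \<bullet> Var) (up_ren (\<lambda>n. n + 2) x)) = (\<lambda>x. Var (Suc x))"
    by (rule nat_fun_eqI) simp_all
  have v0: "tok (B # A # G) ((ren (up_ren (\<lambda>n. n + 2)) (er l B))\<langle>Var 1\<rangle>) (AVar 0)"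
    using le_refl[OF tok_ty[OF G2 tok_Suc[OF G2 B, unfolded ren.simps]]] unfolding sub_ren eq by (simp add: sub_Var_ren)
  have S: "erc (B # A # G) \<turnstile> SgT (er l (aren (\<lambda>n. n + 2) A)) (er l (aren (up_ren (\<lambda>n. n + 2)) B)) \<^bold>: Uni k"
    by (rule ty_Sg) (use tok_ty[OF G2 A2] tok_ty[OF G3 B2] in simp_all)
  have "tok (B # A # G) (ren (\<lambda>n. n + 2) (SgT (er l A) (er l B)))
      (APr (lift 0 2 A) (lift 1 2 B) (AVar 1) (AVar 0))"
    unfolding lift_eq[of 1] lift_0 sh
    using A2 B2 v0 v1 le_refl[OF S]
    by (auto simp del: okm.simps(1) sub_ren)
  then show ?thesis
    unfolding asb_ascons by (intro atm_mor_ascons atm_mor_ren[OF r cok_wf[OF G2]]) simp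
qed

lemma atm_mor_refl:
  assumes G: "cok G" and A: "tok G (Uni k) A"
  shows "atm_mor l (asb 1 [ARfl (lift 0 1 A) (AVar 0) (AVar 0) (AVar 0), AVar 0, AVar 0])
    (erc (A # G)) (id_ctx (er l A) @ erc G)"
proof -
  note G1 = cok_Cons[OF G A]
  note A1 = tok_Suc[OF G1 A, unfolded ren.simps]
  have r: "atm_mor l (\<lambda>n. AVar (n + 1)) (erc (A # G)) (erc G)"
    using atm_mor_ren[OF _ cok_wf[OF G1], of Suc] ren_mor_Suc by simp
  have v: "tok (A # G) (wk 1 (er l A)) (AVar 0)"
    using le_refl[OF tok_ty[OF G1 A1]] by simp
  have v': "erc (A # G) \<turnstile> Var 0 \<^bold>: ren Suc (er l A)"
    using tok_ty[OF G1 v] by simp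
  have "erc (A # G) \<turnstile> IdT (wk 1 (er l A)) (Var 0) (Var 0) \<^bold>: Uni k"
    using ty_Id[OF tok_ty[OF G1 A1, unfolded er_aren] v' v'] by simp
  then have z: "tok (A # G) (IdT (wk 1 (er l A)) (Var 0) (Var 0)) (ARfl (lift 0 1 A) (AVar 0) (AVar 0) (AVar 0))"
    unfolding lift_0_1 using A1 v eq_refl[OF v'] by (auto intro: le_refl simp del: okm.simps(1))
  have "atm_mor l (ascons (AVar 0) (\<lambda>n. AVar (n + 1))) (erc (A # G)) (er l A # erc G)"
    by (rule atm_mor_ascons[OF r]) (use v in simp)
  then have "atm_mor l (ascons (AVar 0) (ascons (AVar 0) (\<lambda>n. AVar (n + 1)))) (erc (A # G)) (wk 1 (er l A) # er l A # erc G)"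
    by (rule atm_mor_ascons) (use v in \<open>simp add: er_ascons\<close>)
  then show ?thesis
    unfolding asb_ascons append_Cons append_Nil
    by (rule atm_mor_ascons) (use z in \<open>simp add: er_ascons numeral_2_eq_2 del: okm.simps\<close>)
qed

lemma tok_apair_pat:
  assumes "cok G" "tok G (Uni k) A" "tok (A # G) (Uni k) B" "tok (ASg A B # G) (Uni m) C"
    "cok (ASg A B # G)"
  shows "tok (B # A # G) (Uni m) (apair_pat A B C)"
  using ok_sub[OF assms(4) cok_wf[OF assms(5)], of _ "erc (B # A # G)"] atm_mor_pair[OF assms(1-3)]
  by (simp add: apair_pat_def subst_0)

lemma tok_arefl_pat:
  assumes "cok G" "tok G (Uni k) A" "tok (aid_ctx A @ G) (Uni m) C"
  shows "tok (A # G) (Uni m) (arefl_pat A C)"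
  using ok_sub[OF assms(3) cok_wf[OF cok_aid_ctx[OF assms(1,2)]], of _ "erc (A # G)"] atm_mor_refl[OF assms(1,2)]
  by (simp add: arefl_pat_def subst_0 er_aid_ctx)

text \<open>Conversion is sound only between terms of a common type, while the components of
  \<open>u\<close> are typed over the annotations of \<open>u\<close>. Each one is moved to the
  annotations of \<open>t\<close>, by the equalities already obtained, before the next comparison is
  used.\<close>

lemma sound_same:
  assumes c: "sound_c c"
  shows "sound_c (same c)"
  unfolding sound_c_def
proof (intro allI impI)
  fix G T t u
  assume G: "cok G" and t: "tok G T t" and u: "tok G T u" and "same c G t u"
  then have h: "head t = head u" and p: "conv_parts c G (parts t) (parts u)"
    by (simp_all add: same_def del: okm.simps) (cases "head t = head u"; simp del: okm.simps)+
  note conv = sound_cD[OF c] and convt = conv_ty[OF c]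
  have refl: "t = u \<Longrightarrow> teq G T t u"
    using eq_refl[OF tok_ty[OF G t]] by simp
  show "teq G T t u"
  proof (cases t)
    case (APi A B)
    then obtain A' B' where u': "u = APi A' B'"
      using h by (cases u) auto
    obtain k where k: "tok G (Uni k) A" "tok (A # G) (Uni k) B" "le (erc G) (Uni k) T"
      using t APi by auto
    obtain j where j: "tok G (Uni j) A'" "tok (A' # G) (Uni j) B'" "le (erc G) (Uni j) T"
      using u u' by auto
    have q: "c G A A'" "c (A # G) B B'"
      using p APi u' by (auto simp: conv_parts'_iff)
    note G1 = cok_Cons[OF G k(1)] and AA = convt[OF G k(1) j(1) q(1)]
    note BB = convt[OF G1 k(2) tok_conv[OF G1 j(2) cok_Cons[OF G j(1)] AA] q(2)]
    have "le (erc G) (Uni (max k j)) T"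
      using k(3) j(3) by (simp add: max_def)
    from le_eq_tm[OF this eq_Pi[OF AA BB[unfolded list.map]]] show ?thesis
      unfolding APi u' by simp
  next
    case (ASg A B)
    then obtain A' B' where u': "u = ASg A' B'"
      using h by (cases u) auto
    obtain k where k: "tok G (Uni k) A" "tok (A # G) (Uni k) B" "le (erc G) (Uni k) T"
      using t ASg by auto
    obtain j where j: "tok G (Uni j) A'" "tok (A' # G) (Uni j) B'" "le (erc G) (Uni j) T"
      using u u' by auto
    have q: "c G A A'" "c (A # G) B B'"
      using p ASg u' by (auto simp: conv_parts'_iff)
    note G1 = cok_Cons[OF G k(1)] and AA = convt[OF G k(1) j(1) q(1)]
    note BB = convt[OF G1 k(2) tok_conv[OF G1 j(2) cok_Cons[OF G j(1)] AA] q(2)]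
    have "le (erc G) (Uni (max k j)) T"
      using k(3) j(3) by (simp add: max_def)
    from le_eq_tm[OF this eq_Sg[OF AA BB[unfolded list.map]]] show ?thesis
      unfolding ASg u' by simp
  next
    case (ALam A0 A B b)
    then obtain A0' A' B' b' where u': "u = ALam A0' A' B' b'"
      using h by (cases u) auto
    obtain k where k: "tok G (Uni k) A0" "tok G (Uni k) A" "tok (A # G) (Uni k) B" "tok (A # G) (er l B) b"
        "teq G (Uni k) A0 A" "le (erc G) (PiT (er l A) (er l B)) T"
      using t ALam by auto
    obtain j where j: "tok G (Uni j) A'" "tok (A' # G) (Uni j) B'" "tok (A' # G) (er l B') b'"
        "teq G (Uni j) A0' A'"
      using u u' by auto
    have q: "c G A A'" "c (A # G) B B'" "c (A # G) b b'"
      using p ALam u' by (auto simp: conv_parts'_iff)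
    note G1 = cok_Cons[OF G k(2)] and AA = convt[OF G k(2) j(1) q(1)]
    note toA = tok_conv[OF G1 _ cok_Cons[OF G j(1)] AA]
    note BB = convt[OF G1 k(3) toA[OF j(2)] q(2)]
    note bb = conv[OF G1 k(4) ok_le[OF toA[OF j(3)] le_eq[OF eq_sym[OF BB]]] q(3)]
    have A0: "teq G (Uni (max j k)) A0 A0'"
      using cumul_eq[OF k(5), of "max j k"] cumul_eq[OF j(4), of "max j k"] cumul_eq[OF AA, of "max j k"]
      by (auto intro: eq_trans eq_sym)
    note w0 = wf_Cons[OF tok_ty[OF G k(1)]] and le0 = le_eq[OF k(5)]
    have "erc G \<turnstile> Lam (er l A0) (er l b) \<doteq> Lam (er l A0') (er l b') \<^bold>: PiT (er l A0) (er l B)"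
      by (rule eq_Lam[OF A0 ctx_conv_eq[OF bb[unfolded list.map] w0 le0]])
    from eq_conv[OF this eq_Pi[OF k(5) eq_refl[OF ctx_conv_ty[OF tok_ty[OF G1 k(3), unfolded list.map] w0 le0]]]]
    show ?thesis
      unfolding ALam u' using k(6) by (auto intro: le_eq_tm)
  next
    case (AApp A B f a)
    then obtain A' B' f' a' where u': "u = AApp A' B' f' a'"
      using h by (cases u) auto
    obtain k where k: "tok G (Uni k) A" "tok (A # G) (Uni k) B" "tok G (PiT (er l A) (er l B)) f" "tok G (er l A) a"
        "le (erc G) ((er l B)\<langle>er l a\<rangle>) T"
      using t AApp by auto
    obtain j where j: "tok G (Uni j) A'" "tok (A' # G) (Uni j) B'" "tok G (PiT (er l A') (er l B')) f'" "tok G (er l A') a'"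
      using u u' by auto
    have q: "c G A A'" "c (A # G) B B'" "c G f f'" "c G a a'"
      using p AApp u' by (auto simp: conv_parts'_iff)
    note G1 = cok_Cons[OF G k(1)] and AA = convt[OF G k(1) j(1) q(1)]
    note BB = convt[OF G1 k(2) tok_conv[OF G1 j(2) cok_Cons[OF G j(1)] AA] q(2)]
    note PP = eq_sym[OF eq_Pi[OF AA BB[unfolded list.map]]]
    from le_eq_tm[OF k(5) eq_App[OF conv[OF G k(3) ok_le[OF j(3) le_eq[OF PP]] q(3)]
        conv[OF G k(4) ok_le[OF j(4) le_eq[OF eq_sym[OF AA]]] q(4)]]] show ?thesis
      unfolding AApp u' by simp
  next
    case (APr A B a b)
    then obtain A' B' a' b' where u': "u = APr A' B' a' b'"
      using h by (cases u) auto
    obtain k where k: "tok G (Uni k) A" "tok (A # G) (Uni k) B" "tok G (er l A) a"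
        "tok G ((er l B)\<langle>er l a\<rangle>) b" "le (erc G) (SgT (er l A) (er l B)) T"
      using t APr by auto
    obtain j where j: "tok G (Uni j) A'" "tok (A' # G) (Uni j) B'" "tok G (er l A') a'" "tok G ((er l B')\<langle>er l a'\<rangle>) b'"
      using u u' by auto
    have q: "c G A A'" "c (A # G) B B'" "c G a a'" "c G b b'"
      using p APr u' by (auto simp: conv_parts'_iff)
    note G1 = cok_Cons[OF G k(1)] and AA = convt[OF G k(1) j(1) q(1)]
    note BB = convt[OF G1 k(2) tok_conv[OF G1 j(2) cok_Cons[OF G j(1)] AA] q(2), unfolded list.map]
    note a' = ok_le[OF j(3) le_eq[OF eq_sym[OF AA]]]
    note aa = conv[OF G k(3) a' q(3)]
    note B = tok_ty[OF G1 k(2), unfolded list.map]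
    note aa' = eq_sym[OF inst_cong[OF B aa tok_ty[OF G k(3)] tok_ty[OF G a']]]
    note Ba = eq_sym[OF eq_tm_inst[OF BB tok_ty[OF G a'], unfolded sub.simps]]
    from le_eq_tm[OF k(5) eq_Pr[OF B aa conv[OF G k(4) ok_le[OF ok_le[OF j(4) le_eq[OF Ba]] le_eq[OF aa']] q(4)]]]
    show ?thesis
      unfolding APr u' by simp
  next
    case (AIndSg A B C g s)
    then obtain A' B' C' g' s' where u': "u = AIndSg A' B' C' g' s'"
      using h by (cases u) auto
    obtain k m where k: "tok G (Uni k) A" "tok (A # G) (Uni k) B" "tok (ASg A B # G) (Uni m) C"
        "tok (B # A # G) (pair_pat (er l C)) g" "tok G (SgT (er l A) (er l B)) s"
        "le (erc G) ((er l C)\<langle>er l s\<rangle>) T"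
      using t AIndSg by auto
    obtain j n where j: "tok G (Uni j) A'" "tok (A' # G) (Uni j) B'" "tok (ASg A' B' # G) (Uni n) C'"
        "tok (B' # A' # G) (pair_pat (er l C')) g'" "tok G (SgT (er l A') (er l B')) s'"
      using u u' by auto
    have q: "c G A A'" "c (A # G) B B'" "c G s s'" "c (ASg A B # G) C C'" "c (B # A # G) g g'"
      using p AIndSg u' by (auto simp: conv_parts'_iff)
    note G1 = cok_Cons[OF G k(1)] and G1' = cok_Cons[OF G j(1)] and AA = convt[OF G k(1) j(1) q(1)]
    note BB = convt[OF G1 k(2) tok_conv[OF G1 j(2) G1' AA] q(2)]
    note G2 = cok_Cons[OF G1 k(2)] and G2' = cok_Cons[OF G1' j(2)]
    have "tok G (Uni k) (ASg A B)" "tok G (Uni j) (ASg A' B')"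
      using k j le_refl[OF ty_Uni[OF cok_wf[OF G]]] by auto
    note GS = cok_Cons[OF G this(1)] and GS' = cok_Cons[OF G this(2)]
    note SS = eq_Sg[OF AA BB[unfolded list.map]]
    then have SS': "teq G (Uni (max k j)) (ASg A B) (ASg A' B')"
      by simp
    note CC = convt[OF GS k(3) tok_conv[OF GS j(3) GS' SS'] q(4), unfolded list.map er.simps]
    have Cp: "erc (B # A # G) \<turnstile> pair_pat (er l C) \<doteq> pair_pat (er l C') \<^bold>: Uni (max m n)"
      using eq_tm_sub[OF cok_wf[OF G2] atm_mor_tm[OF atm_mor_pair[OF G k(1,2)]] CC, unfolded er_asb] by simp
    note gg = conv[OF G2 k(4) ok_le[OF tok_conv2[OF G2 G2' j(4) AA BB] le_eq[OF eq_sym[OF Cp]]] q(5)]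
    from le_eq_tm[OF k(6) eq_IndSg[OF CC gg[unfolded list.map]
        conv[OF G k(5) ok_le[OF j(5) le_eq[OF eq_sym[OF SS]]] q(3)]]]
    show ?thesis
      unfolding AIndSg u' by simp
  next
    case (ACo A B)
    then obtain A' B' where u': "u = ACo A' B'"
      using h by (cases u) auto
    obtain k where k: "tok G (Uni k) A" "tok G (Uni k) B" "le (erc G) (Uni k) T"
      using t ACo by auto
    obtain j where j: "tok G (Uni j) A'" "tok G (Uni j) B'" "le (erc G) (Uni j) T"
      using u u' by auto
    have q: "c G A A'" "c G B B'"
      using p ACo u' by (auto simp: conv_parts'_iff)
    have "le (erc G) (Uni (max k j)) T"
      using k(3) j(3) by (simp add: max_def)
    from le_eq_tm[OF this eq_Co[OF convt[OF G k(1) j(1) q(1)] convt[OF G k(2) j(2) q(2)]]] show ?thesis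
      unfolding ACo u' by simp
  next
    case (AId A a b)
    then obtain A' a' b' where u': "u = AId A' a' b'"
      using h by (cases u) auto
    obtain k where k: "tok G (Uni k) A" "tok G (er l A) a" "tok G (er l A) b" "le (erc G) (Uni k) T"
      using t AId by auto
    obtain j where j: "tok G (Uni j) A'" "tok G (er l A') a'" "tok G (er l A') b'" "le (erc G) (Uni j) T"
      using u u' by auto
    have q: "c G A A'" "c G a a'" "c G b b'"
      using p AId u' by (auto simp: conv_parts'_iff)
    have le: "le (erc G) (Uni (max k j)) T"
      using k(4) j(4) by (simp add: max_def)
    note AA = convt[OF G k(1) j(1) q(1)]
    note toA = ok_le[OF _ le_eq[OF eq_sym[OF AA]]]
    from le_eq_tm[OF le eq_Id[OF AA conv[OF G k(2) toA[OF j(2)] q(2)] conv[OF G k(3) toA[OF j(3)] q(3)]]]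
    show ?thesis
      unfolding AId u' by simp
  next
    case (ARfl A a b z)
    then obtain A' a' b' z' where u': "u = ARfl A' a' b' z'"
      using h by (cases u) auto
    obtain k where k: "tok G (Uni k) A" "tok G (er l A) z" "teq G (er l A) z a" "teq G (er l A) z b"
        "le (erc G) (IdT (er l A) (er l a) (er l b)) T"
      using t ARfl by auto
    obtain j where j: "tok G (Uni j) A'" "tok G (er l A') z'"
      using u u' by auto
    have q: "c G A A'" "c G z z'"
      using p ARfl u' by (auto simp: conv_parts'_iff)
    note A = tok_ty[OF G k(1)]
    note zz = eq_Rfl[OF A conv[OF G k(2) ok_le[OF j(2) le_eq[OF eq_sym[OF convt[OF G k(1) j(1) q(1)]]]] q(2)]]
    from le_eq_tm[OF k(5) eq_conv[OF zz Rfl_conv(2)[OF A tok_ty[OF G k(2)] k(3,4)]]] show ?thesis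
      unfolding ARfl u' by simp
  next
    case (AIndId A C d a b s)
    then obtain A' C' d' a' b' s' where u': "u = AIndId A' C' d' a' b' s'"
      using h by (cases u) auto
    obtain k m where k: "tok G (Uni k) A" "tok (aid_ctx A @ G) (Uni m) C"
        "tok (A # G) (refl_pat (er l C)) d" "tok G (er l A) a" "tok G (er l A) b"
        "tok G (IdT (er l A) (er l a) (er l b)) s"
        "le (erc G) (sub (er l s \<bullet> er l b \<bullet> er l a \<bullet> Var) (er l C)) T"
      using t AIndId by (auto simp: er_aid_ctx)
    obtain j n where j: "tok G (Uni j) A'" "tok (aid_ctx A' @ G) (Uni n) C'"
        "tok (A' # G) (refl_pat (er l C')) d'" "tok G (er l A') a'" "tok G (er l A') b'"
        "tok G (IdT (er l A') (er l a') (er l b')) s'"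
      using u u' by (auto simp: er_aid_ctx)
    have q: "c G A A'" "c G a a'" "c G b b'" "c G s s'" "c (aid_ctx A @ G) C C'" "c (A # G) d d'"
      using p AIndId u' by (auto simp: conv_parts'_iff)
    note G1 = cok_Cons[OF G k(1)] and AA = convt[OF G k(1) j(1) q(1)]
    note toA = ok_le[OF _ le_eq[OF eq_sym[OF AA]]]
    note aa = conv[OF G k(4) toA[OF j(4)] q(2)] and bb = conv[OF G k(5) toA[OF j(5)] q(3)]
    note ss = conv[OF G k(6) ok_le[OF j(6) le_eq[OF eq_sym[OF eq_Id[OF AA aa bb]]]] q(4)]
    note CC = convt[OF cok_aid_ctx[OF G k(1)] k(2) tok_conv3[OF G k(1) j(1) AA j(2)] q(5),
        unfolded map_append er_aid_ctx]
    have Cp: "erc (A # G) \<turnstile> refl_pat (er l C) \<doteq> refl_pat (er l C') \<^bold>: Uni (max m n)"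
      using eq_tm_sub[OF cok_wf[OF G1] atm_mor_tm[OF atm_mor_refl[OF G k(1)]] CC, unfolded er_asb] by simp
    note dd = conv[OF G1 k(3) ok_le[OF tok_conv[OF G1 j(3) cok_Cons[OF G j(1)] AA] le_eq[OF eq_sym[OF Cp]]] q(6)]
    from le_eq_tm[OF k(7) eq_IndId[OF CC[unfolded append_Cons append_Nil] dd[unfolded list.map] aa bb ss]]
    show ?thesis
      unfolding AIndId u' by simp
  next
    case (ADef n d as)
    then obtain bs where u': "u = ADef n d bs"
      using h by (cases u) auto
    have q: "list_all2 (c G) as bs"
      using p by (simp add: ADef u' conv_parts_map)
    have d: "okd l d" "length as = length (dtele d)" "length bs = length (dtele d)"
      and as: "\<And>j. j < length as \<Longrightarrow> tok G (sub (vsub (drop (Suc j) (map (er l) as))) (er l (dtele d ! j))) (as ! j)"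
      and bs: "\<And>j. j < length bs \<Longrightarrow> tok G (sub (vsub (drop (Suc j) (map (er l) bs))) (er l (dtele d ! j))) (bs ! j)"
      and le: "le (erc G) (sub (vsub (map (er l) as)) (er l (dtype d))) T"
      using t u ADef u' by auto
    note w = okd_ty[OF d(1)]
    obtain k where k: "ok l (map (er l) (dtele d)) (Uni k) (dtype d)"
      using d(1) by (cases d) auto
    let ?D = "map (er l) (dtele d)" and ?a = "map (er l) as" and ?b = "map (er l) bs"
    \<comment> \<open>The argument tuples are compared from the end of the list, which is the
      outside of the telescope: equality of the earlier entries is what makes the two types of the
      next entry equal.\<close>
    have "eq_mor (erc G) (vsub (drop j ?a)) (vsub (drop j ?b)) (drop j ?D)" if "j \<le> length (dtele d)" for j
      using that
    proof (induction j rule: inc_induct)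
      case base
      then show ?case
        by (simp add: eq_mor_def tm_mor_def)
    next
      case (step j)
      note wj = wf_drops_wf[OF w(1), unfolded drops_wf_def, rule_format]
      have D: "drop j ?D = er l (dtele d ! j) # drop (Suc j) ?D"
        using step by (simp add: Cons_nth_drop_Suc[symmetric])
      then obtain m where m: "drop (Suc j) ?D \<turnstile> er l (dtele d ! j) \<^bold>: Uni m"
        using wj[of j] by (auto elim: wf.cases)
      have a: "drop j ?a = er l (as ! j) # drop (Suc j) ?a" and b: "drop j ?b = er l (bs ! j) # drop (Suc j) ?b"
        using step d by (simp_all add: Cons_nth_drop_Suc[symmetric])
      have v: "vsub (x # xs) = x \<bullet> vsub xs" for x xs
        by (rule nat_fun_eqI) (simp_all add: vsub_def)
      note TT = sub_cong[OF cok_wf[OF G] step.IH m ty_Uni[OF has_ty_wf[OF m]], unfolded sub.simps]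
      have j: "j < length as" "j < length bs" "c G (as ! j) (bs ! j)"
        using step d q by (simp_all add: list_all2_conv_all_nth)
      note aj = as[OF j(1)] and bj = bs[OF j(2)]
      show ?case
        unfolding D a b v
        by (rule eq_mor_scons[OF step.IH tok_ty[OF G aj] tok_ty[OF G bj]
          conv[OF G aj ok_le[OF bj le_eq[OF eq_sym[OF TT]]] j(3)]])
    qed
    from this[of 0] have "eq_mor (erc G) (vsub ?a) (vsub ?b) ?D"
      by simp
    from sub_cong[OF cok_wf[OF G] this w(2) ok_ty[OF k w(1)]] le_eq_tm[OF le] show ?thesis
      unfolding ADef u' by simp
  qed (use h refl in \<open>cases u; simp\<close>)+
qed

lemma elim_type_sound:
  assumes G: "cok G" and t: "tok G T t" and S: "elim_type G t = Some S"
  shows "\<exists>k. tok G (Uni k) S" "tok G (er l S) t" "le (erc G) (er l S) T"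
proof -
  have "(\<exists>k. tok G (Uni k) S) \<and> tok G (er l S) t \<and> le (erc G) (er l S) T"
  proof (cases t)
    case (AVar n)
    then obtain A where "lookup G n = Some A" and S': "S = lift 0 (Suc n) A"
      using S by (cases "lookup G n") auto
    then have n: "n < length G" "A = G ! n"
      using lookup_eq by blast+
    from cok_lookup[OF G n(1)] obtain k where k: "tok G (Uni k) S"
      using S' n by auto
    with le_refl[OF tok_ty[OF G k]] show ?thesis
      using S' n AVar t by (auto simp: er_lift)
  next
    case (AApp A B f a)
    then have S': "S = subst 0 0 [a] B"
      using S by simp
    obtain k where k: "tok G (Uni k) A" "tok (A # G) (Uni k) B" "tok G (er l A) a"
      using t AApp by auto
    have "tok G (Uni k) S"
      using tok_inst[OF cok_Cons[OF G k(1)] k(2,3)] S' by simp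
    moreover have "tok G (er l S) t"
      using le_refl[OF tok_ty[OF G calculation]] t unfolding AApp S' er_inst okm.simps by blast
    moreover have "le (erc G) (er l S) T"
      using t unfolding AApp S' er_inst okm.simps by blast
    ultimately show ?thesis by blast
  next
    case (AIndSg A B C g p)
    then have S': "S = subst 0 0 [p] C"
      using S by simp
    obtain k m where k: "tok G (Uni k) A" "tok (A # G) (Uni k) B" "tok (ASg A B # G) (Uni m) C"
        "tok G (SgT (er l A) (er l B)) p"
      using t AIndSg by auto
    have "tok G (Uni k) (ASg A B)"
      using k le_refl[OF ty_Uni[OF cok_wf[OF G]]] by auto
    then have "tok G (Uni m) S"
      using tok_inst[OF cok_Cons[OF G] k(3)] k(4) S' by simp
    moreover have "tok G (er l S) t"
      using le_refl[OF tok_ty[OF G calculation]] t unfolding AIndSg S' er_inst okm.simps by blast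
    moreover have "le (erc G) (er l S) T"
      using t unfolding AIndSg S' er_inst okm.simps by blast
    ultimately show ?thesis by blast
  next
    case (AIndId A C d a b p)
    then have S': "S = subst 0 0 [p, b, a] C"
      using S by simp
    obtain k m where k: "tok G (Uni k) A" "tok (aid_ctx A @ G) (Uni m) C" "tok G (er l A) a" "tok G (er l A) b"
        "tok G (IdT (er l A) (er l a) (er l b)) p"
      using t AIndId by (auto simp: er_aid_ctx)
    have "tok G (Uni m) S"
      using tok_inst3[OF G k] S' by simp
    moreover have "tok G (er l S) t"
      using le_refl[OF tok_ty[OF G calculation]] t unfolding AIndId S' er_inst okm.simps by blast
    moreover have "le (erc G) (er l S) T"
      using t unfolding AIndId S' er_inst okm.simps by blast
    ultimately show ?thesis by blast
  next
    case (ADef n d as)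
    with tok_ADef[OF G t[unfolded ADef]] S show ?thesis
      by simp
  qed (use S in simp_all)
  then show "\<exists>k. tok G (Uni k) S" "tok G (er l S) t" "le (erc G) (er l S) T"
    by blast+
qed

text \<open>Once the type of \<open>u\<close> has been converted to the annotated Pi type, applying
  \<open>u\<close> under the binder is typed, and the comparison of bodies becomes an equality of
  \<open>u\<close> with the abstraction through \<open>Pi_uniq\<close>.\<close>

lemma eta_sound:
  assumes c: "sound_c c" and G: "cok G" and t: "tok G T (ALam A0 A B b)" and u: "tok G U u"
    and S: "elim_type G u = Some S" "c G S (APi A B)"
    and b: "c (A # G) b (AApp (lift 0 1 A) (lift 1 1 B) (lift 0 1 u) (AVar 0))"
  shows "teq G T (ALam A0 A B b) u"
proof -
  obtain k where k: "tok G (Uni k) A0" "tok G (Uni k) A" "tok (A # G) (Uni k) B" "teq G (Uni k) A0 A"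
      "tok (A # G) (er l B) b" "le (erc G) (PiT (er l A) (er l B)) T"
    using t by auto
  obtain m where m: "tok G (Uni m) S" and u': "tok G (er l S) u"
    using elim_type_sound[OF G u S(1)] by blast
  have "tok G (Uni k) (APi A B)"
    using k le_refl[OF ty_Uni[OF cok_wf[OF G]]] by auto
  from conv_ty[OF c G m this S(2)] have u'': "tok G (PiT (er l A) (er l B)) u"
    using ok_le[OF u' le_eq] by simp
  note G1 = cok_Cons[OF G k(2)]
  note A1 = tok_Suc[OF G1 k(2), unfolded ren.simps]
  have "tok (A # G) (er l B) (AApp (lift 0 1 A) (lift 1 1 B) (lift 0 1 u) (AVar 0))"
  proof -
    have eq: "(\<lambda>x. (Var 0 \<bullet> Var) (up_ren Suc x)) = Var"
      by (rule nat_fun_eqI) simp_all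
    have "le (erc (A # G)) (er l B) (er l B)"
      using le_refl[OF tok_ty[OF G1 k(3)]] .
    moreover have "le (erc (A # G)) (ren Suc (er l A)) (ren Suc (er l A))"
      using le_refl[OF tok_ty[OF G1 A1, unfolded er_aren]] .
    ultimately show ?thesis
      unfolding lift_0_1 lift_1_1
      using A1 tok_up_Suc[OF G1 G1 k(3)] tok_Suc[OF G1 u''] by (auto simp: eq)
  qed
  from sound_cD[OF c G1 k(5) this b]
  have bb: "er l A # erc G \<turnstile> er l b \<doteq> App (wk 1 (er l u)) (Var 0) \<^bold>: er l B"
    unfolding lift_0_1 by simp
  from ctx_conv_eq[OF this wf_Cons[OF tok_ty[OF G k(1)]] le_eq[OF k(4)]]
  have "er l A0 # erc G \<turnstile> er l b \<doteq> App (wk 1 (er l u)) (Var 0) \<^bold>: er l B" .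
  from eq_Lam[OF k(4) this]
  have 1: "erc G \<turnstile> Lam (er l A0) (er l b) \<doteq> Lam (er l A) (App (wk 1 (er l u)) (Var 0)) \<^bold>:
      PiT (er l A0) (er l B)" .
  have "er l A # erc G \<turnstile> er l B \<^bold>: Uni k"
    using tok_ty[OF G1 k(3)] by simp
  from ctx_conv_ty[OF this wf_Cons[OF tok_ty[OF G k(1)]] le_eq[OF k(4)]]
  have "er l A0 # erc G \<turnstile> er l B \<^bold>: Uni k" .
  \<comment> \<open>\<open>eq_Lam\<close> speaks of the Pi type over the written domain
    \<open>A0\<close>, whereas \<open>Pi_uniq\<close> for \<open>u\<close> speaks of the one over
    \<open>A\<close>.\<close>
  from eq_conv[OF 1 eq_Pi[OF k(4) eq_refl[OF this]]]
  have "erc G \<turnstile> Lam (er l A0) (er l b) \<doteq> Lam (er l A) (App (wk 1 (er l u)) (Var 0)) \<^bold>: PiT (er l A) (er l B)" .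
  with eq_sym[OF Pi_uniq[OF tok_ty[OF G u'']]]
  have "teq G (PiT (er l A) (er l B)) (ALam A0 A B b) u"
    by (auto intro: eq_trans)
  with k(6) show ?thesis
    by (rule le_eq_tm)
qed

end


context at_level
begin

lemma sound_eta:
  assumes c: "sound_c c" and G: "cok G" and t: "tok G T t" and u: "tok G T u" and e: "eta c G t u"
  shows "teq G T t u"
proof -
  obtain A0 A B b S where "t = ALam A0 A B b" "elim_type G u = Some S" "c G S (APi A B)"
      "c (A # G) b (AApp (lift 0 1 A) (lift 1 1 B) (lift 0 1 u) (AVar 0))"
    using e by (auto elim!: eta.elims eta'.elims eta''.elims)
  with eta_sound[OF c G _ u] t show ?thesis
    by blast
qed

lemma sound_conv_values:
  assumes c: "sound_c c"
  shows "sound_c (conv_values c)"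
  unfolding sound_c_def
proof (intro allI impI)
  fix G T t u
  assume *: "cok G" "tok G T t" "tok G T u" and e: "conv_values c G t u"
  show "teq G T t u"
  proof (cases "is_lam t = is_lam u")
    case True
    then have "same c G t u"
      using e by (cases "is_lam t"; cases "is_lam u"; simp add: conv_values_def)
    with sound_cD[OF sound_same[OF c] *] show ?thesis
      by simp
  next
    case False
    then have "eta c G t u \<or> eta c G u t"
      using e by (cases "is_lam t"; cases "is_lam u"; simp add: conv_values_def)
    with sound_eta[OF c *] eq_sym[OF sound_eta[OF c *(1,3,2)]] show ?thesis
      by blast
  qed
qed

lemma sound_conv_step:
  assumes w: "sound_w w" and c: "sound_c c"
  shows "sound_c (conv_step w c)"
  unfolding sound_c_def
proof (intro allI impI)
  fix G T t u
  assume *: "cok G" "tok G T t" "tok G T u" and e: "conv_step w c G t u"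
  note rt = sound_wD[OF w *(1,2), unfolded reds_def] and ru = sound_wD[OF w *(1,3), unfolded reds_def]
  consider "t = u" | "same c G t u" | "conv_values c G (w G t) (w G u)"
    using e unfolding conv_step_def
    by (cases "t = u"; cases "is_elim t"; cases "same c G t u"; simp)
  then show "teq G T t u"
  proof cases
    case 1
    then show ?thesis
      using eq_refl[OF tok_ty[OF *(1,2)]] by simp
  next
    case 2
    then show ?thesis
      using sound_cD[OF sound_same[OF c] *] by blast
  next
    case 3
    then have "teq G T (w G t) (w G u)"
      using sound_cD[OF sound_conv_values[OF c] *(1)] rt ru by blast
    with rt ru show ?thesis
      by (blast intro: eq_trans eq_sym)
  qed
qed


subsection \<open>Inference\<close>

abbreviation good :: "actx \<Rightarrow> src \<Rightarrow> atm \<Rightarrow> atm \<Rightarrow> bool" where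
  "good G s a T \<equiv> tok G (er l T) a \<and> (\<exists>k. tok G (Uni k) T) \<and> er l a = strip l s"

lemma sound_iD: "sound_i i \<Longrightarrow> cok G \<Longrightarrow> src_ok l s \<Longrightarrow> i G s = Some (a, T) \<Longrightarrow> good G s a T"
  unfolding sound_i_def by blast

lemma sound_kD:
  "sound_k k \<Longrightarrow> cok G \<Longrightarrow> src_ok l s \<Longrightarrow> tok G (Uni j) T \<Longrightarrow> k G s T = Some a \<Longrightarrow>
     tok G (er l T) a \<and> er l a = strip l s"
  unfolding sound_k_def by blast

lemma type_level_Some:
  "type_level A T = Some x \<longleftrightarrow> T = AUni (snd x) \<and> A = fst x"
  "Some x = type_level A T \<longleftrightarrow> T = AUni (snd x) \<and> A = fst x"
  by (cases x; cases T; auto)+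

lemma as_type_sound:
  assumes w: "sound_w w" and i: "sound_i i" and G: "cok G" and s: "src_ok l s"
    and e: "as_type w i G s = Some (A, j)"
  shows "tok G (Uni (j + l)) A" "er l A = strip l s"
proof -
  obtain T where "i G s = Some (A, T)" and T: "w G T = AUni j"
    using e unfolding as_type_def
    by (auto elim!: as_type'.elims simp: type_level_Some)
  then have A: "tok G (er l T) A" and T': "\<exists>k. tok G (Uni k) T" and er: "er l A = strip l s"
    using sound_iD[OF i G s] by blast+
  from T' obtain k where "tok G (Uni k) T" ..
  from sound_wD[OF w G this] have "teq G (Uni k) T (AUni j)"
    unfolding T reds_def ..
  from ok_le[OF A le_eq[OF this]] show "tok G (Uni (j + l)) A"
    by simp
  show "er l A = strip l s"
    by (rule er)
qed

lemma le_Uni_refl: "le \<Gamma> (Uni k) (Uni k)"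
  by (simp add: le_Uni)

lemma tok_AUni: "tok G (Uni (Suc (j + l))) (AUni j)" "\<exists>k. tok G (Uni k) (AUni j)"
  by (auto intro: le_Uni_refl)

lemma tok_APi:
  "tok G (Uni j) A \<Longrightarrow> tok (A # G) (Uni k) B \<Longrightarrow> tok G (Uni (max j k)) (APi A B)"
  using ok_cumul[where k = "max j k" and t = A] ok_cumul[where k = "max j k" and t = B] le_Uni_refl
  by fastforce

lemma tok_ASg:
  "tok G (Uni j) A \<Longrightarrow> tok (A # G) (Uni k) B \<Longrightarrow> tok G (Uni (max j k)) (ASg A B)"
  using ok_cumul[where k = "max j k" and t = A] ok_cumul[where k = "max j k" and t = B] le_Uni_refl
  by fastforce

lemma tok_ACo:
  "tok G (Uni j) A \<Longrightarrow> tok G (Uni k) B \<Longrightarrow> tok G (Uni (max j k)) (ACo A B)"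
  using ok_cumul[where k = "max j k" and t = A] ok_cumul[where k = "max j k" and t = B] le_Uni_refl
  by fastforce

lemma tok_AId:
  "tok G (Uni k) A \<Longrightarrow> tok G (er l A) a \<Longrightarrow> tok G (er l A) b \<Longrightarrow> tok G (Uni k) (AId A a b)"
  using le_Uni_refl by fastforce

lemma infer_app_sound:
  assumes w: "sound_w w" and i: "sound_i i" and k: "sound_k k" and G: "cok G"
    and s: "src_ok l (SApp sf sa)" and e: "infer_app w k G sa (i G sf) = Some (t, T)"
  shows "good G (SApp sf sa) t T"
proof -
  obtain f F A B a where f: "i G sf = Some (f, F)" and F: "w G F = APi A B"
    and a: "k G sa A = Some a" and t: "t = AApp A B f a" "T = subst 0 0 [a] B"
    using e by (auto elim!: infer_app.elims infer_app'.elims infer_app''.elims infer_app'.elims[OF sym] infer_app''.elims[OF sym])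
  obtain m where m: "tok G (er l F) f" "tok G (Uni m) F" "er l f = strip l sf"
    using sound_iD[OF i G _ f] s by auto
  have r: "tok G (Uni m) (APi A B)" "teq G (Uni m) F (APi A B)"
    using sound_wD[OF w G m(2)] unfolding F reds_def by blast+
  then obtain n where n: "tok G (Uni n) A" "tok (A # G) (Uni n) B"
    by auto
  have f': "tok G (PiT (er l A) (er l B)) f"
    using ok_le[OF m(1) le_eq[OF r(2)]] by simp
  have a': "tok G (er l A) a" "er l a = strip l sa"
    using sound_kD[OF k G _ n(1) a] s by auto
  note T = tok_inst[OF cok_Cons[OF G n(1)] n(2) a'(1), unfolded sub.simps]
  have "tok G ((er l B)\<langle>er l a\<rangle>) (AApp A B f a)"
    using n f' a'(1) le_refl[OF tok_ty[OF G T]] by (auto simp: er_inst)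
  with T m(3) a'(2) show ?thesis
    unfolding t er_inst by auto
qed

lemma infer_ind_sg_sound:
  assumes w: "sound_w w" and i: "sound_i i" and k: "sound_k k" and G: "cok G"
    and s: "src_ok l (SIndSg sC sd sp)" and e: "infer_ind_sg w i k G sC sd (i G sp) = Some (t, T)"
  shows "good G (SIndSg sC sd sp) t T"
proof -
  obtain p S A B C j g where p: "i G sp = Some (p, S)" and S: "w G S = ASg A B"
    and C: "as_type w i (ASg A B # G) sC = Some (C, j)"
    and g: "k (B # A # G) sd (apair_pat A B C) = Some g"
    and t: "t = AIndSg A B C g p" "T = subst 0 0 [p] C"
    using e by (auto elim!: infer_ind_sg.elims infer_ind_sg'.elims infer_ind_sg''.elims infer_ind_sg'''.elims infer_ind_sg'.elims[OF sym] infer_ind_sg''.elims[OF sym] infer_ind_sg'''.elims[OF sym])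
  obtain m where m: "tok G (er l S) p" "tok G (Uni m) S" "er l p = strip l sp"
    using sound_iD[OF i G _ p] s by auto
  have r: "tok G (Uni m) (ASg A B)" "teq G (Uni m) S (ASg A B)"
    using sound_wD[OF w G m(2)] unfolding S reds_def by blast+
  then obtain n where n: "tok G (Uni n) A" "tok (A # G) (Uni n) B"
    by auto
  note GS = cok_Cons[OF G r(1)] and G2 = cok_Cons[OF cok_Cons[OF G n(1)] n(2)]
  have p': "tok G (SgT (er l A) (er l B)) p"
    using ok_le[OF m(1) le_eq[OF r(2)]] by simp
  have C': "tok (ASg A B # G) (Uni (j + l)) C" "er l C = strip l sC"
    using as_type_sound[OF w i GS _ C] s by auto
  have g': "tok (B # A # G) (pair_pat (er l C)) g" "er l g = strip l sd"
    using sound_kD[OF k G2 _ tok_apair_pat[OF G n C'(1) GS] g] s by (auto simp: er_apair_pat)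
  have T: "tok G (Uni (j + l)) (subst 0 0 [p] C)"
    using tok_inst[OF GS C'(1)] p' by simp
  have "tok G ((er l C)\<langle>er l p\<rangle>) (AIndSg A B C g p)"
    using n C'(1) g'(1) p' le_refl[OF tok_ty[OF G T]] by (auto simp: er_inst)
  with T m(3) C'(2) g'(2) show ?thesis
    unfolding t er_inst by auto
qed

lemma infer_ind_id_sound:
  assumes w: "sound_w w" and i: "sound_i i" and k: "sound_k k" and G: "cok G"
    and s: "src_ok l (SIndId sC sc sa sy sp)" and e: "infer_ind_id w i k G sC sc sy sp (i G sa) = Some (t, T)"
  shows "good G (SIndId sC sc sa sy sp) t T"
proof -
  obtain a A b p C j c where a: "i G sa = Some (a, A)" and b: "k G sy A = Some b"
    and p: "k G sp (AId A a b) = Some p" and C: "as_type w i (aid_ctx A @ G) sC = Some (C, j)"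
    and c: "k (A # G) sc (arefl_pat A C) = Some c"
    and t: "t = AIndId A C c a b p" "T = subst 0 0 [p, b, a] C"
    using e by (auto elim!: infer_ind_id.elims infer_ind_id'.elims infer_ind_id''.elims
        infer_ind_id'''.elims infer_ind_id''''.elims infer_ind_id'.elims[OF sym] infer_ind_id''.elims[OF sym] infer_ind_id'''.elims[OF sym] infer_ind_id''''.elims[OF sym])
  obtain n where n: "tok G (er l A) a" "tok G (Uni n) A" "er l a = strip l sa"
    using sound_iD[OF i G _ a] s by auto
  have b': "tok G (er l A) b" "er l b = strip l sy"
    using sound_kD[OF k G _ n(2) b] s by auto
  have p': "tok G (IdT (er l A) (er l a) (er l b)) p" "er l p = strip l sp"
    using sound_kD[OF k G _ tok_AId[OF n(2,1) b'(1)] p] s by auto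
  note G3 = cok_aid_ctx[OF G n(2)]
  have C': "tok (aid_ctx A @ G) (Uni (j + l)) C" "er l C = strip l sC"
    using as_type_sound[OF w i G3 _ C] s by auto
  have c': "tok (A # G) (refl_pat (er l C)) c" "er l c = strip l sc"
    using sound_kD[OF k cok_Cons[OF G n(2)] _ tok_arefl_pat[OF G n(2) C'(1)] c] s
    by (auto simp: er_arefl_pat)
  have T: "tok G (Uni (j + l)) (subst 0 0 [p, b, a] C)"
    using tok_inst3[OF G n(2) C'(1) n(1) b'(1) p'(1)] by simp
  have "tok G (sub (er l p \<bullet> er l b \<bullet> er l a \<bullet> Var) (er l C)) (AIndId A C c a b p)"
    using n C'(1) c'(1) b'(1) p'(1) le_refl[OF tok_ty[OF G T]] by (auto simp: er_inst er_aid_ctx)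
  with T n(3) C'(2) c'(2) b'(2) p'(2) show ?thesis
    unfolding t er_inst by auto
qed

lemma check_args_sound:
  assumes k: "sound_k k" and G: "cok G"
  shows "cok Ts \<Longrightarrow> list_all (\<lambda>b. b) (map (src_ok l) ss) \<Longrightarrow> check_args k G Ts ss = Some as \<Longrightarrow>
    length as = length Ts \<and> map (er l) as = map (strip l) ss \<and>
    (\<forall>j < length as. tok G (sub (vsub (drop (Suc j) (map (er l) as))) (er l (Ts ! j))) (as ! j))"
proof (induction Ts arbitrary: ss as)
  case Nil
  then show ?case
    by (cases ss) auto
next
  case (Cons T Ts)
  obtain s ss' where ss: "ss = s # ss'"
    using Cons.prems(3) by (cases ss) auto
  obtain bs a where bs: "check_args k G Ts ss' = Some bs" and a: "k G s (subst 0 0 bs T) = Some a"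
    and as: "as = a # bs"
    using Cons.prems(3) unfolding ss by (auto elim!: check_args'.elims check_args''.elims check_args''.elims[OF sym])
  have Ts: "cok Ts"
    using Cons.prems(1) by simp
  have IH: "length bs = length Ts" "map (er l) bs = map (strip l) ss'"
    "\<And>j. j < length bs \<Longrightarrow> tok G (sub (vsub (drop (Suc j) (map (er l) bs))) (er l (Ts ! j))) (bs ! j)"
    using Cons.IH[OF Ts _ bs] Cons.prems(2) ss by auto
  obtain m where m: "tok Ts (Uni m) T"
    using Cons.prems(1) by auto
  note mor = atm_mor_tele[OF G Ts IH(1,3)]
  have "tok G (Uni m) (subst 0 0 bs T)"
    using ok_sub[OF m cok_wf[OF Ts] mor(1)] by (simp add: subst_0)
  from sound_kD[OF k G _ this a] have a': "tok G (er l (subst 0 0 bs T)) a" "er l a = strip l s"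
    using Cons.prems(2) ss by auto
  have "er l (subst 0 0 bs T) = sub (vsub (map (er l) bs)) (er l T)"
    using mor(2)[OF _ tok_ty[OF Ts m]] by (simp add: er_subst)
  with a' IH show ?case
    unfolding as ss by (auto simp: all_less_Suc_eq_0 simp del: okm.simps)
qed

lemma infer_def_sound:
  assumes k: "sound_k k" and G: "cok G" and s: "src_ok l (SDef n d ss)"
    and e: "infer_def n d (check_args k G (dtele d) ss) = Some (t, T)"
  shows "good G (SDef n d ss) t T"
proof -
  obtain as where as: "check_args k G (dtele d) ss = Some as"
    and t: "t = ADef n d as" "T = subst 0 0 as (dtype d)"
    using e by (auto elim!: infer_def.elims)
  have d: "okd l d"
    using s by simp
  note D = okd_cok[OF d]
  have A: "length as = length (dtele d)" "map (er l) as = map (strip l) ss"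
    "\<And>j. j < length as \<Longrightarrow> tok G (sub (vsub (drop (Suc j) (map (er l) as))) (er l (dtele d ! j))) (as ! j)"
    using check_args_sound[OF k G D _ as] s by auto
  note mor = atm_mor_tele[OF G D A(1,3)]
  obtain m where m: "tok (dtele d) (Uni m) (dtype d)"
    using d by (cases d) auto
  have T: "tok G (Uni m) (subst 0 0 as (dtype d))"
    using ok_sub[OF m cok_wf[OF D] mor(1)] by (simp add: subst_0)
  have eq: "er l (subst 0 0 as (dtype d)) = sub (vsub (map (er l) as)) (er l (dtype d))"
    using mor(2)[OF _ tok_ty[OF D m]] by (simp add: er_subst)
  have "tok G (er l (subst 0 0 as (dtype d))) (ADef n d as)"
    using d A(1,3) le_refl[OF tok_ty[OF G T]] unfolding eq by simp
  with T A(2) show ?thesis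
    unfolding t by auto
qed

lemma sound_infer_step:
  assumes w: "sound_w w" and i: "sound_i i" and k: "sound_k k"
  shows "sound_i (infer_step w i k)"
  unfolding sound_i_def
proof (intro allI impI)
  fix G s t T
  assume G: "cok G" and s: "src_ok l s" and e: "infer_step w i k G s = Some (t, T)"
  note ast = as_type_sound[OF w i]
  show "good G s t T"
  proof (cases s)
    case (SVar n)
    then obtain A where A: "lookup G n = Some A" and t: "t = AVar n" "T = lift 0 (Suc n) A"
      using e by (auto elim!: infer_var.elims lift_opt.elims lift_opt.elims[OF sym])
    have n: "n < length G" "A = G ! n"
      using lookup_eq[OF A] by blast+
    obtain m where m: "tok G (Uni m) (lift 0 (Suc n) A)"
      using cok_lookup[OF G n(1)] n(2) by blast
    show ?thesis
      unfolding SVar t using m n le_refl[OF tok_ty[OF G m]] by (auto simp: er_lift)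
  next
    case (SUni j)
    then have t: "t = AUni j" "T = AUni (Suc j)"
      using e by auto
    show ?thesis
      unfolding SUni t using tok_AUni(1)[where G = G and j = j] tok_AUni(2)[where G = G and j = "Suc j"]
      by (simp del: okm.simps)
  next
    case (SPi A B)
    then obtain A' j B' m where t: "as_type w i G A = Some (A', j)" "as_type w i (A' # G) B = Some (B', m)"
        "t = APi A' B'" "T = AUni (max j m)"
      using e by (auto elim!: infer_binder.elims infer_binder'.elims infer_binder'.elims[OF sym])
    have A: "tok G (Uni (j + l)) A'" "er l A' = strip l A"
      using ast[OF G _ t(1)] s SPi by auto
    have B: "tok (A' # G) (Uni (m + l)) B'" "er l B' = strip l B"
      using ast[OF cok_Cons[OF G A(1)] _ t(2)] s SPi by auto
    show ?thesis
      unfolding t SPi using tok_APi[OF A(1) B(1)] A(2) B(2) tok_AUni(2)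
      by (simp del: okm.simps add: max_add_distrib_left)
  next
    case (SSg A B)
    then obtain A' j B' m where t: "as_type w i G A = Some (A', j)" "as_type w i (A' # G) B = Some (B', m)"
        "t = ASg A' B'" "T = AUni (max j m)"
      using e by (auto elim!: infer_binder.elims infer_binder'.elims infer_binder'.elims[OF sym])
    have A: "tok G (Uni (j + l)) A'" "er l A' = strip l A"
      using ast[OF G _ t(1)] s SSg by auto
    have B: "tok (A' # G) (Uni (m + l)) B'" "er l B' = strip l B"
      using ast[OF cok_Cons[OF G A(1)] _ t(2)] s SSg by auto
    show ?thesis
      unfolding t SSg using tok_ASg[OF A(1) B(1)] A(2) B(2) tok_AUni(2)
      by (simp del: okm.simps add: max_add_distrib_left)
  next
    case (SCo A B)
    then obtain A' j B' m where t: "as_type w i G A = Some (A', j)" "as_type w i G B = Some (B', m)"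
        "t = ACo A' B'" "T = AUni (max j m)"
      using e by (auto elim!: infer_co.elims infer_binder'.elims infer_binder'.elims[OF sym])
    have A: "tok G (Uni (j + l)) A'" "er l A' = strip l A"
      using ast[OF G _ t(1)] s SCo by auto
    have B: "tok G (Uni (m + l)) B'" "er l B' = strip l B"
      using ast[OF G _ t(2)] s SCo by auto
    show ?thesis
      unfolding t SCo using tok_ACo[OF A(1) B(1)] A(2) B(2) tok_AUni(2)
      by (simp del: okm.simps add: max_add_distrib_left)
  next
    case (SLam A b)
    then obtain A' j b' B' where t: "as_type w i G A = Some (A', j)" "i (A' # G) b = Some (b', B')"
        "t = ALam A' A' B' b'" "T = APi A' B'"
      using e by (auto elim!: infer_lam.elims infer_lam'.elims infer_lam'.elims[OF sym])
    have A: "tok G (Uni (j + l)) A'" "er l A' = strip l A"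
      using ast[OF G _ t(1)] s SLam by auto
    obtain m where b: "tok (A' # G) (er l B') b'" "tok (A' # G) (Uni m) B'" "er l b' = strip l b"
      using sound_iD[OF i cok_Cons[OF G A(1)] _ t(2)] s SLam by auto
    note P = tok_APi[OF A(1) b(2)]
    let ?m = "max (j + l) m"
    have "tok G (Uni ?m) A'" "tok (A' # G) (Uni ?m) B'" "teq G (Uni ?m) A' A'"
      using ok_cumul[OF A(1)] ok_cumul[OF b(2)] eq_refl[OF tok_ty[OF G ok_cumul[OF A(1)]]] by simp_all
    then have "tok G (PiT (er l A') (er l B')) (ALam A' A' B' b')"
      using b(1) le_refl[OF tok_ty[OF G P]] by auto
    with P A(2) b(3) show ?thesis
      unfolding t SLam by auto
  next
    case (SApp f a)
    then show ?thesis
      using infer_app_sound[OF w i k G] s e by simp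
  next
    case (SIndSg C g p)
    then show ?thesis
      using infer_ind_sg_sound[OF w i k G] s e by simp
  next
    case SEmp
    then have t: "t = AEmp" "T = AUni 0"
      using e by auto
    show ?thesis
      unfolding SEmp t using tok_AUni(2)[where G = G and j = 0] le_Uni_refl by simp
  next
    case SOne
    then have t: "t = AOne" "T = AUni 0"
      using e by auto
    show ?thesis
      unfolding SOne t using tok_AUni(2)[where G = G and j = 0] le_Uni_refl by simp
  next
    case (SId A a b)
    then obtain A' j a' b' where t: "as_type w i G A = Some (A', j)" "k G a A' = Some a'" "k G b A' = Some b'"
        "t = AId A' a' b'" "T = AUni j"
      using e by (auto elim!: infer_id.elims infer_id'.elims infer_id'.elims[OF sym])
    have A: "tok G (Uni (j + l)) A'" "er l A' = strip l A"
      using ast[OF G _ t(1)] s SId by auto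
    have ab: "tok G (er l A') a'" "er l a' = strip l a" "tok G (er l A') b'" "er l b' = strip l b"
      using sound_kD[OF k G _ A(1) t(2)] sound_kD[OF k G _ A(1) t(3)] s SId by auto
    show ?thesis
      unfolding t SId using tok_AId[OF A(1) ab(1,3)] A(2) ab(2,4) tok_AUni(2) by (simp del: okm.simps)
  next
    case (SRfl a)
    then obtain a' A where t: "i G a = Some (a', A)" "t = ARfl A a' a' a'" "T = AId A a' a'"
      using e by (auto elim!: infer_rfl.elims)
    obtain m where a: "tok G (er l A) a'" "tok G (Uni m) A" "er l a' = strip l a"
      using sound_iD[OF i G _ t(1)] s SRfl by auto
    note I = tok_AId[OF a(2,1,1)]
    have "tok G (IdT (er l A) (er l a') (er l a')) (ARfl A a' a' a')"
      using a le_refl[OF tok_ty[OF G I]] eq_refl[OF tok_ty[OF G a(1)]] by auto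
    with I a(3) show ?thesis
      unfolding t SRfl by auto
  next
    case (SIndId C c a b p)
    then show ?thesis
      using infer_ind_id_sound[OF w i k G] s e by simp
  next
    case (SFunext j)
    then obtain m where t: "as_type w i G (sfunext_ty j (length G)) = Some (T, m)" "t = AFunext j"
      using e by (auto elim!: infer_const.elims)
    have T: "tok G (Uni (m + l)) T" "er l T = funext_ty (j + l) (length G)"
      using ast[OF G src_ok_sfunext_ty t(1)] by (auto simp: strip_sfunext_ty)
    show ?thesis
      unfolding t SFunext using T le_refl[OF tok_ty[OF G T(1)]] by auto
  next
    case (SUa j)
    then obtain m where t: "as_type w i G (suniv_ty j (length G)) = Some (T, m)" "t = AUa j"
      using e by (auto elim!: infer_const.elims)
    have T: "tok G (Uni (m + l)) T" "er l T = univalence_ty (j + l) (length G)"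
      using ast[OF G src_ok_suniv_ty t(1)] by (auto simp: strip_suniv_ty)
    show ?thesis
      unfolding t SUa using T le_refl[OF tok_ty[OF G T(1)]] by auto
  next
    case (SAsc U a)
    then obtain j where t: "as_type w i G U = Some (T, j)" "k G a T = Some t"
      using e by (auto elim!: infer_asc.elims infer_asc'.elims infer_asc'.elims[OF sym])
    have T: "tok G (Uni (j + l)) T"
      using ast[OF G _ t(1)] s SAsc by auto
    show ?thesis
      using sound_kD[OF k G _ T t(2)] T s SAsc by auto
  next
    case (SDef n d ss)
    then show ?thesis
      using infer_def_sound[OF k G] s e by simp
  qed (use e in simp_all)
qed

lemma check_infer_sound:
  assumes w: "sound_w w" and c: "sound_c c" and i: "sound_i i" and G: "cok G"
    and s: "src_ok l s" and T: "tok G (Uni j) T" and e: "check_infer w c G T (i G s) = Some t"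
  shows "tok G (er l T) t \<and> er l t = strip l s"
proof -
  obtain U where U: "i G s = Some (t, U)" and e': "c G U T \<or> check_cumul t (w G U) (w G T) = Some t"
    using e by (auto elim!: check_infer.elims check_infer'.elims check_cumul.elims check_cumul'.elims check_infer'.elims[OF sym] check_cumul.elims[OF sym] check_cumul'.elims[OF sym])
  obtain k where t: "tok G (er l U) t" "tok G (Uni k) U" "er l t = strip l s"
    using sound_iD[OF i G s U] by auto
  from e' have "le (erc G) (er l U) (er l T)"
  proof
    assume "c G U T"
    from le_eq[OF conv_ty[OF c G t(2) T this]] show ?thesis .
  next
    assume "check_cumul t (w G U) (w G T) = Some t"
    then obtain m n where mn: "w G U = AUni m" "w G T = AUni n" "m \<le> n"
      by (auto elim!: check_cumul.elims check_cumul'.elims check_cumul'.elims[OF sym])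
    have "le (erc G) (er l U) (Uni (m + l))" "le (erc G) (Uni (n + l)) (er l T)"
      using sound_wD[OF w G t(2)] sound_wD[OF w G T] unfolding mn reds_def
      by (auto intro: le_eq eq_sym)
    then show ?thesis
      using mn(3) by (meson add_le_mono1 le_Uni le_trans)
  qed
  with t show ?thesis
    using ok_le by blast
qed

lemma sound_check_step:
  assumes w: "sound_w w" and c: "sound_c c" and i: "sound_i i" and k: "sound_k k"
  shows "sound_k (check_step w c i k)"
  unfolding sound_k_def
proof (intro allI impI)
  fix G s T j t
  assume G: "cok G" and s: "src_ok l s" and T: "tok G (Uni j) T" and e: "check_step w c i k G s T = Some t"
  note wT = sound_wD[OF w G T, unfolded reds_def]
  show "tok G (er l T) t \<and> er l t = strip l s"
  proof (cases s)
    case (SLam sA sy)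
    then obtain A B A0 m b where WT: "w G T = APi A B" and A0: "as_type w i G sA = Some (A0, m)"
      and cA: "c G A0 A" and b: "k (A # G) sy B = Some b" and t: "t = ALam A0 A B b"
      using e by (auto elim!: check_lam.elims check_lam'.elims check_lam''.elims check_lam'''.elims check_lam'.elims[OF sym] check_lam''.elims[OF sym] check_lam'''.elims[OF sym])
    obtain n where n: "tok G (Uni n) A" "tok (A # G) (Uni n) B"
      using wT unfolding WT by auto
    have A0': "tok G (Uni (m + l)) A0" "er l A0 = strip l sA"
      using as_type_sound[OF w i G _ A0] s SLam by auto
    have b': "tok (A # G) (er l B) b" "er l b = strip l sy"
      using sound_kD[OF k cok_Cons[OF G n(1)] _ n(2) b] s SLam by auto
    let ?m = "max (m + l) n"
    have "tok G (Uni ?m) A0" "tok G (Uni ?m) A" "tok (A # G) (Uni ?m) B" "teq G (Uni ?m) A0 A"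
      using ok_cumul[OF A0'(1)] ok_cumul[OF n(1)] ok_cumul[OF n(2)] conv_ty[OF c G A0'(1) n(1) cA] by simp_all
    then have "tok G (er l T) t"
      unfolding t using b'(1) le_eq[OF eq_sym[OF conjunct2[OF wT[unfolded WT er.simps]]]] by auto
    with A0'(2) b'(2) show ?thesis
      unfolding t SLam by simp
  next
    case (SPr sa sy)
    then obtain A B a b where WT: "w G T = ASg A B" and a: "k G sa A = Some a"
      and b: "k G sy (subst 0 0 [a] B) = Some b" and t: "t = APr A B a b"
      using e by (auto elim!: check_pr.elims check_pr'.elims check_pr''.elims check_pr'.elims[OF sym] check_pr''.elims[OF sym])
    obtain n where n: "tok G (Uni n) A" "tok (A # G) (Uni n) B"
      using wT unfolding WT by auto
    have a': "tok G (er l A) a" "er l a = strip l sa"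
      using sound_kD[OF k G _ n(1) a] s SPr by auto
    have b': "tok G ((er l B)\<langle>er l a\<rangle>) b" "er l b = strip l sy"
      using sound_kD[OF k G _ tok_inst[OF cok_Cons[OF G n(1)] n(2) a'(1), unfolded sub.simps] b] s SPr
      by (auto simp: er_inst)
    have "tok G (er l T) t"
      unfolding t using n a'(1) b'(1) le_eq[OF eq_sym[OF conjunct2[OF wT[unfolded WT er.simps]]]] by auto
    with a'(2) b'(2) show ?thesis
      unfolding t SPr by simp
  next
    case (SRfl sz)
    then obtain A a b z where WT: "w G T = AId A a b" and z: "k G sz A = Some z"
      and cz: "c G z a" "c G z b" and t: "t = ARfl A a b z"
      using e by (auto elim!: check_rfl.elims check_rfl'.elims check_rfl''.elims check_rfl'.elims[OF sym] check_rfl''.elims[OF sym])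
    obtain n where n: "tok G (Uni n) A" "tok G (er l A) a" "tok G (er l A) b"
      using wT unfolding WT by auto
    have z': "tok G (er l A) z" "er l z = strip l sz"
      using sound_kD[OF k G _ n(1) z] s SRfl by auto
    have "tok G (er l T) t"
      unfolding t using n z'(1) sound_cD[OF c G z'(1) n(2) cz(1)] sound_cD[OF c G z'(1) n(3) cz(2)]
        le_eq[OF eq_sym[OF conjunct2[OF wT[unfolded WT er.simps]]]] by auto
    with z'(2) show ?thesis
      unfolding t SRfl by simp
  qed (use check_infer_sound[OF w c i G s T] e in simp_all)
qed

text \<open>Reduction tests annotations by conversion and conversion reduces, each with one unit of
  fuel less, so both are treated in a single induction. The steps are sound for arbitrary sound
  arguments.\<close>

lemma sound_whnf_conv: "sound_w (whnf n) \<and> sound_c (conv n)"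
proof (induction n)
  case 0
  have "whnf 0 = (\<lambda>G t. t)" and "conv 0 = (\<lambda>G t u. False)"
    by (simp_all add: fun_eq_iff)
  then show ?case
    by (simp add: sound_w_def sound_c_def reds_refl)
next
  case (Suc n)
  have "whnf (Suc n) = whnf_step (whnf n) (conv n)" "conv (Suc n) = conv_step (whnf n) (conv n)"
    by (simp_all add: fun_eq_iff)
  with Suc sound_whnf_step sound_conv_step show ?case
    by simp
qed

lemma sound_infer_check: "sound_i (infer n) \<and> sound_k (check n)"
proof (induction n)
  case 0
  then show ?case
    by (simp add: sound_i_def sound_k_def)
next
  case (Suc n)
  have "infer (Suc n) = infer_step (whnf n) (infer n) (check n)"
    "check (Suc n) = check_step (whnf n) (conv n) (infer n) (check n)"
    by (simp_all add: fun_eq_iff)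
  with Suc sound_infer_step sound_check_step sound_whnf_conv[of n] show ?case
    by simp
qed

lemma elab_ctx_sound:
  assumes w: "sound_w w" and i: "sound_i i"
  shows "list_all (src_ok l) Ts \<Longrightarrow> elab_ctx w i Ts = Some G \<Longrightarrow> cok G \<and> erc G = map (strip l) Ts"
proof (induction Ts arbitrary: G)
  case (Cons T Ts)
  obtain G' A j where G': "elab_ctx w i Ts = Some G'" and A: "as_type w i G' T = Some (A, j)"
    and G: "G = A # G'"
    using Cons.prems(2) by (auto elim!: elab_ctx'.elims dest!: sym[of "Some _" "map_option _ _"])
  with Cons as_type_sound[OF w i _ _ A] show ?case
    by fastforce
qed simp

lemma elab_dfn_sound:
  assumes "elab_dfn n tr Ts T t = Some d" "list_all (src_ok l) Ts" "src_ok l T" "src_ok l t"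
  shows "okd l d" "er_dfn l d = strip l t" "erc (dtele d) = map (strip l) Ts" "er l (dtype d) = strip l T"
proof -
  have s: "sound_w (whnf n)" "sound_i (infer n)" "sound_k (check n)"
    using sound_whnf_conv sound_infer_check by auto
  obtain G A j a where G: "elab_ctx (whnf n) (infer n) Ts = Some G"
    and A: "as_type (whnf n) (infer n) G T = Some (A, j)" and a: "check n G t A = Some a" and d: "d = Dfn tr G A a"
    using assms(1) unfolding elab_dfn_def
    by (auto elim!: elab_dfn'.elims elab_dfn''.elims elab_dfn'''.elims elab_dfn''.elims[OF sym] elab_dfn'''.elims[OF sym])
  have G': "cok G" "erc G = map (strip l) Ts"
    using elab_ctx_sound[OF s(1,2) assms(2) G] by auto
  note A' = as_type_sound[OF s(1,2) G'(1) assms(3) A]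
  note a' = sound_kD[OF s(3) G'(1) assms(4) A'(1) a]
  show "okd l d"
    unfolding d using cok_wf[OF G'(1)] tok_ty[OF G'(1) conjunct1[OF a']] G'(1) A'(1) a' by (auto simp: cok_iff)
  show "er_dfn l d = strip l t" "erc (dtele d) = map (strip l) Ts" "er l (dtype d) = strip l T"
    using d a' A'(2) G'(2) by simp_all
qed

end


section \<open>Evaluation\<close>

type_synonym entry = "bool \<times> src list \<times> src \<times> src"

text \<open>Every type is evaluated at its position, which is the length of the context it lives in;
  the accumulator puts the innermost entry at the head.\<close>

fun stele :: "nat \<Rightarrow> src list \<Rightarrow> sexpr list \<Rightarrow> src list" where
  "stele k Ts [] = Ts"
| "stele k Ts (A # As) = stele (Suc k) (A k # Ts) As"

definition entry :: "bool \<Rightarrow> sexpr list \<Rightarrow> sexpr \<Rightarrow> sexpr \<Rightarrow> entry" where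
  "entry tr As A a = (tr, stele 0 [] As, A (length As), a (length As))"

text \<open>Fuel stays a binary numeral, with \<open>steps n\<close> standing for one less than
  \<open>n\<close>. A unit can then be taken off by rewriting, without a large unary number in every
  goal.\<close>

definition steps :: "num \<Rightarrow> nat" where
  "steps = pred_numeral"

lemma steps: "steps (num.Bit0 n) = Suc (steps (Num.BitM n))" "steps (num.Bit1 n) = Suc (steps (num.Bit0 n))"
  by (simp_all add: steps_def pred_numeral_simps numeral_eq_Suc)

text \<open>The amount is 255. It bounds the nesting depth of calls, not their number, since a call
  hands the same remaining fuel to all of its subcalls.\<close>

definition "fuel = steps (num.Bit0 (num.Bit0 (num.Bit0 (num.Bit0 (num.Bit0 (num.Bit0 (num.Bit0 (num.Bit0 num.One))))))))"

fun elab :: "entry \<Rightarrow> dfn option" where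
  "elab (tr, Ts, T, t) = elab_dfn fuel tr Ts T t"

fun entry_ok :: "nat \<Rightarrow> entry \<Rightarrow> bool" where
  "entry_ok l (tr, Ts, T, t) = (list_all (src_ok l) Ts \<and> src_ok l T \<and> src_ok l t)"

abbreviation entry_tele :: "entry \<Rightarrow> src list" where "entry_tele s \<equiv> fst (snd s)"
abbreviation entry_type :: "entry \<Rightarrow> src" where "entry_type s \<equiv> fst (snd (snd s))"
abbreviation entry_body :: "entry \<Rightarrow> src" where "entry_body s \<equiv> snd (snd (snd s))"

text \<open>The run itself does not mention a level; the second conjunct does, because the contained
  definitions have to be typed at each of them.\<close>

definition checks :: "entry \<Rightarrow> dfn \<Rightarrow> bool" where
  "checks s d \<longleftrightarrow> elab s = Some d \<and> (\<forall>l. entry_ok l s)"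

definition dfn_of :: "entry \<Rightarrow> dfn" where
  "dfn_of s = the (elab s)"

lemma checks_sound:
  assumes "checks s d"
  shows "okd l d" "er_dfn l d = strip l (entry_body s)"
    "map (er l) (dtele d) = map (strip l) (entry_tele s)" "er l (dtype d) = strip l (entry_type s)"
proof -
  obtain tr Ts T t where s: "s = (tr, Ts, T, t)"
    by (cases s)
  with at_level.elab_dfn_sound[of fuel tr Ts T t d l] assms
  show "okd l d" "er_dfn l d = strip l (entry_body s)"
    "map (er l) (dtele d) = map (strip l) (entry_tele s)" "er l (dtype d) = strip l (entry_type s)"
    by (simp_all add: checks_def)
qed

lemma checks_ty:
  assumes "checks s d"
  shows "wf (map (strip l) (entry_tele s))"
    "map (strip l) (entry_tele s) \<turnstile> strip l (entry_body s) \<^bold>: strip l (entry_type s)"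
  using okd_ty[OF checks_sound(1)[OF assms]] unfolding checks_sound(2-4)[OF assms] .

text \<open>This is the interface by which later runs use a constant: \<open>dfn_of s\<close>
  remains an opaque name whose fields are rewritten on demand. The body is supplied to the evaluator
  only for transparent constants, while the erasure, needed to compare with the statement, is
  available for all.\<close>

lemma checks_const:
  assumes "checks s (Dfn tr Ts T t)"
  shows "transparent (dfn_of s) = tr \<and> dtele (dfn_of s) = Ts \<and> dtype (dfn_of s) = T \<and>
    (tr \<longrightarrow> dbody (dfn_of s) = t) \<and> (\<forall>l. okd l (dfn_of s)) \<and>
    (\<forall>l. er_dfn l (dfn_of s) = strip l (entry_body s))"
proof -
  have "dfn_of s = Dfn tr Ts T t"
    using assms by (simp add: checks_def dfn_of_def)
  then show ?thesis
    using checks_sound(1,2)[OF assms] by simp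
qed

text \<open>The number only serves to tell constants apart without unfolding them.\<close>
definition con :: "int \<Rightarrow> entry \<Rightarrow> sexpr list \<Rightarrow> sexpr" where
  "con n s as = (\<lambda>m. SDef (num_of_nat (nat n)) (dfn_of s) (rev (map (\<lambda>a. a m) as)))"

abbreviation VS :: sexpr where "VS \<equiv> sv 0"
abbreviation ElS :: "sexpr \<Rightarrow> sexpr" where "ElS E \<equiv> sv (Suc 0) \<star> E"
abbreviation base :: "sexpr list" where "base \<equiv> [su 0, VS \<rightharpoonup> su 0]"

lemma step_rules:
  "whnf (steps (num.Bit0 n)) G t = whnf_step (whnf (steps (Num.BitM n))) (conv (steps (Num.BitM n))) G t"
  "whnf (steps (num.Bit1 n)) G t = whnf_step (whnf (steps (num.Bit0 n))) (conv (steps (num.Bit0 n))) G t"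
  "conv (steps (num.Bit0 n)) G t u = conv_step (whnf (steps (Num.BitM n))) (conv (steps (Num.BitM n))) G t u"
  "conv (steps (num.Bit1 n)) G t u = conv_step (whnf (steps (num.Bit0 n))) (conv (steps (num.Bit0 n))) G t u"
  "infer (steps (num.Bit0 n)) G s =
     infer_step (whnf (steps (Num.BitM n))) (infer (steps (Num.BitM n))) (check (steps (Num.BitM n))) G s"
  "infer (steps (num.Bit1 n)) G s =
     infer_step (whnf (steps (num.Bit0 n))) (infer (steps (num.Bit0 n))) (check (steps (num.Bit0 n))) G s"
  "check (steps (num.Bit0 n)) G s t =
     check_step (whnf (steps (Num.BitM n))) (conv (steps (Num.BitM n))) (infer (steps (Num.BitM n)))
       (check (steps (Num.BitM n))) G s t"
  "check (steps (num.Bit1 n)) G s t =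
     check_step (whnf (steps (num.Bit0 n))) (conv (steps (num.Bit0 n))) (infer (steps (num.Bit0 n)))
       (check (steps (num.Bit0 n))) G s t"
  by (simp_all add: steps)

lemma le_rules: "(0 :: nat) \<le> n" "Suc m \<le> Suc n \<longleftrightarrow> m \<le> n" "\<not> Suc m \<le> 0"
  by simp_all

lemma max_rules: "max 0 n = n" "max n 0 = n" "max (Suc m) (Suc n) = Suc (max m n)" for n :: nat
  by simp_all

lemma sub_rules: "n - 0 = n" "Suc m - Suc n = m - n" for n :: nat
  by simp_all

lemma num_rules: "(2 :: nat) = Suc (Suc 0)" "(1::nat) = Suc 0"
   "(numeral (num.Bit0 k) :: nat) = Suc (numeral (Num.BitM k))"
   "(numeral (num.Bit1 k) :: nat) = Suc (numeral (num.Bit0 k))"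
   "(numeral num.One :: nat) = Suc 0"
  by (simp_all add: numeral_eq_Suc pred_numeral_simps)

lemma tag_rule: "num_of_nat (nat (numeral k)) = k"
  by simp

text \<open>Runs rewrite with these rules alone, so that no general simplification rule reshapes an
  intermediate term. Each checked constant adds its own rules.\<close>

named_theorems eval
lemmas [eval] = 
  lift.simps lift0.simps pick.simps subst_var.simps subst.simps shift_var.simps
  checks_def src_ok.simps entry_ok.simps list.pred_inject
  list.map list.inject list.distinct append_Nil append_Cons rev.simps
  match'.simps match_def contract.simps whnf_app.simps whnf_ind_sg.simps whnf_ind_id.simps
  whnf_def.simps whnf_step.simps head.simps aid_ctx_def parts.simps conv_parts.simps conv_parts'.simps
  same'.simps same_def lookup.simps lift_opt.simps elim_type.simps eta''.simps eta'.simps eta.simps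
  is_lam.simps is_elim.simps conv_values'.simps conv_values_def conv_elims.simps conv_unfold.simps
  conv_step'.simps conv_step_def type_level.simps as_type'.simps as_type_def infer_binder'.simps
  infer_binder.simps infer_co.simps infer_var.simps infer_lam'.simps infer_lam.simps infer_app''.simps
  infer_app'.simps infer_app.simps apair_pat_def infer_ind_sg'''.simps infer_ind_sg''.simps
  infer_ind_sg'.simps infer_ind_sg.simps infer_id'.simps infer_id.simps infer_rfl.simps arefl_pat_def
  infer_ind_id''''.simps infer_ind_id'''.simps infer_ind_id''.simps infer_ind_id'.simps infer_ind_id.simps
  infer_const.simps infer_asc'.simps infer_asc.simps check_args''.simps check_args'.simps
  check_args.simps infer_def.simps infer_step.simps check_lam'''.simps check_lam''.simps
  check_lam'.simps check_lam.simps check_pr''.simps check_pr'.simps check_pr.simps check_rfl''.simps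
  check_rfl'.simps check_rfl.simps check_cumul'.simps check_cumul.simps check_infer'.simps
  check_infer.simps check_step.simps elab_ctx'.simps elab_ctx.simps elab_dfn'''.simps elab_dfn''.simps
  elab_dfn'.simps elab_dfn_def
  atm.inject atm.distinct num.inject num.distinct nat.inject nat.distinct simp_thms
  option.map prod.case add_0 add_Suc list.size
  elab.simps fuel_def step_rules Num.BitM.simps le_rules max_rules sub_rules
  stele.simps entry_def con_def sexpr_defs Let_def num_rules tag_rule


section \<open>The terms\<close>

subsection \<open>Functions, equivalences and paths\<close>

text \<open>
  A constant \<open>x\<close> consists of its source \<open>S_x\<close> (telescope, type and body, where \<open>base\<close> stands for the
  variables \<open>V\<close> and \<open>El\<close>) and the source term \<open>c_x as\<close> applying it.  Applied constants stay folded until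
  the checker needs their bodies, which keeps the terms small; those with flag \<open>False\<close> are never
  unfolded.
\<close>

definition "S_fcomp =
    (let A = sv 0; B = sv 1; C = sv 2; g = sv 3; f = sv 4 in
     entry True [su 0, su 0, su 0, B \<rightharpoonup> C, A \<rightharpoonup> B]
       (A \<rightharpoonup> C)
       (sfcomp A g f))"
abbreviation "c_fcomp A B C g f \<equiv> con 2 S_fcomp [A, B, C, g, f]"
schematic_goal E_fcomp [THEN checks_const, eval]: "checks S_fcomp ?d"
  by (simp only: S_fcomp_def eval)

definition "S_htpy =
    (let P = sv 0; C = sv 1; l = sv 2; r = sv 3 in
     entry True [su 0, su 0, P \<rightharpoonup> C, P \<rightharpoonup> C]
       (su 0)
       (\<Pi> x:P. sid C (l \<star> x) (r \<star> x)))"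
abbreviation "c_htpy P C l r \<equiv> con 3 S_htpy [P, C, l, r]"
schematic_goal E_htpy [THEN checks_const, eval]: "checks S_htpy ?d"
  by (simp only: S_htpy_def eval)

definition "S_happly =
    (let P = sv 0; C = sv 1; l = sv 2; r = sv 3; p = sv 4 in
     entry True [su 0, su 0, P \<rightharpoonup> C, P \<rightharpoonup> C, sid (P \<rightharpoonup> C) l r]
       (c_htpy P C l r)
       (shapply P (\<lambda>_. C) l r p))"
abbreviation "c_happly P C l r p \<equiv> con 4 S_happly [P, C, l, r, p]"
schematic_goal E_happly [THEN checks_const, eval]: "checks S_happly ?d"
  by (simp only: S_happly_def eval)

definition "S_isequiv =
    (let X = sv 0; Y = sv 1; x = sv 2 in
     entry True [su 0, su 0, X \<rightharpoonup> Y]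
       (su 0)
       (sisequiv X Y x))"
abbreviation "c_isequiv X Y x \<equiv> con 5 S_isequiv [X, Y, x]"
schematic_goal E_isequiv [THEN checks_const, eval]: "checks S_isequiv ?d"
  by (simp only: S_isequiv_def eval)

definition "S_equivt =
    (let X = sv 0; Y = sv 1 in
     entry True [su 0, su 0]
       (su 0)
       (\<Sigma> f:X \<rightharpoonup> Y. c_isequiv X Y f))"
abbreviation "c_equivt X Y \<equiv> con 6 S_equivt [X, Y]"
schematic_goal [THEN checks_const, eval]: "checks S_equivt ?d"
  by (simp only: S_equivt_def eval)

definition "S_eqv_inv =
    (let X1 = sv 0; Y = sv 1; f = sv 2; e = sv 3 in
     entry True [su 0, su 0, X1 \<rightharpoonup> Y, c_isequiv X1 Y f]
       (Y \<rightharpoonup> X1)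
       (sfst (Y \<rightharpoonup> X1) (sfst (\<Sigma> g:Y \<rightharpoonup> X1. \<Pi> y:Y. sid Y (f \<star> (g \<star> y)) y) e)))"
abbreviation "c_eqv_inv X1 Y f e \<equiv> con 7 S_eqv_inv [X1, Y, f, e]"
schematic_goal E_eqv_inv [THEN checks_const, eval]: "checks S_eqv_inv ?d"
  by (simp only: S_eqv_inv_def eval)

definition "S_eqv_sec =
    (let X = sv 0; Y = sv 1; f = sv 2; e = sv 3 in
     entry True [su 0, su 0, X \<rightharpoonup> Y, c_isequiv X Y f]
       (\<Pi> y:Y. sid Y (f \<star> (c_eqv_inv X Y f e \<star> y)) y)
       (ssnd (Y \<rightharpoonup> X) (\<lambda>g. \<Pi> y:Y. sid Y (f \<star> (g \<star> y)) y) (sfst (\<Sigma> g:Y \<rightharpoonup> X. \<Pi> y:Y. sid Y (f \<star> (g \<star> y))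
         y) e)))"
abbreviation "c_eqv_sec X Y f e \<equiv> con 8 S_eqv_sec [X, Y, f, e]"
schematic_goal [THEN checks_const, eval]: "checks S_eqv_sec ?d"
  by (simp only: S_eqv_sec_def eval)

definition "S_eqv_linv =
    (let X = sv 0; Y = sv 1; f = sv 2; e = sv 3 in
     entry True [su 0, su 0, X \<rightharpoonup> Y, c_isequiv X Y f]
       (Y \<rightharpoonup> X)
       (sfst (Y \<rightharpoonup> X) (ssnd (\<Sigma> g:Y \<rightharpoonup> X. \<Pi> y:Y. sid Y (f \<star> (g \<star> y)) y) (\<lambda>_. \<Sigma> h:Y \<rightharpoonup> X. \<Pi> x:X. sid X (h
         \<star> (f \<star> x)) x) e)))"
abbreviation "c_eqv_linv X Y f e \<equiv> con 9 S_eqv_linv [X, Y, f, e]"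
schematic_goal [THEN checks_const, eval]: "checks S_eqv_linv ?d"
  by (simp only: S_eqv_linv_def eval)

definition "S_eqv_ret =
    (let X = sv 0; Y = sv 1; f = sv 2; e = sv 3 in
     entry True [su 0, su 0, X \<rightharpoonup> Y, c_isequiv X Y f]
       (\<Pi> x:X. sid X (c_eqv_linv X Y f e \<star> (f \<star> x)) x)
       (ssnd (Y \<rightharpoonup> X) (\<lambda>h. \<Pi> x:X. sid X (h \<star> (f \<star> x)) x) (ssnd (\<Sigma> g:Y \<rightharpoonup> X. \<Pi> y:Y. sid Y (f \<star> (g \<star> y))
         y) (\<lambda>_. \<Sigma> h:Y \<rightharpoonup> X. \<Pi> x:X. sid X (h \<star> (f \<star> x)) x) e)))"
abbreviation "c_eqv_ret X Y f e \<equiv> con 10 S_eqv_ret [X, Y, f, e]"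
schematic_goal [THEN checks_const, eval]: "checks S_eqv_ret ?d"
  by (simp only: S_eqv_ret_def eval)

text \<open>The identity types of the universe, and the type of spans, live in the next universe.\<close>

definition "S_eqv_inv_large =
    (let X1 = sv 0; Y = sv 1; f = sv 2; e = sv 3 in
     entry True [su (Suc 0), su (Suc 0), X1 \<rightharpoonup> Y, sisequiv X1 Y f]
       (Y \<rightharpoonup> X1)
       (sfst (Y \<rightharpoonup> X1) (sfst (\<Sigma> g:Y \<rightharpoonup> X1. \<Pi> y:Y. sid Y (f \<star> (g \<star> y)) y) e)))"
abbreviation "c_eqv_inv_large X1 Y f e \<equiv> con 11 S_eqv_inv_large [X1, Y, f, e]"
schematic_goal [THEN checks_const, eval]: "checks S_eqv_inv_large ?d"
  by (simp only: S_eqv_inv_large_def eval)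

definition "S_eqv_sec_large =
    (let X = sv 0; Y = sv 1; f = sv 2; e = sv 3 in
     entry True [su (Suc 0), su (Suc 0), X \<rightharpoonup> Y, sisequiv X Y f]
       (\<Pi> y:Y. sid Y (f \<star> (c_eqv_inv_large X Y f e \<star> y)) y)
       (ssnd (Y \<rightharpoonup> X) (\<lambda>g. \<Pi> y:Y. sid Y (f \<star> (g \<star> y)) y) (sfst (\<Sigma> g:Y \<rightharpoonup> X. \<Pi> y:Y. sid Y (f \<star> (g \<star> y))
         y) e)))"
abbreviation "c_eqv_sec_large X Y f e \<equiv> con 12 S_eqv_sec_large [X, Y, f, e]"
schematic_goal [THEN checks_const, eval]: "checks S_eqv_sec_large ?d"
  by (simp only: S_eqv_sec_large_def eval)

definition "S_happly_fun =
    (let P = sv 0; C = sv 1; l = sv 2; r = sv 3 in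
     entry True [su 0, su 0, P \<rightharpoonup> C, P \<rightharpoonup> C]
       (sid (P \<rightharpoonup> C) l r \<rightharpoonup> c_htpy P C l r)
       (\<Lambda> p:sid (P \<rightharpoonup> C) l r. c_happly P C l r p))"
abbreviation "c_happly_fun P C l r \<equiv> con 15 S_happly_fun [P, C, l, r]"
schematic_goal E_happly_fun [THEN checks_const, eval]: "checks S_happly_fun ?d"
  by (simp only: S_happly_fun_def eval)

definition "S_funext_eqv =
    (let P = sv 0; C = sv 1; l = sv 2; r = sv 3 in
     entry True [su 0, su 0, P \<rightharpoonup> C, P \<rightharpoonup> C]
       (c_isequiv (sid (P \<rightharpoonup> C) l r) (c_htpy P C l r) (c_happly_fun P C l r))
       (sfx 0 \<star> P \<star> (\<Lambda> _:P. C) \<star> l \<star> r))"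
abbreviation "c_funext_eqv P C l r \<equiv> con 16 S_funext_eqv [P, C, l, r]"
schematic_goal E_funext_eqv [THEN checks_const, eval]: "checks S_funext_eqv ?d"
  by (simp only: S_funext_eqv_def eval)

definition "S_funext =
    (let P = sv 0; C = sv 1; l = sv 2; r = sv 3; h = sv 4; I = sid (P \<rightharpoonup> C) l r; K = c_htpy P C l r
      in
     entry True [su 0, su 0, P \<rightharpoonup> C, P \<rightharpoonup> C, K]
       I
       (c_eqv_inv I K (c_happly_fun P C l r) (c_funext_eqv P C l r) \<star> h))"
abbreviation "c_funext P C l r h \<equiv> con 17 S_funext [P, C, l, r, h]"
schematic_goal E_funext [THEN checks_const, eval]: "checks S_funext ?d"
  by (simp only: S_funext_def eval)

definition "S_path_inv =
    (let X1 = sv 0; x = sv 1; y = sv 2; p = sv 3 in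
     entry True [su 0, X1, X1, sid X1 x y]
       (sid X1 y x)
       (sind_id (\<lambda>u v _. sid X1 v u) (\<lambda>u. srf u) x y p))"
abbreviation "c_path_inv X1 x y p \<equiv> con 18 S_path_inv [X1, x, y, p]"
schematic_goal E_path_inv [THEN checks_const, eval]: "checks S_path_inv ?d"
  by (simp only: S_path_inv_def eval)

definition "S_path_conc =
    (let X1 = sv 0; x = sv 1; y = sv 2; z = sv 3; p = sv 4; q = sv 5 in
     entry True [su 0, X1, X1, X1, sid X1 x y, sid X1 y z]
       (sid X1 x z)
       (sind_id (\<lambda>u v _. sid X1 x u \<rightharpoonup> sid X1 x v) (\<lambda>u. \<Lambda> h:sid X1 x u. h) y z q \<star> p))"
abbreviation "c_path_conc X1 x y z p q \<equiv> con 19 S_path_conc [X1, x, y, z, p, q]"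
schematic_goal E_path_conc [THEN checks_const, eval]: "checks S_path_conc ?d"
  by (simp only: S_path_conc_def eval)

definition "S_ap =
    (let X = sv 0; Y = sv 1; f = sv 2; x = sv 3; y = sv 4; p = sv 5 in
     entry True [su 0, su 0, X \<rightharpoonup> Y, X, X, sid X x y]
       (sid Y (f \<star> x) (f \<star> y))
       (sap Y f x y p))"
abbreviation "c_ap X Y f x y p \<equiv> con 20 S_ap [X, Y, f, x, y, p]"
schematic_goal E_ap [THEN checks_const, eval]: "checks S_ap ?d"
  by (simp only: S_ap_def eval)

definition "S_path_conc_large =
    (let X1 = sv 0; x = sv 1; y = sv 2; z = sv 3; p = sv 4; q = sv 5 in
     entry True [su (Suc 0), X1, X1, X1, sid X1 x y, sid X1 y z]
       (sid X1 x z)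
       (sind_id (\<lambda>u v _. sid X1 x u \<rightharpoonup> sid X1 x v) (\<lambda>u. \<Lambda> h:sid X1 x u. h) y z q \<star> p))"
abbreviation "c_path_conc_large X1 x y z p q \<equiv> con 22 S_path_conc_large [X1, x, y, z, p, q]"
schematic_goal [THEN checks_const, eval]: "checks S_path_conc_large ?d"
  by (simp only: S_path_conc_large_def eval)

definition "S_ap_large =
    (let X = sv 0; Y = sv 1; f = sv 2; x = sv 3; y = sv 4; p = sv 5 in
     entry True [su (Suc 0), su (Suc 0), X \<rightharpoonup> Y, X, X, sid X x y]
       (sid Y (f \<star> x) (f \<star> y))
       (sap Y f x y p))"
abbreviation "c_ap_large X Y f x y p \<equiv> con 23 S_ap_large [X, Y, f, x, y, p]"
schematic_goal [THEN checks_const, eval]: "checks S_ap_large ?d"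
  by (simp only: S_ap_large_def eval)

subsection \<open>Pullbacks and function extensionality\<close>

definition "S_pb =
    (let A = sv 0; B = sv 1; C = sv 2; f = sv 3; g = sv 4 in
     entry True [su 0, su 0, su 0, A \<rightharpoonup> C, B \<rightharpoonup> C]
       (su 0)
       (\<Sigma> a:A. \<Sigma> b:B. sid C (f \<star> a) (g \<star> b)))"
abbreviation "c_pb A B C f g \<equiv> con 24 S_pb [A, B, C, f, g]"
schematic_goal E_pb [THEN checks_const, eval]: "checks S_pb ?d"
  by (simp only: S_pb_def eval)

definition "S_pb_pair =
    (let A = sv 0; B = sv 1; C = sv 2; f = sv 3; g = sv 4; a = sv 5; b = sv 6; k = sv 7 in
     entry True [su 0, su 0, su 0, A \<rightharpoonup> C, B \<rightharpoonup> C, A, B, sid C (f \<star> a) (g \<star> b)]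
       (c_pb A B C f g)
       \<lblot>a, \<lblot>b, k\<rblot>\<rblot>)"
abbreviation "c_pb_pair A B C f g a b k \<equiv> con 25 S_pb_pair [A, B, C, f, g, a, b, k]"
schematic_goal [THEN checks_const, eval]: "checks S_pb_pair ?d"
  by (simp only: S_pb_pair_def eval)

definition "S_pb1 =
    (let A = sv 0; B = sv 1; C = sv 2; f = sv 3; g = sv 4 in
     entry True [su 0, su 0, su 0, A \<rightharpoonup> C, B \<rightharpoonup> C]
       (c_pb A B C f g \<rightharpoonup> A)
       (\<Lambda> w:c_pb A B C f g. sfst A w))"
abbreviation "c_pb1 A B C f g \<equiv> con 26 S_pb1 [A, B, C, f, g]"
schematic_goal E_pb1 [THEN checks_const, eval]: "checks S_pb1 ?d"
  by (simp only: S_pb1_def eval)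

definition "S_pb2 =
    (let A = sv 0; B = sv 1; C = sv 2; f = sv 3; g = sv 4 in
     entry True [su 0, su 0, su 0, A \<rightharpoonup> C, B \<rightharpoonup> C]
       (c_pb A B C f g \<rightharpoonup> B)
       (\<Lambda> w:\<Sigma> a:A. \<Sigma> b:B. sid C (f \<star> a) (g \<star> b). sfst B (ssnd A (\<lambda>a. \<Sigma> b:B. sid C (f \<star> a) (g \<star> b))
         w)))"
abbreviation "c_pb2 A B C f g \<equiv> con 27 S_pb2 [A, B, C, f, g]"
schematic_goal E_pb2 [THEN checks_const, eval]: "checks S_pb2 ?d"
  by (simp only: S_pb2_def eval)

definition "S_pb3 =
    (let A = sv 0; B = sv 1; C = sv 2; f = sv 3; g = sv 4; P = c_pb A B C f g in
     entry True [su 0, su 0, su 0, A \<rightharpoonup> C, B \<rightharpoonup> C]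
       (c_htpy P C (c_fcomp P A C f (c_pb1 A B C f g)) (c_fcomp P B C g (c_pb2 A B C f g)))
       (\<Lambda> w:\<Sigma> a:A. \<Sigma> b:B. sid C (f \<star> a) (g \<star> b). ssnd B (\<lambda>b. sid C (f \<star> sfst A w) (g \<star> b)) (ssnd A
         (\<lambda>a. \<Sigma> b:B. sid C (f \<star> a) (g \<star> b)) w)))"
abbreviation "c_pb3 A B C f g \<equiv> con 28 S_pb3 [A, B, C, f, g]"
schematic_goal E_pb3 [THEN checks_const, eval]: "checks S_pb3 ?d"
  by (simp only: S_pb3_def eval)

text \<open>There is no judgmental uniqueness for pairs, so a point of the pullback is identified
  with the tuple of its projections by two Sigma inductions; on a literal triple the projections
  compute. The ascriptions are there because a bare pair has no inferable type.\<close>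

definition "S_pb_eta =
    (let A = sv 0; B = sv 1; C = sv 2; f = sv 3; g = sv 4; z = sv 5; P = c_pb A B C f g in
     entry False [su 0, su 0, su 0, A \<rightharpoonup> C, B \<rightharpoonup> C, P]
       (sid P (c_pb_pair A B C f g (c_pb1 A B C f g \<star> z) (c_pb2 A B C f g \<star> z) (c_pb3 A B C f g \<star>
         z)) z)
       (sind_sg (\<lambda>z'. sid P (c_pb_pair A B C f g (c_pb1 A B C f g \<star> z') (c_pb2 A B C f g \<star> z')
         (c_pb3 A B C f g \<star> z')) z') (\<lambda>a t. sind_sg (\<lambda>t'. sid P (c_pb_pair A B C f g (c_pb1 A B C f
         g \<star> (\<lblot>a, t'\<rblot> \<Colon> c_pb A B C f g)) (c_pb2 A B C f g \<star> (\<lblot>a, t'\<rblot> \<Colon> c_pb A B C f g)) (c_pb3 A B C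
         f g \<star> (\<lblot>a, t'\<rblot> \<Colon> c_pb A B C f g))) \<lblot>a, t'\<rblot>) (\<lambda>b r. srf \<lblot>a, \<lblot>b, r\<rblot>\<rblot>) t) z))"
abbreviation "c_pb_eta A B C f g z \<equiv> con 29 S_pb_eta [A, B, C, f, g, z]"
schematic_goal [THEN checks_const, eval]: "checks S_pb_eta ?d"
  by (simp only: S_pb_eta_def eval)

definition "S_whisk =
    (let X = sv 0; P = sv 1; C = sv 2; l = sv 3; r = sv 4; u = sv 5; al = sv 6 in
     entry True [su 0, su 0, su 0, P \<rightharpoonup> C, P \<rightharpoonup> C, X \<rightharpoonup> P, sid (P \<rightharpoonup> C) l r]
       (sid (X \<rightharpoonup> C) (c_fcomp X P C l u) (c_fcomp X P C r u))
       (c_ap (P \<rightharpoonup> C) (X \<rightharpoonup> C) (\<Lambda> s:P \<rightharpoonup> C. c_fcomp X P C s u) l r al))"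
abbreviation "c_whisk X P C l r u al \<equiv> con 30 S_whisk [X, P, C, l, r, u, al]"
schematic_goal [THEN checks_const, eval]: "checks S_whisk ?d"
  by (simp only: S_whisk_def eval)

text \<open>For an arbitrary path in place of \<open>c_funext P C l r h\<close>, evaluating the
  whiskered path is evaluating the path at \<open>u x\<close>, by path induction. Only afterwards is
  \<open>happly\<close> of the extensionality path replaced by \<open>h\<close>, using that
  extensionality is a right inverse.\<close>

definition "S_happly_whisk =
    (let X = sv 0; P = sv 1; C = sv 2; l = sv 3; r = sv 4; u = sv 5; h = sv 6; lu = c_fcomp X P C l
      u; ru = c_fcomp X P C r u; al2 = c_funext P C l r h; y = (\<Lambda> x:X. h \<star> (u \<star> x)) \<Colon> c_htpy X C lu
      ru; k2 = c_happly X C lu ru (c_whisk X P C l r u al2); K = c_htpy X C lu ru; K2 = c_htpy P C l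
      r in
     entry False [su 0, su 0, su 0, P \<rightharpoonup> C, P \<rightharpoonup> C, X \<rightharpoonup> P, K2]
       (sid K k2 y)
       (c_path_conc K k2 ((\<Lambda> x:X. c_happly P C l r al2 \<star> (u \<star> x)) \<Colon> c_htpy X C lu ru) y (sind_id
         (\<lambda>l' r' al. sid (c_htpy X C (c_fcomp X P C l' u) (c_fcomp X P C r' u)) (c_happly X C
         (c_fcomp X P C l' u) (c_fcomp X P C r' u) (c_whisk X P C l' r' u al)) ((\<Lambda> x:X. c_happly P C
         l' r' al \<star> (u \<star> x)) \<Colon> c_htpy X C (c_fcomp X P C l' u) (c_fcomp X P C r' u))) (\<lambda>l'. srf
         (\<Lambda> x:X. srf (l' \<star> (u \<star> x)))) l r al2) (c_ap K2 K (\<Lambda> k:c_htpy P C l r. (\<Lambda> x:X. k \<star> (u \<star> x))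
         \<Colon> c_htpy X C lu ru) (c_happly P C l r al2) h (c_eqv_sec (sid (P \<rightharpoonup> C) l r) K2 (c_happly_fun
         P C l r) (c_funext_eqv P C l r) \<star> h))))"
abbreviation "c_happly_whisk X P C l r u h \<equiv> con 31 S_happly_whisk [X, P, C, l, r, u, h]"
schematic_goal [THEN checks_const, eval]: "checks S_happly_whisk ?d"
  by (simp only: S_happly_whisk_def eval)

text \<open>\<open>c_funext\<close> is by construction the right inverse of \<open>happly\<close>;
  that it also cancels on the other side is the usual zigzag. The left inverse takes
  \<open>happly M\<close> back to \<open>M\<close> and \<open>happly b\<close> back to
  \<open>b\<close>, and the two values of \<open>happly\<close> agree by the section law.\<close>

definition "S_funext_happly =
    (let X = sv 0; C = sv 1; c = sv 2; d = sv 3; b = sv 4; I = sid (X \<rightharpoonup> C) c d; y2 = c_happly_fun X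
      C c d; y3 = c_funext_eqv X C c d; K = c_htpy X C c d; M = c_eqv_inv I K y2 y3 \<star> c_happly X C c
      d b; y4 = c_happly_fun X C c d \<star> M; y = c_eqv_linv I K y2 y3 \<star> y4; k = c_happly X C c d b in
     entry False [su 0, su 0, X \<rightharpoonup> C, X \<rightharpoonup> C, I]
       (sid I (c_funext X C c d k) b)
       (c_path_conc I M y b (c_path_inv I y M (c_eqv_ret I K y2 y3 \<star> M)) (c_path_conc I y
         (c_eqv_linv I K y2 y3 \<star> c_happly X C c d b) b (c_ap K I (c_eqv_linv I K y2 y3) y4 k
         (c_eqv_sec I K y2 y3 \<star> c_happly X C c d b)) (c_eqv_ret I K y2 y3 \<star> b))))"
abbreviation "c_funext_happly X C c d b \<equiv> con 32 S_funext_happly [X, C, c, d, b]"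
schematic_goal [THEN checks_const, eval]: "checks S_funext_happly ?d"
  by (simp only: S_funext_happly_def eval)

text \<open>Extensionality is applied to \<open>e\<close>, and both ends are cancelled with
  \<open>c_funext_happly\<close>.\<close>

definition "S_happly_inj =
    (let X = sv 0; C = sv 1; c = sv 2; d = sv 3; b = sv 4; b2 = sv 5; e = sv 6; I = sid (X \<rightharpoonup> C) c d;
      z = \<Lambda> h:c_htpy X C c d. c_funext X C c d h; y = z \<star> c_happly X C c d b; k = c_happly X C c d
      b2; k2 = c_happly X C c d b; K = c_htpy X C c d in
     entry False [su 0, su 0, X \<rightharpoonup> C, X \<rightharpoonup> C, I, I, sid K k2 k]
       (sid I b b2)
       (c_path_conc I b y b2 (c_path_inv I y b (c_funext_happly X C c d b)) (c_path_conc I y (z \<star>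
         c_happly X C c d b2) b2 (c_ap K I z k2 k e) (c_funext_happly X C c d b2))))"
abbreviation "c_happly_inj X C c d b b2 e \<equiv> con 33 S_happly_inj [X, C, c, d, b, b2, e]"
schematic_goal [THEN checks_const, eval]: "checks S_happly_inj ?d"
  by (simp only: S_happly_inj_def eval)

subsection \<open>The functor\<close>

definition "S_bang =
    (let A = sv 2 in
     entry True (base @ [su 0])
       (su 0)
       (\<Sigma> E:VS. ElS E \<rightharpoonup> A))"
abbreviation "c_bang A \<equiv> con 34 S_bang [VS, sv (Suc 0), A]"
schematic_goal E_bang [THEN checks_const, eval]: "checks S_bang ?d"
  by (simp only: S_bang_def eval)

definition "S_bang_fun =
    (let A = sv 2; B = sv 3; f = sv 4 in
     entry True (base @ [su 0, su 0, A \<rightharpoonup> B])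
       (c_bang A \<rightharpoonup> c_bang B)
       (\<Lambda> w:c_bang A. \<lblot>sfst VS w, sfcomp (ElS (sfst VS w)) f (ssnd VS (\<lambda>E. ElS E \<rightharpoonup> A) w)\<rblot>))"
abbreviation "c_bang_fun A B f \<equiv> con 35 S_bang_fun [VS, sv (Suc 0), A, B, f]"
schematic_goal E_bang_fun [THEN checks_const, eval]: "checks S_bang_fun ?d"
  by (simp only: S_bang_fun_def eval)

definition "S_bang_pair =
    (let C = sv 2; E = sv 3; s = sv 4 in
     entry True (base @ [su 0, VS, ElS E \<rightharpoonup> C])
       (c_bang C)
       \<lblot>E, s\<rblot>)"
abbreviation "c_bang_pair C E s \<equiv> con 36 S_bang_pair [VS, sv (Suc 0), C, E, s]"
schematic_goal [THEN checks_const, eval]: "checks S_bang_pair ?d"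
  by (simp only: S_bang_pair_def eval)

definition "S_bang_fst =
    (let C = sv 2; x = sv 3 in
     entry True (base @ [su 0, c_bang C])
       VS
       (sfst VS x))"
abbreviation "c_bang_fst C x \<equiv> con 37 S_bang_fst [VS, sv (Suc 0), C, x]"
schematic_goal [THEN checks_const, eval]: "checks S_bang_fst ?d"
  by (simp only: S_bang_fst_def eval)

definition "S_bang_snd =
    (let C = sv 2; x = sv 3 in
     entry True (base @ [su 0, c_bang C])
       (ElS (c_bang_fst C x) \<rightharpoonup> C)
       (ssnd VS (\<lambda>E. ElS E \<rightharpoonup> C) x))"
abbreviation "c_bang_snd C x \<equiv> con 38 S_bang_snd [VS, sv (Suc 0), C, x]"
schematic_goal [THEN checks_const, eval]: "checks S_bang_snd ?d"
  by (simp only: S_bang_snd_def eval)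

definition "S_bang_path =
    (let C = sv 2; E = sv 3; c = sv 4; d = sv 5; b = sv 6 in
     entry True (base @ [su 0, VS, ElS E \<rightharpoonup> C, ElS E \<rightharpoonup> C, sid (ElS E \<rightharpoonup> C) c d])
       (sid (c_bang C) (c_bang_pair C E c) (c_bang_pair C E d))
       (c_ap (ElS E \<rightharpoonup> C) (c_bang C) (\<Lambda> s:ElS E \<rightharpoonup> C. c_bang_pair C E s) c d b))"
abbreviation "c_bang_path C E c d b \<equiv> con 39 S_bang_path [VS, sv (Suc 0), C, E, c, d, b]"
schematic_goal [THEN checks_const, eval]: "checks S_bang_path ?d"
  by (simp only: S_bang_path_def eval)

text \<open>In the statement the functor is an abstraction applied to a type. The redex is kept
  inside a constant, so that the erasure is literally the raw term of the statement while conversion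
  can still reduce it. \<open>c_bang_mor\<close> and \<open>c_bang_cmp\<close> preserve the other
  redexes in the same way.\<close>

definition "S_bang_ob =
    (let A = sv 2 in
     entry True (base @ [su 0])
       (su 0)
       ((\<Lambda> A':su 0. c_bang A') \<star> A))"
abbreviation "c_bang_ob A \<equiv> con 40 S_bang_ob [VS, sv (Suc 0), A]"
schematic_goal E_bang_ob [THEN checks_const, eval]: "checks S_bang_ob ?d"
  by (simp only: S_bang_ob_def eval)

definition "S_bang_mor =
    (let A = sv 2; B = sv 3 in
     entry True (base @ [su 0, su 0])
       ((A \<rightharpoonup> B) \<rightharpoonup> c_bang A \<rightharpoonup> c_bang B)
       (((\<Lambda> A:su 0. \<Lambda> B:su 0. \<Lambda> f:A \<rightharpoonup> B. c_bang_fun A B f) \<Colon> (\<Pi> A:su 0. \<Pi> B:su 0. (A \<rightharpoonup> B) \<rightharpoonup> c_bang A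
         \<rightharpoonup> c_bang B)) \<star> A \<star> B))"
abbreviation "c_bang_mor A B \<equiv> con 41 S_bang_mor [VS, sv (Suc 0), A, B]"
schematic_goal E_bang_mor [THEN checks_const, eval]: "checks S_bang_mor ?d"
  by (simp only: S_bang_mor_def eval)

definition "S_bang_mor_at =
    (let A = sv 2; B = sv 3; f = sv 4 in
     entry True (base @ [su 0, su 0, A \<rightharpoonup> B])
       (c_bang A \<rightharpoonup> c_bang B)
       (c_bang_mor A B \<star> f))"
abbreviation "c_bang_mor_at A B f \<equiv> con 42 S_bang_mor_at [VS, sv (Suc 0), A, B, f]"
schematic_goal E_bang_mor_at [THEN checks_const, eval]: "checks S_bang_mor_at ?d"
  by (simp only: S_bang_mor_at_def eval)

text \<open>This is the normal shape of the comparison path. Preservation of composition is a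
  reflexivity, and concatenation computes on its second path, so the trailing reflexivity disappears
  and the leading one stays.\<close>

definition "S_bang_fun_path =
    (let P = sv 2; C = sv 3; l = sv 4; r = sv 5; al = sv 6; bX = c_bang P \<rightharpoonup> c_bang C; bf =
      c_bang_fun P C l; bf2 = c_bang_fun P C r in
     entry True (base @ [su 0, su 0, P \<rightharpoonup> C, P \<rightharpoonup> C, sid (P \<rightharpoonup> C) l r])
       (sid bX bf bf2)
       (c_path_conc bX bf bf bf2 (srf bf) (c_ap (P \<rightharpoonup> C) bX (c_bang_mor P C) l r al)))"
abbreviation "c_bang_fun_path P C l r al \<equiv> con 43 S_bang_fun_path [VS, sv (Suc 0), P, C, l, r, al]"
schematic_goal [THEN checks_const, eval]: "checks S_bang_fun_path ?d"
  by (simp only: S_bang_fun_path_def eval)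

text \<open>
  What the comparison path does at \<open>(E, u)\<close>: the left-hand sides of the next two constants are
  \<open>happly\<close> of such a path, the right-hand sides are paths in the second component only.
\<close>

definition "S_bang_fun_path_pair =
    (let P = sv 2; C = sv 3; l = sv 4; r = sv 5; al = sv 6; E = sv 7; u = sv 8; lu = c_fcomp (ElS E)
      P C l u; ru = c_fcomp (ElS E) P C r u in
     entry False (base @ [su 0, su 0, P \<rightharpoonup> C, P \<rightharpoonup> C, sid (P \<rightharpoonup> C) l r, VS, ElS E \<rightharpoonup> P])
       (sid (sid (c_bang C) (c_bang_pair C E lu) (c_bang_pair C E ru)) (c_happly (c_bang P) (c_bang
         C) (c_bang_fun P C l) (c_bang_fun P C r) (c_bang_fun_path P C l r al) \<star> c_bang_pair P E u)
         (c_bang_path C E lu ru (c_whisk (ElS E) P C l r u al)))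
       (sind_id (\<lambda>l' r' al'. sid (sid (c_bang C) (c_bang_pair C E (c_fcomp (ElS E) P C l' u))
         (c_bang_pair C E (c_fcomp (ElS E) P C r' u))) (c_happly (c_bang P) (c_bang C) (c_bang_fun P
         C l') (c_bang_fun P C r') (c_bang_fun_path P C l' r' al') \<star> c_bang_pair P E u) (c_bang_path
         C E (c_fcomp (ElS E) P C l' u) (c_fcomp (ElS E) P C r' u) (c_whisk (ElS E) P C l' r' u
         al'))) (\<lambda>l'. srf (srf (c_bang_pair C E (c_fcomp (ElS E) P C l' u)))) l r al))"
abbreviation "c_bang_fun_path_pair P C l r al E u \<equiv> con 44 S_bang_fun_path_pair [VS, sv (Suc 0), P, C, l, r, al, E, u]"
schematic_goal [THEN checks_const, eval]: "checks S_bang_fun_path_pair ?d"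
  by (simp only: S_bang_fun_path_pair_def eval)

definition "S_bang_funext_pair =
    (let P = sv 2; C = sv 3; l = sv 4; r = sv 5; h = sv 6; E = sv 7; u = sv 8; be = sv 9; e = sv 10;
      lu = c_fcomp (ElS E) P C l u; ru = c_fcomp (ElS E) P C r u; M = \<Lambda> be':sid (ElS E \<rightharpoonup> C) lu ru.
      c_bang_path C E lu ru be'; y = (\<Lambda> x:ElS E. h \<star> (u \<star> x)) \<Colon> c_htpy (ElS E) C lu ru; al =
      c_funext P C l r h; y2 = c_whisk (ElS E) P C l r u al; k = c_happly (ElS E) C lu ru be; K =
      c_htpy (ElS E) C lu ru; I2 = sid (ElS E \<rightharpoonup> C) lu ru; y3 = c_bang_fun_path P C l r al; w =
      c_bang_pair C E lu; w2 = c_bang_pair C E ru; I = sid (c_bang C) w w2; bf = c_bang_fun P C l;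
      bf2 = c_bang_fun P C r in
     entry False (base @ [su 0, su 0, P \<rightharpoonup> C, P \<rightharpoonup> C, c_htpy P C l r, VS, ElS E \<rightharpoonup> P, I2, sid K k y])
       (sid I (c_happly (c_bang P) (c_bang C) bf bf2 y3 \<star> c_bang_pair P E u) (c_bang_path C E lu ru
         be))
       (c_path_conc I (c_happly (c_bang P) (c_bang C) bf bf2 y3 \<star> c_bang_pair P E u \<Colon> sid (c_bang C)
         w w2) (M \<star> c_whisk (ElS E) P C l r u al) (M \<star> be) (c_bang_fun_path_pair P C l r al E u)
         (c_ap I2 I M y2 be (c_happly_inj (ElS E) C lu ru y2 be (c_path_conc K (c_happly (ElS E) C
         lu ru y2) y k (c_happly_whisk (ElS E) P C l r u h) (c_path_inv K k y e))))))"
abbreviation "c_bang_funext_pair P C l r h E u be e \<equiv> con 45 S_bang_funext_pair [VS, sv (Suc 0), P, C, l, r, h, E, u, be, e]"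
schematic_goal [THEN checks_const, eval]: "checks S_bang_funext_pair ?d"
  by (simp only: S_bang_funext_pair_def eval)

subsection \<open>Fibres\<close>

text \<open>\<open>lifts\<close> is the fibre of \<open>g \<circ> _\<close> over \<open>c\<close>, in the form in which it occurs in a cone.\<close>

definition "S_lifts =
    (let B = sv 2; C = sv 3; g = sv 4; E = sv 5; c = sv 6 in
     entry True (base @ [su 0, su 0, B \<rightharpoonup> C, VS, ElS E \<rightharpoonup> C])
       (su 0)
       (\<Sigma> b:ElS E \<rightharpoonup> B. sid (ElS E \<rightharpoonup> C) c (c_fcomp (ElS E) B C g b)))"
abbreviation "c_lifts B C g E c \<equiv> con 46 S_lifts [VS, sv (Suc 0), B, C, g, E, c]"
schematic_goal [THEN checks_const, eval]: "checks S_lifts ?d"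
  by (simp only: S_lifts_def eval)

definition "S_fibre =
    (let B = sv 2; C = sv 3; g = sv 4; x = sv 5 in
     entry True (base @ [su 0, su 0, B \<rightharpoonup> C, c_bang C])
       (su 0)
       (\<Sigma> w:c_bang B. sid (c_bang C) x (c_bang_fun B C g \<star> w)))"
abbreviation "c_fibre B C g x \<equiv> con 47 S_fibre [VS, sv (Suc 0), B, C, g, x]"
schematic_goal [THEN checks_const, eval]: "checks S_fibre ?d"
  by (simp only: S_fibre_def eval)

definition "S_lifts_pair =
    (let B = sv 2; C = sv 3; g = sv 4; E = sv 5; c = sv 6; b = sv 7; be = sv 8 in
     entry True (base @ [su 0, su 0, B \<rightharpoonup> C, VS, ElS E \<rightharpoonup> C, ElS E \<rightharpoonup> B, sid (ElS E \<rightharpoonup> C) c (c_fcomp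
       (ElS E) B C g b)])
       (c_lifts B C g E c)
       \<lblot>b, be\<rblot>)"
abbreviation "c_lifts_pair B C g E c b be \<equiv> con 48 S_lifts_pair [VS, sv (Suc 0), B, C, g, E, c, b, be]"
schematic_goal [THEN checks_const, eval]: "checks S_lifts_pair ?d"
  by (simp only: S_lifts_pair_def eval)

definition "S_fibre_pair =
    (let B = sv 2; C = sv 3; g = sv 4; x = sv 5; w = sv 6; th = sv 7 in
     entry True (base @ [su 0, su 0, B \<rightharpoonup> C, c_bang C, c_bang B, sid (c_bang C) x (c_bang_fun B C g \<star>
       w)])
       (c_fibre B C g x)
       \<lblot>w, th\<rblot>)"
abbreviation "c_fibre_pair B C g x w th \<equiv> con 49 S_fibre_pair [VS, sv (Suc 0), B, C, g, x, w, th]"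
schematic_goal [THEN checks_const, eval]: "checks S_fibre_pair ?d"
  by (simp only: S_fibre_pair_def eval)

definition "S_lifts_to_fibre =
    (let B = sv 2; C = sv 3; g = sv 4; E = sv 5; c = sv 6; w = c_bang_pair C E c in
     entry True (base @ [su 0, su 0, B \<rightharpoonup> C, VS, ElS E \<rightharpoonup> C])
       (c_lifts B C g E c \<rightharpoonup> c_fibre B C g w)
       (\<Lambda> s:c_lifts B C g E c. sind_sg (\<lambda>_. c_fibre B C g w) (\<lambda>b be. \<lblot>c_bang_pair B E b, c_bang_path
         C E c (c_fcomp (ElS E) B C g b) be\<rblot>) s))"
abbreviation "c_lifts_to_fibre B C g E c \<equiv> con 50 S_lifts_to_fibre [VS, sv (Suc 0), B, C, g, E, c]"
schematic_goal [THEN checks_const, eval]: "checks S_lifts_to_fibre ?d"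
  by (simp only: S_lifts_to_fibre_def eval)

text \<open>Over \<open>!g w\<close> there is an evident lift, the second component of
  \<open>w\<close> with a reflexivity. It is transported along the inverse of \<open>th\<close> to
  \<open>x\<close>, with path induction into the functions between the types of lifts.\<close>

definition "S_fibre_to_lifts =
    (let B = sv 2; C = sv 3; g = sv 4; x = sv 5; y = c_bang_fst C x; y2 = c_bang_snd C x in
     entry True (base @ [su 0, su 0, B \<rightharpoonup> C, c_bang C])
       (c_fibre B C g x \<rightharpoonup> c_lifts B C g y y2)
       (\<Lambda> t:c_fibre B C g x. sind_sg (\<lambda>_. c_lifts B C g y y2) (\<lambda>w th. sind_id (\<lambda>u v _. c_lifts B C g
         (c_bang_fst C u) (c_bang_snd C u) \<rightharpoonup> c_lifts B C g (c_bang_fst C v) (c_bang_snd C v)) (\<lambda>u.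
         \<Lambda> h:c_lifts B C g (c_bang_fst C u) (c_bang_snd C u). h) (c_bang_fun B C g \<star> w) x
         (c_path_inv (c_bang C) x (c_bang_fun B C g \<star> w) th) \<star> c_lifts_pair B C g (c_bang_fst C
         (c_bang_fun B C g \<star> w)) (c_bang_snd C (c_bang_fun B C g \<star> w)) (c_bang_snd B w) (srf
         (c_fcomp (ElS (c_bang_fst B w)) B C g (c_bang_snd B w)))) t))"
abbreviation "c_fibre_to_lifts B C g x \<equiv> con 51 S_fibre_to_lifts [VS, sv (Suc 0), B, C, g, x]"
schematic_goal [THEN checks_const, eval]: "checks S_fibre_to_lifts ?d"
  by (simp only: S_fibre_to_lifts_def eval)

text \<open>The map is extended from literal pairs to an arbitrary point \<open>x\<close> by Sigma
  induction, because the round trip below is proved by a path induction in which \<open>x\<close>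
  moves.\<close>

definition "S_lifts_to_fibre_at =
    (let B = sv 2; C = sv 3; g = sv 4; x = sv 5 in
     entry True (base @ [su 0, su 0, B \<rightharpoonup> C, c_bang C])
       (c_lifts B C g (c_bang_fst C x) (c_bang_snd C x) \<rightharpoonup> c_fibre B C g x)
       (sind_sg (\<lambda>x'. c_lifts B C g (c_bang_fst C x') (c_bang_snd C x') \<rightharpoonup> c_fibre B C g x') (\<lambda>E c.
         c_lifts_to_fibre B C g E c) x))"
abbreviation "c_lifts_to_fibre_at B C g x \<equiv> con 52 S_lifts_to_fibre_at [VS, sv (Suc 0), B, C, g, x]"
schematic_goal [THEN checks_const, eval]: "checks S_lifts_to_fibre_at ?d"
  by (simp only: S_lifts_to_fibre_at_def eval)

text \<open>Path induction with a fixed right end is derived from the rule with two free ends by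
  quantifying over all families \<open>K\<close> inside the motive. This quantification places the
  motive one universe higher.\<close>

definition "S_based_path_ind =
    (let X = sv 0; y = sv 1; D = sv 2; d = sv 3; x = sv 4; p = sv 5 in
     entry False [su 0, X, \<Pi> z:X. sid X z y \<rightharpoonup> su 0, D \<star> y \<star> srf y, X, sid X x y]
       (D \<star> x \<star> p)
       (sind_id (\<lambda>u v q. \<Pi> K:\<Pi> z:X. sid X z v \<rightharpoonup> su 0. K \<star> v \<star> srf v \<rightharpoonup> K \<star> u \<star> q) (\<lambda>u. \<Lambda> K:\<Pi> z:X. sid
         X z u \<rightharpoonup> su 0. \<Lambda> e:K \<star> u \<star> srf u. e) x y p \<star> D \<star> d))"
abbreviation "c_based_path_ind X y D d x p \<equiv> con 53 S_based_path_ind [X, y, D, d, x, p]"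
schematic_goal [THEN checks_const, eval]: "checks S_based_path_ind ?d"
  by (simp only: S_based_path_ind_def eval)

text \<open>With \<open>w\<close> split into \<open>(E, b)\<close> the path ends at a computed pair,
  and based path induction turns it into a reflexivity. At that point the transport computes and
  both sides coincide. The path is generalized before the split, as its type mentions
  \<open>w\<close>.\<close>

definition "S_fibre_lifts_fibre =
    (let B = sv 2; C = sv 3; g = sv 4; x = sv 5; t = sv 6; F0 = c_fibre B C g x in
     entry False (base @ [su 0, su 0, B \<rightharpoonup> C, c_bang C, F0])
       (sid F0 (c_lifts_to_fibre_at B C g x \<star> (c_fibre_to_lifts B C g x \<star> t)) t)
       (sind_sg (\<lambda>t'. sid F0 (c_lifts_to_fibre_at B C g x \<star> (c_fibre_to_lifts B C g x \<star> t')) t') (\<lambda>w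
         th. sind_sg (\<lambda>w'. \<Pi> th':sid (c_bang C) x (c_bang_fun B C g \<star> w'). sid F0
         (c_lifts_to_fibre_at B C g x \<star> (c_fibre_to_lifts B C g x \<star> c_fibre_pair B C g x w' th'))
         (c_fibre_pair B C g x w' th')) (\<lambda>E b. \<Lambda> th':sid (c_bang C) x (c_bang_fun B C g \<star>
         c_bang_pair B E b). c_based_path_ind (c_bang C) (c_bang_fun B C g \<star> c_bang_pair B E b)
         (\<Lambda> z:c_bang C. \<Lambda> q:sid (c_bang C) z (c_bang_fun B C g \<star> c_bang_pair B E b). sid (c_fibre B
         C g z) (c_lifts_to_fibre_at B C g z \<star> (c_fibre_to_lifts B C g z \<star> c_fibre_pair B C g z
         (c_bang_pair B E b) q)) (c_fibre_pair B C g z (c_bang_pair B E b) q)) (srf (c_fibre_pair B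
         C g (c_bang_fun B C g \<star> c_bang_pair B E b) (c_bang_pair B E b) (srf (c_bang_fun B C g \<star>
         c_bang_pair B E b)))) x th') w \<star> th) t))"
abbreviation "c_fibre_lifts_fibre B C g x t \<equiv> con 54 S_fibre_lifts_fibre [VS, sv (Suc 0), B, C, g, x, t]"
schematic_goal [THEN checks_const, eval]: "checks S_fibre_lifts_fibre ?d"
  by (simp only: S_fibre_lifts_fibre_def eval)

text \<open>The right end \<open>g \<circ> b\<close> is held fixed and \<open>c\<close> varies, so
  that based path induction reduces \<open>be\<close> to a reflexivity, where both maps
  compute.\<close>

definition "S_lifts_fibre_lifts =
    (let B = sv 2; C = sv 3; g = sv 4; E = sv 5; c = sv 6; s = sv 7; Q = c_lifts B C g E c; w =
      c_bang_pair C E c in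
     entry False (base @ [su 0, su 0, B \<rightharpoonup> C, VS, ElS E \<rightharpoonup> C, Q])
       (sid Q (c_fibre_to_lifts B C g w \<star> (c_lifts_to_fibre B C g E c \<star> s)) s)
       (sind_sg (\<lambda>s'. sid Q (c_fibre_to_lifts B C g w \<star> (c_lifts_to_fibre B C g E c \<star> s')) s') (\<lambda>b
         be. c_based_path_ind (ElS E \<rightharpoonup> C) (c_fcomp (ElS E) B C g b) (\<Lambda> z:ElS E \<rightharpoonup> C. \<Lambda> q:sid (ElS E \<rightharpoonup>
         C) z (c_fcomp (ElS E) B C g b). sid (c_lifts B C g E z) (c_fibre_to_lifts B C g
         (c_bang_pair C E z) \<star> (c_lifts_to_fibre B C g E z \<star> c_lifts_pair B C g E z b q))
         (c_lifts_pair B C g E z b q)) (srf (c_lifts_pair B C g E (c_fcomp (ElS E) B C g b) b (srf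
         (c_fcomp (ElS E) B C g b)))) c be) s))"
abbreviation "c_lifts_fibre_lifts B C g E c s \<equiv> con 55 S_lifts_fibre_lifts [VS, sv (Suc 0), B, C, g, E, c, s]"
schematic_goal [THEN checks_const, eval]: "checks S_lifts_fibre_lifts ?d"
  by (simp only: S_lifts_fibre_lifts_def eval)

subsection \<open>Equivalences\<close>

text \<open>If \<open>c \<circ> m\<close> is homotopic to \<open>n\<close>, then \<open>m\<close>
  after an inverse of \<open>n\<close> inverts \<open>c\<close>. The right inverse of
  \<open>n\<close> serves for the section; for the retraction the left inverse is taken, and
  \<open>x\<close> is first written as \<open>m\<close> of the right inverse of \<open>m\<close> at
  \<open>x\<close> in order to use the triangle.\<close>

definition "S_two_of_three =
    (let S = sv 0; X = sv 1; Y = sv 2; m = sv 3; n = sv 4; c = sv 5; H = sv 6; em = sv 7; en = sv 8;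
      z = \<Lambda> y:Y. m \<star> (c_eqv_linv S Y n en \<star> y) in
     entry False [su 0, su 0, su 0, S \<rightharpoonup> X, S \<rightharpoonup> Y, X \<rightharpoonup> Y, \<Pi> s:S. sid Y (c \<star> (m \<star> s)) (n \<star> s),
       c_isequiv S X m, c_isequiv S Y n]
       (c_isequiv X Y c)
       \<lblot>\<lblot>\<Lambda> y:Y. m \<star> (c_eqv_inv S Y n en \<star> y), \<Lambda> y:Y. c_path_conc Y (c \<star> (m \<star> (c_eqv_inv S Y n en \<star>
         y))) (n \<star> (c_eqv_inv S Y n en \<star> y)) y (H \<star> (c_eqv_inv S Y n en \<star> y)) (c_eqv_sec S Y n en \<star>
         y)\<rblot>, \<lblot>\<Lambda> y:Y. m \<star> (c_eqv_linv S Y n en \<star> y), \<Lambda> x:X. c_path_conc X (z \<star> (c \<star> x)) (z \<star> (c \<star> (m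
         \<star> (c_eqv_inv S X m em \<star> x)))) x (c_ap X X (\<Lambda> x':X. z \<star> (c \<star> x')) x (m \<star> (c_eqv_inv S X m em
         \<star> x)) (c_path_inv X (m \<star> (c_eqv_inv S X m em \<star> x)) x (c_eqv_sec S X m em \<star> x)))
         (c_path_conc X (z \<star> (c \<star> (m \<star> (c_eqv_inv S X m em \<star> x)))) (z \<star> (n \<star> (c_eqv_inv S X m em \<star>
         x))) x (c_ap Y X z (c \<star> (m \<star> (c_eqv_inv S X m em \<star> x))) (n \<star> (c_eqv_inv S X m em \<star> x)) (H \<star>
         (c_eqv_inv S X m em \<star> x))) (c_path_conc X (z \<star> (n \<star> (c_eqv_inv S X m em \<star> x))) (m \<star>
         (c_eqv_inv S X m em \<star> x)) x (c_ap S X m (c_eqv_linv S Y n en \<star> (n \<star> (c_eqv_inv S X m em \<star>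
         x))) (c_eqv_inv S X m em \<star> x) (c_eqv_ret S Y n en \<star> (c_eqv_inv S X m em \<star> x))) (c_eqv_sec S
         X m em \<star> x)))\<rblot>\<rblot>)"
abbreviation "c_two_of_three S X Y m n c H em en \<equiv> con 56 S_two_of_three [S, X, Y, m, n, c, H, em, en]"
schematic_goal [THEN checks_const, eval]: "checks S_two_of_three ?d"
  by (simp only: S_two_of_three_def eval)

definition "S_total_map =
    (let Q = sv 2; W = sv 3; m = sv 4 in
     entry True (base @ [VS \<rightharpoonup> su 0, VS \<rightharpoonup> su 0, \<Pi> E:VS. Q \<star> E \<rightharpoonup> W \<star> E])
       ((\<Sigma> E:VS. Q \<star> E) \<rightharpoonup> (\<Sigma> E:VS. W \<star> E))
       (\<Lambda> s:\<Sigma> E:VS. Q \<star> E. \<lblot>sfst VS s, m \<star> sfst VS s \<star> ssnd VS (\<lambda>E. Q \<star> E) s\<rblot>))"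
abbreviation "c_total_map Q W m \<equiv> con 57 S_total_map [VS, sv (Suc 0), Q, W, m]"
schematic_goal [THEN checks_const, eval]: "checks S_total_map ?d"
  by (simp only: S_total_map_def eval)

text \<open>The inverses are the total maps of the fibrewise right and left inverses; after
  splitting the pair, only its second component moves.\<close>

definition "S_total_map_eqv =
    (let Q = sv 2; W = sv 3; m = sv 4; e = sv 5; z = \<Lambda> E:VS. c_eqv_linv (Q \<star> E) (W \<star> E) (m \<star> E) (e \<star>
      E); z2 = \<Lambda> E:VS. c_eqv_inv (Q \<star> E) (W \<star> E) (m \<star> E) (e \<star> E) in
     entry False (base @ [VS \<rightharpoonup> su 0, VS \<rightharpoonup> su 0, \<Pi> E:VS. Q \<star> E \<rightharpoonup> W \<star> E, \<Pi> E:VS. c_isequiv (Q \<star> E) (W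
       \<star> E) (m \<star> E)])
       (c_isequiv (\<Sigma> E:VS. Q \<star> E) (\<Sigma> E:VS. W \<star> E) (c_total_map Q W m))
       \<lblot>\<lblot>c_total_map W Q z2, \<Lambda> w:\<Sigma> E:VS. W \<star> E. sind_sg (\<lambda>w'. sid (\<Sigma> E:VS. W \<star> E) (c_total_map Q W m
         \<star> (c_total_map W Q z2 \<star> w')) w') (\<lambda>E y. c_ap (W \<star> E) (\<Sigma> E:VS. W \<star> E) (\<Lambda> y':W \<star> E. \<lblot>E, y'\<rblot>)
         (m \<star> E \<star> (c_eqv_inv (Q \<star> E) (W \<star> E) (m \<star> E) (e \<star> E) \<star> y)) y (c_eqv_sec (Q \<star> E) (W \<star> E) (m \<star>
         E) (e \<star> E) \<star> y)) w\<rblot>, \<lblot>c_total_map W Q z, \<Lambda> w:\<Sigma> E:VS. Q \<star> E. sind_sg (\<lambda>w'. sid (\<Sigma> E:VS. Q \<star>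
         E) (c_total_map W Q z \<star> (c_total_map Q W m \<star> w')) w') (\<lambda>E y. c_ap (Q \<star> E) (\<Sigma> E:VS. Q \<star> E)
         (\<Lambda> y':Q \<star> E. \<lblot>E, y'\<rblot>) (c_eqv_linv (Q \<star> E) (W \<star> E) (m \<star> E) (e \<star> E) \<star> (m \<star> E \<star> y)) y
         (c_eqv_ret (Q \<star> E) (W \<star> E) (m \<star> E) (e \<star> E) \<star> y)) w\<rblot>\<rblot>)"
abbreviation "c_total_map_eqv Q W m e \<equiv> con 58 S_total_map_eqv [VS, sv (Suc 0), Q, W, m, e]"
schematic_goal [THEN checks_const, eval]: "checks S_total_map_eqv ?d"
  by (simp only: S_total_map_eqv_def eval)

subsection \<open>Maps into a pullback\<close>

definition "S_cone =
    (let X = sv 0; A = sv 1; B = sv 2; C = sv 3; f = sv 4; g = sv 5 in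
     entry True [su 0, su 0, su 0, su 0, A \<rightharpoonup> C, B \<rightharpoonup> C]
       (su 0)
       (\<Sigma> a:X \<rightharpoonup> A. \<Sigma> b:X \<rightharpoonup> B. sid (X \<rightharpoonup> C) (c_fcomp X A C f a) (c_fcomp X B C g b)))"
abbreviation "c_cone X A B C f g \<equiv> con 59 S_cone [X, A, B, C, f, g]"
schematic_goal [THEN checks_const, eval]: "checks S_cone ?d"
  by (simp only: S_cone_def eval)

definition "S_cone_pair =
    (let X = sv 0; A = sv 1; B = sv 2; C = sv 3; f = sv 4; g = sv 5; a = sv 6; b = sv 7; be = sv 8
      in
     entry True [su 0, su 0, su 0, su 0, A \<rightharpoonup> C, B \<rightharpoonup> C, X \<rightharpoonup> A, X \<rightharpoonup> B, sid (X \<rightharpoonup> C) (c_fcomp X A C f a)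
       (c_fcomp X B C g b)]
       (c_cone X A B C f g)
       \<lblot>a, \<lblot>b, be\<rblot>\<rblot>)"
abbreviation "c_cone_pair X A B C f g a b be \<equiv> con 60 S_cone_pair [X, A, B, C, f, g, a, b, be]"
schematic_goal [THEN checks_const, eval]: "checks S_cone_pair ?d"
  by (simp only: S_cone_pair_def eval)

definition "S_pb_map =
    (let X = sv 0; A = sv 1; B = sv 2; C = sv 3; f = sv 4; g = sv 5; a = sv 6; b = sv 7; k = sv 8 in
     entry True [su 0, su 0, su 0, su 0, A \<rightharpoonup> C, B \<rightharpoonup> C, X \<rightharpoonup> A, X \<rightharpoonup> B, c_htpy X C (c_fcomp X A C f a)
       (c_fcomp X B C g b)]
       (X \<rightharpoonup> c_pb A B C f g)
       (\<Lambda> x:X. \<lblot>a \<star> x, \<lblot>b \<star> x, k \<star> x\<rblot>\<rblot>))"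
abbreviation "c_pb_map X A B C f g a b k \<equiv> con 61 S_pb_map [X, A, B, C, f, g, a, b, k]"
schematic_goal [THEN checks_const, eval]: "checks S_pb_map ?d"
  by (simp only: S_pb_map_def eval)

definition "S_cone_map =
    (let X = sv 0; A = sv 1; B = sv 2; C = sv 3; f = sv 4; g = sv 5; M = \<lambda>_. X \<rightharpoonup> c_pb A B C f g in
     entry True [su 0, su 0, su 0, su 0, A \<rightharpoonup> C, B \<rightharpoonup> C]
       (c_cone X A B C f g \<rightharpoonup> X \<rightharpoonup> c_pb A B C f g)
       (\<Lambda> s:c_cone X A B C f g. sind_sg M (\<lambda>a t. sind_sg M (\<lambda>b be. c_pb_map X A B C f g a b
         (c_happly X C (c_fcomp X A C f a) (c_fcomp X B C g b) be)) t) s))"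
abbreviation "c_cone_map X A B C f g \<equiv> con 62 S_cone_map [X, A, B, C, f, g]"
schematic_goal [THEN checks_const, eval]: "checks S_cone_map ?d"
  by (simp only: S_cone_map_def eval)

definition "S_cone_map_inv =
    (let X = sv 0; A = sv 1; B = sv 2; C = sv 3; f = sv 4; g = sv 5; P = c_pb A B C f g; p1 = c_pb1
      A B C f g; q1 = c_pb2 A B C f g in
     entry True [su 0, su 0, su 0, su 0, A \<rightharpoonup> C, B \<rightharpoonup> C]
       ((X \<rightharpoonup> c_pb A B C f g) \<rightharpoonup> c_cone X A B C f g)
       (\<Lambda> u:X \<rightharpoonup> c_pb A B C f g. \<lblot>c_fcomp X P A p1 u, \<lblot>c_fcomp X P B q1 u, c_funext X C (c_fcomp X A
         C f (c_fcomp X P A p1 u)) (c_fcomp X B C g (c_fcomp X P B q1 u)) (\<Lambda> x:X. c_pb3 A B C f g \<star>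
         (u \<star> x))\<rblot>\<rblot>))"
abbreviation "c_cone_map_inv X A B C f g \<equiv> con 63 S_cone_map_inv [X, A, B, C, f, g]"
schematic_goal [THEN checks_const, eval]: "checks S_cone_map_inv ?d"
  by (simp only: S_cone_map_inv_def eval)

text \<open>The round trip leaves \<open>happly\<close> of an extensionality path, cancelled by its
  section law, and pointwise a tuple of projections, which is \<open>u x\<close> only up to
  \<open>c_pb_eta\<close>. Hence the second use of extensionality.\<close>

definition "S_cone_map_sec =
    (let X = sv 0; A = sv 1; B = sv 2; C = sv 3; f = sv 4; g = sv 5; u = sv 6; M = X \<rightharpoonup> c_pb A B C f
      g; P = c_pb A B C f g; h = c_fcomp X P A (c_pb1 A B C f g) u; h2 = c_fcomp X P B (c_pb2 A B C
      f g) u; gh2 = c_fcomp X B C g h2; fh = c_fcomp X A C f h; y = (\<Lambda> x:X. c_pb3 A B C f g \<star> (u \<star>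
      x)) \<Colon> c_htpy X C fh gh2; k2 = c_happly X C fh gh2 (c_funext X C fh gh2 y); y2 = c_pb_map X A B
      C f g h h2 y; K = c_htpy X C fh gh2 in
     entry False [su 0, su 0, su 0, su 0, A \<rightharpoonup> C, B \<rightharpoonup> C, M]
       (sid M (c_cone_map X A B C f g \<star> (c_cone_map_inv X A B C f g \<star> u)) u)
       (c_path_conc M (c_pb_map X A B C f g h h2 k2) y2 u (c_ap K M (\<Lambda> k:c_htpy X C fh gh2. c_pb_map
         X A B C f g h h2 k) k2 y (c_eqv_sec (sid (X \<rightharpoonup> C) fh gh2) K (c_happly_fun X C fh gh2)
         (c_funext_eqv X C fh gh2) \<star> y)) (c_funext X P y2 u (\<Lambda> x:X. c_pb_eta A B C f g (u \<star> x)))))"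
abbreviation "c_cone_map_sec X A B C f g u \<equiv> con 64 S_cone_map_sec [X, A, B, C, f, g, u]"
schematic_goal [THEN checks_const, eval]: "checks S_cone_map_sec ?d"
  by (simp only: S_cone_map_sec_def eval)

text \<open>The maps \<open>a\<close> and \<open>b\<close> return judgmentally, by eta for
  functions; the path returns by \<open>c_funext_happly\<close>.\<close>

definition "S_cone_map_ret =
    (let X = sv 0; A = sv 1; B = sv 2; C = sv 3; f = sv 4; g = sv 5; s = sv 6; y = c_cone X A B C f
      g in
     entry False [su 0, su 0, su 0, su 0, A \<rightharpoonup> C, B \<rightharpoonup> C, y]
       (sid y (c_cone_map_inv X A B C f g \<star> (c_cone_map X A B C f g \<star> s)) s)
       (sind_sg (\<lambda>s'. sid y (c_cone_map_inv X A B C f g \<star> (c_cone_map X A B C f g \<star> s')) s') (\<lambda>a t.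
         sind_sg (\<lambda>t'. sid y (c_cone_map_inv X A B C f g \<star> (c_cone_map X A B C f g \<star> (\<lblot>a, t'\<rblot> \<Colon>
         c_cone X A B C f g))) (\<lblot>a, t'\<rblot> \<Colon> c_cone X A B C f g)) (\<lambda>b be. c_ap (sid (X \<rightharpoonup> C) (c_fcomp X
         A C f a) (c_fcomp X B C g b)) y (\<Lambda> be':sid (X \<rightharpoonup> C) (c_fcomp X A C f a) (c_fcomp X B C g b).
         c_cone_pair X A B C f g a b be') (c_funext X C (c_fcomp X A C f a) (c_fcomp X B C g b)
         (c_happly X C (c_fcomp X A C f a) (c_fcomp X B C g b) be)) be (c_funext_happly X C (c_fcomp
         X A C f a) (c_fcomp X B C g b) be)) t) s))"
abbreviation "c_cone_map_ret X A B C f g s \<equiv> con 65 S_cone_map_ret [X, A, B, C, f, g, s]"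
schematic_goal [THEN checks_const, eval]: "checks S_cone_map_ret ?d"
  by (simp only: S_cone_map_ret_def eval)

definition "S_cone_map_eqv =
    (let X = sv 0; A = sv 1; B = sv 2; C = sv 3; f = sv 4; g = sv 5 in
     entry False [su 0, su 0, su 0, su 0, A \<rightharpoonup> C, B \<rightharpoonup> C]
       (c_isequiv (c_cone X A B C f g) (X \<rightharpoonup> c_pb A B C f g) (c_cone_map X A B C f g))
       \<lblot>\<lblot>c_cone_map_inv X A B C f g, \<Lambda> u:X \<rightharpoonup> c_pb A B C f g. c_cone_map_sec X A B C f g u\<rblot>,
         \<lblot>c_cone_map_inv X A B C f g, \<Lambda> s:c_cone X A B C f g. c_cone_map_ret X A B C f g s\<rblot>\<rblot>)"
abbreviation "c_cone_map_eqv X A B C f g \<equiv> con 66 S_cone_map_eqv [X, A, B, C, f, g]"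
schematic_goal [THEN checks_const, eval]: "checks S_cone_map_eqv ?d"
  by (simp only: S_cone_map_eqv_def eval)

subsection \<open>The gap map\<close>

definition "S_bang_pb =
    (let A = sv 2; B = sv 3; C = sv 4; f = sv 5; g = sv 6 in
     entry True (base @ [su 0, su 0, su 0, A \<rightharpoonup> C, B \<rightharpoonup> C])
       (su 0)
       (c_pb (c_bang A) (c_bang B) (c_bang C) (c_bang_fun A C f) (c_bang_fun B C g)))"
abbreviation "c_bang_pb A B C f g \<equiv> con 67 S_bang_pb [VS, sv (Suc 0), A, B, C, f, g]"
schematic_goal [THEN checks_const, eval]: "checks S_bang_pb ?d"
  by (simp only: S_bang_pb_def eval)

definition "S_bang_cone =
    (let A = sv 2; B = sv 3; C = sv 4; f = sv 5; g = sv 6 in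
     entry True (base @ [su 0, su 0, su 0, A \<rightharpoonup> C, B \<rightharpoonup> C])
       (su 0)
       (\<Sigma> E:VS. c_cone (ElS E) A B C f g))"
abbreviation "c_bang_cone A B C f g \<equiv> con 68 S_bang_cone [VS, sv (Suc 0), A, B, C, f, g]"
schematic_goal [THEN checks_const, eval]: "checks S_bang_cone ?d"
  by (simp only: S_bang_cone_def eval)

definition "S_bang_cone_pair =
    (let A = sv 2; B = sv 3; C = sv 4; f = sv 5; g = sv 6; E = sv 7; a = sv 8; t = sv 9 in
     entry True (base @ [su 0, su 0, su 0, A \<rightharpoonup> C, B \<rightharpoonup> C, VS, ElS E \<rightharpoonup> A, c_lifts B C g E (c_fcomp
       (ElS E) A C f a)])
       (c_bang_cone A B C f g)
       \<lblot>E, \<lblot>a, t\<rblot>\<rblot>)"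
abbreviation "c_bang_cone_pair A B C f g E a t \<equiv> con 69 S_bang_cone_pair [VS, sv (Suc 0), A, B, C, f, g, E, a, t]"
schematic_goal [THEN checks_const, eval]: "checks S_bang_cone_pair ?d"
  by (simp only: S_bang_cone_pair_def eval)

definition "S_bang_pb_pair =
    (let A = sv 2; B = sv 3; C = sv 4; f = sv 5; g = sv 6; w = sv 7; t = sv 8 in
     entry True (base @ [su 0, su 0, su 0, A \<rightharpoonup> C, B \<rightharpoonup> C, c_bang A, c_fibre B C g (c_bang_fun A C f \<star>
       w)])
       (c_bang_pb A B C f g)
       \<lblot>w, t\<rblot>)"
abbreviation "c_bang_pb_pair A B C f g w t \<equiv> con 70 S_bang_pb_pair [VS, sv (Suc 0), A, B, C, f, g, w, t]"
schematic_goal [THEN checks_const, eval]: "checks S_bang_pb_pair ?d"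
  by (simp only: S_bang_pb_pair_def eval)

text \<open>For fixed \<open>E\<close> and \<open>a\<close> the rest of a cone is
  \<open>c_lifts\<close> over \<open>f \<circ> a\<close>, and for fixed \<open>w\<close> the rest of
  a point of the pullback is \<open>c_fibre\<close> over \<open>!f w\<close>. The map is therefore
  the comparison of lifts and fibres, applied over \<open>A\<close>.\<close>

definition "S_bang_cone_to_pb =
    (let A = sv 2; B = sv 3; C = sv 4; f = sv 5; g = sv 6; y = \<lambda>_. c_bang_pb A B C f g in
     entry True (base @ [su 0, su 0, su 0, A \<rightharpoonup> C, B \<rightharpoonup> C])
       (c_bang_cone A B C f g \<rightharpoonup> c_bang_pb A B C f g)
       (\<Lambda> s:c_bang_cone A B C f g. sind_sg y (\<lambda>E t. sind_sg y (\<lambda>a t'. c_bang_pb_pair A B C f g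
         (c_bang_pair A E a) (c_lifts_to_fibre B C g E (c_fcomp (ElS E) A C f a) \<star> t')) t) s))"
abbreviation "c_bang_cone_to_pb A B C f g \<equiv> con 71 S_bang_cone_to_pb [VS, sv (Suc 0), A, B, C, f, g]"
schematic_goal [THEN checks_const, eval]: "checks S_bang_cone_to_pb ?d"
  by (simp only: S_bang_cone_to_pb_def eval)

definition "S_bang_pb_to_cone =
    (let A = sv 2; B = sv 3; C = sv 4; f = sv 5; g = sv 6 in
     entry True (base @ [su 0, su 0, su 0, A \<rightharpoonup> C, B \<rightharpoonup> C])
       (c_bang_pb A B C f g \<rightharpoonup> c_bang_cone A B C f g)
       (\<Lambda> y:c_bang_pb A B C f g. sind_sg (\<lambda>_. c_bang_cone A B C f g) (\<lambda>w t. c_bang_cone_pair A B C f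
         g (c_bang_fst A w) (c_bang_snd A w) (c_fibre_to_lifts B C g (c_bang_fun A C f \<star> w) \<star> t))
         y))"
abbreviation "c_bang_pb_to_cone A B C f g \<equiv> con 72 S_bang_pb_to_cone [VS, sv (Suc 0), A, B, C, f, g]"
schematic_goal [THEN checks_const, eval]: "checks S_bang_pb_to_cone ?d"
  by (simp only: S_bang_pb_to_cone_def eval)

text \<open>Splitting \<open>w\<close> into \<open>(E, a)\<close> makes \<open>!f w\<close> a
  literal pair; only then do the two directions meet over the same point, and the round trip of
  fibres applies.\<close>

definition "S_bang_pb_cone_pb =
    (let A = sv 2; B = sv 3; C = sv 4; f = sv 5; g = sv 6; y = sv 7; y2 = c_bang_pb A B C f g in
     entry False (base @ [su 0, su 0, su 0, A \<rightharpoonup> C, B \<rightharpoonup> C, y2])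
       (sid y2 (c_bang_cone_to_pb A B C f g \<star> (c_bang_pb_to_cone A B C f g \<star> y)) y)
       (sind_sg (\<lambda>y'. sid y2 (c_bang_cone_to_pb A B C f g \<star> (c_bang_pb_to_cone A B C f g \<star> y')) y')
         (\<lambda>w t. sind_sg (\<lambda>w'. \<Pi> t':c_fibre B C g (c_bang_fun A C f \<star> w'). sid y2 (c_bang_cone_to_pb
         A B C f g \<star> (c_bang_pb_to_cone A B C f g \<star> c_bang_pb_pair A B C f g w' t')) (c_bang_pb_pair
         A B C f g w' t')) (\<lambda>E a. \<Lambda> t':c_fibre B C g (c_bang_fun A C f \<star> c_bang_pair A E a). c_ap
         (c_fibre B C g (c_bang_pair C E (c_fcomp (ElS E) A C f a))) y2 (\<Lambda> t'':c_fibre B C g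
         (c_bang_pair C E (c_fcomp (ElS E) A C f a)). c_bang_pb_pair A B C f g (c_bang_pair A E a)
         t'') (c_lifts_to_fibre B C g E (c_fcomp (ElS E) A C f a) \<star> (c_fibre_to_lifts B C g
         (c_bang_pair C E (c_fcomp (ElS E) A C f a)) \<star> t')) t' (c_fibre_lifts_fibre B C g
         (c_bang_pair C E (c_fcomp (ElS E) A C f a)) t')) w \<star> t) y))"
abbreviation "c_bang_pb_cone_pb A B C f g y \<equiv> con 73 S_bang_pb_cone_pb [VS, sv (Suc 0), A, B, C, f, g, y]"
schematic_goal [THEN checks_const, eval]: "checks S_bang_pb_cone_pb ?d"
  by (simp only: S_bang_pb_cone_pb_def eval)

definition "S_bang_cone_pb_cone =
    (let A = sv 2; B = sv 3; C = sv 4; f = sv 5; g = sv 6; s = sv 7; y = c_bang_cone A B C f g in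
     entry False (base @ [su 0, su 0, su 0, A \<rightharpoonup> C, B \<rightharpoonup> C, y])
       (sid y (c_bang_pb_to_cone A B C f g \<star> (c_bang_cone_to_pb A B C f g \<star> s)) s)
       (sind_sg (\<lambda>s'. sid y (c_bang_pb_to_cone A B C f g \<star> (c_bang_cone_to_pb A B C f g \<star> s')) s')
         (\<lambda>E t. sind_sg (\<lambda>t'. sid y (c_bang_pb_to_cone A B C f g \<star> (c_bang_cone_to_pb A B C f g \<star>
         (\<lblot>E, t'\<rblot> \<Colon> c_bang_cone A B C f g))) (\<lblot>E, t'\<rblot> \<Colon> c_bang_cone A B C f g)) (\<lambda>a t'. c_ap
         (c_lifts B C g E (c_fcomp (ElS E) A C f a)) y (\<Lambda> t'':c_lifts B C g E (c_fcomp (ElS E) A C f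
         a). c_bang_cone_pair A B C f g E a t'') (c_fibre_to_lifts B C g (c_bang_pair C E (c_fcomp
         (ElS E) A C f a)) \<star> (c_lifts_to_fibre B C g E (c_fcomp (ElS E) A C f a) \<star> t')) t'
         (c_lifts_fibre_lifts B C g E (c_fcomp (ElS E) A C f a) t')) t) s))"
abbreviation "c_bang_cone_pb_cone A B C f g s \<equiv> con 74 S_bang_cone_pb_cone [VS, sv (Suc 0), A, B, C, f, g, s]"
schematic_goal [THEN checks_const, eval]: "checks S_bang_cone_pb_cone ?d"
  by (simp only: S_bang_cone_pb_cone_def eval)

definition "S_bang_cone_eqv =
    (let A = sv 2; B = sv 3; C = sv 4; f = sv 5; g = sv 6 in
     entry False (base @ [su 0, su 0, su 0, A \<rightharpoonup> C, B \<rightharpoonup> C])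
       (c_isequiv (c_bang_cone A B C f g) (c_bang_pb A B C f g) (c_bang_cone_to_pb A B C f g))
       \<lblot>\<lblot>c_bang_pb_to_cone A B C f g, \<Lambda> y:c_bang_pb A B C f g. c_bang_pb_cone_pb A B C f g y\<rblot>,
         \<lblot>c_bang_pb_to_cone A B C f g, \<Lambda> s:c_bang_cone A B C f g. c_bang_cone_pb_cone A B C f g
         s\<rblot>\<rblot>)"
abbreviation "c_bang_cone_eqv A B C f g \<equiv> con 75 S_bang_cone_eqv [VS, sv (Suc 0), A, B, C, f, g]"
schematic_goal [THEN checks_const, eval]: "checks S_bang_cone_eqv ?d"
  by (simp only: S_bang_cone_eqv_def eval)

definition "S_square =
    (let A = sv 2; B = sv 3; C = sv 4; f = sv 5; g = sv 6; P = c_pb A B C f g in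
     entry True (base @ [su 0, su 0, su 0, A \<rightharpoonup> C, B \<rightharpoonup> C])
       (su 0)
       (\<Pi> w:c_bang P. sid (c_bang C) (c_bang_fun A C f \<star> (c_bang_fun P A (c_pb1 A B C f g) \<star> w))
         (c_bang_fun B C g \<star> (c_bang_fun P B (c_pb2 A B C f g) \<star> w))))"
abbreviation "c_square A B C f g \<equiv> con 76 S_square [VS, sv (Suc 0), A, B, C, f, g]"
schematic_goal [THEN checks_const, eval]: "checks S_square ?d"
  by (simp only: S_square_def eval)

text \<open>
  The gap map is an equivalence for any square whose value at \<open>(E, u)\<close> is the path of \<open>u\<close>; this covers
  both the square of the theorem and the one needed for spans, which avoids the redexes of the former.
\<close>

definition "S_coherent =
    (let A = sv 2; B = sv 3; C = sv 4; f = sv 5; g = sv 6; Phi = sv 7 in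
     entry True (base @ [su 0, su 0, su 0, A \<rightharpoonup> C, B \<rightharpoonup> C, c_square A B C f g])
       (su 0)
       (\<Pi> E:VS. \<Pi> a:ElS E \<rightharpoonup> A. \<Pi> b:ElS E \<rightharpoonup> B. \<Pi> be:sid (ElS E \<rightharpoonup> C) (c_fcomp (ElS E) A C f a)
         (c_fcomp (ElS E) B C g b). sid (sid (c_bang C) (c_bang_pair C E (c_fcomp (ElS E) A C f a))
         (c_bang_pair C E (c_fcomp (ElS E) B C g b))) (Phi \<star> c_bang_pair (c_pb A B C f g) E
         (c_pb_map (ElS E) A B C f g a b (c_happly (ElS E) C (c_fcomp (ElS E) A C f a) (c_fcomp (ElS
         E) B C g b) be))) (c_bang_path C E (c_fcomp (ElS E) A C f a) (c_fcomp (ElS E) B C g b)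
         be)))"
abbreviation "c_coherent A B C f g Phi \<equiv> con 77 S_coherent [VS, sv (Suc 0), A, B, C, f, g, Phi]"
schematic_goal [THEN checks_const, eval]: "checks S_coherent ?d"
  by (simp only: S_coherent_def eval)

definition "S_gap_map =
    (let A = sv 2; B = sv 3; C = sv 4; f = sv 5; g = sv 6; Phi = sv 7; P = c_pb A B C f g in
     entry True (base @ [su 0, su 0, su 0, A \<rightharpoonup> C, B \<rightharpoonup> C, c_square A B C f g])
       (c_bang P \<rightharpoonup> c_bang_pb A B C f g)
       (\<Lambda> w:c_bang P. \<lblot>c_bang_fun P A (c_pb1 A B C f g) \<star> w, \<lblot>c_bang_fun P B (c_pb2 A B C f g) \<star> w,
         Phi \<star> w\<rblot>\<rblot>))"
abbreviation "c_gap_map A B C f g Phi \<equiv> con 78 S_gap_map [VS, sv (Suc 0), A, B, C, f, g, Phi]"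
schematic_goal [THEN checks_const, eval]: "checks S_gap_map ?d"
  by (simp only: S_gap_map_def eval)

text \<open>On a literal cone the two composites agree judgmentally in their components in
  \<open>!A\<close> and \<open>!B\<close>. What remains is the path component, where coherence says
  precisely that the square has the value wanted.\<close>

definition "S_gap_triangle =
    (let A = sv 2; B = sv 3; C = sv 4; f = sv 5; g = sv 6; Phi = sv 7; H = sv 8; s = sv 9; M =
      \<Lambda> E:VS. ElS E \<rightharpoonup> c_pb A B C f g; z = \<Lambda> E:VS. c_cone_map (ElS E) A B C f g; z2 = \<Lambda> E:VS. c_cone
      (ElS E) A B C f g; y = c_bang_pb A B C f g in
     entry False (base @ [su 0, su 0, su 0, A \<rightharpoonup> C, B \<rightharpoonup> C, c_square A B C f g, c_coherent A B C f g
       Phi, c_bang_cone A B C f g])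
       (sid y (c_gap_map A B C f g Phi \<star> (c_total_map z2 M z \<star> s)) (c_bang_cone_to_pb A B C f g \<star>
         s))
       (sind_sg (\<lambda>s'. sid y (c_gap_map A B C f g Phi \<star> (c_total_map z2 M z \<star> s')) (c_bang_cone_to_pb
         A B C f g \<star> s')) (\<lambda>E t. sind_sg (\<lambda>t'. sid y (c_gap_map A B C f g Phi \<star> (c_total_map z2 M z
         \<star> (\<lblot>E, t'\<rblot> \<Colon> c_bang_cone A B C f g))) (c_bang_cone_to_pb A B C f g \<star> (\<lblot>E, t'\<rblot> \<Colon> c_bang_cone
         A B C f g))) (\<lambda>a t'. sind_sg (\<lambda>t''. sid y (c_gap_map A B C f g Phi \<star> (c_total_map z2 M z \<star>
         c_bang_cone_pair A B C f g E a t'')) (c_bang_cone_to_pb A B C f g \<star> c_bang_cone_pair A B C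
         f g E a t'')) (\<lambda>b be. c_ap (sid (c_bang C) (c_bang_pair C E (c_fcomp (ElS E) A C f a))
         (c_bang_pair C E (c_fcomp (ElS E) B C g b))) y (\<Lambda> th:sid (c_bang C) (c_bang_pair C E
         (c_fcomp (ElS E) A C f a)) (c_bang_pair C E (c_fcomp (ElS E) B C g b)). c_bang_pb_pair A B
         C f g (c_bang_pair A E a) (\<lblot>c_bang_pair B E b, th\<rblot> \<Colon> c_fibre B C g (c_bang_fun A C f \<star>
         c_bang_pair A E a))) (Phi \<star> c_bang_pair (c_pb A B C f g) E (c_pb_map (ElS E) A B C f g a b
         (c_happly (ElS E) C (c_fcomp (ElS E) A C f a) (c_fcomp (ElS E) B C g b) be))) (c_bang_path
         C E (c_fcomp (ElS E) A C f a) (c_fcomp (ElS E) B C g b) be) (H \<star> E \<star> a \<star> b \<star> be)) t') t)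
         s))"
abbreviation "c_gap_triangle A B C f g Phi H s \<equiv> con 79 S_gap_triangle [VS, sv (Suc 0), A, B, C, f, g, Phi, H, s]"
schematic_goal [THEN checks_const, eval]: "checks S_gap_triangle ?d"
  by (simp only: S_gap_triangle_def eval)

text \<open>\<open>!P\<close> is judgmentally the total type of the maps
  \<open>E \<rightarrow> P\<close>, so the cone maps for all \<open>E\<close> together form an
  equivalence onto it. The triangle then lets the gap map inherit invertibility.\<close>

definition "S_gap_map_eqv =
    (let A = sv 2; B = sv 3; C = sv 4; f = sv 5; g = sv 6; Phi = sv 7; H = sv 8; M = \<Lambda> E:VS. ElS E \<rightharpoonup>
      c_pb A B C f g; z = \<Lambda> E:VS. c_cone_map (ElS E) A B C f g; z2 = \<Lambda> E:VS. c_cone (ElS E) A B C f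
      g; bX = c_bang (c_pb A B C f g); y = c_gap_map A B C f g Phi; y2 = c_bang_pb A B C f g in
     entry False (base @ [su 0, su 0, su 0, A \<rightharpoonup> C, B \<rightharpoonup> C, c_square A B C f g, c_coherent A B C f g
       Phi])
       (c_isequiv bX y2 y)
       (c_two_of_three (c_bang_cone A B C f g) bX y2 (c_total_map z2 M z) (c_bang_cone_to_pb A B C f
         g) y (\<Lambda> s:c_bang_cone A B C f g. c_gap_triangle A B C f g Phi H s) (c_total_map_eqv z2 M z
         (\<Lambda> E:VS. c_cone_map_eqv (ElS E) A B C f g)) (c_bang_cone_eqv A B C f g)))"
abbreviation "c_gap_map_eqv A B C f g Phi H \<equiv> con 80 S_gap_map_eqv [VS, sv (Suc 0), A, B, C, f, g, Phi, H]"
schematic_goal [THEN checks_const, eval]: "checks S_gap_map_eqv ?d"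
  by (simp only: S_gap_map_eqv_def eval)

definition "S_pb_square =
    (let A = sv 2; B = sv 3; C = sv 4; f = sv 5; g = sv 6; P = c_pb A B C f g; h = c_fcomp P A C f
      (c_pb1 A B C f g); h2 = c_fcomp P B C g (c_pb2 A B C f g) in
     entry True (base @ [su 0, su 0, su 0, A \<rightharpoonup> C, B \<rightharpoonup> C])
       (c_square A B C f g)
       (c_happly (c_bang P) (c_bang C) (c_bang_fun P C h) (c_bang_fun P C h2) (c_bang_fun_path P C h
         h2 (c_funext P C h h2 (c_pb3 A B C f g)))))"
abbreviation "c_pb_square A B C f g \<equiv> con 81 S_pb_square [VS, sv (Suc 0), A, B, C, f, g]"
schematic_goal [THEN checks_const, eval]: "checks S_pb_square ?d"
  by (simp only: S_pb_square_def eval)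

text \<open>At the map induced by a cone, \<open>c_pb3\<close> computes to \<open>happly\<close> of
  the path of the cone, so the hypothesis of \<open>c_bang_funext_pair\<close> is a
  reflexivity.\<close>

definition "S_pb_square_coherent =
    (let A = sv 2; B = sv 3; C = sv 4; f = sv 5; g = sv 6; P = c_pb A B C f g in
     entry False (base @ [su 0, su 0, su 0, A \<rightharpoonup> C, B \<rightharpoonup> C])
       (c_coherent A B C f g (c_pb_square A B C f g))
       (\<Lambda> E:VS. \<Lambda> a:ElS E \<rightharpoonup> A. \<Lambda> b:ElS E \<rightharpoonup> B. \<Lambda> be:sid (ElS E \<rightharpoonup> C) (c_fcomp (ElS E) A C f a)
         (c_fcomp (ElS E) B C g b). c_bang_funext_pair P C (c_fcomp P A C f (c_pb1 A B C f g))
         (c_fcomp P B C g (c_pb2 A B C f g)) (c_pb3 A B C f g) E (c_pb_map (ElS E) A B C f g a b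
         (c_happly (ElS E) C (c_fcomp (ElS E) A C f a) (c_fcomp (ElS E) B C g b) be)) be (srf
         (c_happly (ElS E) C (c_fcomp (ElS E) A C f a) (c_fcomp (ElS E) B C g b) be))))"
abbreviation "c_pb_square_coherent A B C f g \<equiv> con 82 S_pb_square_coherent [VS, sv (Suc 0), A, B, C, f, g]"
schematic_goal [THEN checks_const, eval]: "checks S_pb_square_coherent ?d"
  by (simp only: S_pb_square_coherent_def eval)

definition "S_pb_gap_map_eqv =
    (let A = sv 2; B = sv 3; C = sv 4; f = sv 5; g = sv 6; y = c_pb_square A B C f g in
     entry False (base @ [su 0, su 0, su 0, A \<rightharpoonup> C, B \<rightharpoonup> C])
       (c_isequiv (c_bang (c_pb A B C f g)) (c_bang_pb A B C f g) (c_gap_map A B C f g y))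
       (c_gap_map_eqv A B C f g y (c_pb_square_coherent A B C f g)))"
abbreviation "c_pb_gap_map_eqv A B C f g \<equiv> con 83 S_pb_gap_map_eqv [VS, sv (Suc 0), A, B, C, f, g]"
schematic_goal [THEN checks_const, eval]: "checks S_pb_gap_map_eqv ?d"
  by (simp only: S_pb_gap_map_eqv_def eval)

subsection \<open>The comparison map\<close>

definition "S_bang_id =
    (let A = sv 2; bf = c_bang_fun A A (sidfun A); y = sidfun (c_bang A) in
     entry True (base @ [su 0])
       (sid (c_bang A \<rightharpoonup> c_bang A) bf y)
       (c_funext (c_bang A) (c_bang A) bf y (\<Lambda> w:c_bang A. sind_sg (\<lambda>z. sid (c_bang A) (c_bang_fun A
         A (sidfun A) \<star> z) z) (\<lambda>E p. srf \<lblot>E, p\<rblot>) w)))"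
abbreviation "c_bang_id A \<equiv> con 84 S_bang_id [VS, sv (Suc 0), A]"
schematic_goal E_bang_id [THEN checks_const, eval]: "checks S_bang_id ?d"
  by (simp only: S_bang_id_def eval)

definition "S_bang_cmp =
    (let A = sv 2; B = sv 3; C = sv 4; f = sv 5; g = sv 6 in
     entry True (base @ [su 0, su 0, su 0, A \<rightharpoonup> B, B \<rightharpoonup> C])
       (sid (c_bang_ob A \<rightharpoonup> c_bang_ob C) (c_bang_mor_at A C (c_fcomp A B C g f)) (c_fcomp (c_bang_ob
         A) (c_bang_ob B) (c_bang_ob C) (c_bang_mor_at B C g) (c_bang_mor_at A B f)))
       (((\<Lambda> A:su 0. \<Lambda> B:su 0. \<Lambda> C:su 0. \<Lambda> f:A \<rightharpoonup> B. \<Lambda> g:B \<rightharpoonup> C. srf (c_bang_fun A C (c_fcomp A B C g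
         f))) \<Colon> (\<Pi> A:su 0. \<Pi> B:su 0. \<Pi> C:su 0. \<Pi> f:A \<rightharpoonup> B. \<Pi> g:B \<rightharpoonup> C. sid (c_bang A \<rightharpoonup> c_bang C)
         (c_bang_fun A C (c_fcomp A B C g f)) (c_fcomp (c_bang A) (c_bang B) (c_bang C) (c_bang_fun
         B C g) (c_bang_fun A B f)))) \<star> A \<star> B \<star> C \<star> f \<star> g))"
abbreviation "c_bang_cmp A B C f g \<equiv> con 85 S_bang_cmp [VS, sv (Suc 0), A, B, C, f, g]"
schematic_goal E_bang_cmp [THEN checks_const, eval]: "checks S_bang_cmp ?d"
  by (simp only: S_bang_cmp_def eval)

definition "S_ob_pb =
    (let A = sv 2; B = sv 3; C = sv 4; f = sv 5; g = sv 6 in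
     entry True (base @ [su 0, su 0, su 0, A \<rightharpoonup> C, B \<rightharpoonup> C])
       (su 0)
       (c_pb (c_bang_ob A) (c_bang_ob B) (c_bang_ob C) (c_bang_mor_at A C f) (c_bang_mor_at B C
         g)))"
abbreviation "c_ob_pb A B C f g \<equiv> con 86 S_ob_pb [VS, sv (Suc 0), A, B, C, f, g]"
schematic_goal E_ob_pb [THEN checks_const, eval]: "checks S_ob_pb ?d"
  by (simp only: S_ob_pb_def eval)

definition "S_comparison_path =
    (let A = sv 2; B = sv 3; C = sv 4; f = sv 5; g = sv 6; P = c_pb A B C f g; oX = c_bang_ob P \<rightharpoonup>
      c_bang_ob C; p1 = c_pb1 A B C f g; h = c_fcomp (c_bang_ob P) (c_bang_ob A) (c_bang_ob C)
      (c_bang_mor_at A C f) (c_bang_mor_at P A p1); h3 = c_fcomp P A C f p1; y = c_bang_mor_at P C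
      h3; q1 = c_pb2 A B C f g; h2 = c_fcomp (c_bang_ob P) (c_bang_ob B) (c_bang_ob C)
      (c_bang_mor_at B C g) (c_bang_mor_at P B q1); h4 = c_fcomp P B C g q1 in
     entry True (base @ [su 0, su 0, su 0, A \<rightharpoonup> C, B \<rightharpoonup> C])
       (sid oX h h2)
       (c_path_conc oX h y h2 (c_path_inv oX y h (c_bang_cmp P A C p1 f)) (c_path_conc oX y
         (c_bang_mor_at P C h4) h2 (c_ap (c_pb A B C f g \<rightharpoonup> C) oX (c_bang_mor P C) h3 h4 (c_funext P
         C h3 h4 (c_pb3 A B C f g))) (c_bang_cmp P B C q1 g))))"
abbreviation "c_comparison_path A B C f g \<equiv> con 87 S_comparison_path [VS, sv (Suc 0), A, B, C, f, g]"
schematic_goal E_comparison_path [THEN checks_const, eval]: "checks S_comparison_path ?d"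
  by (simp only: S_comparison_path_def eval)

definition "S_comparison_square =
    (let A = sv 2; B = sv 3; C = sv 4; f = sv 5; g = sv 6; P = c_pb A B C f g in
     entry True (base @ [su 0, su 0, su 0, A \<rightharpoonup> C, B \<rightharpoonup> C])
       (c_square A B C f g)
       (c_happly (c_bang_ob P) (c_bang_ob C) (c_fcomp (c_bang_ob P) (c_bang_ob A) (c_bang_ob C)
         (c_bang_mor_at A C f) (c_bang_mor_at P A (c_pb1 A B C f g))) (c_fcomp (c_bang_ob P)
         (c_bang_ob B) (c_bang_ob C) (c_bang_mor_at B C g) (c_bang_mor_at P B (c_pb2 A B C f g)))
         (c_comparison_path A B C f g)))"
abbreviation "c_comparison_square A B C f g \<equiv> con 88 S_comparison_square [VS, sv (Suc 0), A, B, C, f, g]"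
schematic_goal [THEN checks_const, eval]: "checks S_comparison_square ?d"
  by (simp only: S_comparison_square_def eval)

definition "S_comparison =
    (let A = sv 2; B = sv 3; C = sv 4; f = sv 5; g = sv 6; P = c_pb A B C f g; p1 = c_pb1 A B C f g;
      q1 = c_pb2 A B C f g in
     entry True (base @ [su 0, su 0, su 0, A \<rightharpoonup> C, B \<rightharpoonup> C])
       (c_bang_ob P \<rightharpoonup> c_ob_pb A B C f g)
       (\<Lambda> w:c_bang_ob P. \<lblot>c_bang_mor_at P A p1 \<star> w, \<lblot>c_bang_mor_at P B q1 \<star> w, c_happly (c_bang_ob
         P) (c_bang_ob C) (c_fcomp (c_bang_ob P) (c_bang_ob A) (c_bang_ob C) (c_bang_mor_at A C f)
         (c_bang_mor_at P A p1)) (c_fcomp (c_bang_ob P) (c_bang_ob B) (c_bang_ob C) (c_bang_mor_at B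
         C g) (c_bang_mor_at P B q1)) (c_comparison_path A B C f g) \<star> w\<rblot>\<rblot>))"
abbreviation "c_comparison A B C f g \<equiv> con 89 S_comparison [VS, sv (Suc 0), A, B, C, f, g]"
schematic_goal E_comparison [THEN checks_const, eval]: "checks S_comparison ?d"
  by (simp only: S_comparison_def eval)

text \<open>The witness is the one for \<open>c_pb_square\<close>: once the redexes are reduced and
  the identifications for composition have become reflexivities, the two squares are
  convertible.\<close>

definition "S_comparison_coherent =
    (let A = sv 2; B = sv 3; C = sv 4; f = sv 5; g = sv 6; P = c_pb A B C f g in
     entry False (base @ [su 0, su 0, su 0, A \<rightharpoonup> C, B \<rightharpoonup> C])
       (c_coherent A B C f g (c_comparison_square A B C f g))
       (\<Lambda> E:VS. \<Lambda> a:ElS E \<rightharpoonup> A. \<Lambda> b:ElS E \<rightharpoonup> B. \<Lambda> be:sid (ElS E \<rightharpoonup> C) (c_fcomp (ElS E) A C f a)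
         (c_fcomp (ElS E) B C g b). c_bang_funext_pair P C (c_fcomp P A C f (c_pb1 A B C f g))
         (c_fcomp P B C g (c_pb2 A B C f g)) (c_pb3 A B C f g) E (c_pb_map (ElS E) A B C f g a b
         (c_happly (ElS E) C (c_fcomp (ElS E) A C f a) (c_fcomp (ElS E) B C g b) be)) be (srf
         (c_happly (ElS E) C (c_fcomp (ElS E) A C f a) (c_fcomp (ElS E) B C g b) be))))"
abbreviation "c_comparison_coherent A B C f g \<equiv> con 90 S_comparison_coherent [VS, sv (Suc 0), A, B, C, f, g]"
schematic_goal [THEN checks_const, eval]: "checks S_comparison_coherent ?d"
  by (simp only: S_comparison_coherent_def eval)

subsection \<open>Spans\<close>

definition "S_span =
    (let A = sv 0; B = sv 1 in
     entry True [su 0, su 0]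
       (su (Suc 0))
       (\<Sigma> X:su 0. (X \<rightharpoonup> A) \<otimes> (X \<rightharpoonup> B)))"
abbreviation "c_span A B \<equiv> con 91 S_span [A, B]"
schematic_goal E_span [THEN checks_const, eval]: "checks S_span ?d"
  by (simp only: S_span_def eval)

definition "S_apex =
    (let A = sv 0; B = sv 1; S = sv 2 in
     entry True [su 0, su 0, c_span A B]
       (su 0)
       (sfst (su 0) S))"
abbreviation "c_apex A B S \<equiv> con 92 S_apex [A, B, S]"
schematic_goal E_apex [THEN checks_const, eval]: "checks S_apex ?d"
  by (simp only: S_apex_def eval)

definition "S_src =
    (let A = sv 0; B = sv 1; S = sv 2 in
     entry True [su 0, su 0, c_span A B]
       (c_apex A B S \<rightharpoonup> A)
       (sfst (sfst (su 0) S \<rightharpoonup> A) (ssnd (su 0) (\<lambda>X. (X \<rightharpoonup> A) \<otimes> (X \<rightharpoonup> B)) S)))"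
abbreviation "c_src A B S \<equiv> con 93 S_src [A, B, S]"
schematic_goal E_src [THEN checks_const, eval]: "checks S_src ?d"
  by (simp only: S_src_def eval)

definition "S_tgt =
    (let A = sv 0; B = sv 1; S = sv 2 in
     entry True [su 0, su 0, c_span A B]
       (c_apex A B S \<rightharpoonup> B)
       (ssnd (sfst (su 0) S \<rightharpoonup> A) (\<lambda>_. sfst (su 0) S \<rightharpoonup> B) (ssnd (su 0) (\<lambda>X. (X \<rightharpoonup> A) \<otimes> (X \<rightharpoonup> B)) S)))"
abbreviation "c_tgt A B S \<equiv> con 94 S_tgt [A, B, S]"
schematic_goal E_tgt [THEN checks_const, eval]: "checks S_tgt ?d"
  by (simp only: S_tgt_def eval)

definition "S_span_triple =
    (let A = sv 0; B = sv 1; X = sv 2; s = sv 3; t = sv 4 in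
     entry True [su 0, su 0, su 0, X \<rightharpoonup> A, X \<rightharpoonup> B]
       (c_span A B)
       \<lblot>X, \<lblot>s, t\<rblot>\<rblot>)"
abbreviation "c_span_triple A B X s t \<equiv> con 95 S_span_triple [A, B, X, s, t]"
schematic_goal E_span_triple [THEN checks_const, eval]: "checks S_span_triple ?d"
  by (simp only: S_span_triple_def eval)

definition "S_span_cmp =
    (let A = sv 0; B = sv 1; C = sv 2; T = sv 3; S = sv 4; P = c_pb (c_apex A B S) (c_apex B C T) B
      (c_tgt A B S) (c_src B C T) in
     entry True [su 0, su 0, su 0, c_span B C, c_span A B]
       (c_span A C)
       \<lblot>c_pb (c_apex A B S) (c_apex B C T) B (c_tgt A B S) (c_src B C T), \<lblot>c_fcomp P (c_apex A B S)
         A (c_src A B S) (c_pb1 (c_apex A B S) (c_apex B C T) B (c_tgt A B S) (c_src B C T)),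
         c_fcomp P (c_apex B C T) C (c_tgt B C T) (c_pb2 (c_apex A B S) (c_apex B C T) B (c_tgt A B
         S) (c_src B C T))\<rblot>\<rblot>)"
abbreviation "c_span_cmp A B C T S \<equiv> con 96 S_span_cmp [A, B, C, T, S]"
schematic_goal E_span_cmp [THEN checks_const, eval]: "checks S_span_cmp ?d"
  by (simp only: S_span_cmp_def eval)

definition "S_eqv_fun =
    (let X = sv 0; Y = sv 1; e = sv 2 in
     entry True [su 0, su 0, c_equivt X Y]
       (X \<rightharpoonup> Y)
       (sfst (X \<rightharpoonup> Y) e))"
abbreviation "c_eqv_fun X Y e \<equiv> con 97 S_eqv_fun [X, Y, e]"
schematic_goal [THEN checks_const, eval]: "checks S_eqv_fun ?d"
  by (simp only: S_eqv_fun_def eval)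

definition "S_idtoeqv =
    (let X = sv 0; Y = sv 1 in
     entry True [su 0, su 0]
       (sid (su 0) X Y \<rightharpoonup> c_equivt X Y)
       (sidtoeqv 0 X Y))"
abbreviation "c_idtoeqv X Y \<equiv> con 98 S_idtoeqv [X, Y]"
schematic_goal [THEN checks_const, eval]: "checks S_idtoeqv ?d"
  by (simp only: S_idtoeqv_def eval)

definition "S_univalence =
    (let X = sv 0; Y = sv 1 in
     entry True [su 0, su 0]
       (sisequiv (sid (su 0) X Y) (c_equivt X Y) (c_idtoeqv X Y))
       (sua 0 \<star> X \<star> Y))"
abbreviation "c_univalence X Y \<equiv> con 99 S_univalence [X, Y]"
schematic_goal [THEN checks_const, eval]: "checks S_univalence ?d"
  by (simp only: S_univalence_def eval)

definition "S_span_pull =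
    (let A = sv 0; B = sv 1; X = sv 2; Y = sv 3; s = sv 4; t = sv 5; e = sv 6; y = c_eqv_fun X Y e
      in
     entry True [su 0, su 0, su 0, su 0, Y \<rightharpoonup> A, Y \<rightharpoonup> B, c_equivt X Y]
       (c_span A B)
       (c_span_triple A B X (c_fcomp X Y A s y) (c_fcomp X Y B t y)))"
abbreviation "c_span_pull A B X Y s t e \<equiv> con 100 S_span_pull [A, B, X, Y, s, t, e]"
schematic_goal [THEN checks_const, eval]: "checks S_span_pull ?d"
  by (simp only: S_span_pull_def eval)

text \<open>The legs are quantified inside the motive because their domain varies along the path. At
  a reflexivity \<open>idtoeqv\<close> computes to the identity equivalence, and pulling back along
  it changes nothing judgmentally.\<close>

definition "S_span_pull_path =
    (let A = sv 0; B = sv 1; X = sv 2; Y = sv 3; s = sv 4; t = sv 5; p = sv 6 in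
     entry False [su 0, su 0, su 0, su 0, Y \<rightharpoonup> A, Y \<rightharpoonup> B, sid (su 0) X Y]
       (sid (c_span A B) (c_span_pull A B X Y s t (c_idtoeqv X Y \<star> p)) (c_span_triple A B Y s t))
       (sind_id (\<lambda>X' Y' q. \<Pi> s':Y' \<rightharpoonup> A. \<Pi> t':Y' \<rightharpoonup> B. sid (c_span A B) (c_span_pull A B X' Y' s' t'
         (c_idtoeqv X' Y' \<star> q)) (c_span_triple A B Y' s' t')) (\<lambda>X'. \<Lambda> s':X' \<rightharpoonup> A. \<Lambda> t':X' \<rightharpoonup> B. srf
         (c_span_triple A B X' s' t')) X Y p \<star> s \<star> t))"
abbreviation "c_span_pull_path A B X Y s t p \<equiv> con 101 S_span_pull_path [A, B, X, Y, s, t, p]"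
schematic_goal [THEN checks_const, eval]: "checks S_span_pull_path ?d"
  by (simp only: S_span_pull_path_def eval)

text \<open>Univalence enters through the right inverse of \<open>idtoeqv\<close>: the equivalence
  is replaced by one that comes from a path, to which the path induction above applies.\<close>

definition "S_span_pull_eqv =
    (let A = sv 0; B = sv 1; X = sv 2; Y = sv 3; s = sv 4; t = sv 5; e = sv 6; y2 = c_span_pull A B
      X Y s t e; y3 = c_span_triple A B Y s t; y4 = c_univalence X Y; I = sid (su 0) X Y; y =
      c_eqv_inv_large I (c_equivt X Y) (c_idtoeqv X Y) y4 \<star> e; j = c_idtoeqv X Y \<star> y in
     entry False [su 0, su 0, su 0, su 0, Y \<rightharpoonup> A, Y \<rightharpoonup> B, c_equivt X Y]
       (sid (c_span A B) y2 y3)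
       (c_path_conc_large (c_span A B) y2 (c_span_pull A B X Y s t j) y3 (c_ap_large (c_equivt X Y)
         (c_span A B) (\<Lambda> e':c_equivt X Y. c_span_pull A B X Y s t e') e j (c_path_inv (c_equivt X Y)
         j e (c_eqv_sec_large I (c_equivt X Y) (c_idtoeqv X Y) y4 \<star> e))) (c_span_pull_path A B X Y s
         t y)))"
abbreviation "c_span_pull_eqv A B X Y s t e \<equiv> con 102 S_span_pull_eqv [A, B, X, Y, s, t, e]"
schematic_goal [THEN checks_const, eval]: "checks S_span_pull_eqv ?d"
  by (simp only: S_span_pull_eqv_def eval)

text \<open>Composed with the gap map, the projections of the pullback of \<open>!f\<close> and
  \<open>!g\<close> become the images under \<open>!\<close> of the projections of \<open>P\<close>.
  Since \<open>!\<close> preserves composition judgmentally, the span pulled back along the gap map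
  is already the image of the composite.\<close>

definition "S_span_pb =
    (let A = sv 2; B = sv 3; C = sv 4; f = sv 5; g = sv 6; X = sv 7; Z = sv 8; s = sv 9; t = sv 10;
      P = c_pb A B C f g; y = c_bang_pb A B C f g; bf = c_bang_fun A C f; bf2 = c_bang_fun B C g; h
      = c_fcomp y (c_bang A) (c_bang X) (c_bang_fun A X s) (c_pb1 (c_bang A) (c_bang B) (c_bang C)
      bf bf2); h2 = c_fcomp y (c_bang B) (c_bang Z) (c_bang_fun B Z t) (c_pb2 (c_bang A) (c_bang B)
      (c_bang C) bf bf2) in
     entry False (base @ [su 0, su 0, su 0, A \<rightharpoonup> C, B \<rightharpoonup> C, su 0, su 0, A \<rightharpoonup> X, B \<rightharpoonup> Z])
       (sid (c_span (c_bang X) (c_bang Z)) (c_span_triple (c_bang X) (c_bang Z) (c_bang P)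
         (c_bang_fun P X (c_fcomp P A X s (c_pb1 A B C f g))) (c_bang_fun P Z (c_fcomp P B Z t
         (c_pb2 A B C f g)))) (c_span_triple (c_bang X) (c_bang Z) y h h2))
       (c_span_pull_eqv (c_bang X) (c_bang Z) (c_bang P) y h h2 \<lblot>c_gap_map A B C f g (c_pb_square A
         B C f g), c_pb_gap_map_eqv A B C f g\<rblot>))"
abbreviation "c_span_pb A B C f g X Z s t \<equiv> con 103 S_span_pb [VS, sv (Suc 0), A, B, C, f, g, X, Z, s, t]"
schematic_goal [THEN checks_const, eval]: "checks S_span_pb ?d"
  by (simp only: S_span_pb_def eval)

subsection \<open>The three judgments\<close>

definition "S_functor = entry False base
     (\<Sigma> F0:su 0 \<rightharpoonup> su 0. \<Sigma> F1:\<Pi> X:su 0. \<Pi> Y:su 0. (X \<rightharpoonup> Y) \<rightharpoonup> F0 \<star> X \<rightharpoonup> F0 \<star> Y. (\<Pi> X:su 0. sid (F0 \<star> X \<rightharpoonup>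
       F0 \<star> X) (F1 \<star> X \<star> X \<star> sidfun X) (sidfun (F0 \<star> X))) \<otimes> (\<Pi> X:su 0. \<Pi> Y:su 0. \<Pi> Z:su 0. \<Pi> f:X \<rightharpoonup>
       Y. \<Pi> g:Y \<rightharpoonup> Z. sid (F0 \<star> X \<rightharpoonup> F0 \<star> Z) (F1 \<star> X \<star> Z \<star> c_fcomp X Y Z g f) (c_fcomp (F0 \<star> X) (F0 \<star>
       Y) (F0 \<star> Z) (F1 \<star> Y \<star> Z \<star> g) (F1 \<star> X \<star> Y \<star> f))))
     (\<lblot>\<Lambda> A:su 0. c_bang A, \<lblot>\<Lambda> A:su 0. \<Lambda> B:su 0. \<Lambda> f:A \<rightharpoonup> B. c_bang_fun A B f, \<lblot>\<Lambda> A:su 0. c_bang_id A,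
       \<Lambda> A:su 0. \<Lambda> B:su 0. \<Lambda> C:su 0. \<Lambda> f:A \<rightharpoonup> B. \<Lambda> g:B \<rightharpoonup> C. srf (c_bang_fun A C (c_fcomp A B C g
       f))\<rblot>\<rblot>\<rblot>)"
schematic_goal E_functor: "checks S_functor ?d"
  by (simp only: S_functor_def eval)

text \<open>The type is spelled with the redexes of the statement, whereas the witness speaks of
  \<open>c_gap_map\<close>; conversion connects the two.\<close>

definition "S_pullbacks = entry False base
     (\<Pi> A:su 0. \<Pi> B:su 0. \<Pi> C:su 0. \<Pi> f:A \<rightharpoonup> C. \<Pi> g:B \<rightharpoonup> C. c_isequiv (c_bang_ob (c_pb A B C f g))
       (c_ob_pb A B C f g) (c_comparison A B C f g))
     (\<Lambda> A:su 0. \<Lambda> B:su 0. \<Lambda> C:su 0. \<Lambda> f:A \<rightharpoonup> C. \<Lambda> g:B \<rightharpoonup> C. c_gap_map_eqv A B C f g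
       (c_comparison_square A B C f g) (c_comparison_coherent A B C f g))"
schematic_goal E_pullbacks: "checks S_pullbacks ?d"
  by (simp only: S_pullbacks_def eval)

text \<open>Both legs of an identity span are the same map, so a single \<open>ap\<close> of the
  span with legs \<open>u\<close> and \<open>u\<close> at \<open>!id = id\<close> settles
  both.\<close>

definition span_pres_id :: sexpr where
  "span_pres_id =
     (\<Lambda> X:su 0. c_ap_large (c_bang X \<rightharpoonup> c_bang X) (c_span (c_bang X) (c_bang X)) (\<Lambda> u:c_bang X \<rightharpoonup>
       c_bang X. c_span_triple (c_bang X) (c_bang X) (c_bang X) u u) (c_bang_fun X X (sidfun X))
       (sidfun (c_bang X)) (c_bang_id X))"

definition span_pres_cmp :: sexpr where
  "span_pres_cmp =
     (\<Lambda> X:su 0. \<Lambda> Y:su 0. \<Lambda> Z:su 0. \<Lambda> S:c_span X Y. \<Lambda> T:c_span Y Z. c_span_pb (c_apex X Y S) (c_apex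
       Y Z T) Y (c_tgt X Y S) (c_src Y Z T) X Z (c_src X Y S) (c_tgt Y Z T))"

definition "S_spans = entry False base
     (\<Sigma> F0:su 0 \<rightharpoonup> su 0. \<Sigma> F1:\<Pi> X:su 0. \<Pi> Y:su 0. c_span X Y \<rightharpoonup> c_span (F0 \<star> X) (F0 \<star> Y). (\<Pi> X:su 0.
       sid (c_span (F0 \<star> X) (F0 \<star> X)) (F1 \<star> X \<star> X \<star> c_span_triple X X X (sidfun X) (sidfun X))
       (c_span_triple (F0 \<star> X) (F0 \<star> X) (F0 \<star> X) (sidfun (F0 \<star> X)) (sidfun (F0 \<star> X)))) \<otimes> (\<Pi> X:su 0.
       \<Pi> Y:su 0. \<Pi> Z:su 0. \<Pi> f:c_span X Y. \<Pi> g:c_span Y Z. sid (c_span (F0 \<star> X) (F0 \<star> Z)) (F1 \<star> X \<star>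
       Z \<star> c_span_cmp X Y Z g f) (c_span_cmp (F0 \<star> X) (F0 \<star> Y) (F0 \<star> Z) (F1 \<star> Y \<star> Z \<star> g) (F1 \<star> X \<star> Y
       \<star> f))))
     (\<lblot>\<Lambda> A:su 0. c_bang A, \<lblot>\<Lambda> A:su 0. \<Lambda> B:su 0. \<Lambda> S:c_span A B. \<lblot>c_bang_ob (c_apex A B S),
       \<lblot>c_bang_mor_at (c_apex A B S) A (c_src A B S), c_bang_mor_at (c_apex A B S) B (c_tgt A B
       S)\<rblot>\<rblot>, \<lblot>span_pres_id, span_pres_cmp\<rblot>\<rblot>\<rblot>)"
schematic_goal E_spans: "checks S_spans ?d"
  by (simp only: S_spans_def span_pres_id_def span_pres_cmp_def eval)


section \<open>The theorem\<close>

text \<open>The context of the theorem, as an entry whose elaboration yields its well-formedness.\<close>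
definition S_codes :: entry where
  "S_codes =
    (let V = sv 0; El = sv 1; code = (\<lambda>T. \<Sigma> G:V. sid (su 0) (El \<star> G) T) in
     entry False
       [su 0, V \<rightharpoonup> su 0,
        \<Pi> x:V. \<Pi> y:V. sisequiv (sid V x y) (sid (su 0) (El \<star> x) (El \<star> y))
          (\<Lambda> p:sid V x y. sap (su 0) El x y p),
        \<Pi> E:V. \<Pi> F:(El \<star> E \<rightharpoonup> V). code (\<Sigma> x:El \<star> E. El \<star> (F \<star> x)),
        code semp,
        \<Pi> E:V. \<Pi> F:V. code (sco (El \<star> E) (El \<star> F)),
        code sone]
       (su 1) (su 0))"
schematic_goal E_codes: "checks S_codes ?d"
  by (simp only: S_codes_def eval)

section \<open>Identification of the checked terms with those of the statement\<close>

lemmas codes_defs = codes_ctx_def telescope_def code_for_def bang_ty_def bang_fun_def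

lemma erase_codes: "map (strip i) (entry_tele S_codes) = codes_ctx i"
  by (simp add: S_codes_def entry_def sexpr_defs expr_defs codes_defs)

lemma wf_codes_ctx: "wf (codes_ctx i)"
  using checks_ty(1)[OF E_codes, of i] unfolding erase_codes .

lemma length_codes_ctx: "length (codes_ctx i) = 7"
  by (simp add: codes_ctx_def telescope_def)

lemma drop_codes_ctx: "drop 5 (codes_ctx i) = [PiT (Var 0) (Uni i), Uni i]"
  by (simp add: codes_ctx_def telescope_def expr_defs upt_rec)

text \<open>Judgments are derived over the two variables of \<open>base\<close>, the outermost ones
  of the context of codes, and reach the whole context by renaming along the five inner
  declarations.\<close>

lemma weaken:
  assumes "entry_tele s = [SPi (SVar 0) (SUni 0), SUni 0]" "checks s d"
  shows "codes_ctx i \<turnstile> wk 5 (strip i (entry_body s)) \<^bold>: wk 5 (strip i (entry_type s))"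
proof -
  have "drop 5 (codes_ctx i) \<turnstile> strip i (entry_body s) \<^bold>: strip i (entry_type s)"
    using checks_ty(2)[OF assms(2), of i] assms(1) by (simp add: drop_codes_ctx)
  from has_ty_ren[OF wf_codes_ctx ren_mor_drop this] show ?thesis .
qed

lemma base_tele: "entry_tele (entry tr base T t) = [SPi (SVar 0) (SUni 0), SUni 0]"
  by (simp add: entry_def sexpr_defs)

lemma vsub_simps: "vsub (a # as) 0 = a" "vsub (a # as) (Suc n) = vsub as n"
  "vsub (a # as) (numeral k) = vsub as (pred_numeral k)"
  by (simp_all add: vsub_def numeral_eq_Suc)

lemma up_ren_numeral: "up_ren r (numeral k) = Suc (r (pred_numeral k))"
  by (simp add: numeral_eq_Suc)

lemmas stmt_defs = functor_tm_def functor_ty_def pres_id_ty_def pres_cmp_ty_def TYPE_cat_def SPAN_cat_def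
  bang_def bang_ty_def bang_fun_def pb_def pb1_def pb2_def pb3_def comparison_path_def comparison_def
  preserves_pullbacks_ty_def span_ty_def apex_def legs_def src_def tgt_def span_cmp_def span_on_mor_def
  span_lift_def

lemmas const_checks =
  E_fcomp E_happly E_isequiv E_bang E_bang_fun E_bang_ob E_bang_mor E_bang_mor_at E_pb E_pb1
  E_pb2 E_pb3 E_bang_id E_funext E_eqv_inv E_happly_fun E_htpy E_funext_eqv E_bang_cmp E_ob_pb
  E_comparison E_comparison_path E_path_inv E_path_conc E_ap E_span E_apex E_src E_tgt
  E_span_triple E_span_cmp

text \<open>Only the bodies of constants are unfolded, as the rules for their erasure refer to the folded form.\<close>
lemmas const_bodies =
  S_fcomp_def S_happly_def S_isequiv_def S_bang_def S_bang_fun_def S_bang_ob_def S_bang_mor_def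
  S_bang_mor_at_def S_pb_def S_pb1_def S_pb2_def S_pb3_def S_bang_id_def S_funext_def
  S_eqv_inv_def S_happly_fun_def S_htpy_def S_funext_eqv_def S_bang_cmp_def S_ob_pb_def
  S_comparison_def S_comparison_path_def S_path_inv_def S_path_conc_def S_ap_def S_span_def
  S_apex_def S_src_def S_tgt_def S_span_triple_def S_span_cmp_def

lemmas erase_rules = const_checks const_bodies[THEN arg_cong[where f = "\<lambda>s. entry_body s"]]
  entry_def con_def sexpr_defs Let_def vsub_simps up_numeral up_ren_numeral

text \<open>The source types and terms are separate copies of those in the statement. These
  equations of raw terms show that each copy erases to the original in a context of length 7, that
  of \<open>codes_ctx\<close>.\<close>

lemma functor_ty: "wk 5 (strip i (entry_type S_functor)) = functor_ty (TYPE_cat i) (TYPE_cat i) 7"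
  by (simp add: S_functor_def erase_rules stmt_defs expr_defs)

lemma functor_tm: "wk 5 (strip i (entry_body S_functor)) = functor_tm (bang i) 7"
  by (simp add: S_functor_def erase_rules stmt_defs expr_defs)

lemma pullbacks_ty: "wk 5 (strip i (entry_type S_pullbacks)) = preserves_pullbacks_ty i (bang i) 7"
  by (simp add: S_pullbacks_def erase_rules stmt_defs expr_defs)

lemma spans_ty: "wk 5 (strip i (entry_type S_spans)) = functor_ty (SPAN_cat i) (SPAN_cat i) 7"
  by (simp add: S_spans_def erase_rules stmt_defs expr_defs)

text \<open>The two witnesses are source expressions evaluated at the length 2 of
  \<open>base\<close> and weakened by 5. As functions of the ambient length they are constant, which
  suffices because the judgment evaluates them at 7 only.\<close>

lemma spans_tm:
  "wk 5 (strip i (entry_body S_spans)) =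
     functor_tm (span_lift i (bang i) (\<lambda>_. wk 5 (strip i (span_pres_id (Suc (Suc 0)))))
       (\<lambda>_. wk 5 (strip i (span_pres_cmp (Suc (Suc 0)))))) 7"
  by (simp add: S_spans_def erase_rules stmt_defs expr_defs)

theorem proposition4p10:
  fixes i :: nat
  shows "codes_ctx i \<tturnstile> functor_tm (bang i) \<^bold>: functor_ty (TYPE_cat i) (TYPE_cat i) \<and>
    (\<exists>e. codes_ctx i \<tturnstile> e \<^bold>: preserves_pullbacks_ty i (bang i)) \<and>
    (\<exists>p q. codes_ctx i \<tturnstile> functor_tm (span_lift i (bang i) p q)
       \<^bold>: functor_ty (SPAN_cat i) (SPAN_cat i))"
proof (intro conjI exI)
  show "codes_ctx i \<tturnstile> functor_tm (bang i) \<^bold>: functor_ty (TYPE_cat i) (TYPE_cat i)"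
    using weaken[OF _ E_functor, of i]
    unfolding has_ty_expr_def length_codes_ctx functor_ty functor_tm
    by (simp add: S_functor_def base_tele)
  show "codes_ctx i \<tturnstile> (\<lambda>_. wk 5 (strip i (entry_body S_pullbacks))) \<^bold>: preserves_pullbacks_ty i (bang i)"
    using weaken[OF _ E_pullbacks, of i]
    unfolding has_ty_expr_def length_codes_ctx pullbacks_ty
    by (simp add: S_pullbacks_def base_tele)
  show "codes_ctx i \<tturnstile> functor_tm (span_lift i (bang i) (\<lambda>_. wk 5 (strip i (span_pres_id (Suc (Suc 0)))))
      (\<lambda>_. wk 5 (strip i (span_pres_cmp (Suc (Suc 0)))))) \<^bold>: functor_ty (SPAN_cat i) (SPAN_cat i)"
    using weaken[OF _ E_spans, of i]
    unfolding has_ty_expr_def length_codes_ctx spans_ty spans_tm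
    by (simp add: S_spans_def base_tele)
qed

end
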